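(* In the setting of the context, let $n, M \in \mathbb{N}$, let $(V_k^i, Y_k^i)$, $i,k\in\mathbb{N}$, be i.i.d. random variables with distribution $\mu$, and assume that $(V_k^i, Y_k^i)$, $\rho_k^i$, $Z_k^i$, $i,k\in\mathbb{N}$, and $B$ are independent. Let $L, L_j^i \in [0,\infty)$, $i\in\{0,1\}$, $j\in\{1,2\}$. Assume for all $s,t\in[0,\infty)$, $x,y\in\overline{D}$, $i\in\{0,1\}$ that $|h_i(s,x)-h_i(t,y)| \le L_1^i|s-t| + L_2^i\|x-y\|$, and for all $x,y\in D$ that $|\bar r(x)-\bar r(y)|\le L\|x-y\|$. Let $w\colon D\to\mathbb{R}$ be continuous and satisfy for all $x\in D$ that $$w(x)=\mathbb{E}\big[h_0(\tau^x, x+B_{\tau^x})\big]+\mathbb{E}\Big[\int_0^{\tau^x} h_1(s,x+B_s)\,ds\Big],$$ and let $\bar w\colon D\times\Omega\to\mathbb{R}$ satisfy for all $x\in D$ that $$\bar w(x)=\frac1n\sum_{i=1}^n\Big[h_0(\bar\tau_M^{x,i},\bar X_M^{x,i})+\frac1d\sum_{k=1}^M \bar r(\bar X_{k-1}^{x,i})^2\, h_1\big(\bar\tau_{k-1}^{x,i}+\bar r(\bar X_{k-1}^{x,i})^2V_k^i,\ \bar X_{k-1}^{x,i}+\bar r(\bar X_{k-1}^{x,i})Y_k^i\big)\Big].$$ Then it holds for all $K\in\mathbb{N}$ that $$\begin{aligned} \mathbb{E}\Big[\sup_{x\in D}|w(x)-\bar w(x)|\Big] &\le (L_1^0+\|h_1\|_\infty)\operatorname{diam}(D)\,\delta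 + L_2^0 d^{1/2}\operatorname{diam}(D)^{1/2}\delta^{1/2}\\ &\quad+\Big(4\|h_0\|_\infty+\tfrac{2\operatorname{diam}(D)^2\|h_1\|_\infty}{d}\Big)\Big(1+\tfrac{\beta^2\delta^2}{2\operatorname{diam}(D)^2}\Big)^{-M}\\ &\quad+\Big(L_2^0+\tfrac{2L_1^0\operatorname{diam}(D)}{d}+\tfrac1d\Big(2\operatorname{diam}(D)\|h_1\|_\infty+\operatorname{diam}(D)^2\big(L_2^1+\tfrac{2L_1^1\operatorname{diam}(D)}{d}\big)\Big)\Big)\tfrac{d^{1/2}\operatorname{diam}(D)}{K}\\ &\quad+\Big(L_2^0+\tfrac{2M\operatorname{diam}(D)\|h_1\|_\infty+L_2^1M\operatorname{diam}(D)^2}{d}\Big)\tfrac{d^{1/2}\operatorname{diam}(D)}{KM^2}\\ &\quad+\tfrac{3\sqrt2\left(\sqrt{d(\log K+2\log M+M\log(1+L))+\log 2}+1\right)\left(\|h_0\|_\infty+\frac{M\operatorname{diam}(D)^2\|h_1\|_\infty}{d}\right)}{\sqrt n}\\ &\quad+\tfrac{12\operatorname{diam}(D)^2(\log n+\log M+\log 6+1)(L_1^0d+L_1^1\operatorname{diam}(D)^2M)}{d^{3/2}KM}. \end{aligned}$$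
   Context: Let $d\in\mathbb{N}=\{1,2,\dots\}$, $\mathbb{N}_0=\mathbb{N}\cup\{0\}$, let $\|\cdot\|$ be the Euclidean norm, and let $D\subseteq\mathbb{R}^d$ be nonempty, open, bounded, and convex. Let $(\Omega,\mathcal{F},\mathbb{P})$ be a probability space carrying all random variables and $B\colon[0,\infty)\times\Omega\to\mathbb{R}^d$ a standard Brownian motion with $B_0=0$. Let $r(x)=\inf\{\|x-y\|\colon y\in\partial D\}$ and, for $x\in\overline D$, $\tau^x=\inf\{t\ge0\colon x+B_t\in\partial D\}$. $(\beta,\varepsilon)$-distance: for $\beta\in(0,1]$, $\varepsilon\in[0,\infty)$, a Lipschitz continuous $\tilde r\colon D\to[0,\infty)$ is a $(\beta,\varepsilon)$-distance on $D$ if $\tilde r(y)\le r(y)$ for all $y\in D$ and $\tilde r(x)\ge\beta r(x)$ for all $x\in D$ with $r(x)\ge\varepsilon$. Let $\beta\in(0,1]$, $\delta\in(0,\infty)$, and let $\bar r$ be a $(\beta,\delta)$-distance on $D$, extended to $\overline D$ by $\bar r=0$ on $\partial D$. Walk-on-Spheres process: let $\zeta=\inf\{t\ge0\colon\|B_t\|\ge1\}$; let $\rho_k^j$, $j,k\in\mathbb{N}$, be i.i.d. copies of $\zeta$; let $Z_k^j$, $j,k\in\mathbb{N}$, be standard normal in $\mathbb{R}^d$; all $\rho_k^j,Z_k^j$, $j,k\in\mathbb{N}$, are independent; $\xi_k^j=\|Z_k^j\|^{-1}Z_k^j$. For $x\in\overline D$, $j,k\in\mathbb{N}$: $\bar X_0^{x,j}=x$,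 $\bar X_k^{x,j}=\bar X_{k-1}^{x,j}+\bar r(\bar X_{k-1}^{x,j})\xi_k^j$, $\bar\tau_0^{x,j}=0$, $\bar\tau_k^{x,j}=\bar\tau_{k-1}^{x,j}+\bar r(\bar X_{k-1}^{x,j})^2\rho_k^j$. Let $U=\{x\in\mathbb{R}^d\colon\|x\|\le1\}$ and let $\mu$ be the probability measure on the Borel sets of $[0,\infty)\times U$ given by $\mu(A)=d\,\mathbb{E}[\int_0^\zeta \mathbf 1_A(s,B_s)\,ds]$. Let $h_0,h_1\colon[0,\infty)\times\overline D\to\mathbb{R}$ be measurable and bounded; $\|F\|_\infty$ denotes the supremum of $|F|$ over the domain of $F$. *)

theory Defs
  imports "HOL-Probability.Probability"
begin

text \<open>Lebesgue density of the centred normal distribution with covariance matrix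
  \<open>\<sigma>\<^sup>2 I\<close>, for \<open>\<sigma> > 0\<close>.\<close>
definition isotropic_normal_density :: "real \<Rightarrow> real ^ 'n \<Rightarrow> real" where
  "isotropic_normal_density \<sigma> x = (\<Prod>i\<in>UNIV. normal_density 0 \<sigma> (x $ i))"

text \<open>Time is a real number, but only nonnegative times are constrained.  As usual, every
  sample path is continuous.\<close>
definition std_brownian_motion :: "'w measure \<Rightarrow> (real \<Rightarrow> 'w \<Rightarrow> real ^ 'n) \<Rightarrow> bool" where
  "std_brownian_motion P B \<longleftrightarrow>
     (\<forall>t\<ge>0. B t \<in> borel_measurable P) \<and>
     (\<forall>\<omega>\<in>space P. B 0 \<omega> = 0) \<and>
     (\<forall>\<omega>\<in>space P. continuous_on {0..} (\<lambda>t. B t \<omega>)) \<and>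
     (\<forall>s t. 0 \<le> s \<and> s < t \<longrightarrow>
        distributed P lborel (\<lambda>\<omega>. B t \<omega> - B s \<omega>)
          (\<lambda>x. ennreal (isotropic_normal_density (sqrt (t - s)) x))) \<and>
     (\<forall>(t :: nat \<Rightarrow> real) m. 0 \<le> t 0 \<and> incseq t \<longrightarrow>
        prob_space.indep_vars P (\<lambda>_. borel)
          (\<lambda>k \<omega>. B (t (Suc k)) \<omega> - B (t k) \<omega>) {..<m})"

text \<open>Extended-real valued, so that the infimum of the empty set is \<open>\<infinity>\<close>.\<close>
definition hitting_time :: "(real \<Rightarrow> 'w \<Rightarrow> 'a) \<Rightarrow> 'a set \<Rightarrow> 'w \<Rightarrow> ereal" where
  "hitting_time X A \<omega> = (INF t\<in>{t. 0 \<le> t \<and> X t \<omega> \<in> A}. ereal t)"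

definition beta_eps_distance ::
    "real \<Rightarrow> real \<Rightarrow> 'a::metric_space set \<Rightarrow> ('a \<Rightarrow> real) \<Rightarrow> bool" where
  "beta_eps_distance \<beta> \<epsilon> D r' \<longleftrightarrow>
     (\<forall>x\<in>D. 0 \<le> r' x) \<and>
     (\<exists>C. C-lipschitz_on D r') \<and>
     (\<forall>y\<in>D. r' y \<le> infdist y (frontier D)) \<and>
     (\<forall>x\<in>D. \<epsilon> \<le> infdist x (frontier D) \<longrightarrow> \<beta> * infdist x (frontier D) \<le> r' x)"

text \<open>The Walk-on-Spheres process; arguments after the distance function and the noise:
  starting point, sample index, step, outcome.\<close>
primrec wos_position :: "('a::real_vector \<Rightarrow> real) \<Rightarrow> (nat \<Rightarrow> nat \<Rightarrow> 'w \<Rightarrow> 'a)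
    \<Rightarrow> 'a \<Rightarrow> nat \<Rightarrow> nat \<Rightarrow> 'w \<Rightarrow> 'a" where
  "wos_position r' \<xi> x j 0 = (\<lambda>\<omega>. x)"
| "wos_position r' \<xi> x j (Suc k) = (\<lambda>\<omega>. wos_position r' \<xi> x j k \<omega> +
     r' (wos_position r' \<xi> x j k \<omega>) *\<^sub>R \<xi> j (Suc k) \<omega>)"

primrec wos_time :: "('a::real_vector \<Rightarrow> real) \<Rightarrow> (nat \<Rightarrow> nat \<Rightarrow> 'w \<Rightarrow> 'a)
    \<Rightarrow> (nat \<Rightarrow> nat \<Rightarrow> 'w \<Rightarrow> real) \<Rightarrow> 'a \<Rightarrow> nat \<Rightarrow> nat \<Rightarrow> 'w \<Rightarrow> real" where
  "wos_time r' \<xi> \<rho> x j 0 = (\<lambda>\<omega>. 0)"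
| "wos_time r' \<xi> \<rho> x j (Suc k) = (\<lambda>\<omega>. wos_time r' \<xi> \<rho> x j k \<omega> +
     (r' (wos_position r' \<xi> x j k \<omega>))\<^sup>2 * \<rho> j (Suc k) \<omega>)"

definition unit_exit_time :: "(real \<Rightarrow> 'w \<Rightarrow> real ^ 'n) \<Rightarrow> 'w \<Rightarrow> ereal" where
  "unit_exit_time B = hitting_time B {x. 1 \<le> norm x}"

definition occupation_measure ::
    "'w measure \<Rightarrow> (real \<Rightarrow> 'w \<Rightarrow> real ^ 'n) \<Rightarrow> (real \<times> (real ^ 'n)) measure" where
  "occupation_measure P B =
     measure_of ({0..} \<times> cball 0 1) (sets (restrict_space borel ({0..} \<times> cball 0 1)))
       (\<lambda>A. of_nat CARD('n) *
          (\<integral>\<^sup>+\<omega>. (\<integral>\<^sup>+s\<in>einterval 0 (unit_exit_time B \<omega>). indicator A (s, B s \<omega>) \<partial>lborel) \<partial>P))"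

definition sup_norm_on :: "'a set \<Rightarrow> ('a \<Rightarrow> real) \<Rightarrow> real" where
  "sup_norm_on S f = (SUP x\<in>S. \<bar>f x\<bar>)"

text \<open>The random variables below take values in different spaces, so their joint independence is
  expressed by the independence of the generated \<open>\<sigma>\<close>-algebras.  The Brownian motion enters as a
  single random element of the path space over \<open>[0,\<infinity>)\<close>.\<close>
datatype source = Src_VY nat nat | Src_rho nat nat | Src_Z nat nat | Src_B

fun source_events :: "'w measure \<Rightarrow> (nat \<Rightarrow> nat \<Rightarrow> 'w \<Rightarrow> real) \<Rightarrow> (nat \<Rightarrow> nat \<Rightarrow> 'w \<Rightarrow> real ^ 'n)
    \<Rightarrow> (nat \<Rightarrow> nat \<Rightarrow> 'w \<Rightarrow> real) \<Rightarrow> (nat \<Rightarrow> nat \<Rightarrow> 'w \<Rightarrow> real ^ 'n) \<Rightarrow> (real \<Rightarrow> 'w \<Rightarrow> real ^ 'n)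
    \<Rightarrow> source \<Rightarrow> 'w set set" where
  "source_events P V Y \<rho> Z B (Src_VY i k) =
     sets (vimage_algebra (space P) (\<lambda>\<omega>. (V i k \<omega>, Y i k \<omega>)) borel)"
| "source_events P V Y \<rho> Z B (Src_rho i k) = sets (vimage_algebra (space P) (\<rho> i k) borel)"
| "source_events P V Y \<rho> Z B (Src_Z i k) = sets (vimage_algebra (space P) (Z i k) borel)"
| "source_events P V Y \<rho> Z B Src_B =
     sets (vimage_algebra (space P) (\<lambda>\<omega>. \<lambda>t\<in>{0..}. B t \<omega>) (\<Pi>\<^sub>M t\<in>{0..}. borel))"

definition source_indices :: "source set" where
  "source_indices = {Src_B} \<union>
     (\<Union>i\<in>{1..}. \<Union>k\<in>{1..}. {Src_VY i k, Src_rho i k, Src_Z i k})"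

end

theory Submission imports Defs begin

text \<open>
  The value function \<open>u (t, x)\<close>, the expected payoff of a Brownian path started in \<open>x\<close> at time \<open>t\<close>,
  satisfies an exact one-step identity: by the strong Markov property at the exit from a ball, by
  Brownian scaling, and since the exit point is uniform on the sphere and independent of the exit
  time, one step of the walk followed by \<open>u\<close> reproduces \<open>u\<close> up to the sampled source term.
  Telescoping, the bias of the estimator is the mean of \<open>u - h0\<close> at the last state.  This
  difference is bounded by a concave function of the position that is small near the boundary, and
  away from the boundary the squared distance to the starting point grows in mean by at least
  \<open>(\<beta> \<delta>)\<^sup>2\<close> per step, so a Lyapunov function combining both bounds gives the geometric rate in \<open>M\<close>.

  The supremum over \<open>x\<close> is reduced to a finite net: the estimator is pathwise Lipschitz in its
  starting point, with a constant growing like \<open>(1 + L) ^ M\<close> and linear in the elapsed clocks, and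
  Hoeffding's lemma bounds the expected maximal deviation over the net.
\<close>

subsection \<open>Isotropic Gaussian measures\<close>

text \<open>Mean exit times are bounded without solving a differential equation. The domain lies
  below each of its supporting hyperplanes, optional stopping in the resulting slab bounds the mean
  exit time by an affine function of the start, and the infimum over all directions is concave. A
  sphere is symmetric about its centre, so for such a function it suffices to compare the centre
  with pairs of antipodal points.

  A path is handled through its values at rational times. Sequences carry a Borel sigma-algebra
  equal to the product one, so laws of paths are compared on cylinders, and exit time, exit point
  and payoff become Borel functions of a sequence.

  Elapsed times are unbounded, so the Lipschitz constant of the estimator is random. It is linear in
  the clocks, hence only their mean enters the bound. All starting points share one integrable
  dominating random variable, which avoids the question whether the supremum over an uncountable set
  is measurable.

  Some constants of the statement exceed what the argument yields: the logarithms in its last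
  summand come from an enlargement at the very end.\<close>

lemma lborel_distr_uminus_euclidean:
  "distr lborel borel (\<lambda>x::'a::euclidean_space. a - x) = lborel"
proof -
  have "lborel = density (distr lborel borel (\<lambda>x::'a. a + (-1) *\<^sub>R x)) (\<lambda>_. ennreal 1)"
    using lborel_affine[of "-1::real" a] by simp
  then show ?thesis by (simp add: density_1)
qed

lemma nn_integral_lborel_shift:
  fixes f :: "'a::euclidean_space \<Rightarrow> ennreal"
  assumes [measurable]: "f \<in> borel_measurable borel"
  shows "(\<integral>\<^sup>+x. f (a + x) \<partial>lborel) = (\<integral>\<^sup>+x. f x \<partial>lborel)"
proof -
  have "(\<integral>\<^sup>+x. f x \<partial>lborel) = (\<integral>\<^sup>+x. f x \<partial>distr lborel borel ((+) a))"
    by (simp add: lborel_distr_plus)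
  also have "\<dots> = (\<integral>\<^sup>+x. f (a + x) \<partial>lborel)" by (subst nn_integral_distr) auto
  finally show ?thesis ..
qed

lemma nn_integral_lborel_reflect:
  fixes f :: "'a::euclidean_space \<Rightarrow> ennreal"
  assumes [measurable]: "f \<in> borel_measurable borel"
  shows "(\<integral>\<^sup>+x. f (a - x) \<partial>lborel) = (\<integral>\<^sup>+x. f x \<partial>lborel)"
proof -
  have "(\<integral>\<^sup>+x. f x \<partial>lborel) = (\<integral>\<^sup>+x. f x \<partial>distr lborel borel (\<lambda>x. a - x))"
    by (simp add: lborel_distr_uminus_euclidean)
  also have "\<dots> = (\<integral>\<^sup>+x. f (a - x) \<partial>lborel)" by (subst nn_integral_distr) auto
  finally show ?thesis ..
qed

lemma orthogonal_transformation_borel_measurable [measurable_dest]: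
  "orthogonal_transformation (R :: 'a::euclidean_space \<Rightarrow> 'a) \<Longrightarrow> R \<in> borel_measurable borel"
  by (intro borel_measurable_continuous_onI linear_continuous_on)
     (simp add: linear_conv_bounded_linear[symmetric] orthogonal_transformation_linear)

text \<open>Fubini's theorem compares the translation-invariant image measure with Lebesgue measure.\<close>
lemma lborel_distr_orthogonal:
  fixes R :: "'a::euclidean_space \<Rightarrow> 'a"
  assumes R: "orthogonal_transformation R"
  shows "distr lborel borel R = lborel"
proof (rule measure_eqI)
  note [measurable] = orthogonal_transformation_borel_measurable[OF R]
  interpret lin: linear R using R by (rule orthogonal_transformation_linear)
  define E where "E = ball (0::'a) 1"
  have [measurable]: "E \<in> sets borel" by (simp add: E_def)
  have "unit_ball_vol (real DIM('a)) \<noteq> 0"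
    using unit_ball_vol_pos[OF of_nat_0_le_iff, of "DIM('a)"] by (metis less_irrefl)
  then have E: "emeasure lborel E \<noteq> 0" "emeasure lborel E \<noteq> \<infinity>"
    by (auto simp: E_def emeasure_ball)
  have RE: "indicator E (R y) = (indicator E y :: ennreal)" for y
    using R by (simp add: E_def orthogonal_transformation_norm indicator_def)
  fix A assume "A \<in> sets (distr lborel borel R)"
  then have [measurable]: "A \<in> sets borel" by simp
  have "emeasure (distr lborel borel R) A = (\<integral>\<^sup>+y. indicator A y \<partial>distr lborel borel R)" by simp
  also have "\<dots> = (\<integral>\<^sup>+y. indicator A (R y) \<partial>lborel)" by (rule nn_integral_distr) measurable
  finally have "emeasure (distr lborel borel R) A * emeasure lborel E
      = (\<integral>\<^sup>+y. (\<integral>\<^sup>+x. indicator A (R y) * indicator E x \<partial>lborel) \<partial>lborel)"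
    by (simp add: nn_integral_cmult nn_integral_multc)
  also have "\<dots> = (\<integral>\<^sup>+y. (\<integral>\<^sup>+x. indicator A (R y) * indicator E (R y + x) \<partial>lborel) \<partial>lborel)"
    by (intro nn_integral_cong nn_integral_lborel_shift[symmetric]) measurable
  also have "\<dots> = (\<integral>\<^sup>+x. (\<integral>\<^sup>+y. indicator A (R y) * indicator E (R y + x) \<partial>lborel) \<partial>lborel)"
    by (rule lborel_pair.Fubini') measurable
  also have "\<dots> = (\<integral>\<^sup>+x. (\<integral>\<^sup>+y. indicator A (R y - x) * indicator E (R y) \<partial>lborel) \<partial>lborel)"
  proof (rule nn_integral_cong)
    fix x
    \<comment> \<open>The shift by \<open>x\<close> acts on the image side; surjectivity turns it
      into a shift of \<open>y\<close> by \<open>z\<close>, under which Lebesgue measure is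
      invariant.\<close>
    obtain z where z: "R z = x" using orthogonal_transformation_surj[OF R] by (metis surjD)
    have "(\<integral>\<^sup>+y. indicator A (R y) * indicator E (R y + x) \<partial>lborel) =
       (\<integral>\<^sup>+y. indicator A (R (- z + y)) * indicator E (R (- z + y) + x) \<partial>lborel)"
      by (rule nn_integral_lborel_shift[symmetric]) measurable
    then show "(\<integral>\<^sup>+y. indicator A (R y) * indicator E (R y + x) \<partial>lborel) =
       (\<integral>\<^sup>+y. indicator A (R y - x) * indicator E (R y) \<partial>lborel)"
      by (simp add: lin.diff z)
  qed
  also have "\<dots> = (\<integral>\<^sup>+y. (\<integral>\<^sup>+x. indicator A (R y - x) * indicator E (R y) \<partial>lborel) \<partial>lborel)"
    by (rule lborel_pair.Fubini') measurable
  also have "\<dots> = (\<integral>\<^sup>+y. emeasure lborel A * indicator E y \<partial>lborel)"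
    by (intro nn_integral_cong, subst nn_integral_lborel_reflect) (simp_all add: RE nn_integral_multc)
  also have "\<dots> = emeasure lborel A * emeasure lborel E"
    by (simp add: nn_integral_cmult)
  finally show "emeasure (distr lborel borel R) A = emeasure lborel A"
    using E by (simp add: ennreal_mult_cancel_left mult.commute[of _ "emeasure lborel E"])
qed simp

definition gauss1 :: "(real ^ 'n) measure" where
  "gauss1 = density lborel (\<lambda>x. ennreal (isotropic_normal_density 1 x))"

text \<open>An image under scaling instead of a density, so that variance \<open>0\<close> is
  included as a Dirac mass. It occurs because time sequences may repeat a point.\<close>

definition gauss :: "real \<Rightarrow> (real ^ 'n) measure" where
  "gauss s = distr gauss1 borel (\<lambda>x. sqrt s *\<^sub>R x)"

text \<open>The density depends on \<open>x\<close> only through its norm; rotation invariance and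
  scaling both come from this form.\<close>

lemma isotropic_normal_density_eq:
  fixes x :: "real ^ 'n"
  shows "isotropic_normal_density \<sigma> x = (1 / sqrt (2 * pi * \<sigma>\<^sup>2)) ^ CARD('n) * exp (- (norm x)\<^sup>2 / (2 * \<sigma>\<^sup>2))"
  unfolding isotropic_normal_density_def normal_density_def
  by (simp add: prod.distrib prod_dividef power_divide exp_sum[symmetric] sum_negf sum_divide_distrib[symmetric]
      norm_vec_def L2_set_def sum_nonneg)

lemma isotropic_normal_density_measurable [measurable]:
  "isotropic_normal_density \<sigma> \<in> borel_measurable borel"
  unfolding isotropic_normal_density_eq[abs_def] by measurable

lemma sets_gauss1 [simp, measurable_cong]: "sets gauss1 = sets borel"
  by (simp add: gauss1_def)

lemma sets_gauss [simp, measurable_cong]: "sets (gauss s) = sets borel"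
  by (simp add: gauss_def)

lemma prod_Basis_cart: "(\<Prod>b\<in>Basis. f b (x \<bullet> b)) = (\<Prod>i\<in>UNIV. f (axis i 1) (x $ i))"
  for x :: "real ^ 'n"
proof -
  have "(\<Prod>b\<in>Basis. f b (x \<bullet> b)) = (\<Prod>b\<in>range (\<lambda>i::'n. axis i 1). f b (x \<bullet> b))"
    by (rule prod.cong) (auto simp: Basis_vec_def)
  also have "\<dots> = (\<Prod>i\<in>UNIV. f (axis i 1) (x \<bullet> axis i 1))"
    by (subst prod.reindex) (auto simp: inj_on_def axis_eq_axis)
  finally show ?thesis by (simp add: inner_axis)
qed

lemma nn_integral_gauss1_prod:
  fixes f :: "'n::finite \<Rightarrow> real \<Rightarrow> ennreal"
  assumes [measurable]: "\<And>i. f i \<in> borel_measurable borel"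
  shows "(\<integral>\<^sup>+x. (\<Prod>i\<in>UNIV. f i (x $ i)) \<partial>gauss1) =
    (\<Prod>i\<in>UNIV. (\<integral>\<^sup>+y. f i y * ennreal (std_normal_density y) \<partial>lborel))"
proof -
  \<comment> \<open>The product formula for \<open>lborel\<close> runs over basis vectors, so the
    coordinate is recovered from its axis vector.\<close>
  define g where "g b y = f (THE i. b = axis i 1) y * ennreal (std_normal_density y)" for b :: "real ^ 'n" and y
  have the: "(THE i'. axis i (1::real) = axis i' 1) = i" for i :: 'n
    by (rule the_equality) (auto simp: axis_eq_axis)
  have "(\<integral>\<^sup>+x. (\<Prod>i\<in>UNIV. f i (x $ i)) \<partial>gauss1)
     = (\<integral>\<^sup>+x. (\<Prod>i\<in>UNIV. f i (x $ i) * ennreal (std_normal_density (x $ i))) \<partial>lborel)"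
    unfolding gauss1_def
    by (subst nn_integral_density)
       (auto simp: prod.distrib isotropic_normal_density_def prod_ennreal mult.commute intro!: nn_integral_cong)
  also have "\<dots> = (\<integral>\<^sup>+x. (\<Prod>b\<in>Basis. g b (x \<bullet> b)) \<partial>lborel)"
    by (subst prod_Basis_cart) (simp add: g_def the)
  also have "\<dots> = (\<Prod>b\<in>Basis. (\<integral>\<^sup>+x. g b x \<partial>lborel))"
    by (rule nn_integral_lborel_prod) (auto simp: g_def)
  also have "\<dots> = (\<Prod>i\<in>UNIV. (\<integral>\<^sup>+y. f i y * ennreal (std_normal_density y) \<partial>lborel))"
    using prod_Basis_cart[of "\<lambda>b y. (\<integral>\<^sup>+x. g b x \<partial>lborel)" 0] by (simp add: g_def the)
  finally show ?thesis .
qed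

lemma nn_integral_std_normal: "(\<integral>\<^sup>+y. ennreal (std_normal_density y) \<partial>lborel) = 1"
  using prob_space.emeasure_space_1[OF prob_space_normal_density[of 1 0]]
  by (simp add: emeasure_density)

lemma prob_space_gauss1: "prob_space (gauss1 :: (real ^ 'n) measure)"
proof
  have "(\<integral>\<^sup>+x. (\<Prod>i\<in>(UNIV::'n set). (\<lambda>_ _. 1) i (x $ i)) \<partial>gauss1) = 1"
    by (subst nn_integral_gauss1_prod) (simp_all add: nn_integral_std_normal)
  then show "emeasure (gauss1 :: (real ^ 'n) measure) (space gauss1) = 1" by simp
qed

lemma prob_space_gauss: "prob_space (gauss s)"
  unfolding gauss_def by (rule prob_space.prob_space_distr[OF prob_space_gauss1]) simp

lemma nn_integral_gauss1_component: "(\<integral>\<^sup>+x. ennreal ((x $ j)\<^sup>2) \<partial>gauss1) = 1"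
proof -
  define f where "f i y = (if i = j then ennreal (y\<^sup>2) else 1)" for i y
  have "(\<integral>\<^sup>+x. ennreal ((x $ j)\<^sup>2) \<partial>gauss1) = (\<integral>\<^sup>+x. (\<Prod>i\<in>UNIV. f i (x $ i)) \<partial>gauss1)"
    by (intro nn_integral_cong) (simp add: f_def)
  also have "\<dots> = (\<Prod>i\<in>UNIV. (\<integral>\<^sup>+y. f i y * ennreal (std_normal_density y) \<partial>lborel))"
    by (rule nn_integral_gauss1_prod) (auto simp: f_def)
  also have "\<dots> = (\<Prod>i\<in>UNIV. if i = j then (\<integral>\<^sup>+y. ennreal (std_normal_density y * y\<^sup>2) \<partial>lborel) else 1)"
    by (intro prod.cong) (auto simp: f_def nn_integral_std_normal ennreal_mult[symmetric] mult.commute)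
  also have "\<dots> = (\<integral>\<^sup>+y. ennreal (std_normal_density y * y\<^sup>2) \<partial>lborel)" by simp
  also have "\<dots> = 1"
    using std_normal_moment_even[of 1]
    by (subst nn_integral_eq_integral) (auto simp: has_bochner_integral_iff)
  finally show ?thesis .
qed

lemma gauss1_orthogonal:
  assumes R: "orthogonal_transformation (R :: real ^ 'n \<Rightarrow> real ^ 'n)"
  shows "distr gauss1 borel R = gauss1"
proof -
  note [measurable] = orthogonal_transformation_borel_measurable[OF R]
  have "distr gauss1 borel R = distr (density lborel (\<lambda>x. ennreal (isotropic_normal_density 1 (R x)))) borel R"
    using R by (simp add: gauss1_def isotropic_normal_density_eq orthogonal_transformation_norm)
  also have "\<dots> = density (distr lborel borel R) (\<lambda>x. ennreal (isotropic_normal_density 1 x))"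
  proof (rule measure_eqI)
    fix A assume "A \<in> sets (distr (density lborel (\<lambda>x. ennreal (isotropic_normal_density 1 (R x)))) borel R)"
    then have [measurable]: "A \<in> sets borel" by simp
    then have [measurable]: "R -` A \<in> sets borel" by (rule measurable_sets_borel[rotated]) measurable
    show "emeasure (distr (density lborel (\<lambda>x. ennreal (isotropic_normal_density 1 (R x)))) borel R) A =
      emeasure (density (distr lborel borel R) (\<lambda>x. ennreal (isotropic_normal_density 1 x))) A"
      by (auto simp: emeasure_density emeasure_distr nn_integral_distr indicator_def intro!: nn_integral_cong)
  qed simp
  also have "\<dots> = gauss1" by (simp add: lborel_distr_orthogonal[OF R] gauss1_def)
  finally show ?thesis .
qed

lemma gauss_orthogonal:
  assumes R: "orthogonal_transformation (R :: real ^ 'n \<Rightarrow> real ^ 'n)"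
  shows "distr (gauss s) borel R = gauss s"
proof -
  note [measurable] = orthogonal_transformation_borel_measurable[OF R]
  have "distr (gauss s) borel R = distr (distr gauss1 borel R) borel (\<lambda>x. sqrt s *\<^sub>R x)"
    unfolding gauss_def using R
    by (subst (1 2) distr_distr) (auto simp: o_def orthogonal_transformation_scaleR)
  then show ?thesis by (simp add: gauss1_orthogonal[OF R] gauss_def)
qed

lemma gauss_scale:
  assumes "0 < r"
  shows "distr (gauss (s / r\<^sup>2)) borel (\<lambda>x. r *\<^sub>R x) = gauss s"
  unfolding gauss_def using assms
  by (subst distr_distr) (auto simp: o_def real_sqrt_divide intro!: distr_cong)

lemma density_isotropic_eq_gauss:
  assumes "0 < s"
  shows "density lborel (\<lambda>x. ennreal (isotropic_normal_density (sqrt s) x)) = (gauss s :: (real ^ 'n) measure)"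
proof -
  define c where "c = sqrt s"
  have c: "0 < c" using assms by (simp add: c_def)
  \<comment> \<open>The Jacobian \<open>c ^ CARD('n)\<close> of the dilation cancels the change in
    the normalising constant.\<close>
  have sc: "isotropic_normal_density c (c *\<^sub>R x) * c ^ CARD('n) = isotropic_normal_density 1 x" for x :: "real ^ 'n"
    using c by (simp add: isotropic_normal_density_eq power_mult_distrib real_sqrt_mult power_divide field_simps)
  have lb: "lborel = density (distr lborel borel (\<lambda>x::real^'n. c *\<^sub>R x)) (\<lambda>_. ennreal (c ^ CARD('n)))"
    using lborel_affine[of c "0 :: real ^ 'n"] c by (simp add: ennreal_power)
  have "density lborel (\<lambda>x. ennreal (isotropic_normal_density c x)) =
     density (density (distr lborel borel (\<lambda>x::real^'n. c *\<^sub>R x)) (\<lambda>_. ennreal (c ^ CARD('n)))) (\<lambda>x. ennreal (isotropic_normal_density c x))"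
    by (subst lb) (rule refl)
  also have "\<dots> = gauss s"
    unfolding gauss_def gauss1_def c_def[symmetric]
  proof (rule measure_eqI)
    fix A assume "A \<in> sets (density (density (distr lborel borel (\<lambda>x::real^'n. c *\<^sub>R x)) (\<lambda>_. ennreal (c ^ CARD('n)))) (\<lambda>x. ennreal (isotropic_normal_density c x)))"
    then have [measurable]: "A \<in> sets borel" by simp
    then have [measurable]: "(*\<^sub>R) c -` A \<in> sets borel" by (rule measurable_sets_borel[rotated]) measurable
    have nn: "0 \<le> isotropic_normal_density c x" for x :: "real ^ 'n"
      by (simp add: isotropic_normal_density_def prod_nonneg)
    show "emeasure (density (density (distr lborel borel (\<lambda>x::real^'n. c *\<^sub>R x)) (\<lambda>_. ennreal (c ^ CARD('n)))) (\<lambda>x. ennreal (isotropic_normal_density c x))) A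
      = emeasure (distr (density lborel (\<lambda>x. ennreal (isotropic_normal_density 1 x))) borel ((*\<^sub>R) c)) A"
      by (auto simp: emeasure_density nn_integral_density nn_integral_distr emeasure_distr indicator_def
          sc[symmetric] ennreal_mult nn c less_imp_le mult_ac intro!: nn_integral_cong)
  qed simp
  finally show ?thesis by (simp add: c_def)
qed

lemma gauss_0: "gauss 0 = return borel (0 :: real ^ 'n)"
proof -
  interpret prob_space "gauss1 :: (real ^ 'n) measure" by (rule prob_space_gauss1)
  show ?thesis by (simp add: gauss_def)
qed

subsection \<open>Laws of Brownian paths\<close>

lemma space_gauss: "space (gauss s) = UNIV"
  using sets_eq_imp_space_eq[OF sets_gauss] by simp

text \<open>An enumeration, with repetitions, of the nonnegative rationals. A continuous path is
  determined by its values at these countably many times.\<close>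

definition qt :: "nat \<Rightarrow> real" where
  "qt k = \<bar>real_of_rat (from_nat k)\<bar>"

lemma qt_nonneg [simp]: "0 \<le> qt k"
  by (simp add: qt_def)

lemma ex_qt: assumes "0 \<le> t" "t \<in> \<rat>" shows "\<exists>k. qt k = t"
proof -
  obtain r where "t = real_of_rat r" using assms(2) by (auto elim: Rats_cases)
  then have "qt (to_nat r) = t" using assms(1) by (simp add: qt_def)
  then show ?thesis ..
qed

text \<open>The path restricted to rational times. On \<open>nat \<Rightarrow> 'a\<close> the Borel
  and the product sigma-algebra coincide for the spaces used here, so a law of paths is a measure on
  a countable product.\<close>

definition skel :: "(real \<Rightarrow> 'a) \<Rightarrow> nat \<Rightarrow> 'a" where
  "skel f k = f (qt k)"

lemma measurable_to_seq:
  fixes f :: "'w \<Rightarrow> nat \<Rightarrow> 'a::second_countable_topology"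
  assumes "\<And>k. (\<lambda>w. f w k) \<in> borel_measurable M"
  shows "f \<in> borel_measurable M"
proof -
  have "f \<in> measurable M (PiM UNIV (\<lambda>_. borel))"
    using assms by (intro measurable_PiM_single') auto
  then show ?thesis
    by (simp add: measurable_cong_sets[OF refl sets_PiM_equal_borel])
qed

lemma measurable_seq_component:
  "(\<lambda>f. f k) \<in> borel_measurable (borel :: (nat \<Rightarrow> 'a::second_countable_topology) measure)"
  by (intro borel_measurable_continuous_onI continuous_on_product_coordinates)

text \<open>Increments are specified along infinite nondecreasing sequences; finitely many times are
  sorted, started at \<open>0\<close>, ended at \<open>s\<close>, and continued by the constant
  \<open>s\<close>.\<close>

lemma ex_time_grid:
  fixes s :: real
  assumes "finite S" "S \<subseteq> {0..s}" "0 \<le> s"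
  obtains u :: "nat \<Rightarrow> real" and m :: nat
  where "u 0 = 0" "u m = s" "incseq u" "S \<subseteq> u ` {..m}"
proof -
  define S' where "S' = insert 0 (insert s S)"
  define xs where "xs = sorted_list_of_set S'"
  have fin: "finite S'" "S' \<noteq> {}" using assms by (auto simp: S'_def)
  have xs: "set xs = S'" "sorted xs" "xs \<noteq> []" using fin by (auto simp: xs_def)
  define m where "m = length xs - 1"
  define u where "u k = xs ! min k m" for k
  have len: "length xs = Suc m" using xs(3) by (cases xs) (auto simp: m_def)
  have mono: "incseq u"
    unfolding incseq_def u_def using xs(2) len by (auto intro!: sorted_nth_mono)
  have sub: "S' \<subseteq> u ` {..m}"
  proof
    fix x assume "x \<in> S'"
    then obtain i where "i < length xs" "xs ! i = x" using xs(1) by (metis in_set_conv_nth)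
    then show "x \<in> u ` {..m}" using len by (intro image_eqI[of _ _ i]) (auto simp: u_def)
  qed
  have rng: "u k \<in> S'" for k using xs(1) len by (auto simp: u_def intro!: nth_mem)
  have "u 0 = 0"
  proof -
    obtain i where "u i = 0" using sub by (auto simp: S'_def)
    then have "u 0 \<le> 0" using mono by (metis incseqD le0)
    then show ?thesis using rng[of 0] assms by (auto simp: S'_def)
  qed
  moreover have "u m = s"
  proof -
    obtain i where "i \<le> m" "u i = s" using sub by (auto simp: S'_def)
    then have "s \<le> u m" using mono by (metis incseqD)
    then show ?thesis using rng[of m] assms by (auto simp: S'_def)
  qed
  ultimately show ?thesis using that mono sub by (auto simp: S'_def)
qed

text \<open>A path started at \<open>0\<close> has at each grid time the value of a partial sum of
  increments, so conditions on values are conditions on the vector of increments. The set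
  \<open>E\<close> does not depend on the path, which lets two processes be compared.\<close>

lemma cylinder_via_increments:
  fixes A :: "real \<Rightarrow> 'a::euclidean_space set"
  assumes u: "u 0 = 0" and J: "finite J" "J \<subseteq> u ` {..m}" and A: "\<And>q. A q \<in> sets borel"
  obtains E where "E \<in> sets (PiM {..<m} (\<lambda>_. borel))"
    "\<forall>f. f 0 = 0 \<longrightarrow> (\<forall>q\<in>J. f q \<in> A q) = ((\<lambda>k\<in>{..<m}. f (u (Suc k)) - f (u k)) \<in> E)"
proof -
  obtain j where j: "\<And>q. q \<in> J \<Longrightarrow> j q \<le> m \<and> u (j q) = q"
    using J(2) unfolding subset_iff image_iff by (metis atMost_iff)
  define E where "E = {v \<in> space (PiM {..<m} (\<lambda>_. borel :: 'a measure)). \<forall>q\<in>J. (\<Sum>k<j q. v k) \<in> A q}"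
  have m: "(\<lambda>v. \<Sum>k<j q. v k) \<in> borel_measurable (PiM {..<m} (\<lambda>_. borel :: 'a measure))" if "q \<in> J" for q
    using j[OF that] by (intro borel_measurable_sum measurable_component_singleton) auto
  have "E \<in> sets (PiM {..<m} (\<lambda>_. borel))"
  proof -
    have "{v \<in> space (PiM {..<m} (\<lambda>_. borel :: 'a measure)). (\<Sum>k<j q. v k) \<in> A q} \<in> sets (PiM {..<m} (\<lambda>_. borel))"
      if "q \<in> J" for q
      using measurable_sets[OF m[OF that] A[of q]] by (simp add: vimage_def Int_def conj_commute)
    then show ?thesis
      unfolding E_def using J(1) by (intro sets.sets_Collect_finite_All) auto
  qed
  moreover have "(\<forall>q\<in>J. f q \<in> A q) = ((\<lambda>k\<in>{..<m}. f (u (Suc k)) - f (u k)) \<in> E)" if f: "f 0 = 0" for f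
  proof -
    have "(\<Sum>k<j q. (\<lambda>k\<in>{..<m}. f (u (Suc k)) - f (u k)) k) = f q" if "q \<in> J" for q
    proof -
      have "(\<Sum>k<j q. (\<lambda>k\<in>{..<m}. f (u (Suc k)) - f (u k)) k) = (\<Sum>k<j q. f (u (Suc k)) - f (u k))"
        using j[OF that] by (intro sum.cong) auto
      then show ?thesis using j[OF that] f u by (simp add: sum_lessThan_telescope[of "\<lambda>k. f (u k)"])
    qed
    then show ?thesis
      by (auto simp: E_def space_PiM)
  qed
  ultimately show ?thesis using that by blast
qed

text \<open>Brownian motion described by the joint law of its increments.  In this form the property
  passes to conditional measures, so that the independence of the future from the past becomes
  uniqueness in law.\<close>
locale bm = prob_space P for P :: "'w measure" +
  fixes B :: "real \<Rightarrow> 'w \<Rightarrow> real ^ 'n"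
  assumes B_measurable: "0 \<le> s \<Longrightarrow> B s \<in> borel_measurable P"
    and B_0: "w \<in> space P \<Longrightarrow> B 0 w = 0"
    and B_continuous: "w \<in> space P \<Longrightarrow> continuous_on {0..} (\<lambda>t. B t w)"
    and B_increments: "0 \<le> t 0 \<Longrightarrow> incseq t \<Longrightarrow> (\<And>k. C k \<in> sets borel) \<Longrightarrow>
      measure P {w\<in>space P. \<forall>k<m. B (t (Suc k)) w - B (t k) w \<in> C k} =
      (\<Prod>k<m. measure (gauss (t (Suc k) - t k)) (C k))"

lemma bm_if_std_brownian_motion:
  assumes P: "prob_space P" and B: "std_brownian_motion P B"
  shows "bm P B"
proof -
  interpret prob_space P by fact
  note B = B[unfolded std_brownian_motion_def]
  note Bm = B[THEN conjunct1, rule_format]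
    and B0 = B[THEN conjunct2, THEN conjunct1, rule_format]
    and Bc = B[THEN conjunct2, THEN conjunct2, THEN conjunct1, rule_format]
    and Bd = B[THEN conjunct2, THEN conjunct2, THEN conjunct2, THEN conjunct1, rule_format, OF conjI]
    and Bi = B[THEN conjunct2, THEN conjunct2, THEN conjunct2, THEN conjunct2, rule_format, OF conjI]
  have distr: "distr P borel (\<lambda>w. B t w - B s w) = gauss (t - s)" if "0 \<le> s" "s \<le> t" for s t
  \<comment> \<open>A density is available for positive time spans only; a vanishing increment has
    the Dirac law \<open>gauss 0\<close>.\<close>
  proof (cases "s = t")
    case True
    have "distr P borel (\<lambda>w. 0 :: real ^ 'b) = return borel 0" by (rule distr_const) simp
    with True show ?thesis by (simp add: gauss_0)
  next
    case False
    then have "distributed P lborel (\<lambda>w. B t w - B s w) (\<lambda>x. ennreal (isotropic_normal_density (sqrt (t - s)) x))"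
      using Bd[of s t] that by auto
    then have "distr P lborel (\<lambda>w. B t w - B s w) = gauss (t - s)"
      using that False by (simp add: distributed_distr_eq_density density_isotropic_eq_gauss)
    moreover have "distr P lborel (\<lambda>w. B t w - B s w) = distr P borel (\<lambda>w. B t w - B s w)"
      by (rule distr_cong) auto
    ultimately show ?thesis by simp
  qed
  show ?thesis
  proof
    fix t :: "nat \<Rightarrow> real" and C :: "nat \<Rightarrow> (real ^ 'b) set" and m :: nat
    assume t: "0 \<le> t 0" "incseq t" and C: "\<And>k. C k \<in> sets borel"
    have tk: "0 \<le> t k" "t k \<le> t (Suc k)" for k
      using t by (auto simp: incseq_Suc_iff intro: order_trans[OF t(1)] incseqD[OF t(2)])
    have ind: "indep_vars (\<lambda>_. borel) (\<lambda>k w. B (t (Suc k)) w - B (t k) w) {..<m}"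
      using t by (rule Bi)
    show "measure P {w\<in>space P. \<forall>k<m. B (t (Suc k)) w - B (t k) w \<in> C k} =
      (\<Prod>k<m. measure (gauss (t (Suc k) - t k)) (C k))"
    \<comment> \<open>The product rule for independent variables is applied to a nonempty index
      set.\<close>
    proof (cases "m = 0")
      case True then show ?thesis by (simp add: prob_space)
    next
      case False
      have "{w\<in>space P. \<forall>k<m. B (t (Suc k)) w - B (t k) w \<in> C k} =
         (\<Inter>k\<in>{..<m}. (\<lambda>w. B (t (Suc k)) w - B (t k) w) -` C k \<inter> space P)"
        using False by auto
      also have "measure P \<dots> = (\<Prod>k<m. prob ((\<lambda>w. B (t (Suc k)) w - B (t k) w) -` C k \<inter> space P))"
        using False C by (intro indep_varsD_finite[OF ind]) auto
      also have "\<dots> = (\<Prod>k<m. measure (gauss (t (Suc k) - t k)) (C k))"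
      proof (intro prod.cong refl)
        fix k assume "k \<in> {..<m}"
        have "(\<lambda>w. B (t (Suc k)) w - B (t k) w) \<in> borel_measurable P"
          using tk by (intro borel_measurable_diff Bm)
        then show "prob ((\<lambda>w. B (t (Suc k)) w - B (t k) w) -` C k \<inter> space P) = measure (gauss (t (Suc k) - t k)) (C k)"
          using C by (simp add: distr[OF tk, symmetric] measure_distr)
      qed
      finally show ?thesis .
    qed
  qed (use Bm B0 Bc in auto)
qed

context bm
begin

abbreviation incr :: "(nat \<Rightarrow> real) \<Rightarrow> nat \<Rightarrow> 'w \<Rightarrow> real ^ 'n" where
  "incr t k w \<equiv> B (t (Suc k)) w - B (t k) w"

lemma incr_measurable:
  assumes "0 \<le> t 0" "incseq t"
  shows "incr t k \<in> borel_measurable P"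
  using assms by (intro borel_measurable_diff B_measurable) (auto intro: order_trans[OF assms(1)] incseqD)

lemma incr_vec_measurable:
  assumes "0 \<le> t 0" "incseq t"
  shows "(\<lambda>w. \<lambda>k\<in>I. incr t k w) \<in> measurable P (PiM I (\<lambda>_. borel))"
  by (intro measurable_restrict incr_measurable assms)

lemma incr_law:
  assumes t: "0 \<le> t 0" "incseq t"
  shows "distr P (PiM {..<m} (\<lambda>_. borel)) (\<lambda>w. \<lambda>k\<in>{..<m}. incr t k w) =
    PiM {..<m} (\<lambda>k. gauss (t (Suc k) - t k))"
proof -
  interpret G: prob_space "gauss s :: (real ^ 'n) measure" for s by (rule prob_space_gauss)
  interpret product_sigma_finite "\<lambda>k. gauss (t (Suc k) - t k) :: (real ^ 'n) measure" ..
  show ?thesis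
  proof (rule PiM_eqI)
  show "sets (distr P (PiM {..<m} (\<lambda>_. borel)) (\<lambda>w. \<lambda>k\<in>{..<m}. incr t k w)) = sets (PiM {..<m} (\<lambda>k. gauss (t (Suc k) - t k) :: (real ^ 'n) measure))"
    by (simp cong: sets_PiM_cong)
  fix A assume A: "\<And>k. k \<in> {..<m} \<Longrightarrow> A k \<in> sets (gauss (t (Suc k) - t k) :: (real ^ 'n) measure)"
  \<comment> \<open>The axiom asks for a Borel set at every index, whereas nothing is known about
    \<open>A\<close> beyond \<open>m\<close>.\<close>
  define A' where "A' k = (if k < m then A k else UNIV)" for k
  have A': "A' k \<in> sets borel" for k using A[of k] by (auto simp: A'_def)
  have [measurable]: "Pi\<^sub>E {..<m} A \<in> sets (PiM {..<m} (\<lambda>_. borel))"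
    using A by (intro sets_PiM_I_finite) auto
  have "emeasure (distr P (PiM {..<m} (\<lambda>_. borel)) (\<lambda>w. \<lambda>k\<in>{..<m}. incr t k w)) (Pi\<^sub>E {..<m} A) =
    emeasure P ((\<lambda>w. \<lambda>k\<in>{..<m}. incr t k w) -` Pi\<^sub>E {..<m} A \<inter> space P)"
    by (rule emeasure_distr[OF incr_vec_measurable[OF t]]) measurable
  also have "(\<lambda>w. \<lambda>k\<in>{..<m}. incr t k w) -` Pi\<^sub>E {..<m} A \<inter> space P = {w\<in>space P. \<forall>k<m. incr t k w \<in> A' k}"
    by (rule set_eqI) (simp add: A'_def PiE_iff conj_commute Ball_def)
  also have "emeasure P \<dots> = ennreal (\<Prod>k<m. measure (gauss (t (Suc k) - t k)) (A' k))"
    using B_increments[OF t A'] by (simp add: emeasure_eq_measure)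
  also have "\<dots> = (\<Prod>k<m. emeasure (gauss (t (Suc k) - t k)) (A k))"
    by (simp add: prod_ennreal[symmetric] G.emeasure_eq_measure A'_def)
  finally show "emeasure (distr P (PiM {..<m} (\<lambda>_. borel)) (\<lambda>w. \<lambda>k\<in>{..<m}. incr t k w)) (Pi\<^sub>E {..<m} A) =
    (\<Prod>k\<in>{..<m}. emeasure (gauss (t (Suc k) - t k)) (A k))" .
  qed auto
qed

lemma incr_distr:
  assumes t: "0 \<le> t 0" "incseq t"
  shows "distr P borel (incr t k) = gauss (t (Suc k) - t k)"
proof -
  have "distr P borel (incr t k) =
     distr (distr P (PiM {..<Suc k} (\<lambda>_. borel)) (\<lambda>w. \<lambda>k\<in>{..<Suc k}. incr t k w)) borel (\<lambda>f. f k)"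
    by (subst distr_distr[OF _ incr_vec_measurable[OF t]]) (auto simp: o_def)
  also have "\<dots> = distr (PiM {..<Suc k} (\<lambda>k. gauss (t (Suc k) - t k))) (gauss (t (Suc k) - t k)) (\<lambda>f. f k)"
    by (subst incr_law[OF t]) (rule distr_cong, auto)
  also have "\<dots> = gauss (t (Suc k) - t k)"
    by (rule distr_PiM_component) (auto simp: prob_space_gauss)
  finally show ?thesis .
qed

lemma incr_indep:
  assumes t: "0 \<le> t 0" "incseq t"
  shows "indep_vars (\<lambda>_. borel) (incr t) {..<m}"
proof -
  \<comment> \<open>The characterisation of independence by the joint law needs a nonempty index
    set, hence \<open>Suc m\<close>.\<close>
  have "indep_vars (\<lambda>_. borel) (incr t) {..<Suc m}"
  proof (rule indep_vars_iff_distr_eq_PiM'[THEN iffD2])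
    have "(\<lambda>k. distr P borel (incr t k)) = (\<lambda>k. gauss (t (Suc k) - t k))"
      using incr_distr[OF t] by (intro ext)
    then show "distr P (PiM {..<Suc m} (\<lambda>_. borel)) (\<lambda>w. \<lambda>k\<in>{..<Suc m}. incr t k w) =
      PiM {..<Suc m} (\<lambda>k. distr P borel (incr t k))"
      by (simp only: incr_law[OF t])
  qed (auto intro: incr_measurable[OF t])
  then show ?thesis by (rule indep_vars_subset) auto
qed

lemma skel_measurable: "(\<lambda>w. skel (\<lambda>t. B t w)) \<in> borel_measurable P"
  by (rule measurable_to_seq) (simp add: skel_def B_measurable)

definition path_law :: "(nat \<Rightarrow> real ^ 'n) measure" where
  "path_law = distr P borel (\<lambda>w. skel (\<lambda>t. B t w))"

lemma sets_path_law [simp, measurable_cong]: "sets path_law = sets borel"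
  by (simp add: path_law_def)

lemma prob_space_path_law: "prob_space path_law"
  unfolding path_law_def by (rule prob_space_distr) (rule skel_measurable)

end

text \<open>Finite-dimensional cylinders determine a law on the countable product. On a common time
  grid each cylinder is an event in the increments, whose joint law is the same for both
  processes.\<close>

lemma path_law_unique:
  assumes P: "bm P B" and Q: "bm Q (B' :: real \<Rightarrow> 'v \<Rightarrow> real ^ 'n)"
  shows "bm.path_law P B = bm.path_law Q B'"
proof -
  interpret b: bm P B by fact
  interpret b': bm Q B' by fact
  interpret L: prob_space b.path_law by (rule b.prob_space_path_law)
  have prob: "emeasure P {w\<in>space P. \<forall>q\<in>J. B q w \<in> A q} = emeasure Q {w\<in>space Q. \<forall>q\<in>J. B' q w \<in> A q}"
    if J: "finite J" "\<And>q. q \<in> J \<Longrightarrow> 0 \<le> q" and A: "\<And>q. A q \<in> sets borel" for J and A :: "real \<Rightarrow> (real ^ 'n) set"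
  proof -
    have "J \<subseteq> {0..Max (insert 0 J)}" "0 \<le> Max (insert 0 J)" using J by auto
    from ex_time_grid[OF J(1) this] obtain u m where u: "u 0 = 0" "incseq u" "J \<subseteq> u ` {..m}"
      by metis
    then have u0: "0 \<le> u 0" by simp
    obtain E where
      E: "E \<in> sets (PiM {..<m} (\<lambda>_. borel))" and
      *: "\<forall>f. f 0 = 0 \<longrightarrow> (\<forall>q\<in>J. f q \<in> A q) = ((\<lambda>k\<in>{..<m}. f (u (Suc k)) - f (u k)) \<in> E)"
      by (rule cylinder_via_increments[where A=A, OF u(1) J(1) u(3) A])
    have "{w\<in>space P. \<forall>q\<in>J. B q w \<in> A q} = (\<lambda>w. \<lambda>k\<in>{..<m}. b.incr u k w) -` E \<inter> space P"
      using *[rule_format, of "\<lambda>t. B t w" for w] b.B_0 by auto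
    also have "emeasure P \<dots> = emeasure (distr P (PiM {..<m} (\<lambda>_. borel)) (\<lambda>w. \<lambda>k\<in>{..<m}. b.incr u k w)) E"
      by (rule emeasure_distr[OF b.incr_vec_measurable[OF u0 u(2)] E, symmetric])
    also have "\<dots> = emeasure (distr Q (PiM {..<m} (\<lambda>_. borel)) (\<lambda>w. \<lambda>k\<in>{..<m}. b'.incr u k w)) E"
      by (simp only: b.incr_law[OF u0 u(2)] b'.incr_law[OF u0 u(2)])
    also have "\<dots> = emeasure Q ((\<lambda>w. \<lambda>k\<in>{..<m}. b'.incr u k w) -` E \<inter> space Q)"
      by (rule emeasure_distr[OF b'.incr_vec_measurable[OF u0 u(2)] E])
    also have "(\<lambda>w. \<lambda>k\<in>{..<m}. b'.incr u k w) -` E \<inter> space Q = {w\<in>space Q. \<forall>q\<in>J. B' q w \<in> A q}"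
      using *[rule_format, of "\<lambda>t. B' t w" for w] b'.B_0 by auto
    finally show ?thesis .
  qed
  have sets_eq: "sets (PiM UNIV (\<lambda>_::nat. borel :: (real ^ 'n) measure)) = sets borel"
    by (rule sets_PiM_equal_borel)
  show ?thesis
  proof (rule measure_eqI_PiM_infinite[where I=UNIV and M="\<lambda>_. borel"])
    fix A :: "nat \<Rightarrow> (real ^ 'n) set" and J :: "nat set"
    assume J: "finite J" and A: "\<And>i. i \<in> J \<Longrightarrow> A i \<in> sets borel"
    \<comment> \<open>The enumeration \<open>qt\<close> repeats values, so all conditions imposed at
      the same time are intersected first.\<close>
    define A' where "A' q = (\<Inter>i\<in>{i\<in>J. qt i = q}. A i)" for q
    have A': "A' q \<in> sets borel" for q
    proof (cases "{i\<in>J. qt i = q} = {}")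
      case True
      then have "A' q = UNIV" by (auto simp: A'_def)
      then show ?thesis by simp
    next
      case False
      then show ?thesis unfolding A'_def using J A by (intro sets.finite_INT) auto
    qed
    have eq: "prod_emb UNIV (\<lambda>_. borel) J (Pi\<^sub>E J A) = {f. \<forall>i\<in>J. f i \<in> A i}"
      by (auto simp: prod_emb_def PiE_iff)
    have [measurable]: "{f. \<forall>i\<in>J. f i \<in> A i} \<in> sets (borel :: (nat \<Rightarrow> real ^ 'n) measure)"
      unfolding eq[symmetric] sets_eq[symmetric] using J A by (intro sets_PiM_I) auto
    have "emeasure b.path_law {f. \<forall>i\<in>J. f i \<in> A i} = emeasure P {w\<in>space P. \<forall>q\<in>qt ` J. B q w \<in> A' q}"
      unfolding b.path_law_def
      by (subst emeasure_distr[OF b.skel_measurable]) (auto simp: skel_def A'_def intro!: arg_cong[where f="emeasure P"])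
    also have "\<dots> = emeasure Q {w\<in>space Q. \<forall>q\<in>qt ` J. B' q w \<in> A' q}"
      using J A' by (intro prob) auto
    also have "\<dots> = emeasure b'.path_law {f. \<forall>i\<in>J. f i \<in> A i}"
      unfolding b'.path_law_def
      by (subst emeasure_distr[OF b'.skel_measurable]) (auto simp: skel_def A'_def intro!: arg_cong[where f="emeasure Q"])
    finally show "emeasure b.path_law (prod_emb UNIV (\<lambda>_. borel) J (Pi\<^sub>E J A)) = emeasure b'.path_law (prod_emb UNIV (\<lambda>_. borel) J (Pi\<^sub>E J A))"
      by (simp add: eq)
  qed (use L.finite_measure_axioms in \<open>auto simp: sets_eq\<close>)
qed

section \<open>Scaling and rotation of Brownian motion\<close>

context bm
begin

text \<open>Together with \<open>path_law_unique\<close> this makes scaling a symmetry of the path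
  law; \<open>bm_rotated\<close> does the same for rotations.\<close>

lemma bm_scaled:
  assumes r: "0 < r"
  shows "bm P (\<lambda>t w. r *\<^sub>R B (t / r\<^sup>2) w)"
proof
  fix t :: "nat \<Rightarrow> real" and C :: "nat \<Rightarrow> (real ^ 'n) set" and m
  assume t: "0 \<le> t 0" "incseq t" and C: "\<And>k. C k \<in> sets borel"
  have t': "0 \<le> t 0 / r\<^sup>2" "incseq (\<lambda>k. t k / r\<^sup>2)"
    using t r by (auto simp: incseq_def divide_right_mono)
  have meas: "(\<lambda>x. r *\<^sub>R x) \<in> measurable (gauss s) borel" for s :: real by simp
  have C': "(\<lambda>x. r *\<^sub>R x) -` C k \<in> sets borel" for k
    by (rule measurable_sets_borel[OF _ C]) measurable
  have "measure P {w\<in>space P. \<forall>k<m. r *\<^sub>R B (t (Suc k) / r\<^sup>2) w - r *\<^sub>R B (t k / r\<^sup>2) w \<in> C k} =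
     measure P {w\<in>space P. \<forall>k<m. B (t (Suc k) / r\<^sup>2) w - B (t k / r\<^sup>2) w \<in> (\<lambda>x. r *\<^sub>R x) -` C k}"
    by (simp add: scaleR_diff_right)
  also have "\<dots> = (\<Prod>k<m. measure (gauss (t (Suc k) / r\<^sup>2 - t k / r\<^sup>2)) ((\<lambda>x. r *\<^sub>R x) -` C k))"
    by (rule B_increments[OF t' C'])
  also have "\<dots> = (\<Prod>k<m. measure (gauss (t (Suc k) - t k)) (C k))"
  proof (intro prod.cong refl)
    fix k
    have "measure (gauss (t (Suc k) - t k)) (C k) = measure (distr (gauss ((t (Suc k) - t k) / r\<^sup>2)) borel (\<lambda>x. r *\<^sub>R x)) (C k)"
      by (simp only: gauss_scale[OF r])
    also have "\<dots> = measure (gauss ((t (Suc k) - t k) / r\<^sup>2)) ((\<lambda>x. r *\<^sub>R x) -` C k)"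
      by (simp only: measure_distr[OF meas C] space_gauss Int_UNIV_right)
    finally show "measure (gauss (t (Suc k) / r\<^sup>2 - t k / r\<^sup>2)) ((\<lambda>x. r *\<^sub>R x) -` C k) = measure (gauss (t (Suc k) - t k)) (C k)"
      by (simp only: diff_divide_distrib)
  qed
  finally show "measure P {w\<in>space P. \<forall>k<m. r *\<^sub>R B (t (Suc k) / r\<^sup>2) w - r *\<^sub>R B (t k / r\<^sup>2) w \<in> C k} = \<dots>" .
next
  fix w assume "w \<in> space P"
  then have "continuous_on {0..} (\<lambda>t. B t w)" by (rule B_continuous)
  then show "continuous_on {0..} (\<lambda>t. r *\<^sub>R B (t / r\<^sup>2) w)"
  proof (rule continuous_on_scaleR[OF continuous_on_const continuous_on_compose2[of "{0..}" "\<lambda>t. B t w" "{0..}" "\<lambda>t. t / r\<^sup>2"]])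
    show "continuous_on {0..} (\<lambda>t. t / r\<^sup>2)" using r by (intro continuous_intros) auto
  qed auto
qed (auto simp: B_0 intro!: borel_measurable_scaleR B_measurable)

lemma bm_rotated:
  fixes R :: "real ^ 'n \<Rightarrow> real ^ 'n"
  assumes R: "orthogonal_transformation R"
  shows "bm P (\<lambda>t w. R (B t w))"
proof
  interpret lin: linear R using R by (rule orthogonal_transformation_linear)
  note [measurable] = orthogonal_transformation_borel_measurable[OF R]
  fix t :: "nat \<Rightarrow> real" and C :: "nat \<Rightarrow> (real ^ 'n) set" and m
  assume t: "0 \<le> t 0" "incseq t" and C: "\<And>k. C k \<in> sets borel"
  have meas: "R \<in> measurable (gauss s) borel" for s :: real by simp
  have C': "R -` C k \<in> sets borel" for k
    by (rule measurable_sets_borel[OF _ C]) measurable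
  have "measure P {w\<in>space P. \<forall>k<m. R (B (t (Suc k)) w) - R (B (t k) w) \<in> C k} =
     measure P {w\<in>space P. \<forall>k<m. B (t (Suc k)) w - B (t k) w \<in> R -` C k}"
    by (simp add: lin.diff)
  also have "\<dots> = (\<Prod>k<m. measure (gauss (t (Suc k) - t k)) (R -` C k))"
    by (rule B_increments[OF t C'])
  also have "\<dots> = (\<Prod>k<m. measure (gauss (t (Suc k) - t k)) (C k))"
  proof (intro prod.cong refl)
    fix k
    have "measure (gauss (t (Suc k) - t k)) (C k) = measure (distr (gauss (t (Suc k) - t k)) borel R) (C k)"
      by (simp only: gauss_orthogonal[OF R])
    also have "\<dots> = measure (gauss (t (Suc k) - t k)) (R -` C k)"
      by (simp only: measure_distr[OF meas C] space_gauss Int_UNIV_right)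
    finally show "measure (gauss (t (Suc k) - t k)) (R -` C k) = measure (gauss (t (Suc k) - t k)) (C k)" ..
  qed
  finally show "measure P {w\<in>space P. \<forall>k<m. R (B (t (Suc k)) w) - R (B (t k) w) \<in> C k} = \<dots>" .
next
  interpret lin: linear R using R by (rule orthogonal_transformation_linear)
  fix w assume "w \<in> space P"
  then have "continuous_on {0..} (\<lambda>t. B t w)" by (rule B_continuous)
  then show "continuous_on {0..} (\<lambda>t. R (B t w))"
    by (rule linear_continuous_on_compose) (rule lin.linear_axioms)
  show "R (B 0 w) = 0" using \<open>w \<in> space P\<close> by (simp add: B_0 lin.zero)
next
  note [measurable] = orthogonal_transformation_borel_measurable[OF R]
  fix t :: real assume "0 \<le> t" note [measurable] = B_measurable[OF this]
  show "(\<lambda>w. R (B t w)) \<in> borel_measurable P" by measurable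
qed

end

subsection \<open>The strong Markov property\<close>

text \<open>The indicator of a closed set is the limit of the continuous functions
  \<open>max 0 (1 - k * infdist x C)\<close>, and closed sets form an intersection-stable generator.
  Continuous test functions are what limits of approximating stopping times can be tested
  against.\<close>

lemma measure_eqI_continuous:
  fixes M N :: "'a::metric_space measure"
  assumes M: "finite_measure M" "sets M = sets borel" and N: "finite_measure N" "sets N = sets borel"
    and eq: "\<And>f :: 'a \<Rightarrow> real. continuous_on UNIV f \<Longrightarrow> (\<And>x. 0 \<le> f x \<and> f x \<le> 1) \<Longrightarrow>
      (\<integral>x. f x \<partial>M) = (\<integral>x. f x \<partial>N)"
  shows "M = N"
proof -
  interpret M: finite_measure M by fact
  interpret N: finite_measure N by fact
  note [measurable_cong] = M(2) N(2)
  have closed: "measure M C = measure N C" if C: "closed C" for C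
  proof (cases "C = {}")
    case False
    have [measurable]: "C \<in> sets borel" using C by (rule borel_closed)
    define f where "f k x = max 0 (1 - real k * infdist x C)" for k x
    have cont: "continuous_on UNIV (f k)" for k
      unfolding f_def by (intro continuous_intros)
    have [measurable]: "f k \<in> borel_measurable borel" for k
      using cont by (rule borel_measurable_continuous_onI)
    have bnd: "0 \<le> f k x \<and> f k x \<le> 1" for k x
      by (simp add: f_def infdist_nonneg)
    have lim: "(\<lambda>k. f k x) \<longlonglongrightarrow> indicator C x" for x
    proof (cases "x \<in> C")
      case True
      then show ?thesis by (simp add: f_def)
    next
      case False
      then have pos: "infdist x C > 0"
        using C \<open>C \<noteq> {}\<close> by (metis in_closed_iff_infdist_zero infdist_nonneg less_eq_real_def)
      obtain k0 :: nat where k0: "1 / infdist x C < k0" using reals_Archimedean2 by blast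
      have "f k x = 0" if "k \<ge> k0" for k
      proof -
        have "1 / infdist x C < k" using k0 that by (meson less_le_trans of_nat_mono)
        then show ?thesis using pos by (simp add: f_def field_simps max_def)
      qed
      then have "eventually (\<lambda>k. f k x = indicator C x) sequentially"
        using False by (auto simp: eventually_sequentially)
      then show ?thesis by (rule tendsto_eventually)
    qed
    have "(\<lambda>k. \<integral>x. f k x \<partial>M) \<longlonglongrightarrow> (\<integral>x. indicator C x \<partial>M)"
      using C by (intro integral_dominated_convergence[where w="\<lambda>_. 1"]) (auto simp: lim bnd)
    moreover have "(\<lambda>k. \<integral>x. f k x \<partial>N) \<longlonglongrightarrow> (\<integral>x. indicator C x \<partial>N)"
      using C by (intro integral_dominated_convergence[where w="\<lambda>_. 1"]) (auto simp: lim bnd)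
    ultimately have "(\<integral>x. indicator C x \<partial>M) = (\<integral>x. (indicator C x :: real) \<partial>N)"
      using eq[OF cont bnd] LIMSEQ_unique by auto
    then show ?thesis using C by (simp add: sets_eq_imp_space_eq[OF M(2)] sets_eq_imp_space_eq[OF N(2)])
  qed simp
  show ?thesis
  proof (rule measure_eqI_generator_eq[where E="Collect closed" and \<Omega>=UNIV and A="\<lambda>_. UNIV"])
    show "Int_stable (Collect closed :: 'a set set)" by (auto simp: Int_stable_def)
    show "sets M = sigma_sets UNIV (Collect closed)" "sets N = sigma_sets UNIV (Collect closed)"
      using M(2) N(2) by (auto simp: borel_eq_closed)
  qed (auto simp: closed M.emeasure_eq_measure N.emeasure_eq_measure)
qed

lemma tendsto_coordinatewise:
  fixes l :: "'i \<Rightarrow> 'a::topological_space"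
  assumes "\<And>i. ((\<lambda>c. f c i) \<longlongrightarrow> l i) F"
  shows "(f \<longlongrightarrow> l) F"
proof -
  have "limitin (product_topology (\<lambda>i. euclidean) UNIV) f l F"
    unfolding limitin_componentwise using assms by simp
  then show ?thesis by (simp only: euclidean_product_topology limitin_canonical_iff)
qed

text \<open>Rounding goes upwards so that a rounded stopping time does not anticipate the
  future.\<close>

lemma dyadic_ceiling_tendsto:
  assumes "0 \<le> x"
  shows "(\<lambda>n. real (nat \<lceil>2^n * x\<rceil>) / 2^n) \<longlonglongrightarrow> x"
proof (rule tendsto_sandwich[of "\<lambda>_. x" _ _ "\<lambda>n. x + (1/2)^n"])
  have eq: "real (nat \<lceil>2^n * x\<rceil>) = of_int \<lceil>2^n * x\<rceil>" for n :: nat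
    using assms by (simp add: of_nat_nat)
  have "x \<le> real (nat \<lceil>2^n * x\<rceil>) / 2^n" for n
    unfolding eq using le_of_int_ceiling[of "2^n * x"] by (simp add: field_simps)
  then show "\<forall>\<^sub>F n in sequentially. x \<le> real (nat \<lceil>2^n * x\<rceil>) / 2^n" by simp
  have "real (nat \<lceil>2^n * x\<rceil>) / 2^n \<le> x + (1/2)^n" for n
  proof -
    have "of_int \<lceil>2^n * x\<rceil> \<le> 2^n * x + 1" by linarith
    then have "of_int \<lceil>2^n * x\<rceil> / 2^n \<le> (2^n * x + 1) / 2^n" by (rule divide_right_mono) simp
    then show ?thesis unfolding eq by (simp add: add_divide_distrib power_one_over)
  qed
  then show "\<forall>\<^sub>F n in sequentially. real (nat \<lceil>2^n * x\<rceil>) / 2^n \<le> x + (1/2)^n" by simp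
  have "(\<lambda>n. x + (1/2)^n) \<longlonglongrightarrow> x + 0" by (intro tendsto_intros LIMSEQ_power_zero) simp
  then show "(\<lambda>n. x + (1/2)^n) \<longlonglongrightarrow> x" by simp
qed simp

text \<open>Events of the form \<open>x \<le> c\<close> are the only ones that a stopping time
  controls, so the value of the rounded time is expressed by two of them. For \<open>j = 0\<close>
  the lower condition is void because \<open>x\<close> is nonnegative.\<close>

lemma dyadic_ceiling_eq_iff:
  assumes "0 \<le> x"
  shows "nat \<lceil>2^n * x\<rceil> = j \<longleftrightarrow> x \<le> real j / 2^n \<and> (j = 0 \<or> \<not> x \<le> (real j - 1) / 2^n)"
proof -
  have 1: "x \<le> y / 2^n \<longleftrightarrow> 2^n * x \<le> y" for y by (simp add: field_simps)
  have "0 \<le> 2^n * x" using assms by simp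
  then show ?thesis unfolding 1
  proof (cases "j = 0")
    case False
    have "0 \<le> \<lceil>2^n * x\<rceil>" using \<open>0 \<le> 2^n * x\<close> by linarith
    then have "nat \<lceil>2^n * x\<rceil> = j \<longleftrightarrow> \<lceil>2^n * x\<rceil> = int j" using nat_eq_iff by auto
    also have "\<dots> \<longleftrightarrow> real j - 1 < 2^n * x \<and> 2^n * x \<le> real j" by (simp add: ceiling_eq_iff)
    finally show "nat \<lceil>2^n * x\<rceil> = j \<longleftrightarrow> 2^n * x \<le> real j \<and> (j = 0 \<or> \<not> 2^n * x \<le> real j - 1)"
      using False by (auto simp: not_le)
  qed simp
qed

section \<open>The past up to a fixed time and the Markov property\<close>

context bm
begin

text \<open>Conditions at finitely many times rather than one: these events are stable under
  intersection, as needed to pass independence to the generated sigma-algebra.\<close>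

definition past_cylinders :: "real \<Rightarrow> 'w set set" where
  "past_cylinders s = {{w\<in>space P. \<forall>q\<in>J. B q w \<in> A q} | J A.
     finite J \<and> J \<subseteq> {0..s} \<and> (\<forall>q. A q \<in> sets borel)}"

definition past :: "real \<Rightarrow> 'w measure" where
  "past s = sigma (space P) (past_cylinders s)"

lemma cylinder_event:
  assumes "finite J" "\<And>q. q \<in> J \<Longrightarrow> 0 \<le> q" "\<And>q. A q \<in> sets borel"
  shows "{w\<in>space P. \<forall>q\<in>J. B q w \<in> A q} \<in> events"
proof -
  have "{w\<in>space P. B q w \<in> A q} \<in> events" if "q \<in> J" for q
    using measurable_sets[OF B_measurable[OF assms(2)[OF that]] assms(3)[of q]]
    by (simp add: vimage_def Int_def conj_commute)
  then show ?thesis using assms(1) by (intro sets.sets_Collect_finite_All) auto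
qed

lemma past_cylinders_events: "past_cylinders s \<subseteq> events"
proof
  fix a assume "a \<in> past_cylinders s"
  then obtain J A where a: "a = {w\<in>space P. \<forall>q\<in>J. B q w \<in> A q}" "finite J" "J \<subseteq> {0..s}" "\<forall>q. A q \<in> sets borel"
    unfolding past_cylinders_def by blast
  show "a \<in> events" unfolding a(1) by (rule cylinder_event) (use a in auto)
qed

lemma sets_past: "sets (past s) = sigma_sets (space P) (past_cylinders s)"
  unfolding past_def using past_cylinders_events sets.space_closed
  by (intro sets_measure_of) blast

lemma space_past [simp]: "space (past s) = space P"
  unfolding past_def by (rule space_measure_of) (use past_cylinders_events sets.space_closed in blast)

lemma past_events: "A \<in> sets (past s) \<Longrightarrow> A \<in> events"
  unfolding sets_past using sets.sigma_sets_subset[OF past_cylinders_events] by blast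

lemma B_past: assumes "0 \<le> q" "q \<le> s" shows "B q \<in> borel_measurable (past s)"
proof (rule measurableI)
  fix C :: "(real ^ 'n) set" assume C: "C \<in> sets borel"
  have "B q -` C \<inter> space (past s) = {w\<in>space P. \<forall>q\<in>{q}. B q w \<in> C}" by auto
  also have "\<dots> \<in> past_cylinders s"
    unfolding past_cylinders_def using assms C by (intro CollectI exI[of _ "{q}"] exI[of _ "\<lambda>_. C"]) auto
  finally show "B q -` C \<inter> space (past s) \<in> sets (past s)" by (auto simp: sets_past)
qed auto

lemma Int_stable_past_cylinders: "Int_stable (past_cylinders s)"
proof (rule Int_stableI)
  fix a b assume "a \<in> past_cylinders s" "b \<in> past_cylinders s"
  then obtain J A J' A' where
    a: "a = {w\<in>space P. \<forall>q\<in>J. B q w \<in> A q}" "finite J" "J \<subseteq> {0..s}" "\<forall>q. A q \<in> sets borel" and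
    b: "b = {w\<in>space P. \<forall>q\<in>J'. B q w \<in> A' q}" "finite J'" "J' \<subseteq> {0..s}" "\<forall>q. A' q \<in> sets borel"
    by (auto simp: past_cylinders_def)
  define A'' where "A'' q = (if q \<in> J then A q else UNIV) \<inter> (if q \<in> J' then A' q else UNIV)" for q
  have "a \<inter> b = {w\<in>space P. \<forall>q\<in>J \<union> J'. B q w \<in> A'' q}"
    unfolding a(1) b(1) A''_def by (auto split: if_splits)
  moreover have "\<forall>q. A'' q \<in> sets borel" using a(4) b(4) by (simp add: A''_def)
  ultimately show "a \<inter> b \<in> past_cylinders s"
    unfolding past_cylinders_def using a(2,3) b(2,3)
    by (intro CollectI exI[of _ "J \<union> J'"] exI[of _ A''] conjI) auto
qed

lemma shifted_incr_event:
  assumes s: "0 \<le> s" and t: "0 \<le> t 0" "incseq t" and C: "\<And>k. C k \<in> sets borel"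
  shows "{w\<in>space P. \<forall>k<m. B (s + t (Suc k)) w - B (s + t k) w \<in> C k} \<in> events"
    and "prob {w\<in>space P. \<forall>k<m. B (s + t (Suc k)) w - B (s + t k) w \<in> C k} =
      (\<Prod>k<m. measure (gauss (t (Suc k) - t k)) (C k))"
proof -
  have st: "0 \<le> s + t 0" "incseq (\<lambda>k. s + t k)" using s t by (auto simp: incseq_def)
  have "{w\<in>space P. B (s + t (Suc k)) w - B (s + t k) w \<in> C k} \<in> events" for k
    using measurable_sets[OF incr_measurable[OF st] C[of k]] by (simp add: vimage_def Int_def conj_commute)
  then have "{w\<in>space P. \<forall>k\<in>{..<m}. B (s + t (Suc k)) w - B (s + t k) w \<in> C k} \<in> events"
    by (intro sets.sets_Collect_finite_All) auto
  then show "{w\<in>space P. \<forall>k<m. B (s + t (Suc k)) w - B (s + t k) w \<in> C k} \<in> events"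
    by (simp only: Ball_def lessThan_iff)
  show "prob {w\<in>space P. \<forall>k<m. B (s + t (Suc k)) w - B (s + t k) w \<in> C k} =
      (\<Prod>k<m. measure (gauss (t (Suc k) - t k)) (C k))"
    using B_increments[where t="\<lambda>k. s + t k", OF st C, of m] by (simp only: add_diff_cancel_left)
qed

lemma cylinder_indep:
  fixes m :: nat and t :: "nat \<Rightarrow> real" and C :: "nat \<Rightarrow> (real ^ 'n) set"
  assumes s: "0 \<le> s" and t: "0 \<le> t 0" "incseq t" and C: "\<And>k. C k \<in> sets borel"
    and a: "a \<in> past_cylinders s"
  defines "L \<equiv> {w\<in>space P. \<forall>k<m. B (s + t (Suc k)) w - B (s + t k) w \<in> C k}"
  shows "prob (a \<inter> L) = prob a * prob L"
proof -
  obtain J A where J: "a = {w\<in>space P. \<forall>q\<in>J. B q w \<in> A q}" "finite J" "J \<subseteq> {0..s}" and A: "\<And>q. A q \<in> sets borel"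
    using a by (auto simp: past_cylinders_def)
  obtain u l where u: "u 0 = 0" "u l = s" "incseq u" "J \<subseteq> u ` {..l}"
    by (rule ex_time_grid[OF J(2,3) s])
  obtain E where E: "E \<in> sets (PiM {..<l} (\<lambda>_. borel))" and
    *: "\<forall>f. f 0 = 0 \<longrightarrow> (\<forall>q\<in>J. f q \<in> A q) = ((\<lambda>k\<in>{..<l}. f (u (Suc k)) - f (u k)) \<in> E)"
    by (rule cylinder_via_increments[where A=A, OF u(1) J(2) u(4) A])
  \<comment> \<open>One time sequence: the grid of the past event, then the shifted future times.
    Increments below \<open>l\<close> decide the past event, those from \<open>Suc l\<close> on the
    future one; increment \<open>l\<close> bridges \<open>s\<close> and \<open>s + t 0\<close> and
    belongs to neither.\<close>
  define v where "v k = (if k \<le> l then u k else s + t (k - Suc l))" for k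
  have "v k \<le> v (Suc k)" for k
  proof -
    consider "Suc k \<le> l" | "k = l" | "l < k" by linarith
    then show ?thesis
    proof cases
      case 1 then show ?thesis using u(3) by (simp add: v_def incseq_SucD)
    next
      case 2 then show ?thesis using u(2) t(1) by (simp add: v_def)
    next
      case 3
      then have "Suc k - Suc l = Suc (k - Suc l)" by simp
      then show ?thesis using 3 t(2) by (simp add: v_def incseq_SucD del: diff_Suc_Suc)
    qed
  qed
  then have v: "0 \<le> v 0" "incseq v" using u(1) by (auto simp: v_def incseq_Suc_iff)
  define K where "K = {Suc l..<Suc l + m}"
  define E' where "E' = Pi\<^sub>E K (\<lambda>k. C (k - Suc l))"
  have E': "E' \<in> sets (PiM K (\<lambda>_. borel))"
    unfolding E'_def K_def using C by (intro sets_PiM_I_finite) auto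
  have "indep_var (PiM {..<l} (\<lambda>_. borel)) (\<lambda>w. restrict (\<lambda>i. incr v i w) {..<l})
     (PiM K (\<lambda>_. borel)) (\<lambda>w. restrict (\<lambda>i. incr v i w) K)"
    by (rule indep_var_restrict[OF incr_indep[OF v, of "Suc l + m"]]) (auto simp: K_def)
  note indep_varD[OF this E E']
  moreover have "(\<lambda>w. restrict (\<lambda>i. incr v i w) {..<l}) -` E \<inter> space P = a"
  proof -
    have "restrict (\<lambda>i. incr v i w) {..<l} = (\<lambda>k\<in>{..<l}. B (u (Suc k)) w - B (u k) w)" for w
      by (rule restrict_ext) (auto simp: v_def)
    then show ?thesis using * [rule_format, of "\<lambda>t. B t w" for w] B_0 unfolding J(1) by auto
  qed
  moreover have "(\<lambda>w. restrict (\<lambda>i. incr v i w) K) -` E' \<inter> space P = L"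
  proof -
    have "restrict (\<lambda>i. incr v i w) K \<in> E' \<longleftrightarrow> (\<forall>k<m. B (s + t (Suc k)) w - B (s + t k) w \<in> C k)" for w
    proof -
      have "restrict (\<lambda>i. incr v i w) K \<in> E' \<longleftrightarrow> (\<forall>i\<in>K. incr v i w \<in> C (i - Suc l))"
        by (simp add: E'_def PiE_iff)
      also have "\<dots> \<longleftrightarrow> (\<forall>k\<in>{..<m}. incr v (Suc l + k) w \<in> C (Suc l + k - Suc l))"
      proof -
        have "K = (\<lambda>k. Suc l + k) ` {..<m}"
          unfolding K_def lessThan_atLeast0 by (subst image_add_atLeastLessThan) (simp add: add.commute)
        then show ?thesis by simp
      qed
      also have "\<dots> \<longleftrightarrow> (\<forall>k<m. B (s + t (Suc k)) w - B (s + t k) w \<in> C k)"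
        by (auto simp: v_def)
      finally show ?thesis .
    qed
    then show ?thesis unfolding L_def by auto
  qed
  moreover have "(\<lambda>x. (\<lambda>i\<in>{..<l}. incr v i x, \<lambda>i\<in>K. incr v i x)) -` (E \<times> E') \<inter> space P =
    ((\<lambda>w. restrict (\<lambda>i. incr v i w) {..<l}) -` E \<inter> space P) \<inter> ((\<lambda>w. restrict (\<lambda>i. incr v i w) K) -` E' \<inter> space P)"
    by auto
  ultimately show ?thesis by simp
qed

text \<open>Independence from the single event \<open>L\<close> extends from the intersection-stable
  cylinders to everything they generate.\<close>

lemma past_indep:
  fixes m :: nat and t :: "nat \<Rightarrow> real" and C :: "nat \<Rightarrow> (real ^ 'n) set"
  assumes s: "0 \<le> s" and t: "0 \<le> t 0" "incseq t" and C: "\<And>k. C k \<in> sets borel"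
    and a: "a \<in> sets (past s)"
  defines "L \<equiv> {w\<in>space P. \<forall>k<m. B (s + t (Suc k)) w - B (s + t k) w \<in> C k}"
  shows "prob (a \<inter> L) = prob a * prob L"
proof -
  have L: "L \<in> events" unfolding L_def by (rule shifted_incr_event(1)[OF s t C])
  have "indep_set (past_cylinders s) {L}"
  proof (rule indep_setI)
    fix a b assume "a \<in> past_cylinders s" "b \<in> {L}"
    then show "prob (a \<inter> b) = prob a * prob b"
      using cylinder_indep[OF s t C, of a m] by (simp only: L_def singleton_iff)
  qed (use past_cylinders_events L in blast)+
  then have "indep_set (sigma_sets (space P) (past_cylinders s)) (sigma_sets (space P) {L})"
    by (rule indep_set_sigma_sets[OF _ Int_stable_past_cylinders]) (simp add: Int_stable_def)
  then show ?thesis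
    by (rule indep_setD) (use a sets_past in blast)+
qed

lemma bm_shifted:
  assumes s: "0 \<le> s" and a: "a \<in> sets (past s)" and pos: "prob a > 0"
  shows "bm (uniform_measure P a) (\<lambda>t w. B (s + t) w - B s w)"
proof -
  have ae: "a \<in> events" using a by (rule past_events)
  have pos': "emeasure P a \<noteq> 0" "emeasure P a \<noteq> \<infinity>" using pos by (auto simp: emeasure_eq_measure)
  interpret U: prob_space "uniform_measure P a"
    by (rule prob_space_uniform_measure[OF pos'])
  show ?thesis
  proof
    fix t :: real assume "0 \<le> t"
    then have "(\<lambda>w. B (s + t) w - B s w) \<in> borel_measurable P"
      using s by (intro borel_measurable_diff B_measurable) auto
    then show "(\<lambda>w. B (s + t) w - B s w) \<in> borel_measurable (uniform_measure P a)"
      by simp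
  next
    fix w assume "w \<in> space (uniform_measure P a)"
    then have w: "w \<in> space P" by simp
    show "continuous_on {0..} (\<lambda>t. B (s + t) w - B s w)"
    proof (rule continuous_on_diff[OF continuous_on_compose2[OF B_continuous[OF w], where f="\<lambda>t. s + t"] continuous_on_const])
      show "continuous_on {0..} (\<lambda>t. s + t)" by (intro continuous_intros)
    qed (use s in auto)
  next
    fix t :: "nat \<Rightarrow> real" and C :: "nat \<Rightarrow> (real ^ 'n) set" and m
    assume t: "0 \<le> t 0" "incseq t" and C: "\<And>k. C k \<in> sets borel"
    let ?L = "{w\<in>space P. \<forall>k<m. B (s + t (Suc k)) w - B (s + t k) w \<in> C k}"
    have "{w\<in>space (uniform_measure P a). \<forall>k<m. B (s + t (Suc k)) w - B s w - (B (s + t k) w - B s w) \<in> C k} = ?L"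
      by simp
    moreover have "measure (uniform_measure P a) ?L = prob (a \<inter> ?L) / prob a"
      by (rule measure_uniform_measure[OF pos' shifted_incr_event(1)[OF s t C]])
    ultimately show "measure (uniform_measure P a) {w\<in>space (uniform_measure P a). \<forall>k<m. B (s + t (Suc k)) w - B s w - (B (s + t k) w - B s w) \<in> C k} =
      (\<Prod>k<m. measure (gauss (t (Suc k) - t k)) (C k))"
      using pos past_indep[OF s t C a, of m] shifted_incr_event(2)[OF s t C, of m] by simp
  qed simp
qed

lemma shifted_skel_measurable:
  "0 \<le> s \<Longrightarrow> (\<lambda>w. skel (\<lambda>t. B (s + t) w - B s w)) \<in> borel_measurable P"
  by (rule measurable_to_seq) (auto simp: skel_def intro!: borel_measurable_diff B_measurable)

lemma markov:
  assumes s: "0 \<le> s" and a: "a \<in> sets (past s)" and C: "C \<in> sets borel"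
  shows "prob (a \<inter> {w\<in>space P. skel (\<lambda>t. B (s + t) w - B s w) \<in> C}) = prob a * measure path_law C"
proof (cases "prob a = 0")
  case True
  have "prob (a \<inter> {w\<in>space P. skel (\<lambda>t. B (s + t) w - B s w) \<in> C}) \<le> prob a"
    using past_events[OF a] by (intro finite_measure_mono) auto
  then show ?thesis using True by (simp add: measure_le_0_iff)
next
  case False
  then have pos: "prob a > 0" using measure_nonneg[of P a] by linarith
  have pos': "emeasure P a \<noteq> 0" "emeasure P a \<noteq> \<infinity>" using pos by (auto simp: emeasure_eq_measure)
  have b: "bm (uniform_measure P a) (\<lambda>t w. B (s + t) w - B s w)"
    by (rule bm_shifted[OF s a pos])
  then interpret b: bm "uniform_measure P a" "\<lambda>t w. B (s + t) w - B s w" .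
  have eq: "(\<lambda>w. skel (\<lambda>t. B (s + t) w - B s w)) -` C \<inter> space P = {w\<in>space P. skel (\<lambda>t. B (s + t) w - B s w) \<in> C}"
    by auto
  have ev: "{w\<in>space P. skel (\<lambda>t. B (s + t) w - B s w) \<in> C} \<in> events"
    using measurable_sets[OF shifted_skel_measurable[OF s] C] unfolding eq .
  have "measure path_law C = measure b.path_law C"
    using path_law_unique[OF bm_axioms b] by simp
  also have "\<dots> = measure (uniform_measure P a) {w\<in>space P. skel (\<lambda>t. B (s + t) w - B s w) \<in> C}"
    unfolding b.path_law_def measure_distr[OF b.skel_measurable C] by (simp add: eq)
  also have "\<dots> = prob (a \<inter> {w\<in>space P. skel (\<lambda>t. B (s + t) w - B s w) \<in> C}) / prob a"
    by (rule measure_uniform_measure[OF pos' ev])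
  finally show ?thesis using pos by simp
qed


text \<open>Null sets are allowed because an exit time that is finite only almost surely is turned into a
  real-valued function.\<close>
definition stopping :: "('w \<Rightarrow> real) \<Rightarrow> bool" where
  "stopping \<sigma> \<longleftrightarrow> \<sigma> \<in> borel_measurable P \<and> (\<forall>w\<in>space P. 0 \<le> \<sigma> w) \<and>
     (\<forall>s\<ge>0. \<exists>a\<in>sets (past s). AE w in P. \<sigma> w \<le> s \<longleftrightarrow> w \<in> a)"

abbreviation post :: "('w \<Rightarrow> real) \<Rightarrow> 'w \<Rightarrow> nat \<Rightarrow> real ^ 'n" where
  "post \<sigma> w \<equiv> skel (\<lambda>t. B (\<sigma> w + t) w - B (\<sigma> w) w)"

lemma past_mono: assumes "s \<le> s'" shows "sets (past s) \<subseteq> sets (past s')"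
  unfolding sets_past
proof (rule sigma_sets_mono')
  show "past_cylinders s \<subseteq> past_cylinders s'"
  proof
    fix a assume "a \<in> past_cylinders s"
    then obtain J A where a: "a = {w\<in>space P. \<forall>q\<in>J. B q w \<in> A q}" "finite J" "J \<subseteq> {0..s}" "\<forall>q. A q \<in> sets borel"
      unfolding past_cylinders_def by blast
    moreover have "J \<subseteq> {0..s'}" using a(3) assms by auto
    ultimately show "a \<in> past_cylinders s'"
      unfolding past_cylinders_def by (intro CollectI exI[of _ J] exI[of _ A] conjI)
  qed
qed

text \<open>At a time with countably many values measurability is checked piece by piece; continuity
  of paths carries it to the limit of the dyadic approximations.\<close>

lemma B_stopped_measurable:
  assumes \<sigma>: "\<sigma> \<in> borel_measurable P" and nn: "\<And>w. w \<in> space P \<Longrightarrow> 0 \<le> \<sigma> w"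
  shows "(\<lambda>w. B (\<sigma> w) w) \<in> borel_measurable P"
proof -
  note [measurable] = \<sigma>
  define k where "k n w = nat \<lceil>2^n * \<sigma> w\<rceil>" for n :: nat and w
  have [measurable]: "k n \<in> measurable P (count_space UNIV)" for n unfolding k_def by measurable
  have m: "(\<lambda>w. B (real (k n w) / 2^n) w) \<in> borel_measurable P" for n
    by (rule measurable_compose_countable[where f="\<lambda>i w. B (real i / 2^n) w" and g="k n"]) (auto intro!: B_measurable)
  show ?thesis
  proof (rule borel_measurable_LIMSEQ_metric[OF m])
    fix w assume w: "w \<in> space P"
    have "(\<lambda>n. real (k n w) / 2^n) \<longlonglongrightarrow> \<sigma> w"
      using dyadic_ceiling_tendsto[OF nn[OF w]] by (simp add: k_def)
    then show "(\<lambda>n. B (real (k n w) / 2^n) w) \<longlonglongrightarrow> B (\<sigma> w) w"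
      using B_continuous[OF w] nn[OF w]
      by (auto intro!: continuous_on_tendsto_compose[of "{0..}" "\<lambda>t. B t w"])
  qed
qed

lemma post_measurable:
  assumes \<sigma>: "\<sigma> \<in> borel_measurable P" and nn: "\<And>w. w \<in> space P \<Longrightarrow> 0 \<le> \<sigma> w"
  shows "post \<sigma> \<in> borel_measurable P"
  by (rule measurable_to_seq)
     (auto simp: skel_def intro!: borel_measurable_diff B_stopped_measurable[of "\<lambda>w. \<sigma> w + c" for c] B_stopped_measurable[OF assms] borel_measurable_add \<sigma> nn add_nonneg_nonneg)

text \<open>On the event \<open>k w = j\<close> the random time is the constant
  \<open>j / N\<close>, and the event agrees almost everywhere with one of the past up to that time.
  The Markov property applies to each piece and the pieces are summed.\<close>

lemma strong_markov_discrete: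
  assumes N: "0 < N" and k[measurable]: "k \<in> measurable P (count_space UNIV)"
    and ex: "\<And>j. \<exists>a\<in>sets (past (real j / N)). AE w in P. k w = j \<longleftrightarrow> w \<in> a"
  defines "\<sigma> \<equiv> \<lambda>w. real (k w :: nat) / N"
  shows "distr P borel (\<lambda>w. ((\<sigma> w, B (\<sigma> w) w), post \<sigma> w)) =
    distr P borel (\<lambda>w. (\<sigma> w, B (\<sigma> w) w)) \<Otimes>\<^sub>M path_law"
proof (rule pair_measure_eqI[symmetric])
  have [measurable]: "\<sigma> \<in> borel_measurable P" unfolding \<sigma>_def by measurable
  have nn: "0 \<le> \<sigma> w" for w using N by (simp add: \<sigma>_def)
  note [measurable] = B_stopped_measurable[OF \<open>\<sigma> \<in> borel_measurable P\<close> nn] post_measurable[OF \<open>\<sigma> \<in> borel_measurable P\<close> nn]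
  interpret PL: prob_space path_law by (rule prob_space_path_law)
  show "sigma_finite_measure path_law" ..
  interpret D: prob_space "distr P borel (\<lambda>w. (\<sigma> w, B (\<sigma> w) w))" by (rule prob_space_distr) measurable
  show "sigma_finite_measure (distr P borel (\<lambda>w. (\<sigma> w, B (\<sigma> w) w)))" ..
  have sp: "sets (distr P borel (\<lambda>w. (\<sigma> w, B (\<sigma> w) w)) \<Otimes>\<^sub>M path_law) =
    sets ((borel :: (real \<times> (real ^ 'n)) measure) \<Otimes>\<^sub>M (borel :: (nat \<Rightarrow> real ^ 'n) measure))"
    by (rule sets_pair_measure_cong) auto
  show "sets (distr P borel (\<lambda>w. (\<sigma> w, B (\<sigma> w) w)) \<Otimes>\<^sub>M path_law) =
    sets (distr P borel (\<lambda>w. ((\<sigma> w, B (\<sigma> w) w), post \<sigma> w)))"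
    unfolding sp by (simp only: borel_prod sets_distr)
  fix A :: "(real \<times> (real ^ 'n)) set" and C :: "(nat \<Rightarrow> real ^ 'n) set"
  assume "A \<in> sets (distr P borel (\<lambda>w. (\<sigma> w, B (\<sigma> w) w)))" "C \<in> sets path_law"
  then have A[measurable]: "A \<in> sets borel" and C[measurable]: "C \<in> sets borel" by auto
  have AC: "A \<times> C \<in> sets borel"
    using pair_measureI[OF A C] by (simp only: borel_prod)
  let ?s = "\<lambda>j. real j / N"
  have s: "0 \<le> ?s j" for j using N by simp
  define G where "G j = {w\<in>space P. k w = j \<and> (?s j, B (?s j) w) \<in> A}" for j
  define H where "H j = {w\<in>space P. skel (\<lambda>t. B (?s j + t) w - B (?s j) w) \<in> C}" for j
  have H: "H j \<in> events" for j
    using measurable_sets[OF shifted_skel_measurable[OF s[of j]] C] by (simp add: H_def vimage_def Int_def conj_commute)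
  have G: "G j \<in> events" for j
  proof -
    note [measurable] = B_measurable[OF s[of j]]
    show ?thesis unfolding G_def by measurable
  qed
  have GH: "emeasure P (G j \<inter> H j) = emeasure P (G j) * emeasure path_law C" for j
  proof -
    obtain a where a: "a \<in> sets (past (?s j))" and ae: "AE w in P. k w = j \<longleftrightarrow> w \<in> a" using ex[of j] by blast
    have "(\<lambda>w. (?s j, B (?s j) w)) \<in> borel_measurable (past (?s j))"
      using B_past[OF s[of j] order_refl] by (intro borel_measurable_Pair) auto
    from measurable_sets[OF this A]
    have a': "a \<inter> ((\<lambda>w. (?s j, B (?s j) w)) -` A \<inter> space P) \<in> sets (past (?s j))" (is "?a' \<in> _")
      using a by auto
    have "AE w in P. w \<in> G j \<longleftrightarrow> w \<in> ?a'"
      using ae AE_space by eventually_elim (auto simp: G_def)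
    then have "AE w in P. w \<in> G j \<inter> H j \<longleftrightarrow> w \<in> ?a' \<inter> H j" "AE w in P. w \<in> G j \<longleftrightarrow> w \<in> ?a'"
      by auto
    then have "prob (G j \<inter> H j) = prob (?a' \<inter> H j)" "prob (G j) = prob ?a'"
      using G H past_events[OF a'] by (auto intro!: finite_measure_eq_AE)
    moreover have "prob (?a' \<inter> H j) = prob ?a' * measure path_law C"
      unfolding H_def by (rule markov[OF s a' C])
    ultimately show ?thesis
      by (simp add: emeasure_eq_measure PL.emeasure_eq_measure ennreal_mult)
  qed
  have dG: "disjoint_family G" "disjoint_family (\<lambda>j. G j \<inter> H j)"
    by (auto simp: disjoint_family_on_def G_def)
  have "emeasure (distr P borel (\<lambda>w. (\<sigma> w, B (\<sigma> w) w))) A = emeasure P ((\<lambda>w. (\<sigma> w, B (\<sigma> w) w)) -` A \<inter> space P)"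
    by (rule emeasure_distr) measurable
  also have "(\<lambda>w. (\<sigma> w, B (\<sigma> w) w)) -` A \<inter> space P = (\<Union>j. G j)"
    by (auto simp: G_def \<sigma>_def)
  also have "emeasure P \<dots> = (\<Sum>j. emeasure P (G j))"
    using G dG by (intro suminf_emeasure[symmetric]) auto
  finally have "emeasure (distr P borel (\<lambda>w. (\<sigma> w, B (\<sigma> w) w))) A * emeasure path_law C = (\<Sum>j. emeasure P (G j \<inter> H j))"
    by (simp add: GH)
  also have "\<dots> = emeasure P (\<Union>j. G j \<inter> H j)"
    using G H dG by (intro suminf_emeasure) auto
  also have "(\<Union>j. G j \<inter> H j) = (\<lambda>w. ((\<sigma> w, B (\<sigma> w) w), post \<sigma> w)) -` (A \<times> C) \<inter> space P"
    by (auto simp: G_def H_def \<sigma>_def)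
  also have "emeasure P \<dots> = emeasure (distr P borel (\<lambda>w. ((\<sigma> w, B (\<sigma> w) w), post \<sigma> w))) (A \<times> C)"
    using AC by (intro emeasure_distr[symmetric]) auto
  finally show "emeasure (distr P borel (\<lambda>w. (\<sigma> w, B (\<sigma> w) w))) A * emeasure path_law C =
    emeasure (distr P borel (\<lambda>w. ((\<sigma> w, B (\<sigma> w) w), post \<sigma> w))) (A \<times> C)" .
qed

text \<open>The stopping time is approximated from above by dyadic ones. Path continuity makes state
  and future converge at every coordinate, so both sides converge when tested against bounded
  continuous functions.\<close>

theorem strong_markov:
  assumes "stopping \<sigma>"
  shows "distr P borel (\<lambda>w. ((\<sigma> w, B (\<sigma> w) w), post \<sigma> w)) =
    distr P borel (\<lambda>w. (\<sigma> w, B (\<sigma> w) w)) \<Otimes>\<^sub>M path_law" (is "?L = ?R")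
proof (rule measure_eqI_continuous)
  have \<sigma>[measurable]: "\<sigma> \<in> borel_measurable P" and nn: "\<And>w. w \<in> space P \<Longrightarrow> 0 \<le> \<sigma> w"
    and ex: "\<And>s. 0 \<le> s \<Longrightarrow> \<exists>a\<in>sets (past s). AE w in P. \<sigma> w \<le> s \<longleftrightarrow> w \<in> a"
    using assms by (auto simp: stopping_def)
  note [measurable] = B_stopped_measurable[OF \<sigma> nn] post_measurable[OF \<sigma> nn]
  interpret PL: prob_space path_law by (rule prob_space_path_law)
  have sp: "sets (distr P borel g \<Otimes>\<^sub>M path_law) = sets borel" for g :: "'w \<Rightarrow> real \<times> (real ^ 'n)"
  proof -
    have "sets (distr P borel g \<Otimes>\<^sub>M path_law) = sets ((borel :: (real \<times> (real ^ 'n)) measure) \<Otimes>\<^sub>M (borel :: (nat \<Rightarrow> real ^ 'n) measure))"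
      by (rule sets_pair_measure_cong) auto
    then show ?thesis by (simp only: borel_prod)
  qed
  have L: "prob_space ?L" by (rule prob_space_distr) measurable
  then show "finite_measure ?L" by (rule prob_space.finite_measure)
  have R: "prob_space (distr P borel g \<Otimes>\<^sub>M path_law)" if "g \<in> borel_measurable P" for g :: "'w \<Rightarrow> real \<times> (real ^ 'n)"
  proof -
    interpret D: prob_space "distr P borel g" by (rule prob_space_distr[OF that])
    interpret PP: pair_prob_space "distr P borel g" path_law ..
    show ?thesis by (rule PP.P.prob_space_axioms)
  qed
  show "finite_measure ?R" by (rule prob_space.finite_measure, rule R) measurable
  show "sets ?L = sets borel" by simp
  show "sets ?R = sets borel" by (rule sp)
  define k where "k n w = nat \<lceil>2^n * \<sigma> w\<rceil>" for n :: nat and w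
  have k[measurable]: "k n \<in> measurable P (count_space UNIV)" for n unfolding k_def by measurable
  define \<sigma>n where "\<sigma>n n w = real (k n w) / 2^n" for n w
  have \<sigma>n[measurable]: "\<sigma>n n \<in> borel_measurable P" for n unfolding \<sigma>n_def by measurable
  have nnn: "0 \<le> \<sigma>n n w" for n w by (simp add: \<sigma>n_def)
  note [measurable] = B_stopped_measurable[OF \<sigma>n nnn] post_measurable[OF \<sigma>n nnn]
  have kj: "k n w = j \<longleftrightarrow> \<sigma> w \<le> real j / 2^n \<and> (j = 0 \<or> \<not> \<sigma> w \<le> (real j - 1) / 2^n)" if "w \<in> space P" for n w j
    unfolding k_def using dyadic_ceiling_eq_iff[OF nn[OF that]] by simp
  have exk: "\<exists>a\<in>sets (past (real j / 2^n)). AE w in P. k n w = j \<longleftrightarrow> w \<in> a" for n j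
  proof -
    obtain a where a: "a \<in> sets (past (real j / 2^n))" "AE w in P. \<sigma> w \<le> real j / 2^n \<longleftrightarrow> w \<in> a"
      using ex[of "real j / 2^n"] by auto
    show ?thesis
    proof (cases "j = 0")
      case True
      have "AE w in P. k n w = j \<longleftrightarrow> w \<in> a" using a(2) AE_space by eventually_elim (use kj True in auto)
      then show ?thesis using a(1) by blast
    next
      case False
      then have "0 \<le> (real j - 1) / 2^n" by simp
      from ex[OF this] obtain b where b: "b \<in> sets (past ((real j - 1) / 2^n))" "AE w in P. \<sigma> w \<le> (real j - 1) / 2^n \<longleftrightarrow> w \<in> b"
        by blast
      have "b \<in> sets (past (real j / 2^n))"
        using past_mono[of "(real j - 1) / 2^n" "real j / 2^n"] b(1) by (auto simp: divide_right_mono)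
      then have "a - b \<in> sets (past (real j / 2^n))" using a(1) by auto
      moreover have "AE w in P. k n w = j \<longleftrightarrow> w \<in> a - b"
        using a(2) b(2) AE_space by eventually_elim (use kj False in auto)
      ultimately show ?thesis by blast
    qed
  qed
  have SM: "distr P borel (\<lambda>w. ((\<sigma>n n w, B (\<sigma>n n w) w), post (\<sigma>n n) w)) =
    distr P borel (\<lambda>w. (\<sigma>n n w, B (\<sigma>n n w) w)) \<Otimes>\<^sub>M path_law" for n
    using strong_markov_discrete[of "2^n" "k n", OF _ k exk] unfolding \<sigma>n_def[abs_def] by simp
  have lim: "(\<lambda>n. \<sigma>n n w) \<longlonglongrightarrow> \<sigma> w" if "w \<in> space P" for w
    unfolding \<sigma>n_def k_def by (rule dyadic_ceiling_tendsto[OF nn[OF that]])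
  have limB: "(\<lambda>n. B (\<sigma>n n w + t) w) \<longlonglongrightarrow> B (\<sigma> w + t) w" if "w \<in> space P" "0 \<le> t" for w t
    using B_continuous[OF that(1)] nn[OF that(1)] nnn that(2) lim[OF that(1)]
    by (intro continuous_on_tendsto_compose[of "{0..}" "\<lambda>t. B t w"] tendsto_add tendsto_const) auto
  have lima: "(\<lambda>n. (\<sigma>n n w, B (\<sigma>n n w) w)) \<longlonglongrightarrow> (\<sigma> w, B (\<sigma> w) w)" if "w \<in> space P" for w
    using lim[OF that] limB[OF that order_refl] by (auto intro: tendsto_Pair)
  have limp: "(\<lambda>n. post (\<sigma>n n) w) \<longlonglongrightarrow> post \<sigma> w" if "w \<in> space P" for w
    by (rule tendsto_coordinatewise)
       (use limB[OF that] limB[OF that order_refl] in \<open>auto simp: skel_def intro!: tendsto_diff\<close>)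
  fix \<Phi> :: "(real \<times> (real ^ 'n)) \<times> (nat \<Rightarrow> real ^ 'n) \<Rightarrow> real"
  assume cont: "continuous_on UNIV \<Phi>" and bnd: "\<And>x. 0 \<le> \<Phi> x \<and> \<Phi> x \<le> 1"
  have bnd': "\<bar>\<Phi> x\<bar> \<le> 1" "\<Phi> x \<le> 1" for x using bnd[of x] by auto
  have \<Phi>[measurable]: "\<Phi> \<in> borel_measurable borel" using cont by (rule borel_measurable_continuous_onI)
  have \<Phi>'[measurable]: "\<Phi> \<in> borel_measurable (borel \<Otimes>\<^sub>M borel)" by (simp only: borel_prod \<Phi>)
  \<comment> \<open>Averaging over the future first turns an integral over the product measure into
    an expectation under \<open>P\<close>, so the limit on that side is a second dominated
    convergence.\<close>
  define \<Psi> where "\<Psi> a = (\<integral>f. \<Phi> (a, f) \<partial>path_law)" for a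
  have [measurable]: "\<Psi> \<in> borel_measurable borel" unfolding \<Psi>_def by measurable
  have \<Psi>b: "\<bar>\<Psi> a\<bar> \<le> 1" for a
  proof -
    have "\<bar>\<Psi> a\<bar> \<le> (\<integral>f. 1 \<partial>path_law)"
      unfolding \<Psi>_def by (intro integral_abs_bound[THEN order_trans] integral_mono) (auto simp: bnd' intro!: PL.integrable_const_bound[where B=1])
    then show ?thesis by (simp add: PL.prob_space)
  qed
  have prod: "(\<integral>x. \<Phi> x \<partial>(distr P borel g \<Otimes>\<^sub>M path_law)) = (\<integral>w. \<Psi> (g w) \<partial>P)"
    if [measurable]: "g \<in> borel_measurable P" for g :: "'w \<Rightarrow> real \<times> (real ^ 'n)"
  proof -
    interpret D: prob_space "distr P borel g" by (rule prob_space_distr) measurable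
    interpret PP: pair_prob_space "distr P borel g" path_law ..
    have "(\<integral>x. \<Phi> x \<partial>(distr P borel g \<Otimes>\<^sub>M path_law)) = (\<integral>a. \<Psi> a \<partial>distr P borel g)"
      unfolding \<Psi>_def by (intro PP.integral_fst'[symmetric] PP.P.integrable_const_bound[where B=1]) (auto simp: bnd')
    also have "\<dots> = (\<integral>w. \<Psi> (g w) \<partial>P)" by (rule integral_distr) measurable
    finally show ?thesis .
  qed
  have "(\<lambda>n. \<integral>w. \<Phi> ((\<sigma>n n w, B (\<sigma>n n w) w), post (\<sigma>n n) w) \<partial>P) \<longlonglongrightarrow> (\<integral>w. \<Phi> ((\<sigma> w, B (\<sigma> w) w), post \<sigma> w) \<partial>P)"
  proof (rule integral_dominated_convergence[where w="\<lambda>_. 1"])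
    show "AE w in P. (\<lambda>n. \<Phi> ((\<sigma>n n w, B (\<sigma>n n w) w), post (\<sigma>n n) w)) \<longlonglongrightarrow> \<Phi> ((\<sigma> w, B (\<sigma> w) w), post \<sigma> w)"
      using AE_space
    proof eventually_elim
      case (elim w)
      then show ?case
        by (intro continuous_on_tendsto_compose[OF cont] tendsto_Pair[OF lima limp]) auto
    qed
  qed (auto simp: bnd')
  moreover have "(\<lambda>n. \<integral>w. \<Psi> (\<sigma>n n w, B (\<sigma>n n w) w) \<partial>P) \<longlonglongrightarrow> (\<integral>w. \<Psi> (\<sigma> w, B (\<sigma> w) w) \<partial>P)"
  proof (rule integral_dominated_convergence[where w="\<lambda>_. 1"])
    show "AE w in P. (\<lambda>n. \<Psi> (\<sigma>n n w, B (\<sigma>n n w) w)) \<longlonglongrightarrow> \<Psi> (\<sigma> w, B (\<sigma> w) w)"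
      using AE_space
    proof eventually_elim
      case (elim w)
      show ?case unfolding \<Psi>_def
      proof (rule integral_dominated_convergence[where w="\<lambda>_. 1"])
        show "AE f in path_law. (\<lambda>n. \<Phi> ((\<sigma>n n w, B (\<sigma>n n w) w), f)) \<longlonglongrightarrow> \<Phi> ((\<sigma> w, B (\<sigma> w) w), f)"
          using elim by (intro AE_I2 continuous_on_tendsto_compose[OF cont] tendsto_Pair[OF lima tendsto_const]) auto
      qed (auto simp: bnd')
    qed
  qed (use \<Psi>b in auto)
  moreover have "(\<integral>w. \<Phi> ((\<sigma>n n w, B (\<sigma>n n w) w), post (\<sigma>n n) w) \<partial>P) = (\<integral>w. \<Psi> (\<sigma>n n w, B (\<sigma>n n w) w) \<partial>P)" for n
  proof -
    have "(\<integral>w. \<Phi> ((\<sigma>n n w, B (\<sigma>n n w) w), post (\<sigma>n n) w) \<partial>P) =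
      (\<integral>x. \<Phi> x \<partial>distr P borel (\<lambda>w. ((\<sigma>n n w, B (\<sigma>n n w) w), post (\<sigma>n n) w)))"
      by (rule integral_distr[symmetric]) measurable
    then show ?thesis by (simp add: SM prod)
  qed
  ultimately have "(\<integral>w. \<Phi> ((\<sigma> w, B (\<sigma> w) w), post \<sigma> w) \<partial>P) = (\<integral>w. \<Psi> (\<sigma> w, B (\<sigma> w) w) \<partial>P)"
    by (simp add: LIMSEQ_unique)
  moreover have "(\<integral>x. \<Phi> x \<partial>?L) = (\<integral>w. \<Phi> ((\<sigma> w, B (\<sigma> w) w), post \<sigma> w) \<partial>P)"
    by (rule integral_distr) measurable
  ultimately show "(\<integral>x. \<Phi> x \<partial>?L) = (\<integral>x. \<Phi> x \<partial>?R)" by (simp add: prod)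
qed

end

subsection \<open>Hitting times\<close>

text \<open>The start \<open>y\<close> is kept apart from the path \<open>g\<close>, so that one
  path functional serves all starting points.\<close>

definition first_hit :: "'a::real_vector set \<Rightarrow> 'a \<Rightarrow> (real \<Rightarrow> 'a) \<Rightarrow> ereal" where
  "first_hit A y g = (INF t\<in>{t. 0 \<le> t \<and> y + g t \<in> A}. ereal t)"

lemma hitting_time_eq_first_hit:
  "hitting_time (\<lambda>t w. y + B t w) A w = first_hit A y (\<lambda>t. B t w)"
  by (simp add: hitting_time_def first_hit_def)

lemma first_hit_nonneg: "0 \<le> first_hit A y g"
  unfolding first_hit_def by (intro INF_greatest) auto

lemma first_hit_le: "0 \<le> t \<Longrightarrow> y + g t \<in> A \<Longrightarrow> first_hit A y g \<le> ereal t"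
  unfolding first_hit_def by (intro INF_lower) auto

lemma first_hit_attained:
  fixes A :: "'a::real_normed_vector set"
  assumes g: "continuous_on {0..} g" and A: "closed A" and fin: "first_hit A y g \<noteq> \<infinity>"
  obtains t where "0 \<le> t" "y + g t \<in> A" "first_hit A y g = ereal t"
proof -
  define T where "T = {t. 0 \<le> t \<and> y + g t \<in> A}"
  have T: "T \<noteq> {}" using fin by (auto simp: first_hit_def T_def[symmetric] top_ereal_def)
  have bdd: "bdd_below T" by (rule bdd_belowI[of _ 0]) (auto simp: T_def)
  have "T = {0..} \<inter> (\<lambda>t. y + g t) -` A" by (auto simp: T_def)
  moreover have "closed \<dots>"
    using g by (intro continuous_closed_preimage A closed_real_atLeast continuous_intros)
  ultimately have "closed T" by simp
  from closed_contains_Inf[OF T bdd this] have *: "Inf T \<in> T" .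
  have "first_hit A y g = ereal (Inf T)"
  proof (rule antisym)
    show "first_hit A y g \<le> ereal (Inf T)" using * by (intro first_hit_le) (auto simp: T_def)
    show "ereal (Inf T) \<le> first_hit A y g"
      unfolding first_hit_def T_def[symmetric] using bdd by (intro INF_greatest) (simp add: cInf_lower)
  qed
  with * show ?thesis using that by (auto simp: T_def)
qed

lemma first_hit_le_iff:
  fixes A :: "'a::real_normed_vector set"
  assumes g: "continuous_on {0..} g" and A: "closed A"
  shows "first_hit A y g \<le> ereal s \<longleftrightarrow> (\<exists>t. 0 \<le> t \<and> t \<le> s \<and> y + g t \<in> A)"
proof
  assume le: "first_hit A y g \<le> ereal s"
  then have "first_hit A y g \<noteq> \<infinity>" by auto
  from first_hit_attained[OF g A this] le show "\<exists>t. 0 \<le> t \<and> t \<le> s \<and> y + g t \<in> A" by (metis ereal_less_eq(3))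
next
  assume "\<exists>t. 0 \<le> t \<and> t \<le> s \<and> y + g t \<in> A"
  then show "first_hit A y g \<le> ereal s" using first_hit_le order_trans by (metis ereal_less_eq(3))
qed

lemma first_hit_shift:
  fixes A :: "'a::real_normed_vector set"
  assumes s: "0 \<le> s" and no: "\<And>t. 0 \<le> t \<Longrightarrow> t < s \<Longrightarrow> y + g t \<notin> A"
  shows "first_hit A y g = ereal s + first_hit A (y + g s) (\<lambda>t. g (s + t) - g s)"
proof -
  have "{t. 0 \<le> t \<and> y + g t \<in> A} = (\<lambda>t. s + t) ` {t. 0 \<le> t \<and> y + g s + (g (s + t) - g s) \<in> A}"
  proof (intro equalityI subsetI)
    fix t assume t: "t \<in> {t. 0 \<le> t \<and> y + g t \<in> A}"
    then have "s \<le> t" using no by force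
    then show "t \<in> (\<lambda>t. s + t) ` {t. 0 \<le> t \<and> y + g s + (g (s + t) - g s) \<in> A}"
      using t by (intro image_eqI[of _ _ "t - s"]) (auto simp: algebra_simps)
  qed (use s in \<open>auto simp: algebra_simps\<close>)
  then have "first_hit A y g = (INF t\<in>{t. 0 \<le> t \<and> y + g s + (g (s + t) - g s) \<in> A}. ereal s + ereal t)"
    unfolding first_hit_def by (simp add: image_image)
  also have "\<dots> = ereal s + first_hit A (y + g s) (\<lambda>t. g (s + t) - g s)"
  \<comment> \<open>If the set is never hit, both sides are infinite; a shift commutes with an
    infimum over a nonempty set.\<close>
  proof (cases "{t. 0 \<le> t \<and> y + g s + (g (s + t) - g s) \<in> A} = {}")
    case True
    show ?thesis unfolding first_hit_def True by (simp add: top_ereal_def)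
  next
    case False
    then show ?thesis unfolding first_hit_def
      by (intro INF_ereal_add_right) auto
  qed
  finally show ?thesis .
qed

text \<open>Coming arbitrarily close to \<open>A\<close> at rational times up to \<open>s\<close>.
  For a continuous path and a closed set this means a hit by time \<open>s\<close>, because the
  distance attains its minimum on a compact interval.\<close>

definition hit_by :: "'a::euclidean_space set \<Rightarrow> real \<Rightarrow> 'a \<Rightarrow> (nat \<Rightarrow> 'a) \<Rightarrow> bool" where
  "hit_by A s y f \<longleftrightarrow> (\<forall>m. \<exists>k. qt k \<le> s \<and> infdist (y + f k) A < 1 / real (Suc m))"

text \<open>A measurable function on all sequences that computes hitting times on the
  skeletons of continuous paths.\<close>
definition hit_time :: "'a::euclidean_space set \<Rightarrow> 'a \<Rightarrow> (nat \<Rightarrow> 'a) \<Rightarrow> ereal" where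
  "hit_time A y f = (INF k. if hit_by A (qt k) y f then ereal (qt k) else \<infinity>)"

lemma hit_by_skel_iff:
  assumes g: "continuous_on {0..} g" and A: "closed A" "A \<noteq> {}" and s: "0 \<le> s"
  shows "hit_by A s y (skel g) \<longleftrightarrow> first_hit A y g \<le> ereal s"
  unfolding first_hit_le_iff[OF g A(1)]
proof
  assume h: "hit_by A s y (skel g)"
  have "continuous_on {0..s} (\<lambda>t. infdist (y + g t) A)"
    by (intro continuous_intros continuous_on_subset[OF g]) auto
  then obtain t where t: "t \<in> {0..s}" "\<And>u. u \<in> {0..s} \<Longrightarrow> infdist (y + g t) A \<le> infdist (y + g u) A"
    using continuous_attains_inf[of "{0..s}" "\<lambda>t. infdist (y + g t) A"] s by auto
  have "infdist (y + g t) A \<le> 0"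
  proof (rule field_le_epsilon)
    fix e :: real assume "0 < e"
    then obtain m where m: "1 / real (Suc m) < e" using nat_approx_posE by blast
    obtain k where "qt k \<le> s" "infdist (y + g (qt k)) A < 1 / real (Suc m)"
      using h by (auto simp: hit_by_def skel_def)
    then show "infdist (y + g t) A \<le> 0 + e" using t(2)[of "qt k"] m by auto
  qed
  then have "y + g t \<in> A" using A in_closed_iff_infdist_zero infdist_nonneg by (metis order_antisym)
  then show "\<exists>t. 0 \<le> t \<and> t \<le> s \<and> y + g t \<in> A" using t(1) by auto
next
  assume "\<exists>t. 0 \<le> t \<and> t \<le> s \<and> y + g t \<in> A"
  then obtain t where t: "0 \<le> t" "t \<le> s" "y + g t \<in> A" by blast
  show "hit_by A s y (skel g)" unfolding hit_by_def
  proof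
    fix m :: nat
    have "\<exists>d>0. \<forall>u\<in>{0..}. dist u t < d \<longrightarrow> dist (g u) (g t) < 1 / real (Suc m)"
      using g t(1) unfolding continuous_on_iff by simp
    then obtain d where d: "d > 0" "\<And>u. 0 \<le> u \<Longrightarrow> dist u t < d \<Longrightarrow> dist (g u) (g t) < 1 / real (Suc m)"
      by auto
    \<comment> \<open>The rational time must not exceed \<open>t\<close>, otherwise it could exceed
      \<open>s\<close>; at \<open>t = 0\<close> it is \<open>0\<close> itself.\<close>
    obtain q where q: "q \<in> \<rat>" "0 \<le> q" "q \<le> t" "dist q t < d"
    proof (cases "t = 0")
      case True then show ?thesis using that[of 0] d(1) by simp
    next
      case False
      then have "max 0 (t - d) < t" using t(1) d(1) by simp
      from Rats_dense_in_real[OF this] obtain q where "q \<in> \<rat>" "max 0 (t - d) < q" "q < t" by blast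
      then show ?thesis using that[of q] by (auto simp: dist_real_def)
    qed
    obtain k where k: "qt k = q" using ex_qt[OF q(2,1)] by blast
    have "infdist (y + g q) A \<le> dist (y + g q) (y + g t)" by (rule infdist_le[OF t(3)])
    also have "\<dots> < 1 / real (Suc m)" using d(2)[OF q(2,4)] by simp
    finally show "\<exists>k. qt k \<le> s \<and> infdist (y + skel g k) A < 1 / real (Suc m)"
      using k q t by (intro exI[of _ k]) (simp add: skel_def)
  qed
qed

text \<open>Rational times approach the hitting time from above and the set has been hit by each of
  them, so the infimum is exact even at an irrational time.\<close>

lemma hit_time_skel:
  assumes g: "continuous_on {0..} g" and A: "closed A" "A \<noteq> {}"
  shows "hit_time A y (skel g) = first_hit A y g"
proof -
  have "hit_time A y (skel g) = (INF k. if first_hit A y g \<le> ereal (qt k) then ereal (qt k) else \<infinity>)"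
    unfolding hit_time_def by (simp add: hit_by_skel_iff[OF g A])
  also have "\<dots> = first_hit A y g"
  proof (rule antisym)
    show "first_hit A y g \<le> (INF k. if first_hit A y g \<le> ereal (qt k) then ereal (qt k) else \<infinity>)"
      by (intro INF_greatest) auto
    show "(INF k. if first_hit A y g \<le> ereal (qt k) then ereal (qt k) else \<infinity>) \<le> first_hit A y g" (is "?I \<le> _")
    proof (cases "first_hit A y g = \<infinity>")
      case False
      then obtain t where t: "0 \<le> t" "first_hit A y g = ereal t" by (rule first_hit_attained[OF g A(1)])
      show ?thesis unfolding t(2)
      proof (rule ereal_le_epsilon2)
        fix e :: real assume "0 < e"
        then obtain q where q: "q \<in> \<rat>" "t < q" "q < t + e" using Rats_dense_in_real[of t "t + e"] by auto
        then obtain k where k: "qt k = q" using ex_qt[of q] t(1) by auto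
        have "?I \<le> (if first_hit A y g \<le> ereal (qt k) then ereal (qt k) else \<infinity>)" by (rule INF_lower) simp
        also have "\<dots> \<le> ereal t + ereal e" using q k t by simp
        finally show "(INF k. if ereal t \<le> ereal (qt k) then ereal (qt k) else \<infinity>) \<le> ereal t + ereal e" by (simp add: t(2))
      qed
    qed simp
  qed
  finally show ?thesis .
qed

lemma hit_by_measurable:
  "Measurable.pred borel (\<lambda>p :: 'a::euclidean_space \<times> (nat \<Rightarrow> 'a). hit_by A s (fst p) (snd p))"
proof -
  have "(\<lambda>p :: 'a \<times> (nat \<Rightarrow> 'a). infdist (fst p + snd p k) A) \<in> borel_measurable borel" for k
    by (intro borel_measurable_continuous_onI continuous_on_infdist continuous_intros continuous_on_product_then_coordinatewise)
  note [measurable] = this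
  show ?thesis unfolding hit_by_def by measurable
qed

lemma hit_time_measurable [measurable]:
  "(\<lambda>p :: 'a::euclidean_space \<times> (nat \<Rightarrow> 'a). hit_time A (fst p) (snd p)) \<in> borel_measurable borel"
proof -
  note [measurable] = hit_by_measurable
  show ?thesis unfolding hit_time_def by measurable
qed

lemma hit_time_measurable':
  assumes "f \<in> borel_measurable M" "g \<in> borel_measurable M"
  shows "(\<lambda>x. hit_time A (f x) (g x)) \<in> borel_measurable M"
proof -
  have "(\<lambda>x. (f x, g x)) \<in> borel_measurable M" using assms by (rule borel_measurable_Pair)
  from measurable_compose[OF this hit_time_measurable] show ?thesis by simp
qed

definition qt_index :: "real \<Rightarrow> nat" where
  "qt_index q = (SOME k. qt k = q)"

text \<open>Evaluation at a real time, recovered from the skeleton along dyadic times. As a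
  pointwise \<open>lim\<close> it is Borel in the sequence and the time jointly, on arbitrary
  sequences.\<close>

definition path_at :: "(nat \<Rightarrow> 'a::euclidean_space) \<Rightarrow> real \<Rightarrow> 'a" where
  "path_at f t = lim (\<lambda>n. f (qt_index (real (nat \<lceil>2^n * t\<rceil>) / 2^n)))"

lemma path_at_skel:
  assumes g: "continuous_on {0..} g" and t: "0 \<le> t"
  shows "path_at (skel g) t = g t"
proof -
  have "qt (qt_index (real (nat \<lceil>2^n * t\<rceil>) / 2^n)) = real (nat \<lceil>2^n * t\<rceil>) / 2^n" for n
    unfolding qt_index_def by (rule someI_ex) (intro ex_qt, auto)
  then have eq: "skel g (qt_index (real (nat \<lceil>2^n * t\<rceil>) / 2^n)) = g (real (nat \<lceil>2^n * t\<rceil>) / 2^n)" for n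
    by (simp add: skel_def)
  have "(\<lambda>n. g (real (nat \<lceil>2^n * t\<rceil>) / 2^n)) \<longlonglongrightarrow> g t"
  proof (rule continuous_on_tendsto_compose[OF g dyadic_ceiling_tendsto[OF t]])
    have "real k / 2 ^ n \<in> {0..}" for k n :: nat by simp
    then show "\<forall>\<^sub>F n in sequentially. real (nat \<lceil>2 ^ n * t\<rceil>) / 2 ^ n \<in> {0..}"
      by (intro always_eventually allI)
  qed (use t in simp)
  then show ?thesis unfolding path_at_def eq by (rule limI)
qed

lemma path_at_measurable:
  assumes f: "f \<in> borel_measurable M" and t: "t \<in> borel_measurable M"
  shows "(\<lambda>x. path_at (f x) (t x)) \<in> borel_measurable M"
  unfolding path_at_def
proof (rule borel_measurable_lim_metric)
  fix n :: nat
  note [measurable] = t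
  have fk: "(\<lambda>x. f x k) \<in> borel_measurable M" for k
    using measurable_compose[OF f measurable_seq_component[of k]] .
  have "(\<lambda>x. nat \<lceil>2^n * t x\<rceil>) \<in> measurable M (count_space UNIV)" by measurable
  from measurable_compose[OF this, of "\<lambda>j. qt_index (real j / 2^n)" "count_space UNIV"]
  have "(\<lambda>x. qt_index (real (nat \<lceil>2^n * t x\<rceil>) / 2^n)) \<in> measurable M (count_space UNIV)" by simp
  from measurable_compose_countable[OF fk this]
  show "(\<lambda>x. f x (qt_index (real (nat \<lceil>2^n * t x\<rceil>) / 2^n))) \<in> borel_measurable M" .
qed

subsection \<open>Optional stopping\<close>

text \<open>A rotation carries \<open>e\<close> to a coordinate axis, where the second moment is
  one-dimensional.\<close>

lemma nn_integral_gauss1_inner: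
  fixes e :: "real ^ 'n"
  assumes e: "norm e = 1"
  shows "(\<integral>\<^sup>+x. ennreal ((e \<bullet> x)\<^sup>2) \<partial>gauss1) = 1"
proof -
  fix i :: 'n
  have n1: "norm (axis i 1 :: real ^ 'n) = 1" by (simp add: norm_axis_1)
  obtain R :: "real ^ 'n \<Rightarrow> real ^ 'n" where R: "orthogonal_transformation R" "R e = axis i 1"
    by (rule orthogonal_transformation_exists_1[OF e n1]) (rule that)
  note [measurable] = orthogonal_transformation_borel_measurable[OF R(1)]
  have "e \<bullet> x = R x $ i" for x
  proof -
    have "e \<bullet> x = R e \<bullet> R x" using R(1) unfolding orthogonal_transformation_def by metis
    also have "\<dots> = R x $ i" unfolding R(2) by (simp add: inner_axis')
    finally show ?thesis .
  qed
  then have "(\<integral>\<^sup>+x. ennreal ((e \<bullet> x)\<^sup>2) \<partial>gauss1) = (\<integral>\<^sup>+x. ennreal ((R x $ i)\<^sup>2) \<partial>gauss1)"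
    by (simp only:)
  also have "\<dots> = (\<integral>\<^sup>+x. ennreal ((x $ i)\<^sup>2) \<partial>distr gauss1 borel R)"
    by (rule nn_integral_distr[symmetric]) measurable
  finally have "(\<integral>\<^sup>+x. ennreal ((e \<bullet> x)\<^sup>2) \<partial>gauss1) = (\<integral>\<^sup>+x. ennreal ((x $ i)\<^sup>2) \<partial>distr gauss1 borel R)" .
  then show ?thesis by (simp add: gauss1_orthogonal[OF R(1)] nn_integral_gauss1_component)
qed

lemma gauss1_inner_mean:
  fixes e :: "real ^ 'n"
  assumes e: "norm e = 1"
  shows "integrable gauss1 (\<lambda>x. e \<bullet> x)" "(\<integral>x. e \<bullet> x \<partial>gauss1) = 0"
proof -
  interpret prob_space "gauss1 :: (real ^ 'n) measure" by (rule prob_space_gauss1)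
  have sq: "integrable gauss1 (\<lambda>x. (e \<bullet> x)\<^sup>2)"
    by (rule integrableI_nonneg) (auto simp: nn_integral_gauss1_inner[OF e])
  then show int: "integrable gauss1 (\<lambda>x. e \<bullet> x)"
    by (rule square_integrable_imp_integrable[rotated]) simp
  have neg: "orthogonal_transformation (\<lambda>x. - x :: real ^ 'n)" by (simp add: orthogonal_transformation_def linear_uminus)
  have "(\<integral>x. e \<bullet> x \<partial>gauss1) = (\<integral>x. e \<bullet> x \<partial>distr gauss1 borel (\<lambda>x. - x))"
    by (simp only: gauss1_orthogonal[OF neg])
  also have "\<dots> = (\<integral>x. e \<bullet> (- x) \<partial>gauss1)" by (rule integral_distr) auto
  also have "\<dots> = - (\<integral>x. e \<bullet> x \<partial>gauss1)" by simp
  finally show "(\<integral>x. e \<bullet> x \<partial>gauss1) = 0" by simp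
qed

context bm
begin

lemma B_distr: assumes "0 \<le> a" shows "distr P borel (B a) = gauss a"
proof -
  define t where "t k = (if k = 0 then 0 else a)" for k :: nat
  have t: "0 \<le> t 0" "incseq t" using assms by (auto simp: t_def incseq_def)
  have "distr P borel (B a) = distr P borel (incr t 0)"
    by (rule distr_cong) (auto simp: t_def B_0)
  also have "\<dots> = gauss a" using incr_distr[OF t, of 0] by (simp add: t_def)
  finally show ?thesis .
qed

lemma B_moments:
  assumes a: "0 \<le> a" and e: "norm e = 1"
  shows "integrable P (\<lambda>w. e \<bullet> B a w)" "expectation (\<lambda>w. e \<bullet> B a w) = 0"
    "integrable P (\<lambda>w. (e \<bullet> B a w)\<^sup>2)" "expectation (\<lambda>w. (e \<bullet> B a w)\<^sup>2) = a"
proof -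
  note [measurable] = B_measurable[OF a]
  have "integrable (gauss a) (\<lambda>x. e \<bullet> x)"
    unfolding gauss_def using gauss1_inner_mean(1)[OF e] by (subst integrable_distr_eq) auto
  then show "integrable P (\<lambda>w. e \<bullet> B a w)"
    unfolding B_distr[OF a, symmetric] by (subst (asm) integrable_distr_eq) auto
  have "expectation (\<lambda>w. e \<bullet> B a w) = (\<integral>x. e \<bullet> x \<partial>gauss a)"
    unfolding B_distr[OF a, symmetric] by (rule integral_distr[symmetric]) auto
  also have "\<dots> = (\<integral>x. sqrt a * (e \<bullet> x) \<partial>gauss1)"
    unfolding gauss_def by (subst integral_distr) auto
  finally show "expectation (\<lambda>w. e \<bullet> B a w) = 0"
    by (simp add: gauss1_inner_mean[OF e])
  have "(\<integral>\<^sup>+w. ennreal ((e \<bullet> B a w)\<^sup>2) \<partial>P) = (\<integral>\<^sup>+x. ennreal ((e \<bullet> x)\<^sup>2) \<partial>gauss a)"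
    unfolding B_distr[OF a, symmetric] by (subst nn_integral_distr) auto
  also have "\<dots> = (\<integral>\<^sup>+x. ennreal a * ennreal ((e \<bullet> x)\<^sup>2) \<partial>gauss1)"
    unfolding gauss_def using a
    by (subst nn_integral_distr) (auto simp: ennreal_mult[symmetric] power_mult_distrib intro!: nn_integral_cong)
  also have "\<dots> = ennreal a"
    by (subst nn_integral_cmult) (auto simp: nn_integral_gauss1_inner[OF e])
  finally have nn: "(\<integral>\<^sup>+w. ennreal ((e \<bullet> B a w)\<^sup>2) \<partial>P) = ennreal a" .
  then show "integrable P (\<lambda>w. (e \<bullet> B a w)\<^sup>2)" by (intro integrableI_nonneg) auto
  show "expectation (\<lambda>w. (e \<bullet> B a w)\<^sup>2) = a"
    using nn a by (subst integral_eq_nn_integral) auto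
qed

lemma stoppingD:
  assumes "stopping \<sigma>"
  shows "\<sigma> \<in> borel_measurable P" "\<And>w. w \<in> space P \<Longrightarrow> 0 \<le> \<sigma> w"
    "(\<lambda>w. B (\<sigma> w) w) \<in> borel_measurable P" "post \<sigma> \<in> borel_measurable P"
    "(\<lambda>w. ((\<sigma> w, B (\<sigma> w) w), post \<sigma> w)) \<in> borel_measurable P"
proof -
  show 1: "\<sigma> \<in> borel_measurable P" and 2: "\<And>w. w \<in> space P \<Longrightarrow> 0 \<le> \<sigma> w"
    using assms by (auto simp: stopping_def)
  show 3: "(\<lambda>w. B (\<sigma> w) w) \<in> borel_measurable P" by (rule B_stopped_measurable[OF 1 2])
  show 4: "post \<sigma> \<in> borel_measurable P" by (rule post_measurable[OF 1 2])
  show "(\<lambda>w. ((\<sigma> w, B (\<sigma> w) w), post \<sigma> w)) \<in> borel_measurable P"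
    by (intro borel_measurable_Pair 1 3 4)
qed

text \<open>The form for calculations: the future after the stopping time becomes an independent
  copy of the path, carried by the inner variable \<open>w'\<close>.\<close>

lemma strong_markov_nn:
  fixes F :: "(real \<times> (real ^ 'n)) \<times> (nat \<Rightarrow> real ^ 'n) \<Rightarrow> ennreal"
  assumes \<sigma>: "stopping \<sigma>" and F: "F \<in> borel_measurable borel"
  shows "(\<integral>\<^sup>+w. F ((\<sigma> w, B (\<sigma> w) w), post \<sigma> w) \<partial>P) =
    (\<integral>\<^sup>+w. (\<integral>\<^sup>+w'. F ((\<sigma> w, B (\<sigma> w) w), skel (\<lambda>t. B t w')) \<partial>P) \<partial>P)"
proof -
  interpret PL: prob_space path_law by (rule prob_space_path_law)
  note [measurable] = stoppingD(1,3)[OF \<sigma>]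
  have F'[measurable]: "F \<in> borel_measurable (borel \<Otimes>\<^sub>M borel)" using F by (simp only: borel_prod)
  have "(\<integral>\<^sup>+w. F ((\<sigma> w, B (\<sigma> w) w), post \<sigma> w) \<partial>P) =
    (\<integral>\<^sup>+x. F x \<partial>(distr P borel (\<lambda>w. (\<sigma> w, B (\<sigma> w) w)) \<Otimes>\<^sub>M path_law))"
    unfolding strong_markov[OF \<sigma>, symmetric] by (rule nn_integral_distr[OF stoppingD(5)[OF \<sigma>], symmetric]) (use F in simp)
  also have "\<dots> = (\<integral>\<^sup>+a. (\<integral>\<^sup>+f. F (a, f) \<partial>path_law) \<partial>distr P borel (\<lambda>w. (\<sigma> w, B (\<sigma> w) w)))"
    by (rule PL.nn_integral_fst[symmetric]) simp
  also have "\<dots> = (\<integral>\<^sup>+w. (\<integral>\<^sup>+f. F ((\<sigma> w, B (\<sigma> w) w), f) \<partial>path_law) \<partial>P)"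
    by (rule nn_integral_distr) measurable
  also have "\<dots> = (\<integral>\<^sup>+w. (\<integral>\<^sup>+w'. F ((\<sigma> w, B (\<sigma> w) w), skel (\<lambda>t. B t w')) \<partial>P) \<partial>P)"
    unfolding path_law_def by (intro nn_integral_cong nn_integral_distr[OF skel_measurable]) measurable
  finally show ?thesis .
qed

lemma strong_markov_integral:
  fixes F :: "(real \<times> (real ^ 'n)) \<times> (nat \<Rightarrow> real ^ 'n) \<Rightarrow> real"
  assumes \<sigma>: "stopping \<sigma>" and F: "F \<in> borel_measurable borel"
    and int: "integrable P (\<lambda>w. F ((\<sigma> w, B (\<sigma> w) w), post \<sigma> w))"
  shows "expectation (\<lambda>w. F ((\<sigma> w, B (\<sigma> w) w), post \<sigma> w)) =
    expectation (\<lambda>w. expectation (\<lambda>w'. F ((\<sigma> w, B (\<sigma> w) w), skel (\<lambda>t. B t w'))))"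
    and "integrable P (\<lambda>w. expectation (\<lambda>w'. F ((\<sigma> w, B (\<sigma> w) w), skel (\<lambda>t. B t w'))))"
proof -
  note [measurable] = stoppingD(1,3)[OF \<sigma>]
  interpret PL: prob_space path_law by (rule prob_space_path_law)
  interpret D: prob_space "distr P borel (\<lambda>w. (\<sigma> w, B (\<sigma> w) w))" by (rule prob_space_distr) measurable
  interpret PP: pair_prob_space "distr P borel (\<lambda>w. (\<sigma> w, B (\<sigma> w) w))" path_law ..
  have F'[measurable]: "F \<in> borel_measurable (borel \<Otimes>\<^sub>M borel)" using F by (simp only: borel_prod)
  have eq: "(\<integral>f. F (a, f) \<partial>path_law) = expectation (\<lambda>w'. F (a, skel (\<lambda>t. B t w')))" for a
    unfolding path_law_def by (rule integral_distr[OF skel_measurable]) measurable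
  have intp: "integrable (distr P borel (\<lambda>w. (\<sigma> w, B (\<sigma> w) w)) \<Otimes>\<^sub>M path_law) F"
    unfolding strong_markov[OF \<sigma>, symmetric]
    using int by (subst integrable_distr_eq[OF stoppingD(5)[OF \<sigma>] F])
  have m: "(\<lambda>a. \<integral>f. F (a, f) \<partial>path_law) \<in> borel_measurable borel" by measurable
  have "expectation (\<lambda>w. F ((\<sigma> w, B (\<sigma> w) w), post \<sigma> w)) =
    (\<integral>x. F x \<partial>(distr P borel (\<lambda>w. (\<sigma> w, B (\<sigma> w) w)) \<Otimes>\<^sub>M path_law))"
    unfolding strong_markov[OF \<sigma>, symmetric] by (rule integral_distr[OF stoppingD(5)[OF \<sigma>] F, symmetric])
  also have "\<dots> = (\<integral>a. (\<integral>f. F (a, f) \<partial>path_law) \<partial>distr P borel (\<lambda>w. (\<sigma> w, B (\<sigma> w) w)))"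
    by (rule PP.integral_fst'[symmetric, OF intp])
  also have "\<dots> = (\<integral>w. (\<integral>f. F ((\<sigma> w, B (\<sigma> w) w), f) \<partial>path_law) \<partial>P)"
    by (rule integral_distr[OF _ m]) measurable
  finally show "expectation (\<lambda>w. F ((\<sigma> w, B (\<sigma> w) w), post \<sigma> w)) =
    expectation (\<lambda>w. expectation (\<lambda>w'. F ((\<sigma> w, B (\<sigma> w) w), skel (\<lambda>t. B t w'))))"
    by (simp only: eq)
  have "integrable (distr P borel (\<lambda>w. (\<sigma> w, B (\<sigma> w) w))) (\<lambda>a. \<integral>f. F (a, f) \<partial>path_law)"
    by (rule PP.integrable_fst'[OF intp])
  then have "integrable P (\<lambda>w. \<integral>f. F ((\<sigma> w, B (\<sigma> w) w), f) \<partial>path_law)"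
    by (subst (asm) integrable_distr_eq[OF _ m]) auto
  then show "integrable P (\<lambda>w. expectation (\<lambda>w'. F ((\<sigma> w, B (\<sigma> w) w), skel (\<lambda>t. B t w'))))"
    by (simp only: eq)
qed

lemma shifted_path_continuous:
  assumes "w \<in> space P" "0 \<le> s"
  shows "continuous_on {0..} (\<lambda>t. B (s + t) w - B s w)"
proof (rule continuous_on_diff[OF continuous_on_compose2[OF B_continuous[OF assms(1)], where f="\<lambda>t. s + t"] continuous_on_const])
  show "continuous_on {0..} (\<lambda>t. s + t)" by (intro continuous_intros)
qed (use assms in auto)

text \<open>Optional stopping, from \<open>B\<^sub>t = B\<^sub>\<sigma> + (B\<^sub>t - B\<^sub>\<sigma>)\<close> and the strong Markov property.\<close>
lemma optional_stopping:
  assumes \<sigma>: "stopping \<sigma>" and le: "\<And>w. w \<in> space P \<Longrightarrow> \<sigma> w \<le> t" and e: "norm e = 1"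
  shows "integrable P (\<lambda>w. e \<bullet> B (\<sigma> w) w)" "expectation (\<lambda>w. e \<bullet> B (\<sigma> w) w) = 0"
    "integrable P (\<lambda>w. (e \<bullet> B (\<sigma> w) w)\<^sup>2)" "expectation (\<lambda>w. (e \<bullet> B (\<sigma> w) w)\<^sup>2) = expectation \<sigma>"
proof -
  note [measurable] = stoppingD(1,3)[OF \<sigma>]
  note nn = stoppingD(2)[OF \<sigma>]
  have t: "0 \<le> t" using nn le not_empty by (meson ex_in_conv order_trans)
  \<comment> \<open>The component of \<open>B t\<close> along \<open>e\<close>, rebuilt from
    stopping time, stopped state and future. On an independent future it becomes a sum of two
    independent terms.\<close>
  define G where "G p = e \<bullet> (snd (fst p) + path_at (snd p) (t - fst (fst p)))"
    for p :: "(real \<times> (real ^ 'n)) \<times> (nat \<Rightarrow> real ^ 'n)"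
  have fs: "(\<lambda>p::(real \<times> (real ^ 'n)) \<times> (nat \<Rightarrow> real ^ 'n). fst (fst p)) \<in> borel_measurable borel"
    "(\<lambda>p::(real \<times> (real ^ 'n)) \<times> (nat \<Rightarrow> real ^ 'n). snd (fst p)) \<in> borel_measurable borel"
    "(\<lambda>p::(real \<times> (real ^ 'n)) \<times> (nat \<Rightarrow> real ^ 'n). snd p) \<in> borel_measurable borel"
    by (intro borel_measurable_continuous_onI continuous_intros)+
  have G[measurable]: "G \<in> borel_measurable borel"
    unfolding G_def using fs
    by (intro borel_measurable_inner borel_measurable_const borel_measurable_add path_at_measurable borel_measurable_diff)
  have G1: "G ((\<sigma> w, B (\<sigma> w) w), post \<sigma> w) = e \<bullet> B t w" if w: "w \<in> space P" for w
    unfolding G_def using le[OF w] by (simp add: path_at_skel[OF shifted_path_continuous[OF w nn[OF w]]])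
  have G2: "G ((\<sigma> w, B (\<sigma> w) w), skel (\<lambda>t. B t w')) = e \<bullet> B (\<sigma> w) w + e \<bullet> B (t - \<sigma> w) w'"
    if "w \<in> space P" "w' \<in> space P" for w w'
    unfolding G_def using le[OF that(1)] by (simp add: path_at_skel[OF B_continuous[OF that(2)]] inner_add_right)
  have ts: "0 \<le> t - \<sigma> w" if "w \<in> space P" for w using le[OF that] by simp
  \<comment> \<open>The cross term vanishes because the increment over the remaining time
    \<open>t - \<sigma> w\<close> has mean \<open>0\<close>; its second moment is that remaining
    time.\<close>
  have sq: "(\<integral>\<^sup>+w'. ennreal ((G ((\<sigma> w, B (\<sigma> w) w), skel (\<lambda>t. B t w')))\<^sup>2) \<partial>P) =
      ennreal ((e \<bullet> B (\<sigma> w) w)\<^sup>2 + (t - \<sigma> w))" if w: "w \<in> space P" for w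
  proof -
    let ?c = "e \<bullet> B (\<sigma> w) w"
    note m = B_moments[OF ts[OF w] e]
    have "(\<integral>\<^sup>+w'. ennreal ((G ((\<sigma> w, B (\<sigma> w) w), skel (\<lambda>t. B t w')))\<^sup>2) \<partial>P) =
      (\<integral>\<^sup>+w'. ennreal (?c\<^sup>2 + 2 * ?c * (e \<bullet> B (t - \<sigma> w) w') + (e \<bullet> B (t - \<sigma> w) w')\<^sup>2) \<partial>P)"
      by (intro nn_integral_cong) (simp add: G2[OF w] power2_sum algebra_simps)
    also have "\<dots> = ennreal (expectation (\<lambda>w'. ?c\<^sup>2 + 2 * ?c * (e \<bullet> B (t - \<sigma> w) w') + (e \<bullet> B (t - \<sigma> w) w')\<^sup>2))"
    proof (rule nn_integral_eq_integral)
      show "integrable P (\<lambda>w'. ?c\<^sup>2 + 2 * ?c * (e \<bullet> B (t - \<sigma> w) w') + (e \<bullet> B (t - \<sigma> w) w')\<^sup>2)"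
        using m by (intro Bochner_Integration.integrable_add integrable_const integrable_mult_right)
      have "0 \<le> (?c + b)\<^sup>2" for b :: real by simp
      then have "0 \<le> ?c\<^sup>2 + 2 * ?c * b + b\<^sup>2" for b :: real by (simp only: power2_sum algebra_simps)
      then show "AE w' in P. 0 \<le> ?c\<^sup>2 + 2 * ?c * (e \<bullet> B (t - \<sigma> w) w') + (e \<bullet> B (t - \<sigma> w) w')\<^sup>2" by simp
    qed
    also have "expectation (\<lambda>w'. ?c\<^sup>2 + 2 * ?c * (e \<bullet> B (t - \<sigma> w) w') + (e \<bullet> B (t - \<sigma> w) w')\<^sup>2) = ?c\<^sup>2 + (t - \<sigma> w)"
      using m by (simp add: prob_space)
    finally show ?thesis .
  qed
  \<comment> \<open>The computation is done with nonnegative integrals because square integrability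
    of the stopped component is one of its results.\<close>
  have "ennreal t = (\<integral>\<^sup>+w. ennreal ((e \<bullet> B t w)\<^sup>2) \<partial>P)"
    using B_moments[OF t e] by (simp add: nn_integral_eq_integral)
  also have "\<dots> = (\<integral>\<^sup>+w. ennreal ((G ((\<sigma> w, B (\<sigma> w) w), post \<sigma> w))\<^sup>2) \<partial>P)"
    by (intro nn_integral_cong) (simp add: G1)
  also have "\<dots> = (\<integral>\<^sup>+w. (\<integral>\<^sup>+w'. ennreal ((G ((\<sigma> w, B (\<sigma> w) w), skel (\<lambda>t. B t w')))\<^sup>2) \<partial>P) \<partial>P)"
    by (rule strong_markov_nn[OF \<sigma>]) measurable
  also have "\<dots> = (\<integral>\<^sup>+w. ennreal ((e \<bullet> B (\<sigma> w) w)\<^sup>2 + (t - \<sigma> w)) \<partial>P)"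
    by (intro nn_integral_cong) (simp add: sq)
  finally have tot: "(\<integral>\<^sup>+w. ennreal ((e \<bullet> B (\<sigma> w) w)\<^sup>2 + (t - \<sigma> w)) \<partial>P) = ennreal t" ..
  have int: "integrable P (\<lambda>w. (e \<bullet> B (\<sigma> w) w)\<^sup>2 + (t - \<sigma> w))"
    by (rule integrableI_nonneg) (auto simp: tot le intro!: AE_I2 add_nonneg_nonneg)
  have ints: "integrable P \<sigma>"
    using nn le t by (intro integrable_const_bound[where B=t]) (auto intro!: AE_I2)
  have "integrable P (\<lambda>w. ((e \<bullet> B (\<sigma> w) w)\<^sup>2 + (t - \<sigma> w)) - (t - \<sigma> w))"
    using int ints by (intro Bochner_Integration.integrable_diff) auto
  then show int2: "integrable P (\<lambda>w. (e \<bullet> B (\<sigma> w) w)\<^sup>2)" by simp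
  then show int1: "integrable P (\<lambda>w. e \<bullet> B (\<sigma> w) w)"
    by (rule square_integrable_imp_integrable[rotated]) simp
  have "expectation (\<lambda>w. (e \<bullet> B (\<sigma> w) w)\<^sup>2 + (t - \<sigma> w)) = t"
    using tot t by (subst integral_eq_nn_integral) (auto intro!: AE_I2 add_nonneg_nonneg le)
  moreover have "expectation (\<lambda>w. (e \<bullet> B (\<sigma> w) w)\<^sup>2 + (t - \<sigma> w)) = expectation (\<lambda>w. (e \<bullet> B (\<sigma> w) w)\<^sup>2) + (t - expectation \<sigma>)"
    using int2 ints by (simp add: prob_space)
  ultimately show "expectation (\<lambda>w. (e \<bullet> B (\<sigma> w) w)\<^sup>2) = expectation \<sigma>" by simp
  have "integrable P (\<lambda>w. G ((\<sigma> w, B (\<sigma> w) w), post \<sigma> w))"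
    using B_moments(1)[OF t e] by (subst Bochner_Integration.integrable_cong[OF refl G1]) auto
  from strong_markov_integral(1)[OF \<sigma> G this]
  have "expectation (\<lambda>w. e \<bullet> B t w) = expectation (\<lambda>w. expectation (\<lambda>w'. e \<bullet> B (\<sigma> w) w + e \<bullet> B (t - \<sigma> w) w'))"
    using G1 G2 by (simp cong: Bochner_Integration.integral_cong)
  also have "\<dots> = expectation (\<lambda>w. e \<bullet> B (\<sigma> w) w)"
    using B_moments[OF ts e] by (intro Bochner_Integration.integral_cong refl) (simp add: prob_space)
  finally show "expectation (\<lambda>w. e \<bullet> B (\<sigma> w) w) = 0" using B_moments(2)[OF t e] by simp
qed

end

section \<open>Hitting times of closed sets: stopping property and moments\<close>

context bm
begin

abbreviation hit :: "(real ^ 'n) set \<Rightarrow> real ^ 'n \<Rightarrow> 'w \<Rightarrow> ereal" where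
  "hit A y w \<equiv> first_hit A y (\<lambda>t. B t w)"

lemma hit_measurable:
  assumes "closed A" "A \<noteq> {}"
  shows "hit A y \<in> borel_measurable P"
proof -
  have "(\<lambda>w. hit_time A y (skel (\<lambda>t. B t w))) \<in> borel_measurable P"
    by (rule hit_time_measurable') (auto intro: skel_measurable)
  then show ?thesis
    by (subst measurable_cong[where g="\<lambda>w. hit_time A y (skel (\<lambda>t. B t w))"])
       (auto simp: hit_time_skel[OF B_continuous assms])
qed

text \<open>The criterion \<open>hit_by\<close> looks only at rational times up to \<open>s\<close>,
  so the event lies in the past without completion.\<close>

lemma hit_past:
  assumes A: "closed A" "A \<noteq> {}" and s: "0 \<le> s"
  shows "{w\<in>space P. hit A y w \<le> ereal s} \<in> sets (past s)"
proof -
  have "{w\<in>space (past s). qt k \<le> s \<and> infdist (y + B (qt k) w) A < 1 / real (Suc m)} \<in> sets (past s)" for k m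
  proof (cases "qt k \<le> s")
    case True
    have "(\<lambda>x. infdist (y + x) A) \<in> borel_measurable borel"
      by (intro borel_measurable_continuous_onI continuous_intros)
    from measurable_compose[OF B_past[OF qt_nonneg True] this]
    have "(\<lambda>w. infdist (y + B (qt k) w) A) \<in> borel_measurable (past s)" .
    then have "{w\<in>space (past s). infdist (y + B (qt k) w) A < 1 / real (Suc m)} \<in> sets (past s)"
      by (rule borel_measurable_less[OF _ borel_measurable_const])
    with True show ?thesis by simp
  qed simp
  then have "{w\<in>space (past s). \<forall>m. \<exists>k. qt k \<le> s \<and> infdist (y + B (qt k) w) A < 1 / real (Suc m)} \<in> sets (past s)"
    by (intro sets.sets_Collect_countable_All sets.sets_Collect_countable_Ex)
  also have "{w\<in>space (past s). \<forall>m. \<exists>k. qt k \<le> s \<and> infdist (y + B (qt k) w) A < 1 / real (Suc m)} =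
    {w\<in>space P. hit A y w \<le> ereal s}"
    using hit_by_skel_iff[OF B_continuous A s, unfolded hit_by_def skel_def] by auto
  finally show ?thesis .
qed

lemma stopping_hit_min:
  assumes A: "closed A" "A \<noteq> {}" and t: "0 \<le> t"
  shows "stopping (\<lambda>w. real_of_ereal (min (hit A y w) (ereal t)))"
  unfolding stopping_def
proof (intro conjI ballI allI impI)
  note [measurable] = hit_measurable[OF A]
  show "(\<lambda>w. real_of_ereal (min (hit A y w) (ereal t))) \<in> borel_measurable P" by measurable
  show "0 \<le> real_of_ereal (min (hit A y w) (ereal t))" for w
    using t by (intro real_of_ereal_pos) (simp add: min_def first_hit_nonneg)
  fix s :: real assume s: "0 \<le> s"
  have *: "real_of_ereal (min h (ereal t)) \<le> s \<longleftrightarrow> t \<le> s \<or> h \<le> ereal s" if "0 \<le> h" for h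
    using that by (cases h) (auto simp: min_def)
  show "\<exists>a\<in>sets (past s). AE w in P. (real_of_ereal (min (hit A y w) (ereal t)) \<le> s) = (w \<in> a)"
  proof (cases "t \<le> s")
    case True
    then have "AE w in P. (real_of_ereal (min (hit A y w) (ereal t)) \<le> s) = (w \<in> space P)"
      by (intro AE_I2) (simp add: *[OF first_hit_nonneg])
    moreover have "space P \<in> sets (past s)" using sets.top[of "past s"] by simp
    ultimately show ?thesis by blast
  next
    case False
    then have "AE w in P. (real_of_ereal (min (hit A y w) (ereal t)) \<le> s) = (w \<in> {w\<in>space P. hit A y w \<le> ereal s})"
      by (intro AE_I2) (simp add: *[OF first_hit_nonneg])
    then show ?thesis using hit_past[OF A s] by blast
  qed
qed

lemma stopping_hit:
  assumes A: "closed A" "A \<noteq> {}" and fin: "AE w in P. hit A y w \<noteq> \<infinity>"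
  shows "stopping (\<lambda>w. real_of_ereal (hit A y w))"
  unfolding stopping_def
proof (intro conjI ballI allI impI)
  note [measurable] = hit_measurable[OF A]
  show "(\<lambda>w. real_of_ereal (hit A y w)) \<in> borel_measurable P" by measurable
  show "0 \<le> real_of_ereal (hit A y w)" for w
    using first_hit_nonneg by (intro real_of_ereal_pos)
  fix s :: real assume s: "0 \<le> s"
  \<comment> \<open>An infinite hitting time is turned into \<open>0\<close> by
    \<open>real_of_ereal\<close> and would count as an immediate stop; this is the null set that
    \<open>stopping\<close> tolerates.\<close>
  have *: "real_of_ereal h \<le> s \<longleftrightarrow> h \<le> ereal s" if "0 \<le> h" "h \<noteq> \<infinity>" for h
    using that by (cases h) auto
  have "AE w in P. (real_of_ereal (hit A y w) \<le> s) = (w \<in> {w\<in>space P. hit A y w \<le> ereal s})"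
    using fin AE_space by eventually_elim (simp add: *[OF first_hit_nonneg])
  then show "\<exists>a\<in>sets (past s). AE w in P. (real_of_ereal (hit A y w) \<le> s) = (w \<in> a)"
    using hit_past[OF A s] by blast
qed

text \<open>Monotone convergence along the truncations at \<open>n\<close>. The uniform bound also
  rules out an infinite time with positive probability, since the truncations then increase to
  infinity.\<close>

lemma hit_expectation_limit:
  assumes A: "closed A" "A \<noteq> {}" and c: "0 \<le> c"
    and le: "\<And>t. 0 \<le> t \<Longrightarrow> expectation (\<lambda>w. real_of_ereal (min (hit A y w) (ereal t))) \<le> c"
  shows "AE w in P. hit A y w \<noteq> \<infinity>" "integrable P (\<lambda>w. real_of_ereal (hit A y w))"
    "expectation (\<lambda>w. real_of_ereal (hit A y w)) \<le> c"
proof -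
  note [measurable] = hit_measurable[OF A]
  define f where "f n w = ennreal (real_of_ereal (min (hit A y w) (ereal (real n))))" for n :: nat and w
  have f[measurable]: "f n \<in> borel_measurable P" for n unfolding f_def by measurable
  have nn: "0 \<le> real_of_ereal (min (hit A y w) (ereal t))" if "0 \<le> t" for t w
    using that by (intro real_of_ereal_pos) (simp add: min_def first_hit_nonneg)
  have ub: "real_of_ereal (min (hit A y w) (ereal t)) \<le> t" if "0 \<le> t" for t w
    using first_hit_nonneg[of A y "\<lambda>t. B t w"] that by (cases "hit A y w") (auto simp: min_def)
  have mono: "incseq f"
  proof (intro incseq_SucI le_funI)
    fix n w
    show "f n w \<le> f (Suc n) w"
      unfolding f_def using first_hit_nonneg[of A y "\<lambda>t. B t w"]
      by (intro ennreal_leI) (cases "hit A y w", auto simp: min_def)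
  qed
  have "(\<integral>\<^sup>+w. f n w \<partial>P) \<le> ennreal c" for n
  proof -
    have "integrable P (\<lambda>w. real_of_ereal (min (hit A y w) (ereal (real n))))"
    proof (rule integrable_const_bound[where B="real n"])
      have "norm (real_of_ereal (min (hit A y w) (ereal (real n)))) \<le> real n" for w
        using ub[of "real n" w] by (simp only: real_norm_def abs_of_nonneg[OF nn[OF of_nat_0_le_iff]] of_nat_0_le_iff)
      then show "AE w in P. norm (real_of_ereal (min (hit A y w) (ereal (real n)))) \<le> real n" by (intro AE_I2)
    qed measurable
    then have "(\<integral>\<^sup>+w. f n w \<partial>P) = ennreal (expectation (\<lambda>w. real_of_ereal (min (hit A y w) (ereal (real n)))))"
      unfolding f_def using nn by (intro nn_integral_eq_integral) auto
    then show ?thesis using le[of "real n"] by (simp add: ennreal_leI)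
  qed
  then have sup: "(\<integral>\<^sup>+w. (SUP n. f n w) \<partial>P) \<le> ennreal c"
    using nn_integral_monotone_convergence_SUP[OF mono f] by (simp add: SUP_least)
  then have "(\<integral>\<^sup>+w. (SUP n. f n w) \<partial>P) \<noteq> \<infinity>" by (auto simp: top_unique)
  then have "AE w in P. (SUP n. f n w) \<noteq> \<infinity>" by (intro nn_integral_noteq_infinite) auto
  then show fin: "AE w in P. hit A y w \<noteq> \<infinity>"
  proof eventually_elim
    case (elim w)
    show ?case
    proof
      assume "hit A y w = \<infinity>"
      then have "f n w = of_nat n" for n by (simp add: f_def ennreal_of_nat_eq_real_of_nat)
      then show False using elim by (simp add: ennreal_SUP_of_nat_eq_top)
    qed
  qed
  have "(\<integral>\<^sup>+w. ennreal (real_of_ereal (hit A y w)) \<partial>P) \<le> (\<integral>\<^sup>+w. (SUP n. f n w) \<partial>P)"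
  proof (rule nn_integral_mono_AE)
    show "AE w in P. ennreal (real_of_ereal (hit A y w)) \<le> (SUP n. f n w)"
      using fin
    proof eventually_elim
      case (elim w)
      then obtain r where r: "hit A y w = ereal r" using first_hit_nonneg[of A y "\<lambda>t. B t w"] by (cases "hit A y w") auto
      obtain n :: nat where n: "r \<le> real n" using real_arch_simple by blast
      have "ennreal (real_of_ereal (hit A y w)) = f n w" using n by (simp add: f_def r min_def)
      also have "\<dots> \<le> (SUP n. f n w)" by (rule SUP_upper) simp
      finally show ?case .
    qed
  qed
  then have nnl: "(\<integral>\<^sup>+w. ennreal (real_of_ereal (hit A y w)) \<partial>P) \<le> ennreal c" using sup by (rule order_trans)
  have nnh: "0 \<le> real_of_ereal (hit A y w)" for w using first_hit_nonneg by (intro real_of_ereal_pos)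
  show "integrable P (\<lambda>w. real_of_ereal (hit A y w))"
    using nnl by (intro integrableI_nonneg) (auto simp: nnh intro: le_less_trans)
  show "expectation (\<lambda>w. real_of_ereal (hit A y w)) \<le> c"
    using nnl c by (subst integral_eq_nn_integral) (auto simp: nnh intro!: enn2real_leI)
qed

lemma optional_stopping_norm:
  assumes \<sigma>: "stopping \<sigma>" and le: "\<And>w. w \<in> space P \<Longrightarrow> \<sigma> w \<le> t"
  shows "integrable P (\<lambda>w. (norm (B (\<sigma> w) w))\<^sup>2)"
    "expectation (\<lambda>w. (norm (B (\<sigma> w) w))\<^sup>2) = real CARD('n) * expectation \<sigma>"
proof -
  have ax: "norm (axis i 1 :: real ^ 'n) = 1" for i by (simp add: norm_axis_1)
  have eq: "(norm x)\<^sup>2 = (\<Sum>i\<in>UNIV. (axis i 1 \<bullet> x)\<^sup>2)" for x :: "real ^ 'n"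
    by (simp add: norm_vec_def L2_set_def sum_nonneg inner_axis')
  note os = optional_stopping[OF \<sigma> le ax]
  show "integrable P (\<lambda>w. (norm (B (\<sigma> w) w))\<^sup>2)"
    unfolding eq using os(3) by (intro Bochner_Integration.integrable_sum) auto
  show "expectation (\<lambda>w. (norm (B (\<sigma> w) w))\<^sup>2) = real CARD('n) * expectation \<sigma>"
    unfolding eq using os(3,4) by (subst Bochner_Integration.integral_sum) auto
qed

context
  fixes A :: "(real ^ 'n) set" and y :: "real ^ 'n"
  assumes A: "closed A" "A \<noteq> {}"
begin

lemma hit_min_props:
  assumes "0 \<le> t"
  shows "0 \<le> real_of_ereal (min (hit A y w) (ereal t))"
    "real_of_ereal (min (hit A y w) (ereal t)) \<le> t"
    "ereal (real_of_ereal (min (hit A y w) (ereal t))) \<le> hit A y w"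
  using first_hit_nonneg[of A y "\<lambda>t. B t w"] assms
  by (cases "hit A y w"; auto simp: min_def)+

lemma hit_min_integrable:
  assumes t: "0 \<le> t"
  shows "integrable P (\<lambda>w. real_of_ereal (min (hit A y w) (ereal t)))"
proof (rule integrable_const_bound[where B=t])
  show "AE w in P. norm (real_of_ereal (min (hit A y w) (ereal t))) \<le> t"
  proof (rule AE_I2)
    fix w
    have "norm (real_of_ereal (min (hit A y w) (ereal t))) = real_of_ereal (min (hit A y w) (ereal t))"
      by (simp only: real_norm_def abs_of_nonneg[OF hit_min_props(1)[OF t]])
    then show "norm (real_of_ereal (min (hit A y w) (ereal t))) \<le> t"
      using hit_min_props(2)[OF t] by (simp only:)
  qed
qed (rule stoppingD(1)[OF stopping_hit_min[OF A t]])

text \<open>For \<open>b\<close> the component of the stopped path along \<open>e\<close>, the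
  product \<open>(p - b) * (q + b)\<close> is nonnegative. Since \<open>b\<close> has mean
  \<open>0\<close> and second moment the mean of the stopping time, taking expectations gives the
  bound.\<close>

lemma hit_slab:
  assumes e: "norm e = 1"
    and slab: "\<And>w s. w \<in> space P \<Longrightarrow> 0 \<le> s \<Longrightarrow> ereal s \<le> hit A y w \<Longrightarrow> e \<bullet> B s w \<le> p \<and> - q \<le> e \<bullet> B s w"
    and t: "0 \<le> t"
  shows "expectation (\<lambda>w. real_of_ereal (min (hit A y w) (ereal t))) \<le> p * q"
proof -
  let ?\<sigma> = "\<lambda>w. real_of_ereal (min (hit A y w) (ereal t))"
  have le: "?\<sigma> w \<le> t" for w by (rule hit_min_props(2)[OF t])
  note os = optional_stopping[OF stopping_hit_min[OF A t] le e]
  have "0 \<le> expectation (\<lambda>w. (p - e \<bullet> B (?\<sigma> w) w) * (q + e \<bullet> B (?\<sigma> w) w))"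
  proof (intro integral_nonneg_AE AE_I2 mult_nonneg_nonneg)
    fix w assume "w \<in> space P"
    from slab[OF this hit_min_props(1)[OF t] hit_min_props(3)[OF t]]
    show "0 \<le> p - e \<bullet> B (?\<sigma> w) w" "0 \<le> q + e \<bullet> B (?\<sigma> w) w" by linarith+
  qed
  also have "\<dots> = expectation (\<lambda>w. p * q + (p - q) * (e \<bullet> B (?\<sigma> w) w) - (e \<bullet> B (?\<sigma> w) w)\<^sup>2)"
    by (rule arg_cong[where f=expectation]) (simp add: fun_eq_iff algebra_simps power2_eq_square)
  also have "\<dots> = p * q - expectation ?\<sigma>"
    using os by (simp add: prob_space)
  finally show ?thesis by simp
qed

context
  fixes R :: real
  assumes R: "\<And>w s. w \<in> space P \<Longrightarrow> 0 \<le> s \<Longrightarrow> ereal s \<le> hit A y w \<Longrightarrow> norm (B s w) \<le> R"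
begin

lemma hit_min_norm:
  assumes t: "0 \<le> t" and w: "w \<in> space P"
  shows "(norm (B (real_of_ereal (min (hit A y w) (ereal t))) w))\<^sup>2 \<le> R\<^sup>2"
  using R[OF w hit_min_props(1)[OF t] hit_min_props(3)[OF t]] by (intro power_mono) auto

text \<open>By optional stopping the dimension times the mean truncated time equals the mean of the
  squared norm, which is at most \<open>R\<^sup>2\<close>.\<close>

lemma hit_ball:
  shows "AE w in P. hit A y w \<noteq> \<infinity>" "integrable P (\<lambda>w. real_of_ereal (hit A y w))"
    "expectation (\<lambda>w. real_of_ereal (hit A y w)) \<le> R\<^sup>2 / CARD('n)"
proof -
  have le: "expectation (\<lambda>w. real_of_ereal (min (hit A y w) (ereal t))) \<le> R\<^sup>2 / CARD('n)" if t: "0 \<le> t" for t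
  proof -
    note os = optional_stopping_norm[OF stopping_hit_min[OF A t] hit_min_props(2)[OF t]]
    have "expectation (\<lambda>w. (norm (B (real_of_ereal (min (hit A y w) (ereal t))) w))\<^sup>2) \<le> expectation (\<lambda>w. R\<^sup>2)"
      using os(1) hit_min_norm[OF t] by (intro integral_mono) auto
    then show ?thesis using os(2) by (simp add: prob_space field_simps)
  qed
  show "AE w in P. hit A y w \<noteq> \<infinity>" "integrable P (\<lambda>w. real_of_ereal (hit A y w))"
    "expectation (\<lambda>w. real_of_ereal (hit A y w)) \<le> R\<^sup>2 / CARD('n)"
    using hit_expectation_limit[OF A _ le] by auto
qed

text \<open>Almost surely the truncated times eventually equal the hitting time, and the path stays
  bounded by \<open>R\<close> up to it, so dominated convergence applies to optional
  stopping.\<close>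

lemma hit_norm_sq:
  shows "expectation (\<lambda>w. (norm (B (real_of_ereal (hit A y w)) w))\<^sup>2) \<le> CARD('n) * expectation (\<lambda>w. real_of_ereal (hit A y w))"
    "integrable P (\<lambda>w. (norm (B (real_of_ereal (hit A y w)) w))\<^sup>2)"
    "integrable P (\<lambda>w. norm (B (real_of_ereal (hit A y w)) w))"
proof -
  let ?\<sigma> = "\<lambda>n w. real_of_ereal (min (hit A y w) (ereal (real n)))"
  let ?\<tau> = "\<lambda>w. real_of_ereal (hit A y w)"
  have t: "0 \<le> real n" for n by simp
  note st = stopping_hit_min[OF A t] and os = optional_stopping_norm[OF stopping_hit_min[OF A t] hit_min_props(2)[OF t]]
  note st' = stopping_hit[OF A hit_ball(1)]
  note [measurable] = stoppingD(1,3)[OF st] stoppingD(1,3)[OF st']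
  have ev: "AE w in P. eventually (\<lambda>n. ?\<sigma> n w = ?\<tau> w) sequentially"
    using hit_ball(1)
  proof eventually_elim
    case (elim w)
    then obtain r where r: "hit A y w = ereal r" using first_hit_nonneg[of A y "\<lambda>t. B t w"] by (cases "hit A y w") auto
    obtain n :: nat where n: "r \<le> real n" using real_arch_simple by blast
    have "?\<sigma> m w = ?\<tau> w" if "m \<ge> n" for m
      using n that by (simp add: r min_def)
    then show ?case by (auto simp: eventually_sequentially)
  qed
  have conv: "integrable P (\<lambda>w. (norm (B (?\<tau> w) w))\<^sup>2)"
    "(\<lambda>n. expectation (\<lambda>w. (norm (B (?\<sigma> n w) w))\<^sup>2)) \<longlonglongrightarrow> expectation (\<lambda>w. (norm (B (?\<tau> w) w))\<^sup>2)"
  proof -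
    have "AE w in P. (\<lambda>n. (norm (B (?\<sigma> n w) w))\<^sup>2) \<longlonglongrightarrow> (norm (B (?\<tau> w) w))\<^sup>2"
      using ev
    proof eventually_elim
      case (elim w)
      then show ?case by (intro tendsto_eventually) (auto elim: eventually_mono)
    qed
    moreover have "AE w in P. norm ((norm (B (?\<sigma> n w) w))\<^sup>2) \<le> R\<^sup>2" for n
      using hit_min_norm[OF t] by (intro AE_I2) simp
    ultimately show "integrable P (\<lambda>w. (norm (B (?\<tau> w) w))\<^sup>2)"
      "(\<lambda>n. expectation (\<lambda>w. (norm (B (?\<sigma> n w) w))\<^sup>2)) \<longlonglongrightarrow> expectation (\<lambda>w. (norm (B (?\<tau> w) w))\<^sup>2)"
      by - (rule integrable_dominated_convergence[where s="\<lambda>n w. (norm (B (?\<sigma> n w) w))\<^sup>2" and w="\<lambda>_. R\<^sup>2"]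
          integral_dominated_convergence[where w="\<lambda>_. R\<^sup>2"]; (assumption | simp))+
  qed
  show "integrable P (\<lambda>w. (norm (B (?\<tau> w) w))\<^sup>2)" by (rule conv)
  then show "integrable P (\<lambda>w. norm (B (?\<tau> w) w))"
    by (rule square_integrable_imp_integrable[rotated]) measurable
  show "expectation (\<lambda>w. (norm (B (?\<tau> w) w))\<^sup>2) \<le> CARD('n) * expectation ?\<tau>"
  proof (rule LIMSEQ_le_const2[OF conv(2)], intro exI[of _ 0] allI impI)
    fix n :: nat
    have "expectation (?\<sigma> n) \<le> expectation ?\<tau>"
    proof (rule integral_mono_AE)
      show "integrable P (?\<sigma> n)" by (rule hit_min_integrable[OF t])
      show "AE w in P. ?\<sigma> n w \<le> ?\<tau> w" using hit_ball(1)
      proof eventually_elim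
        case (elim w)
        then obtain r where "hit A y w = ereal r" using first_hit_nonneg[of A y "\<lambda>t. B t w"] by (cases "hit A y w") auto
        then show ?case by (simp add: min_def)
      qed
    qed (rule hit_ball)
    then show "expectation (\<lambda>w. (norm (B (?\<sigma> n w) w))\<^sup>2) \<le> CARD('n) * expectation ?\<tau>"
      unfolding os(2) by (intro mult_left_mono) auto
  qed
qed

text \<open>After time \<open>s\<close> the squared norm can increase by at most
  \<open>R\<^sup>2\<close>, and it changes only if the set has not been hit by then. Optional
  stopping at two truncations converts this into time. It serves the second moment below.\<close>

lemma hit_remaining:
  assumes s: "0 \<le> s"
  shows "expectation (\<lambda>w. real_of_ereal (hit A y w) - real_of_ereal (min (hit A y w) (ereal s))) \<le>
    R\<^sup>2 / CARD('n) * prob {w\<in>space P. s < real_of_ereal (hit A y w)}"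
proof -
  let ?\<sigma> = "\<lambda>t w. real_of_ereal (min (hit A y w) (ereal t))"
  let ?\<tau> = "\<lambda>w. real_of_ereal (hit A y w)"
  let ?S = "{w\<in>space P. s < ?\<tau> w}"
  have os: "integrable P (\<lambda>w. (norm (B (?\<sigma> t w) w))\<^sup>2)"
    "expectation (\<lambda>w. (norm (B (?\<sigma> t w) w))\<^sup>2) = real CARD('n) * expectation (?\<sigma> t)" if "0 \<le> t" for t
    by (rule optional_stopping_norm[OF stopping_hit_min[OF A that] hit_min_props(2)[OF that]])+
  have int: "integrable P (?\<sigma> t)" if "0 \<le> t" for t
    using that by (rule hit_min_integrable)
  note [measurable] = stoppingD(1)[OF stopping_hit[OF A hit_ball(1)]]
  have S[measurable]: "?S \<in> events" by measurable
  have le: "expectation (?\<sigma> t) \<le> expectation (?\<sigma> s) + R\<^sup>2 / CARD('n) * prob ?S" if t: "s \<le> t" for t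
  proof -
    have t0: "0 \<le> t" using s t by simp
    have "expectation (\<lambda>w. (norm (B (?\<sigma> t w) w))\<^sup>2 - (norm (B (?\<sigma> s w) w))\<^sup>2) \<le> expectation (\<lambda>w. R\<^sup>2 * indicator ?S w)"
    proof (rule integral_mono_AE)
      show "AE w in P. (norm (B (?\<sigma> t w) w))\<^sup>2 - (norm (B (?\<sigma> s w) w))\<^sup>2 \<le> R\<^sup>2 * indicator ?S w"
        using hit_ball(1) AE_space
      proof eventually_elim
        case (elim w)
        then obtain r where r: "hit A y w = ereal r" using first_hit_nonneg[of A y "\<lambda>t. B t w"] by (cases "hit A y w") auto
        show ?case
        proof (cases "s < r")
          case True
          then have "indicator ?S w = (1::real)" using elim r by simp
          moreover have "(norm (B (?\<sigma> t w) w))\<^sup>2 - (norm (B (?\<sigma> s w) w))\<^sup>2 \<le> R\<^sup>2 - 0"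
            using hit_min_norm[OF t0 elim(2)] by (intro diff_mono) auto
          ultimately show ?thesis by simp
        next
          case False
          then show ?thesis using t by (simp add: r min_def)
        qed
      qed
      show "integrable P (\<lambda>w. (norm (B (?\<sigma> t w) w))\<^sup>2 - (norm (B (?\<sigma> s w) w))\<^sup>2)"
        by (intro Bochner_Integration.integrable_diff os(1) t0 s)
      show "integrable P (\<lambda>w. R\<^sup>2 * indicator ?S w)"
        by (intro integrable_mult_right integrable_real_indicator S) (simp add: less_top[symmetric])
    qed
    then have "CARD('n) * expectation (?\<sigma> t) - CARD('n) * expectation (?\<sigma> s) \<le> R\<^sup>2 * prob ?S"
      using os[OF t0] os[OF s] by simp
    then show ?thesis by (simp add: field_simps)
  qed
  have "expectation ?\<tau> \<le> expectation (?\<sigma> s) + R\<^sup>2 / CARD('n) * prob ?S"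
  proof (rule hit_expectation_limit(3)[OF A])
    show "0 \<le> expectation (?\<sigma> s) + R\<^sup>2 / CARD('n) * prob ?S"
      using hit_min_props(1)[OF s] by (intro add_nonneg_nonneg integral_nonneg_AE) auto
    fix t :: real assume t: "0 \<le> t"
    show "expectation (?\<sigma> t) \<le> expectation (?\<sigma> s) + R\<^sup>2 / CARD('n) * prob ?S"
    proof (cases "s \<le> t")
      case False
      have "expectation (?\<sigma> t) \<le> expectation (?\<sigma> s)"
      proof (rule integral_mono[OF int[OF t] int[OF s]])
        fix w show "?\<sigma> t w \<le> ?\<sigma> s w"
          using False first_hit_nonneg[of A y "\<lambda>t. B t w"] by (cases "hit A y w") (auto simp: min_def)
      qed
      moreover have "0 \<le> R\<^sup>2 / CARD('n) * prob ?S" by simp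
      ultimately show ?thesis by linarith
    qed (rule le)
  qed
  then show ?thesis using int[OF s] hit_ball(2) by simp
qed

text \<open>Reflecting \<open>s\<close> to \<open>\<tau> - s\<close> and exchanging the integrals
  reduces the left side to the mean remaining time after \<open>s\<close>, integrated over
  \<open>s\<close>. By \<open>hit_remaining\<close> this is at most \<open>c\<close> times the
  integral of the tail probability, that is \<open>c\<close> times the mean, hence at most
  \<open>c\<^sup>2\<close> with \<open>c = R\<^sup>2 / CARD('n)\<close>.\<close>

lemma hit_second_moment:
  "(\<integral>\<^sup>+w. (\<integral>\<^sup>+s. ennreal s * indicator {0<..<real_of_ereal (hit A y w)} s \<partial>lborel) \<partial>P) \<le> ennreal ((R\<^sup>2 / CARD('n))\<^sup>2)"
proof -
  let ?\<tau> = "\<lambda>w. real_of_ereal (hit A y w)"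
  let ?c = "R\<^sup>2 / CARD('n)"
  note [measurable] = stoppingD(1)[OF stopping_hit[OF A hit_ball(1)]] hit_measurable[OF A]
  interpret pair_sigma_finite P lborel ..
  have c: "0 \<le> ?c" by simp
  have nn: "0 \<le> ?\<tau> w" for w using first_hit_nonneg by (intro real_of_ereal_pos)
  have "(\<integral>\<^sup>+s. ennreal s * indicator {0<..<?\<tau> w} s \<partial>lborel) =
    (\<integral>\<^sup>+s. ennreal (?\<tau> w - s) * indicator {0<..<?\<tau> w} (?\<tau> w - s) \<partial>lborel)" for w
    by (rule nn_integral_lborel_reflect[symmetric]) measurable
  also have "\<dots> w = (\<integral>\<^sup>+s. ennreal (?\<tau> w - s) * indicator {0<..<?\<tau> w} s \<partial>lborel)" for w
    by (intro nn_integral_cong) (auto simp: indicator_def)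
  finally have "(\<integral>\<^sup>+w. (\<integral>\<^sup>+s. ennreal s * indicator {0<..<?\<tau> w} s \<partial>lborel) \<partial>P) =
    (\<integral>\<^sup>+w. (\<integral>\<^sup>+s. ennreal (?\<tau> w - s) * indicator {0<..<?\<tau> w} s \<partial>lborel) \<partial>P)" by simp
  also have "\<dots> = (\<integral>\<^sup>+s. (\<integral>\<^sup>+w. ennreal (?\<tau> w - s) * indicator {0<..<?\<tau> w} s \<partial>P) \<partial>lborel)"
    by (rule Fubini'[symmetric]) (simp add: greaterThanLessThan_def greaterThan_def lessThan_def indicator_def cong: if_cong)
  also have "\<dots> \<le> (\<integral>\<^sup>+s. (\<integral>\<^sup>+w. ennreal ?c * indicator {0<..<?\<tau> w} s \<partial>P) \<partial>lborel)"
  proof (rule nn_integral_mono)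
    fix s :: real
    show "(\<integral>\<^sup>+w. ennreal (?\<tau> w - s) * indicator {0<..<?\<tau> w} s \<partial>P) \<le> (\<integral>\<^sup>+w. ennreal ?c * indicator {0<..<?\<tau> w} s \<partial>P)"
    proof (cases "0 < s")
      case True
      let ?S = "{w\<in>space P. s < ?\<tau> w}"
      let ?d = "\<lambda>w. ?\<tau> w - real_of_ereal (min (hit A y w) (ereal s))"
      have S: "?S \<in> events" by measurable
      have dn: "AE w in P. 0 \<le> ?d w \<and> ennreal (?\<tau> w - s) * indicator {0<..<?\<tau> w} s \<le> ennreal (?d w)"
        using hit_ball(1)
      proof eventually_elim
        case (elim w)
        then obtain r where r: "hit A y w = ereal r" using first_hit_nonneg[of A y "\<lambda>t. B t w"] by (cases "hit A y w") auto
        show ?case using True by (auto simp: r min_def indicator_def)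
      qed
      have int: "integrable P ?d"
        using True by (intro Bochner_Integration.integrable_diff hit_ball(2) hit_min_integrable) simp
      have "(\<integral>\<^sup>+w. ennreal (?\<tau> w - s) * indicator {0<..<?\<tau> w} s \<partial>P) \<le> (\<integral>\<^sup>+w. ennreal (?d w) \<partial>P)"
        using dn by (intro nn_integral_mono_AE) auto
      also have "\<dots> = ennreal (expectation ?d)"
        using dn by (intro nn_integral_eq_integral int) auto
      also have "\<dots> \<le> ennreal (?c * prob ?S)"
        using hit_remaining[of s] True by (intro ennreal_leI) simp
      also have "\<dots> = ennreal ?c * ennreal (prob ?S)" by (rule ennreal_mult[OF c measure_nonneg])
      also have "\<dots> = (\<integral>\<^sup>+w. ennreal ?c * indicator ?S w \<partial>P)"
        using S by (simp add: nn_integral_cmult emeasure_eq_measure)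
      also have "\<dots> = (\<integral>\<^sup>+w. ennreal ?c * indicator {0<..<?\<tau> w} s \<partial>P)"
        using True by (intro nn_integral_cong) (auto simp: indicator_def)
      finally show ?thesis .
    qed simp
  qed
  also have "\<dots> = (\<integral>\<^sup>+w. (\<integral>\<^sup>+s. ennreal ?c * indicator {0<..<?\<tau> w} s \<partial>lborel) \<partial>P)"
    by (rule Fubini') (simp add: greaterThanLessThan_def greaterThan_def lessThan_def indicator_def cong: if_cong)
  also have "\<dots> = (\<integral>\<^sup>+w. ennreal ?c * ennreal (?\<tau> w) \<partial>P)"
    by (intro nn_integral_cong) (simp add: nn_integral_cmult nn)
  also have "\<dots> = ennreal ?c * ennreal (expectation ?\<tau>)"
    using hit_ball(2) nn by (simp add: nn_integral_cmult nn_integral_eq_integral)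
  also have "\<dots> \<le> ennreal ?c * ennreal ?c"
    using hit_ball(3) by (intro mult_left_mono ennreal_leI) auto
  also have "\<dots> = ennreal (?c\<^sup>2)" by (simp add: ennreal_mult[symmetric] power2_eq_square)
  finally show ?thesis .
qed

end

end

end

subsection \<open>Exit from balls\<close>

text \<open>Averaging over small caps shows that a rotation-invariant law on the sphere is unique:
  by transitivity all caps of a fixed radius have the same mass, and Fubini's theorem shows that
  this mass is the same for both laws.\<close>
lemma sphere_law_unique:
  fixes M N :: "(real ^ 'n) measure"
  assumes M: "prob_space M" "sets M = sets borel" "AE x in M. norm x = 1"
    and N: "prob_space N" "sets N = sets borel" "AE x in N. norm x = 1"
    and MR: "\<And>R. orthogonal_transformation R \<Longrightarrow> distr M borel R = M"
    and NR: "\<And>R. orthogonal_transformation R \<Longrightarrow> distr N borel R = N"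
  shows "M = N"
proof (rule measure_eqI_continuous)
  interpret M: prob_space M by fact
  interpret N: prob_space N by fact
  interpret MN: pair_prob_space M N ..
  note [measurable_cong] = M(2) N(2)
  have sp: "space M = UNIV" "space N = UNIV"
    using sets_eq_imp_space_eq[OF M(2)] sets_eq_imp_space_eq[OF N(2)] by auto
  show "finite_measure M" "finite_measure N" "sets M = sets borel" "sets N = sets borel"
    using M(2) N(2) M.finite_measure_axioms N.finite_measure_axioms by auto
  fix f :: "real ^ 'n \<Rightarrow> real"
  assume cont: "continuous_on UNIV f" and bnd: "\<And>x. 0 \<le> f x \<and> f x \<le> 1"
  have [measurable]: "f \<in> borel_measurable borel" using cont by (rule borel_measurable_continuous_onI)
  have bnd': "\<bar>f x\<bar> \<le> 1" for x using bnd[of x] by auto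
  have uc: "uniformly_continuous_on (sphere (0 :: real ^ 'n) 1) f"
    by (intro compact_uniformly_continuous continuous_on_subset[OF cont]) auto
  obtain i :: 'n where True by blast
  define z0 :: "real ^ 'n" where "z0 = axis i 1"
  have z0: "norm z0 = 1" by (simp add: z0_def norm_axis_1)
  have cap: "measure Q (ball z e) = measure Q (ball z0 e)"
    if z: "norm z = 1" and Q: "sets Q = sets borel" "\<And>R. orthogonal_transformation R \<Longrightarrow> distr Q borel R = Q"
    for Q :: "(real ^ 'n) measure" and z e
  proof -
    obtain R :: "real ^ 'n \<Rightarrow> real ^ 'n" where R: "orthogonal_transformation R" "R z0 = z"
      by (rule orthogonal_transformation_exists_1[OF z0 z]) (rule that)
    have lin: "linear R" using R(1) by (rule orthogonal_transformation_linear)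
    note [measurable] = orthogonal_transformation_borel_measurable[OF R(1)]
    have m: "R \<in> measurable Q borel" using Q(1) by (simp add: measurable_cong_sets[OF Q(1) refl])
    have "dist z (R x) = dist z0 x" for x
    proof -
      have "dist z (R x) = norm (R z0 - R x)" by (simp only: dist_norm R(2))
      also have "\<dots> = norm (R (z0 - x))" by (simp only: linear_diff[OF lin])
      also have "\<dots> = norm (z0 - x)" by (rule orthogonal_transformation_norm[OF R(1)])
      finally show ?thesis by (simp only: dist_norm)
    qed
    then have "R -` ball z e = ball z0 e" by (simp add: set_eq_iff)
    moreover have "measure (distr Q borel R) (ball z e) = measure Q (R -` ball z e \<inter> space Q)"
      by (rule measure_distr[OF m]) simp
    ultimately show ?thesis using Q(2)[OF R(1)] sets_eq_imp_space_eq[OF Q(1)] by simp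
  qed
  have "\<bar>(\<integral>x. f x \<partial>M) - (\<integral>x. f x \<partial>N)\<bar> \<le> \<eta>" if \<eta>: "0 < \<eta>" for \<eta>
  proof -
    from uc[unfolded uniformly_continuous_on_def, rule_format, OF \<eta>]
    obtain \<epsilon> where \<epsilon>0: "\<epsilon> > 0" "\<forall>x\<in>sphere 0 1. \<forall>x'\<in>sphere 0 1. dist x' x < \<epsilon> \<longrightarrow> dist (f x') (f x) < \<eta>"
      by (elim exE conjE)
    have \<epsilon>: "\<epsilon> > 0" "\<And>x y. norm x = 1 \<Longrightarrow> norm y = 1 \<Longrightarrow> dist y x < \<epsilon> \<Longrightarrow> \<bar>f y - f x\<bar> < \<eta>"
      using \<epsilon>0 by (auto simp: dist_real_def)
    \<comment> \<open>Integrating the kernel in either variable gives the mass of a cap, which is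
      the same for all centres. On its support the two arguments of \<open>f\<close> can be
      exchanged at cost \<open>\<eta>\<close>.\<close>
    define k where "k p = (indicator {p. dist (fst p) (snd p) < \<epsilon>} p :: real)" for p :: "(real ^ 'n) \<times> (real ^ 'n)"
    have [measurable]: "k \<in> borel_measurable (M \<Otimes>\<^sub>M N)" unfolding k_def by measurable
    define c where "c = measure N (ball z0 \<epsilon>)"
    define c' where "c' = measure M (ball z0 \<epsilon>)"
    have kN: "(\<integral>z. k (y, z) \<partial>N) = c" if "norm y = 1" for y
    proof -
      have "(\<lambda>z. k (y, z)) = indicator (ball y \<epsilon>)" by (auto simp: k_def indicator_def fun_eq_iff)
      then show ?thesis using cap[OF that N(2) NR] by (simp add: c_def sp)
    qed
    have kM: "(\<integral>y. k (y, z) \<partial>M) = c'" if "norm z = 1" for z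
    proof -
      have "(\<lambda>y. k (y, z)) = indicator (ball z \<epsilon>)" by (auto simp: k_def indicator_def fun_eq_iff dist_commute)
      then show ?thesis using cap[OF that M(2) MR] by (simp add: c'_def sp)
    qed
    have ib: "integrable (M \<Otimes>\<^sub>M N) g" if "g \<in> borel_measurable (M \<Otimes>\<^sub>M N)" "\<And>p. \<bar>g p\<bar> \<le> 1" for g :: "(real ^ 'n) \<times> (real ^ 'n) \<Rightarrow> real"
      using that by (intro MN.P.integrable_const_bound[where B=1]) auto
    have i1: "integrable (M \<Otimes>\<^sub>M N) (\<lambda>p. f (fst p) * k p)"
      by (rule ib) (auto simp: k_def indicator_def bnd')
    have i2: "integrable (M \<Otimes>\<^sub>M N) (\<lambda>p. f (snd p) * k p)"
      by (rule ib) (auto simp: k_def indicator_def bnd')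
    have i3: "integrable (M \<Otimes>\<^sub>M N) k"
      by (rule ib) (auto simp: k_def indicator_def)
    have I1: "(\<integral>p. f (fst p) * k p \<partial>(M \<Otimes>\<^sub>M N)) = c * (\<integral>x. f x \<partial>M)"
    proof -
      have "(\<integral>p. f (fst p) * k p \<partial>(M \<Otimes>\<^sub>M N)) = (\<integral>y. f y * (\<integral>z. k (y, z) \<partial>N) \<partial>M)"
        by (subst MN.integral_fst'[OF i1, symmetric]) simp
      also have "\<dots> = (\<integral>y. f y * c \<partial>M)"
        using M(3) by (intro integral_cong_AE) (auto simp: kN)
      finally show ?thesis by simp
    qed
    have I2: "(\<integral>p. f (snd p) * k p \<partial>(M \<Otimes>\<^sub>M N)) = c' * (\<integral>x. f x \<partial>N)"
    proof -
      have "(\<integral>p. f (snd p) * k p \<partial>(M \<Otimes>\<^sub>M N)) = (\<integral>z. f z * (\<integral>y. k (y, z) \<partial>M) \<partial>N)"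
        using MN.integral_snd[of "\<lambda>y z. f z * k (y, z)"] i2 by (simp add: case_prod_beta')
      also have "\<dots> = (\<integral>z. f z * c' \<partial>N)"
        using N(3) by (intro integral_cong_AE) (auto simp: kM)
      finally show ?thesis by simp
    qed
    have I3: "(\<integral>p. k p \<partial>(M \<Otimes>\<^sub>M N)) = c" "(\<integral>p. k p \<partial>(M \<Otimes>\<^sub>M N)) = c'"
    proof -
      have "(\<integral>p. k p \<partial>(M \<Otimes>\<^sub>M N)) = (\<integral>y. (\<integral>z. k (y, z) \<partial>N) \<partial>M)"
        by (rule MN.integral_fst'[OF i3, symmetric])
      also have "\<dots> = (\<integral>y. c \<partial>M)"
        using M(3) by (intro integral_cong_AE) (auto simp: kN)
      finally show "(\<integral>p. k p \<partial>(M \<Otimes>\<^sub>M N)) = c" by (simp add: M.prob_space)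
      have "(\<integral>p. k p \<partial>(M \<Otimes>\<^sub>M N)) = (\<integral>z. (\<integral>y. k (y, z) \<partial>M) \<partial>N)"
        using MN.integral_snd[of "\<lambda>y z. k (y, z)"] i3 by (simp add: case_prod_beta')
      also have "\<dots> = (\<integral>z. c' \<partial>N)"
        using N(3) by (intro integral_cong_AE) (auto simp: kM)
      finally show "(\<integral>p. k p \<partial>(M \<Otimes>\<^sub>M N)) = c'" by (simp add: N.prob_space)
    qed
    \<comment> \<open>Finitely many caps cover the compact sphere and all have the same mass, so
      mass zero would contradict total mass one.\<close>
    have cpos: "0 < c"
    proof (rule ccontr)
      assume "\<not> 0 < c"
      then have c0: "c = 0" using measure_nonneg[of N "ball z0 \<epsilon>"] by (simp add: c_def)
      have "sphere (0 :: real ^ 'n) 1 \<subseteq> (\<Union>z\<in>sphere 0 1. ball z \<epsilon>)" using \<epsilon>(1) by force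
      then obtain T where T: "T \<subseteq> sphere 0 1" "finite T" "sphere (0 :: real ^ 'n) 1 \<subseteq> (\<Union>z\<in>T. ball z \<epsilon>)"
        using compactE_image[OF compact_sphere[of "0 :: real ^ 'n" 1], of "sphere 0 1" "\<lambda>z. ball z \<epsilon>"] by auto
      have "AE x in N. x \<in> (\<Union>z\<in>T. ball z \<epsilon>)" using N(3) by eventually_elim (rule subsetD[OF T(3)], simp)
      then have "measure N (\<Union>z\<in>T. ball z \<epsilon>) = 1" using T(2) by (intro N.prob_eq_1[THEN iffD2]) auto
      moreover have "measure N (\<Union>z\<in>T. ball z \<epsilon>) \<le> (\<Sum>z\<in>T. measure N (ball z \<epsilon>))"
        using T(2) by (intro N.finite_measure_subadditive_finite) auto
      moreover have "(\<Sum>z\<in>T. measure N (ball z \<epsilon>)) = 0"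
        using T(1) cap[OF _ N(2) NR] c0 by (intro sum.neutral) (auto simp: c_def)
      ultimately show False by simp
    qed
    have "c * \<bar>(\<integral>x. f x \<partial>M) - (\<integral>x. f x \<partial>N)\<bar> = \<bar>(\<integral>p. f (fst p) * k p \<partial>(M \<Otimes>\<^sub>M N)) - (\<integral>p. f (snd p) * k p \<partial>(M \<Otimes>\<^sub>M N))\<bar>"
      unfolding I1 I2 using I3 cpos by (simp add: abs_mult right_diff_distrib[symmetric])
    also have "\<dots> = \<bar>\<integral>p. f (fst p) * k p - f (snd p) * k p \<partial>(M \<Otimes>\<^sub>M N)\<bar>"
      using i1 i2 by simp
    also have "\<dots> \<le> (\<integral>p. \<eta> * k p \<partial>(M \<Otimes>\<^sub>M N))"
    proof (rule order_trans[OF integral_abs_bound integral_mono_AE])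
      have "AE p in M \<Otimes>\<^sub>M N. norm (fst p) = 1 \<and> norm (snd p) = 1"
      proof (rule MN.AE_pair_measure)
        show "AE x in M. AE y in N. norm (fst (x, y)) = 1 \<and> norm (snd (x, y)) = 1"
          using M(3)
        proof eventually_elim
          case (elim x)
          show ?case using N(3) by eventually_elim (use elim in simp)
        qed
      qed measurable
      then show "AE p in M \<Otimes>\<^sub>M N. \<bar>f (fst p) * k p - f (snd p) * k p\<bar> \<le> \<eta> * k p"
      proof eventually_elim
        case (elim p)
        then show ?case using \<epsilon>(2)[of "snd p" "fst p"] by (auto simp: k_def indicator_def)
      qed
    qed (use i1 i2 i3 in auto)
    also have "\<dots> = c * \<eta>" using I3 by simp
    finally show ?thesis using cpos by simp
  qed
  then have "\<bar>(\<integral>x. f x \<partial>M) - (\<integral>x. f x \<partial>N)\<bar> \<le> 0"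
    by (rule dense_ge)
  then show "(\<integral>x. f x \<partial>M) = (\<integral>x. f x \<partial>N)" by simp
qed

text \<open>The uniform law on the unit sphere. The origin is mapped to \<open>0\<close> because
  \<open>inverse 0 = 0\<close>, but it has Gaussian mass zero.\<close>

definition sphere_law :: "(real ^ 'n) measure" where
  "sphere_law = distr gauss1 borel (\<lambda>x. inverse (norm x) *\<^sub>R x)"

lemma sets_sphere_law [simp, measurable_cong]: "sets sphere_law = sets borel"
  by (simp add: sphere_law_def)

lemma prob_space_sphere_law: "prob_space (sphere_law :: (real ^ 'n) measure)"
  unfolding sphere_law_def by (rule prob_space.prob_space_distr[OF prob_space_gauss1]) measurable

lemma AE_sphere_law_norm: "AE x in (sphere_law :: (real ^ 'n) measure). norm x = 1"
proof -
  have "AE x in lborel. x \<noteq> (0 :: real ^ 'n)" by (rule AE_lborel_singleton)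
  then have "AE x in (gauss1 :: (real ^ 'n) measure). x \<noteq> 0"
    unfolding gauss1_def by (subst AE_density) auto
  then show ?thesis
    unfolding sphere_law_def by (subst AE_distr_iff) (auto elim: eventually_mono)
qed

lemma sphere_law_orthogonal:
  assumes R: "orthogonal_transformation (R :: real ^ 'n \<Rightarrow> real ^ 'n)"
  shows "distr sphere_law borel R = sphere_law"
proof -
  note [measurable] = orthogonal_transformation_borel_measurable[OF R]
  have "distr sphere_law borel R = distr (distr gauss1 borel R) borel (\<lambda>x. inverse (norm x) *\<^sub>R x)"
    unfolding sphere_law_def using R
    by (subst (1 2) distr_distr) (auto simp: o_def orthogonal_transformation_scaleR orthogonal_transformation_norm)
  then show ?thesis by (simp add: gauss1_orthogonal[OF R] sphere_law_def)
qed

lemma limit_point_in_closure: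
  fixes g :: "real \<Rightarrow> 'a::real_normed_vector"
  assumes g: "continuous_on {0..} g" and s: "0 \<le> s" and C: "\<And>u. 0 \<le> u \<Longrightarrow> u < s \<Longrightarrow> g u \<in> C"
    and 0: "g 0 \<in> closure C"
  shows "g s \<in> closure C"
proof (cases "s = 0")
  case False
  then have s: "0 < s" using s by simp
  have "g ` closure {0..<s} \<subseteq> closure C"
  proof (rule image_closure_subset)
    show "continuous_on (closure {0..<s}) g"
      using s by (intro continuous_on_subset[OF g]) auto
  qed (use C closure_subset[of C] in auto)
  moreover have "s \<in> closure {0..<s}" using s by auto
  ultimately show ?thesis by auto
qed (use 0 in simp)

section \<open>Exit time and exit point of a centred ball\<close>

context bm
begin

definition ball_exit :: "real \<Rightarrow> 'w \<Rightarrow> real" where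
  "ball_exit r w = real_of_ereal (hit {x. r \<le> norm x} 0 w)"

lemma closed_outside_ball: "closed {x :: real ^ 'n. r \<le> norm x}"
  by (intro closed_Collect_le continuous_intros)

lemma outside_ball_nonempty: "{x :: real ^ 'n. r \<le> norm x} \<noteq> {}"
  using vector_choose_size[of "max r 0"] by (metis (mono_tags) empty_Collect_eq max.cobounded1 max.cobounded2)

lemma hit_outside_ball:
  assumes r: "0 < r" and w: "w \<in> space P" and s: "0 \<le> s" "ereal s \<le> hit {x. r \<le> norm x} 0 w"
  shows "norm (B s w) \<le> r" "\<And>u. 0 \<le> u \<Longrightarrow> u < s \<Longrightarrow> norm (B u w) < r"
proof -
  show lt: "norm (B u w) < r" if "0 \<le> u" "u < s" for u
  proof (rule ccontr)
    assume "\<not> norm (B u w) < r"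
    then have "hit {x. r \<le> norm x} 0 w \<le> ereal u" using that(1) by (intro first_hit_le) auto
    with s(2) have "ereal s \<le> ereal u" by (rule order_trans)
    then show False using that by simp
  qed
  have "B s w \<in> closure (ball 0 r)"
    using lt r B_0[OF w] by (intro limit_point_in_closure[OF B_continuous[OF w] s(1)]) auto
  then show "norm (B s w) \<le> r" using r by simp
qed

lemma ball_exit_props:
  assumes r: "0 < r"
  shows "AE w in P. hit {x. r \<le> norm x} 0 w \<noteq> \<infinity>" "integrable P (ball_exit r)"
    "expectation (ball_exit r) \<le> r\<^sup>2 / CARD('n)"
  unfolding ball_exit_def[abs_def]
  by (rule hit_ball[OF closed_outside_ball outside_ball_nonempty hit_outside_ball(1)[OF r]]; assumption)+

lemma stopping_ball_exit: "0 < r \<Longrightarrow> stopping (ball_exit r)"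
  unfolding ball_exit_def[abs_def]
  by (rule stopping_hit[OF closed_outside_ball outside_ball_nonempty ball_exit_props(1)])

lemma ball_exit_before:
  assumes r: "0 < r" and w: "w \<in> space P" and u: "0 \<le> u" "u < ball_exit r w"
  shows "norm (B u w) < r"
proof -
  let ?h = "hit {x. r \<le> norm x} 0 w"
  have "0 < ball_exit r w" using u by simp
  then have "?h \<noteq> \<infinity>" by (auto simp: ball_exit_def)
  then have "?h = ereal (ball_exit r w)"
    using first_hit_nonneg[of "{x. r \<le> norm x}" 0 "\<lambda>t. B t w"] by (cases ?h) (auto simp: ball_exit_def)
  then show ?thesis using hit_outside_ball(2)[OF r w, of "ball_exit r w" u] u by auto
qed

lemma ball_exit_finite:
  assumes r: "0 < r" and w: "w \<in> space P" and fin: "hit {x. r \<le> norm x} 0 w \<noteq> \<infinity>"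
  shows "hit {x. r \<le> norm x} 0 w = ereal (ball_exit r w)" "0 \<le> ball_exit r w" "norm (B (ball_exit r w) w) = r"
proof -
  let ?h = "hit {x. r \<le> norm x} 0 w"
  show eq: "?h = ereal (ball_exit r w)"
    using fin first_hit_nonneg[of "{x. r \<le> norm x}" 0 "\<lambda>t. B t w"] by (cases ?h) (auto simp: ball_exit_def)
  show nn: "0 \<le> ball_exit r w"
    unfolding ball_exit_def using first_hit_nonneg by (intro real_of_ereal_pos)
  obtain t where t: "0 \<le> t" "0 + B t w \<in> {x. r \<le> norm x}" "?h = ereal t"
    by (rule first_hit_attained[OF B_continuous[OF w] closed_outside_ball fin]) (rule that)
  then have "t = ball_exit r w" using eq by simp
  then show "norm (B (ball_exit r w) w) = r"
    using t hit_outside_ball(1)[OF r w nn] eq by auto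
qed

lemma ball_exit_nonneg: "0 \<le> ball_exit r w"
  unfolding ball_exit_def using first_hit_nonneg by (intro real_of_ereal_pos)


lemma exit_functional_measurable:
  "(\<lambda>f :: nat \<Rightarrow> real ^ 'n. (real_of_ereal (hit_time A 0 f), path_at f (real_of_ereal (hit_time A 0 f)))) \<in> borel_measurable borel"
proof -
  have "(\<lambda>f :: nat \<Rightarrow> real ^ 'n. hit_time A 0 f) \<in> borel_measurable borel"
    by (rule hit_time_measurable') auto
  then have "(\<lambda>f :: nat \<Rightarrow> real ^ 'n. real_of_ereal (hit_time A 0 f)) \<in> borel_measurable borel" by measurable
  then show ?thesis by (intro borel_measurable_Pair path_at_measurable) auto
qed

text \<open>Exit time and exit point are one fixed Borel functional of the skeleton, so they have
  the same law for any two Brownian motions.\<close>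

lemma exit_law_transfer:
  assumes B': "bm P B'" and r: "0 < r"
  shows "distr P borel (\<lambda>w. (ball_exit r w, B (ball_exit r w) w)) =
    distr P borel (\<lambda>w. (bm.ball_exit B' r w, B' (bm.ball_exit B' r w) w))"
proof -
  let ?A = "{x :: real ^ 'n. r \<le> norm x}"
  let ?F = "\<lambda>f :: nat \<Rightarrow> real ^ 'n. (real_of_ereal (hit_time ?A 0 f), path_at f (real_of_ereal (hit_time ?A 0 f)))"
  have *: "distr P borel (\<lambda>w. (bm.ball_exit B r w, B (bm.ball_exit B r w) w)) = distr (bm.path_law P B) borel ?F"
    if "bm P B" for B :: "real \<Rightarrow> 'w \<Rightarrow> real ^ 'n"
  proof -
    interpret b: bm P B by fact
    have "distr b.path_law borel ?F = distr P borel (?F \<circ> (\<lambda>w. skel (\<lambda>t. B t w)))"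
      unfolding b.path_law_def by (rule distr_distr[OF exit_functional_measurable b.skel_measurable])
    also have "\<dots> = distr P borel (\<lambda>w. (b.ball_exit r w, B (b.ball_exit r w) w))"
    proof (rule distr_cong[OF refl refl])
      fix w assume w: "w \<in> space P"
      have "hit_time ?A 0 (skel (\<lambda>t. B t w)) = b.hit ?A 0 w"
        by (rule hit_time_skel[OF b.B_continuous[OF w] closed_outside_ball outside_ball_nonempty])
      then have "real_of_ereal (hit_time ?A 0 (skel (\<lambda>t. B t w))) = b.ball_exit r w"
        by (simp add: b.ball_exit_def)
      then show "(?F \<circ> (\<lambda>w. skel (\<lambda>t. B t w))) w = (b.ball_exit r w, B (b.ball_exit r w) w)"
        by (simp add: path_at_skel[OF b.B_continuous[OF w] b.ball_exit_nonneg])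
    qed
    finally show ?thesis ..
  qed
  show ?thesis unfolding *[OF bm_axioms] *[OF B'] path_law_unique[OF bm_axioms B'] ..
qed

text \<open>Rotating the path leaves the exit time unchanged and rotates the exit point.\<close>

lemma exit_law_rotated:
  assumes R: "orthogonal_transformation (R :: real ^ 'n \<Rightarrow> real ^ 'n)"
  shows "distr P borel (\<lambda>w. (ball_exit 1 w, B (ball_exit 1 w) w)) =
    distr P borel (\<lambda>w. (ball_exit 1 w, R (B (ball_exit 1 w) w)))"
proof -
  have b: "bm P (\<lambda>t w. R (B t w))" by (rule bm_rotated[OF R])
  interpret b: bm P "\<lambda>t w. R (B t w)" by (rule b)
  have "b.ball_exit 1 w = ball_exit 1 w" for w
    unfolding b.ball_exit_def ball_exit_def first_hit_def by (simp add: orthogonal_transformation_norm[OF R])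
  then show ?thesis using exit_law_transfer[OF b, of 1] by simp
qed

text \<open>Conditioned on any event of positive probability in the exit time, the exit point still
  has a rotation-invariant law on the sphere, hence the uniform one. As the conditional law is the
  same for all such events, exit point and exit time are independent.\<close>

lemma exit_law:
  "distr P borel (\<lambda>w. (ball_exit 1 w, B (ball_exit 1 w) w)) = distr P borel (ball_exit 1) \<Otimes>\<^sub>M sphere_law"
proof (rule pair_measure_eqI[symmetric])
  let ?Z = "ball_exit 1" and ?X = "\<lambda>w. B (ball_exit 1 w) w"
  have st: "stopping ?Z" by (rule stopping_ball_exit) simp
  note [measurable] = stoppingD(1,3)[OF st]
  interpret S: prob_space "sphere_law :: (real ^ 'n) measure" by (rule prob_space_sphere_law)
  interpret Zl: prob_space "distr P borel ?Z" by (rule prob_space_distr) measurable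
  show "sigma_finite_measure (distr P borel ?Z)" "sigma_finite_measure (sphere_law :: (real ^ 'n) measure)" ..
  have "sets (distr P borel ?Z \<Otimes>\<^sub>M (sphere_law :: (real ^ 'n) measure)) = sets ((borel :: real measure) \<Otimes>\<^sub>M (borel :: (real ^ 'n) measure))"
    by (rule sets_pair_measure_cong) auto
  then show "sets (distr P borel ?Z \<Otimes>\<^sub>M sphere_law) = sets (distr P borel (\<lambda>w. (?Z w, ?X w)))"
    by (simp only: borel_prod sets_distr)
  fix C :: "real set" and A :: "(real ^ 'n) set"
  assume "C \<in> sets (distr P borel ?Z)" "A \<in> sets (sphere_law :: (real ^ 'n) measure)"
  then have C[measurable]: "C \<in> sets borel" and A[measurable]: "A \<in> sets borel" by auto
  define E where "E = {w\<in>space P. ?Z w \<in> C}"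
  have E[measurable]: "E \<in> events" unfolding E_def by measurable
  have XA: "{w\<in>space P. ?X w \<in> A} \<in> events" by measurable
  have "prob (E \<inter> {w\<in>space P. ?X w \<in> A}) = prob E * measure sphere_law A"
  proof (cases "prob E = 0")
    case True
    have "prob (E \<inter> {w\<in>space P. ?X w \<in> A}) \<le> prob E" using E by (intro finite_measure_mono) auto
    then show ?thesis using True by (simp add: measure_le_0_iff)
  next
    case False
    then have pos: "prob E > 0" using measure_nonneg[of P E] by linarith
    have pos': "emeasure P E \<noteq> 0" "emeasure P E \<noteq> \<infinity>" using pos by (auto simp: emeasure_eq_measure)
    interpret U: prob_space "uniform_measure P E" by (rule prob_space_uniform_measure[OF pos'])
    let ?M = "distr (uniform_measure P E) borel ?X"
    have Xm: "?X \<in> borel_measurable (uniform_measure P E)" by measurable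
    have mM: "measure ?M A' = prob (E \<inter> {w\<in>space P. ?X w \<in> A'}) / prob E" if A': "A' \<in> sets borel" for A'
    proof -
      have ev: "{w\<in>space P. ?X w \<in> A'} \<in> events" using A' by measurable
      have "measure ?M A' = measure (uniform_measure P E) (?X -` A' \<inter> space (uniform_measure P E))"
        by (rule measure_distr[OF Xm A'])
      also have "?X -` A' \<inter> space (uniform_measure P E) = {w\<in>space P. ?X w \<in> A'}" by auto
      also have "measure (uniform_measure P E) \<dots> = prob (E \<inter> {w\<in>space P. ?X w \<in> A'}) / prob E"
        by (rule measure_uniform_measure[OF pos' ev])
      finally show ?thesis .
    qed
    interpret M: prob_space ?M by (rule U.prob_space_distr[OF Xm])
    have "?M = sphere_law"
    proof (rule sphere_law_unique)
      show "prob_space ?M" by (rule M.prob_space_axioms)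
      show "AE x in ?M. norm x = 1"
      proof (subst AE_distr_iff[OF Xm])
        have "AE w in P. norm (?X w) = 1"
          using ball_exit_props(1)[OF zero_less_one] AE_space
          by eventually_elim (rule ball_exit_finite(3)[OF zero_less_one])
        then show "AE w in uniform_measure P E. norm (?X w) = 1"
          by (intro AE_uniform_measureI) auto
      qed measurable
      fix R :: "real ^ 'n \<Rightarrow> real ^ 'n" assume R: "orthogonal_transformation R"
      note [measurable] = orthogonal_transformation_borel_measurable[OF R]
      interpret M': prob_space "distr ?M borel R" by (rule M.prob_space_distr) measurable
      show "distr ?M borel R = ?M"
      proof (rule measure_eqI)
        fix A' assume "A' \<in> sets (distr ?M borel R)"
        then have A'[measurable]: "A' \<in> sets borel" by simp
        have RA[measurable]: "R -` A' \<in> sets borel" by (rule measurable_sets_borel[OF _ A']) measurable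
        have CA: "C \<times> A' \<in> sets borel" using pair_measureI[OF C A'] by (simp only: borel_prod)
        have "prob (E \<inter> {w\<in>space P. ?X w \<in> R -` A'}) = measure (distr P borel (\<lambda>w. (?Z w, R (?X w)))) (C \<times> A')"
          by (subst measure_distr[OF _ CA]) (auto simp: E_def intro!: arg_cong[where f=prob])
        also have "\<dots> = measure (distr P borel (\<lambda>w. (?Z w, ?X w))) (C \<times> A')"
          by (simp only: exit_law_rotated[OF R])
        also have "\<dots> = prob (E \<inter> {w\<in>space P. ?X w \<in> A'})"
          by (subst measure_distr[OF _ CA]) (auto simp: E_def intro!: arg_cong[where f=prob])
        finally have eq: "prob (E \<inter> {w\<in>space P. ?X w \<in> R -` A'}) = prob (E \<inter> {w\<in>space P. ?X w \<in> A'})" .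
        have "measure (distr ?M borel R) A' = measure ?M (R -` A')"
          by (subst measure_distr) auto
        also have "\<dots> = measure ?M A'" by (simp only: mM[OF RA] mM[OF A'] eq)
        finally show "emeasure (distr ?M borel R) A' = emeasure ?M A'"
          by (simp only: M'.emeasure_eq_measure M.emeasure_eq_measure)
      qed simp
    qed (auto simp: prob_space_sphere_law AE_sphere_law_norm sphere_law_orthogonal)
    then have "measure sphere_law A = prob (E \<inter> {w\<in>space P. ?X w \<in> A}) / prob E" using mM[OF A] by simp
    then show ?thesis using pos by simp
  qed
  moreover have CA: "C \<times> A \<in> sets borel" using pair_measureI[OF C A] by (simp only: borel_prod)
  moreover have "emeasure (distr P borel (\<lambda>w. (?Z w, ?X w))) (C \<times> A) = emeasure P (E \<inter> {w\<in>space P. ?X w \<in> A})"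
    by (subst emeasure_distr[OF _ CA]) (auto simp: E_def intro!: arg_cong[where f="emeasure P"])
  moreover have "emeasure (distr P borel ?Z) C = emeasure P E"
    by (subst emeasure_distr[OF _ C]) (auto simp: E_def intro!: arg_cong[where f="emeasure P"])
  ultimately show "emeasure (distr P borel ?Z) C * emeasure sphere_law A = emeasure (distr P borel (\<lambda>w. (?Z w, ?X w))) (C \<times> A)"
    by (simp add: emeasure_eq_measure S.emeasure_eq_measure ennreal_mult)
qed

end

subsection \<open>The value function\<close>

lemma bounded_integrable_interval:
  fixes k :: "real \<Rightarrow> real"
  assumes "k \<in> borel_measurable borel" "\<And>s. \<bar>k s\<bar> \<le> C"
  shows "integrable lborel (\<lambda>s. k s * indicator {a<..<b} s)"
proof (rule Bochner_Integration.integrable_bound)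
  have "emeasure lborel {a<..<b} < \<infinity>" by (cases "a \<le> b") auto
  then show "integrable lborel (\<lambda>s. C * indicator {a<..<b} s)"
    by (intro integrable_mult_right integrable_real_indicator) auto
  have "0 \<le> C" using assms(2)[of 0] by simp
  then show "AE s in lborel. norm (k s * indicator {a<..<b} s) \<le> norm (C * indicator {a<..<b} s)"
    using assms(2) by (intro AE_I2) (auto simp: indicator_def)
qed (use assms(1) in measurable)

lemma bounded_integral_interval:
  fixes k :: "real \<Rightarrow> real"
  assumes k: "k \<in> borel_measurable borel" "\<And>s. \<bar>k s\<bar> \<le> C" and b: "0 \<le> b"
  shows "\<bar>\<integral>s. k s * indicator {0<..<b} s \<partial>lborel\<bar> \<le> C * b"
proof -
  have "\<bar>\<integral>s. k s * indicator {0<..<b} s \<partial>lborel\<bar> \<le> (\<integral>s. C * indicator {0<..<b} s \<partial>lborel)"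
  proof (rule order_trans[OF integral_abs_bound integral_mono])
    show "integrable lborel (\<lambda>s. C * indicator {0<..<b} s)"
      using bounded_integrable_interval[of "\<lambda>_. C" "\<bar>C\<bar>"] by simp
    show "integrable lborel (\<lambda>s. \<bar>k s * indicator {0<..<b} s\<bar>)"
      using bounded_integrable_interval[OF k] by (rule integrable_abs)
  qed (use k(2) in \<open>auto simp: indicator_def\<close>)
  also have "\<dots> = C * b" using b by (simp add: measure_def)
  finally show ?thesis .
qed

lemma integral_interval_split:
  fixes k :: "real \<Rightarrow> real"
  assumes k: "k \<in> borel_measurable borel" "\<And>s. \<bar>k s\<bar> \<le> C" and ab: "0 \<le> a" "a \<le> b"
  shows "(\<integral>s. k s * indicator {0<..<b} s \<partial>lborel) =
    (\<integral>s. k (a + s) * indicator {0<..<b - a} s \<partial>lborel) + (\<integral>s. k s * indicator {0<..<a} s \<partial>lborel)"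
proof -
  have "(\<integral>s. k s * indicator {a<..<b} s \<partial>lborel) = (\<integral>s. k (a + 1 * s) * indicator {a<..<b} (a + 1 * s) \<partial>lborel)"
    by (subst lborel_integral_real_affine[of 1 _ a]) auto
  also have "\<dots> = (\<integral>s. k (a + s) * indicator {0<..<b - a} s \<partial>lborel)"
    by (intro Bochner_Integration.integral_cong) (auto simp: indicator_def)
  finally have 1: "(\<integral>s. k (a + s) * indicator {0<..<b - a} s \<partial>lborel) = (\<integral>s. k s * indicator {a<..<b} s \<partial>lborel)" ..
  have "(\<integral>s. k s * indicator {0<..<b} s \<partial>lborel) = (\<integral>s. k s * indicator {a<..<b} s + k s * indicator {0<..<a} s \<partial>lborel)"
  proof (rule integral_cong_AE)
    \<comment> \<open>The point \<open>a\<close> belongs to neither open interval, so the pieces add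
      up only almost everywhere.\<close>
    have "AE s in lborel. s \<noteq> a" by (rule AE_lborel_singleton)
    then show "AE s in lborel. k s * indicator {0<..<b} s = k s * indicator {a<..<b} s + k s * indicator {0<..<a} s"
      by eventually_elim (use ab in \<open>auto simp: indicator_def\<close>)
  qed (use k(1) in measurable)
  also have "\<dots> = (\<integral>s. k s * indicator {a<..<b} s \<partial>lborel) + (\<integral>s. k s * indicator {0<..<a} s \<partial>lborel)"
    by (intro Bochner_Integration.integral_add bounded_integrable_interval[OF k])
  finally show ?thesis unfolding 1 .
qed

text \<open>A function of start and path skeleton, so that the strong Markov property can be applied
  to it as a Borel functional. The running part is cut off at the extended time \<open>T\<close>;
  the boundary part takes \<open>0\<close> for an infinite one, which is a null event in the uses
  below.\<close>

definition payoff :: "(real ^ 'n) set \<Rightarrow> (real \<times> (real ^ 'n) \<Rightarrow> real) \<Rightarrow> (real \<times> (real ^ 'n) \<Rightarrow> real) \<Rightarrow>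
    (real \<times> (real ^ 'n)) \<times> (nat \<Rightarrow> real ^ 'n) \<Rightarrow> real" where
  "payoff A h0 h1 p = (let t = fst (fst p); y = snd (fst p); f = snd p; T = hit_time A y f in
     h0 (t + real_of_ereal T, y + path_at f (real_of_ereal T)) +
     (\<integral>s. h1 (t + s, y + path_at f s) * (if 0 < s \<and> ereal s < T then 1 else 0) \<partial>lborel))"

lemma payoff_measurable:
  assumes h0: "h0 \<in> borel_measurable borel" and h1: "h1 \<in> borel_measurable borel"
  shows "payoff A h0 h1 \<in> borel_measurable borel"
proof -
  let ?B = "borel :: ((real \<times> (real ^ 'n)) \<times> (nat \<Rightarrow> real ^ 'n)) measure"
  have fs: "(\<lambda>p::(real \<times> (real ^ 'n)) \<times> (nat \<Rightarrow> real ^ 'n). fst (fst p)) \<in> borel_measurable borel"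
    "(\<lambda>p::(real \<times> (real ^ 'n)) \<times> (nat \<Rightarrow> real ^ 'n). snd (fst p)) \<in> borel_measurable borel"
    "(\<lambda>p::(real \<times> (real ^ 'n)) \<times> (nat \<Rightarrow> real ^ 'n). snd p) \<in> borel_measurable borel"
    by (intro borel_measurable_continuous_onI continuous_intros)+
  have T: "(\<lambda>p. hit_time A (snd (fst p)) (snd p)) \<in> borel_measurable ?B"
    by (rule hit_time_measurable'[OF fs(2,3)])
  then have rT: "(\<lambda>p. real_of_ereal (hit_time A (snd (fst p)) (snd p))) \<in> borel_measurable ?B" by measurable
  have 1: "(\<lambda>p. h0 (fst (fst p) + real_of_ereal (hit_time A (snd (fst p)) (snd p)),
      snd (fst p) + path_at (snd p) (real_of_ereal (hit_time A (snd (fst p)) (snd p))))) \<in> borel_measurable ?B"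
    by (rule measurable_compose[OF _ h0], intro borel_measurable_Pair borel_measurable_add path_at_measurable fs rT)
  have pr: "fst \<in> measurable (?B \<Otimes>\<^sub>M lborel) ?B" "snd \<in> borel_measurable (?B \<Otimes>\<^sub>M lborel)" by measurable
  note fs' = measurable_compose[OF pr(1) fs(1)] measurable_compose[OF pr(1) fs(2)] measurable_compose[OF pr(1) fs(3)]
  have "(\<lambda>q. h1 (fst (fst (fst q)) + snd q, snd (fst (fst q)) + path_at (snd (fst q)) (snd q))) \<in> borel_measurable (?B \<Otimes>\<^sub>M lborel)"
    by (rule measurable_compose[OF _ h1], intro borel_measurable_Pair borel_measurable_add path_at_measurable fs' pr(2))
  moreover have "(\<lambda>q. if 0 < snd q \<and> ereal (snd q) < hit_time A (snd (fst (fst q))) (snd (fst q)) then 1 else 0 :: real) \<in> borel_measurable (?B \<Otimes>\<^sub>M lborel)"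
  proof -
    note [measurable] = measurable_compose[OF pr(1) T] pr(2)
    show ?thesis by measurable
  qed
  ultimately have "(\<lambda>q. h1 (fst (fst (fst q)) + snd q, snd (fst (fst q)) + path_at (snd (fst q)) (snd q)) *
      (if 0 < snd q \<and> ereal (snd q) < hit_time A (snd (fst (fst q))) (snd (fst q)) then 1 else 0)) \<in> borel_measurable (?B \<Otimes>\<^sub>M lborel)"
    by (rule borel_measurable_times)
  then have "(\<lambda>(p, s). h1 (fst (fst p) + s, snd (fst p) + path_at (snd p) s) *
      (if 0 < s \<and> ereal s < hit_time A (snd (fst p)) (snd p) then 1 else 0)) \<in> borel_measurable (?B \<Otimes>\<^sub>M lborel)"
    by (simp only: case_prod_beta')
  then have "(\<lambda>p. \<integral>s. h1 (fst (fst p) + s, snd (fst p) + path_at (snd p) s) *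
      (if 0 < s \<and> ereal s < hit_time A (snd (fst p)) (snd p) then 1 else 0) \<partial>lborel) \<in> borel_measurable ?B"
    by (rule sigma_finite_measure.borel_measurable_lebesgue_integral[OF lborel.sigma_finite_measure_axioms])
  from borel_measurable_add[OF 1 this] show ?thesis unfolding payoff_def[abs_def] Let_def .
qed

text \<open>Both extended numbers are compared through their finite upper bounds, which covers the
  case that the ball is never left.\<close>

lemma first_hit_scaled:
  fixes g :: "real \<Rightarrow> real ^ 'n"
  assumes g: "continuous_on {0..} g" and r: "0 < r"
  shows "first_hit {x. r \<le> norm x} 0 (\<lambda>t. r *\<^sub>R g (t / r\<^sup>2)) = ereal (r\<^sup>2) * first_hit {x. 1 \<le> norm x} 0 g"
proof -
  have cl: "closed {x :: real ^ 'n. c \<le> norm x}" for c by (intro closed_Collect_le continuous_intros)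
  have g': "continuous_on {0..} (\<lambda>t. r *\<^sub>R g (t / r\<^sup>2))"
  proof (rule continuous_on_scaleR[OF continuous_on_const continuous_on_compose2[OF g]])
    show "continuous_on {0..} (\<lambda>t. t / r\<^sup>2)" using r by (intro continuous_intros) auto
  qed auto
  have r2: "0 < r\<^sup>2" using r by simp
  have "first_hit {x. r \<le> norm x} 0 (\<lambda>t. r *\<^sub>R g (t / r\<^sup>2)) \<le> ereal s \<longleftrightarrow> first_hit {x. 1 \<le> norm x} 0 g \<le> ereal (s / r\<^sup>2)" for s
    unfolding first_hit_le_iff[OF g' cl] first_hit_le_iff[OF g cl]
  proof
    assume "\<exists>t. 0 \<le> t \<and> t \<le> s \<and> 0 + r *\<^sub>R g (t / r\<^sup>2) \<in> {x. r \<le> norm x}"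
    then obtain t where t: "0 \<le> t" "t \<le> s" "r \<le> r * norm (g (t / r\<^sup>2))" using r by auto
    then show "\<exists>t. 0 \<le> t \<and> t \<le> s / r\<^sup>2 \<and> 0 + g t \<in> {x. 1 \<le> norm x}"
      using r by (intro exI[of _ "t / r\<^sup>2"]) (auto simp: divide_right_mono)
  next
    assume "\<exists>t. 0 \<le> t \<and> t \<le> s / r\<^sup>2 \<and> 0 + g t \<in> {x. 1 \<le> norm x}"
    then obtain t where t: "0 \<le> t" "t \<le> s / r\<^sup>2" "1 \<le> norm (g t)" by auto
    then show "\<exists>t. 0 \<le> t \<and> t \<le> s \<and> 0 + r *\<^sub>R g (t / r\<^sup>2) \<in> {x. r \<le> norm x}"
      using r by (intro exI[of _ "t * r\<^sup>2"]) (auto simp: field_simps)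
  qed
  moreover have "ereal (r\<^sup>2) * h \<le> ereal s \<longleftrightarrow> h \<le> ereal (s / r\<^sup>2)" for h s
    using r2 by (cases h) (auto simp: field_simps)
  ultimately have iff: "first_hit {x. r \<le> norm x} 0 (\<lambda>t. r *\<^sub>R g (t / r\<^sup>2)) \<le> ereal s \<longleftrightarrow>
     ereal (r\<^sup>2) * first_hit {x. 1 \<le> norm x} 0 g \<le> ereal s" for s
    by simp
  show ?thesis by (rule antisym; rule ereal_le_real) (use iff in auto)
qed

context bm
begin

text \<open>The path avoids \<open>A\<close> before \<open>a\<close>, so the hitting time is
  \<open>a\<close> plus that of the restarted path, which ends at the same time and place.\<close>

lemma path_continuation:
  assumes w: "w \<in> space P" and a: "0 \<le> a" and no: "\<And>t. 0 \<le> t \<Longrightarrow> t < a \<Longrightarrow> x + B t w \<notin> A"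
    and A: "closed A" "A \<noteq> {}" and fin: "hit A x w \<noteq> \<infinity>"
    and h1: "h1 \<in> borel_measurable borel" "\<And>z. \<bar>h1 z\<bar> \<le> C"
  shows "payoff A h0 h1 ((t, x), skel (\<lambda>t. B t w)) =
    payoff A h0 h1 ((t + a, x + B a w), skel (\<lambda>t. B (a + t) w - B a w)) +
    (\<integral>s. h1 (t + s, x + B s w) * indicator {0<..<a} s \<partial>lborel)"
proof -
  let ?f = "skel (\<lambda>t. B t w)" and ?g = "skel (\<lambda>t. B (a + t) w - B a w)"
  note Bc = B_continuous[OF w] and Bc' = shifted_path_continuous[OF w a]
  have sh: "hit A x w = ereal a + first_hit A (x + B a w) (\<lambda>t. B (a + t) w - B a w)"
    by (rule first_hit_shift[OF a no])
  then obtain b where b: "first_hit A (x + B a w) (\<lambda>t. B (a + t) w - B a w) = ereal b" "0 \<le> b"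
    using fin first_hit_nonneg[of A "x + B a w" "\<lambda>t. B (a + t) w - B a w"]
    by (cases "first_hit A (x + B a w) (\<lambda>t. B (a + t) w - B a w)") auto
  have T: "hit_time A x ?f = ereal (a + b)" "hit_time A (x + B a w) ?g = ereal b"
    using hit_time_skel[OF Bc A, of x] hit_time_skel[OF Bc' A, of "x + B a w"] sh b by simp_all
  \<comment> \<open>Nothing is known about \<open>B\<close> at negative times, so the integrand goes
    through \<open>path_at\<close>: Borel on the whole line and equal to \<open>B\<close> where the
    indicator is nonzero.\<close>
  define k where "k s = h1 (t + s, x + path_at ?f s)" for s
  have k: "k \<in> borel_measurable borel" "\<bar>k s\<bar> \<le> C" for s
  proof -
    show "k \<in> borel_measurable borel" unfolding k_def
      by (rule measurable_compose[OF _ h1(1)], intro borel_measurable_Pair borel_measurable_add path_at_measurable) auto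
    show "\<bar>k s\<bar> \<le> C" unfolding k_def by (rule h1(2))
  qed
  have pf: "path_at ?f s = B s w" if "0 \<le> s" for s by (rule path_at_skel[OF Bc that])
  have pg: "path_at ?g s = B (a + s) w - B a w" if "0 \<le> s" for s by (rule path_at_skel[OF Bc' that])
  have pg': "x + (B a w + path_at ?g s) = x + B (a + s) w" if "0 \<le> s" for s using pg[OF that] by simp
  have e1: "payoff A h0 h1 ((t, x), ?f) = h0 (t + (a + b), x + B (a + b) w) + (\<integral>s. k s * indicator {0<..<a + b} s \<partial>lborel)"
    unfolding payoff_def Let_def fst_conv snd_conv T k_def using a b(2)
    by (simp add: pf) (intro Bochner_Integration.integral_cong, auto simp: indicator_def)
  have "payoff A h0 h1 ((t + a, x + B a w), ?g) = h0 (t + a + b, x + B a w + (B (a + b) w - B a w)) +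
    (\<integral>s. h1 (t + a + s, x + B a w + path_at ?g s) * (if 0 < s \<and> ereal s < ereal b then 1 else 0) \<partial>lborel)"
    unfolding payoff_def Let_def fst_conv snd_conv T using b(2) by (simp add: pg)
  also have "(\<integral>s. h1 (t + a + s, x + B a w + path_at ?g s) * (if 0 < s \<and> ereal s < ereal b then 1 else 0) \<partial>lborel) =
    (\<integral>s. k (a + s) * indicator {0<..<b} s \<partial>lborel)"
    using a by (intro Bochner_Integration.integral_cong) (auto simp: indicator_def k_def pf pg' add.assoc)
  finally have e2: "payoff A h0 h1 ((t + a, x + B a w), ?g) = h0 (t + (a + b), x + B (a + b) w) +
    (\<integral>s. k (a + s) * indicator {0<..<b} s \<partial>lborel)" by (simp add: add.assoc)
  have e3: "(\<integral>s. h1 (t + s, x + B s w) * indicator {0<..<a} s \<partial>lborel) = (\<integral>s. k s * indicator {0<..<a} s \<partial>lborel)"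
    by (intro Bochner_Integration.integral_cong) (auto simp: indicator_def k_def pf)
  show ?thesis unfolding e1 e2 e3
    using integral_interval_split[OF k a, of "a + b"] b(2) by simp
qed

text \<open>An integral over \<open>path_law\<close> instead of \<open>P\<close>: it depends on the
  Brownian motion only through its law, so a rescaled motion has the same value function.\<close>

definition value_fn :: "(real ^ 'n) set \<Rightarrow> (real \<times> (real ^ 'n) \<Rightarrow> real) \<Rightarrow> (real \<times> (real ^ 'n) \<Rightarrow> real) \<Rightarrow>
    real \<times> (real ^ 'n) \<Rightarrow> real" where
  "value_fn A h0 h1 z = (\<integral>f. payoff A h0 h1 (z, f) \<partial>path_law)"

lemma value_fn_measurable:
  assumes h0: "h0 \<in> borel_measurable borel" and h1: "h1 \<in> borel_measurable borel"
  shows "value_fn A h0 h1 \<in> borel_measurable borel"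
proof -
  interpret PL: prob_space path_law by (rule prob_space_path_law)
  have "payoff A h0 h1 \<in> borel_measurable (borel \<Otimes>\<^sub>M borel)"
    using payoff_measurable[OF assms] by (simp only: borel_prod)
  note [measurable] = this
  show ?thesis unfolding value_fn_def[abs_def] by measurable
qed

lemma value_fn_eq:
  assumes h0: "h0 \<in> borel_measurable borel" and h1: "h1 \<in> borel_measurable borel"
  shows "value_fn A h0 h1 z = expectation (\<lambda>w. payoff A h0 h1 (z, skel (\<lambda>t. B t w)))"
proof -
  have "(\<lambda>f. (z, f)) \<in> borel_measurable (borel :: (nat \<Rightarrow> real ^ 'n) measure)"
    by (intro borel_measurable_Pair) auto
  from measurable_compose[OF this payoff_measurable[OF assms]]
  show ?thesis unfolding value_fn_def path_law_def by (intro integral_distr[OF skel_measurable])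
qed

lemma payoff_skel:
  assumes w: "w \<in> space P" and A: "closed A" "A \<noteq> {}"
  shows "payoff A h0 h1 ((t, x), skel (\<lambda>t. B t w)) =
    h0 (t + real_of_ereal (hit A x w), x + B (real_of_ereal (hit A x w)) w) +
    (\<integral>s. h1 (t + s, x + B s w) * (if 0 < s \<and> ereal s < hit A x w then 1 else 0) \<partial>lborel)"
proof -
  have nn: "0 \<le> real_of_ereal (hit A x w)" using first_hit_nonneg by (intro real_of_ereal_pos)
  show ?thesis
    unfolding payoff_def Let_def fst_conv snd_conv hit_time_skel[OF B_continuous[OF w] A]
    by (simp add: path_at_skel[OF B_continuous[OF w] nn])
       (intro Bochner_Integration.integral_cong, auto simp: path_at_skel[OF B_continuous[OF w]])
qed

lemma payoff_bound:
  assumes w: "w \<in> space P" and A: "closed A" "A \<noteq> {}" and fin: "hit A x w \<noteq> \<infinity>"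
    and h0: "\<And>z. \<bar>h0 z\<bar> \<le> C0" and h1: "h1 \<in> borel_measurable borel" "\<And>z. \<bar>h1 z\<bar> \<le> C1"
  shows "\<bar>\<integral>s. h1 (t + s, x + B s w) * (if 0 < s \<and> ereal s < hit A x w then 1 else 0) \<partial>lborel\<bar> \<le> C1 * real_of_ereal (hit A x w)"
    "\<bar>payoff A h0 h1 ((t, x), skel (\<lambda>t. B t w))\<bar> \<le> C0 + C1 * real_of_ereal (hit A x w)"
proof -
  obtain r where r: "hit A x w = ereal r" "0 \<le> r" using fin first_hit_nonneg[of A x "\<lambda>t. B t w"] by (cases "hit A x w") auto
  define k where "k s = h1 (t + s, x + path_at (skel (\<lambda>t. B t w)) s)" for s
  have k: "k \<in> borel_measurable borel" "\<bar>k s\<bar> \<le> C1" for s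
  proof -
    show "k \<in> borel_measurable borel" unfolding k_def
      by (rule measurable_compose[OF _ h1(1)], intro borel_measurable_Pair borel_measurable_add path_at_measurable) auto
    show "\<bar>k s\<bar> \<le> C1" unfolding k_def by (rule h1(2))
  qed
  have "(\<integral>s. h1 (t + s, x + B s w) * (if 0 < s \<and> ereal s < hit A x w then 1 else 0) \<partial>lborel) = (\<integral>s. k s * indicator {0<..<r} s \<partial>lborel)"
    by (intro Bochner_Integration.integral_cong) (auto simp: indicator_def k_def r path_at_skel[OF B_continuous[OF w]])
  then show 1: "\<bar>\<integral>s. h1 (t + s, x + B s w) * (if 0 < s \<and> ereal s < hit A x w then 1 else 0) \<partial>lborel\<bar> \<le> C1 * real_of_ereal (hit A x w)"
    using bounded_integral_interval[OF k r(2)] by (simp add: r(1))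
  show "\<bar>payoff A h0 h1 ((t, x), skel (\<lambda>t. B t w))\<bar> \<le> C0 + C1 * real_of_ereal (hit A x w)"
    unfolding payoff_skel[OF w A] using 1 h0 by (intro order_trans[OF abs_triangle_ineq add_mono]) auto
qed

lemma skel_payoff_measurable:
  assumes h0: "h0 \<in> borel_measurable borel" and h1: "h1 \<in> borel_measurable borel"
  shows "(\<lambda>w. payoff A h0 h1 (z, skel (\<lambda>t. B t w))) \<in> borel_measurable P"
  by (rule measurable_compose[OF _ payoff_measurable[OF assms]], intro borel_measurable_Pair skel_measurable) auto

lemma payoff_integrable:
  assumes A: "closed A" "A \<noteq> {}" and fin: "AE w in P. hit A x w \<noteq> \<infinity>"
    and int: "integrable P (\<lambda>w. real_of_ereal (hit A x w))"
    and h0: "h0 \<in> borel_measurable borel" "\<And>z. \<bar>h0 z\<bar> \<le> C0" and h1: "h1 \<in> borel_measurable borel" "\<And>z. \<bar>h1 z\<bar> \<le> C1"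
  shows "integrable P (\<lambda>w. payoff A h0 h1 ((t, x), skel (\<lambda>t. B t w)))"
proof (rule Bochner_Integration.integrable_bound)
  show "integrable P (\<lambda>w. C0 + C1 * real_of_ereal (hit A x w))"
    using int by (intro Bochner_Integration.integrable_add integrable_mult_right) auto
  show "AE w in P. norm (payoff A h0 h1 ((t, x), skel (\<lambda>t. B t w))) \<le> norm (C0 + C1 * real_of_ereal (hit A x w))"
    using fin AE_space
  proof eventually_elim
    case (elim w)
    from payoff_bound(2)[where t=t and ?h0.0=h0, OF elim(2) A elim(1) h0(2) h1] show ?case by simp
  qed
qed (rule skel_payoff_measurable[OF h0(1) h1(1)])

text \<open>Pathwise, the payoff splits at the exit from the ball into the source collected so far
  and the payoff of the restarted path; the strong Markov property turns the latter into the value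
  function at the exit state.\<close>

lemma one_step:
  assumes A: "closed A" "A \<noteq> {}" and fin: "AE w in P. hit A x w \<noteq> \<infinity>"
    and int: "integrable P (\<lambda>w. real_of_ereal (hit A x w))"
    and h0: "h0 \<in> borel_measurable borel" "\<And>z. \<bar>h0 z\<bar> \<le> C0" and h1: "h1 \<in> borel_measurable borel" "\<And>z. \<bar>h1 z\<bar> \<le> C1"
    and r: "0 < r" "ball x r \<inter> A = {}"
  shows "value_fn A h0 h1 (t, x) = expectation (\<lambda>w. value_fn A h0 h1 (t + ball_exit r w, x + B (ball_exit r w) w)) +
    expectation (\<lambda>w. \<integral>s. h1 (t + s, x + B s w) * indicator {0<..<ball_exit r w} s \<partial>lborel)"
proof -
  let ?Z = "ball_exit r"
  have st: "stopping ?Z" by (rule stopping_ball_exit[OF r(1)])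
  note Zm = stoppingD(1,3)[OF st]
  define G where "G p = payoff A h0 h1 ((t + fst (fst p), x + snd (fst p)), snd p)"
    for p :: "(real \<times> (real ^ 'n)) \<times> (nat \<Rightarrow> real ^ 'n)"
  define J where "J w = (\<integral>s. h1 (t + s, x + B s w) * indicator {0<..<?Z w} s \<partial>lborel)" for w
  have G: "G \<in> borel_measurable borel"
    unfolding G_def
    by (rule measurable_compose[OF _ payoff_measurable[OF h0(1) h1(1)]],
        intro borel_measurable_continuous_onI continuous_intros)
  have dec: "AE w in P. payoff A h0 h1 ((t, x), skel (\<lambda>t. B t w)) = G ((?Z w, B (?Z w) w), post ?Z w) + J w"
    using fin AE_space
  proof eventually_elim
    case (elim w)
    show ?case unfolding G_def J_def fst_conv snd_conv
    proof (rule path_continuation[OF elim(2) ball_exit_nonneg _ A elim(1) h1])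
      fix s assume "0 \<le> s" "s < ?Z w"
      then have "norm (B s w) < r" by (rule ball_exit_before[OF r(1) elim(2)])
      then have "x + B s w \<in> ball x r" by (simp add: dist_norm)
      then show "x + B s w \<notin> A" using r(2) by blast
    qed
  qed
  have Gm: "(\<lambda>w. G ((?Z w, B (?Z w) w), post ?Z w)) \<in> borel_measurable P"
    by (rule measurable_compose[OF stoppingD(5)[OF st] G])
  have kb: "\<bar>J w\<bar> \<le> C1 * ?Z w" if w: "w \<in> space P" for w
  proof -
    define k where "k s = h1 (t + s, x + path_at (skel (\<lambda>t. B t w)) s)" for s
    have k: "k \<in> borel_measurable borel" "\<bar>k s\<bar> \<le> C1" for s
    proof -
      show "k \<in> borel_measurable borel" unfolding k_def
        by (rule measurable_compose[OF _ h1(1)], intro borel_measurable_Pair borel_measurable_add path_at_measurable) auto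
      show "\<bar>k s\<bar> \<le> C1" unfolding k_def by (rule h1(2))
    qed
    have "J w = (\<integral>s. k s * indicator {0<..<?Z w} s \<partial>lborel)" unfolding J_def
      by (intro Bochner_Integration.integral_cong) (auto simp: indicator_def k_def path_at_skel[OF B_continuous[OF w]])
    then show ?thesis using bounded_integral_interval[OF k ball_exit_nonneg] by simp
  qed
  have Jm: "J \<in> borel_measurable P"
  proof -
    have pr: "fst \<in> measurable (P \<Otimes>\<^sub>M lborel) P" "snd \<in> borel_measurable (P \<Otimes>\<^sub>M lborel)" by measurable
    have "(\<lambda>q. h1 (t + snd q, x + path_at (skel (\<lambda>t. B t (fst q))) (snd q))) \<in> borel_measurable (P \<Otimes>\<^sub>M lborel)"
      by (rule measurable_compose[OF _ h1(1)], intro borel_measurable_Pair borel_measurable_add borel_measurable_const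
          path_at_measurable measurable_compose[OF pr(1) skel_measurable] pr(2))
    moreover have "(\<lambda>q. if 0 < snd q \<and> snd q < ?Z (fst q) then 1 else 0 :: real) \<in> borel_measurable (P \<Otimes>\<^sub>M lborel)"
    proof -
      note [measurable] = measurable_compose[OF pr(1) Zm(1)] pr(2)
      show ?thesis by measurable
    qed
    ultimately have "(\<lambda>q. h1 (t + snd q, x + path_at (skel (\<lambda>t. B t (fst q))) (snd q)) * (if 0 < snd q \<and> snd q < ?Z (fst q) then 1 else 0)) \<in> borel_measurable (P \<Otimes>\<^sub>M lborel)"
      by (rule borel_measurable_times)
    then have "(\<lambda>(w, s). h1 (t + s, x + path_at (skel (\<lambda>t. B t w)) s) * (if 0 < s \<and> s < ?Z w then 1 else 0)) \<in> borel_measurable (P \<Otimes>\<^sub>M lborel)"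
      by (simp only: case_prod_beta')
    then have "(\<lambda>w. \<integral>s. h1 (t + s, x + path_at (skel (\<lambda>t. B t w)) s) * (if 0 < s \<and> s < ?Z w then 1 else 0) \<partial>lborel) \<in> borel_measurable P"
      by (rule sigma_finite_measure.borel_measurable_lebesgue_integral[OF lborel.sigma_finite_measure_axioms])
    moreover have "J w = (\<integral>s. h1 (t + s, x + path_at (skel (\<lambda>t. B t w)) s) * (if 0 < s \<and> s < ?Z w then 1 else 0) \<partial>lborel)" if "w \<in> space P" for w
      unfolding J_def by (intro Bochner_Integration.integral_cong) (auto simp: indicator_def path_at_skel[OF B_continuous[OF that]])
    ultimately show ?thesis by (subst measurable_cong) auto
  qed
  have Ji: "integrable P J"
  proof (rule Bochner_Integration.integrable_bound[OF _ Jm])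
    show "integrable P (\<lambda>w. C1 * ?Z w)" using ball_exit_props(2)[OF r(1)] by (rule integrable_mult_right)
    show "AE w in P. norm (J w) \<le> norm (C1 * ?Z w)"
    proof (rule AE_I2)
      fix w assume "w \<in> space P"
      from kb[OF this] show "norm (J w) \<le> norm (C1 * ?Z w)" by simp
    qed
  qed
  note Pi = payoff_integrable[OF A fin int h0 h1, of t]
  have Gi: "integrable P (\<lambda>w. G ((?Z w, B (?Z w) w), post ?Z w))"
  proof (rule integrable_cong_AE_imp[OF Bochner_Integration.integrable_diff[OF Pi Ji] Gm])
    show "AE w in P. payoff A h0 h1 ((t, x), skel (\<lambda>t. B t w)) - J w = G ((?Z w, B (?Z w) w), post ?Z w)"
      using dec by eventually_elim simp
  qed
  have "value_fn A h0 h1 (t, x) = expectation (\<lambda>w. G ((?Z w, B (?Z w) w), post ?Z w) + J w)"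
    unfolding value_fn_eq[OF h0(1) h1(1)]
    by (rule integral_cong_AE[OF skel_payoff_measurable[OF h0(1) h1(1)] borel_measurable_add[OF Gm Jm] dec])
  also have "\<dots> = expectation (\<lambda>w. G ((?Z w, B (?Z w) w), post ?Z w)) + expectation J"
    by (rule Bochner_Integration.integral_add[OF Gi Ji])
  also have "expectation (\<lambda>w. G ((?Z w, B (?Z w) w), post ?Z w)) =
    expectation (\<lambda>w. value_fn A h0 h1 (t + ball_exit r w, x + B (ball_exit r w) w))"
    using strong_markov_integral(1)[OF st G Gi] by (simp only: G_def fst_conv snd_conv value_fn_eq[OF h0(1) h1(1)])
  finally show ?thesis unfolding J_def .
qed

end

subsection \<open>The occupation measure\<close>

context bm
begin

lemma unit_exit_time_eq: "unit_exit_time B w = hit {x. 1 \<le> norm x} 0 w"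
  by (simp add: unit_exit_time_def hitting_time_def first_hit_def)

definition occ_density :: "'w \<times> real \<Rightarrow> real" where
  "occ_density q = real CARD('n) * (if 0 < snd q \<and> ereal (snd q) < hit {x. 1 \<le> norm x} 0 (fst q) then 1 else 0)"

text \<open>Truncation makes every value lie in the cylinder over the unit ball, as a measurable map
  into the restricted space requires. Where it changes the point, \<open>occ_density\<close> is
  zero.\<close>

definition occ_point :: "'w \<times> real \<Rightarrow> real \<times> (real ^ 'n)" where
  "occ_point q = (max 0 (snd q), let b = path_at (skel (\<lambda>t. B t (fst q))) (max 0 (snd q)) in if norm b \<le> 1 then b else 0)"

lemma occ_density_measurable: "occ_density \<in> borel_measurable (P \<Otimes>\<^sub>M lborel)"
proof -
  have pr: "fst \<in> measurable (P \<Otimes>\<^sub>M lborel) P" "snd \<in> borel_measurable (P \<Otimes>\<^sub>M lborel)" by measurable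
  note [measurable] = measurable_compose[OF pr(1) hit_measurable[OF closed_outside_ball outside_ball_nonempty]] pr(2)
  show ?thesis unfolding occ_density_def[abs_def] by measurable
qed

lemma occ_point_measurable: "occ_point \<in> borel_measurable (P \<Otimes>\<^sub>M lborel)"
proof -
  have pr: "fst \<in> measurable (P \<Otimes>\<^sub>M lborel) P" "snd \<in> borel_measurable (P \<Otimes>\<^sub>M lborel)" by measurable
  have m: "(\<lambda>q :: 'w \<times> real. max 0 (snd q)) \<in> borel_measurable (P \<Otimes>\<^sub>M lborel)" using pr(2) by measurable
  have b: "(\<lambda>q. path_at (skel (\<lambda>t. B t (fst q))) (max 0 (snd q))) \<in> borel_measurable (P \<Otimes>\<^sub>M lborel)"
    by (intro path_at_measurable measurable_compose[OF pr(1) skel_measurable] m)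
  have "(\<lambda>b :: real ^ 'n. if norm b \<le> 1 then b else 0) \<in> borel_measurable borel" by measurable
  from measurable_compose[OF b this] m show ?thesis
    unfolding occ_point_def[abs_def] Let_def by (intro borel_measurable_Pair)
qed

lemma occ_point_eq:
  assumes w: "fst q \<in> space P" and q: "occ_density q \<noteq> 0"
  shows "occ_point q = (snd q, B (snd q) (fst q))"
proof -
  have s: "0 < snd q" "ereal (snd q) < hit {x. 1 \<le> norm x} 0 (fst q)"
    using q by (auto simp: occ_density_def split: if_splits)
  have "norm (B (snd q) (fst q)) \<le> 1"
    by (rule hit_outside_ball(1)[OF zero_less_one w]) (use s in auto)
  then show ?thesis using s
    by (simp add: occ_point_def path_at_skel[OF B_continuous[OF w]] Let_def)
qed

definition occ_law :: "(real \<times> (real ^ 'n)) measure" where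
  "occ_law = distr (density (P \<Otimes>\<^sub>M lborel) (\<lambda>q. ennreal (occ_density q))) (restrict_space borel ({0..} \<times> cball 0 1)) occ_point"

lemma occ_domain_sets: "({0..} \<times> cball 0 1 :: (real \<times> (real ^ 'n)) set) \<in> sets borel"
  by (intro borel_closed closed_Times) auto

lemma occ_point_measurable':
  "occ_point \<in> measurable (density (P \<Otimes>\<^sub>M lborel) (\<lambda>q. ennreal (occ_density q))) (restrict_space borel ({0..} \<times> cball 0 1))"
proof (rule measurable_restrict_space2)
  show "occ_point \<in> space (density (P \<Otimes>\<^sub>M lborel) (\<lambda>q. ennreal (occ_density q))) \<rightarrow> {0..} \<times> cball 0 1"
    by (auto simp: occ_point_def Let_def)
  show "occ_point \<in> borel_measurable (density (P \<Otimes>\<^sub>M lborel) (\<lambda>q. ennreal (occ_density q)))"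
    using occ_point_measurable by simp
qed

lemma occ_nn_integral:
  assumes f: "f \<in> borel_measurable borel"
  shows "(\<integral>\<^sup>+z. f z \<partial>occ_law) = (\<integral>\<^sup>+w. (\<integral>\<^sup>+s. ennreal (occ_density (w, s)) * f (s, B s w) \<partial>lborel) \<partial>P)"
proof -
  interpret PL: pair_sigma_finite P lborel ..
  have fp: "(\<lambda>q. f (occ_point q)) \<in> borel_measurable (P \<Otimes>\<^sub>M lborel)"
    by (rule measurable_compose[OF occ_point_measurable f])
  have f': "f \<in> borel_measurable (restrict_space borel ({0..} \<times> cball 0 1))"
    using f by (rule measurable_restrict_space1)
  have "(\<integral>\<^sup>+z. f z \<partial>occ_law) = (\<integral>\<^sup>+q. f (occ_point q) \<partial>density (P \<Otimes>\<^sub>M lborel) (\<lambda>q. ennreal (occ_density q)))"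
    unfolding occ_law_def by (rule nn_integral_distr[OF occ_point_measurable']) (use f' in simp)
  also have "\<dots> = (\<integral>\<^sup>+q. ennreal (occ_density q) * f (occ_point q) \<partial>(P \<Otimes>\<^sub>M lborel))"
    by (rule nn_integral_density[OF _ fp]) (use occ_density_measurable in measurable)
  also have "\<dots> = (\<integral>\<^sup>+w. (\<integral>\<^sup>+s. ennreal (occ_density (w, s)) * f (occ_point (w, s)) \<partial>lborel) \<partial>P)"
    by (rule lborel.nn_integral_fst[symmetric]) (use fp occ_density_measurable in measurable)
  also have "\<dots> = (\<integral>\<^sup>+w. (\<integral>\<^sup>+s. ennreal (occ_density (w, s)) * f (s, B s w) \<partial>lborel) \<partial>P)"
  proof (rule nn_integral_cong, rule nn_integral_cong)
    fix w s assume "w \<in> space P"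
    then show "ennreal (occ_density (w, s)) * f (occ_point (w, s)) = ennreal (occ_density (w, s)) * f (s, B s w)"
      using occ_point_eq[of "(w, s)"] by (cases "occ_density (w, s) = 0") auto
  qed
  finally show ?thesis .
qed

text \<open>A measure given by \<open>measure_of\<close> has the prescribed values only if the
  prescription is countably additive. Identifying it with an image measure settles this and makes
  its integrals computable.\<close>

lemma occupation_measure_eq: "occupation_measure P B = occ_law"
proof -
  let ?\<Omega> = "{0..} \<times> cball 0 1 :: (real \<times> (real ^ 'n)) set"
  let ?R = "restrict_space borel ?\<Omega>"
  have spR: "space ?R = ?\<Omega>" by (simp add: space_restrict_space)
  have "occupation_measure P B = measure_of ?\<Omega> (sets ?R) (emeasure occ_law)"
    unfolding occupation_measure_def
  proof (rule measure_of_eq)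
    show "sets ?R \<subseteq> Pow ?\<Omega>" using sets.space_closed[of ?R] by (simp only: spR)
    fix A assume "A \<in> sigma_sets ?\<Omega> (sets ?R)"
    then have A: "A \<in> sets ?R" using sets.sigma_sets_eq[of ?R] by (simp only: spR)
    then have Ab: "A \<in> sets borel" using sets_restrict_space_iff[of ?\<Omega> borel A] occ_domain_sets by auto
    have "emeasure occ_law A = (\<integral>\<^sup>+z. indicator A z \<partial>occ_law)"
      using A by (intro nn_integral_indicator[symmetric]) (simp add: occ_law_def)
    also have "\<dots> = (\<integral>\<^sup>+w. (\<integral>\<^sup>+s. ennreal (occ_density (w, s)) * indicator A (s, B s w) \<partial>lborel) \<partial>P)"
      using Ab by (intro occ_nn_integral) auto
    also have "\<dots> = (\<integral>\<^sup>+w. of_nat CARD('n) * (\<integral>\<^sup>+s\<in>einterval 0 (unit_exit_time B w). indicator A (s, B s w) \<partial>lborel) \<partial>P)"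
    proof (rule nn_integral_cong)
      fix w assume w: "w \<in> space P"
      let ?g = "\<lambda>s. indicator A (s, B s w) * indicator (einterval 0 (unit_exit_time B w)) s :: ennreal"
      have g: "?g \<in> borel_measurable lborel"
      proof -
        have "(\<lambda>s. (s, path_at (skel (\<lambda>t. B t w)) s)) \<in> borel_measurable borel"
          by (intro borel_measurable_Pair path_at_measurable) auto
        from measurable_compose[OF this borel_measurable_indicator[OF Ab]]
        have "(\<lambda>s. indicator A (s, path_at (skel (\<lambda>t. B t w)) s) * indicator (einterval 0 (unit_exit_time B w)) s :: ennreal) \<in> borel_measurable borel"
          by (intro borel_measurable_times_ennreal) auto
        also have "(\<lambda>s. indicator A (s, path_at (skel (\<lambda>t. B t w)) s) * indicator (einterval 0 (unit_exit_time B w)) s :: ennreal) = ?g"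
          by (rule ext) (auto simp: indicator_def einterval_def path_at_skel[OF B_continuous[OF w]] zero_ereal_def)
        finally show ?thesis by simp
      qed
      have "(\<integral>\<^sup>+s. ennreal (occ_density (w, s)) * indicator A (s, B s w) \<partial>lborel) = (\<integral>\<^sup>+s. of_nat CARD('n) * ?g s \<partial>lborel)"
        by (intro nn_integral_cong)
           (auto simp: occ_density_def indicator_def einterval_def unit_exit_time_eq zero_ereal_def ennreal_of_nat_eq_real_of_nat)
      also have "\<dots> = of_nat CARD('n) * (\<integral>\<^sup>+s. ?g s \<partial>lborel)" by (rule nn_integral_cmult[OF g])
      finally show "(\<integral>\<^sup>+s. ennreal (occ_density (w, s)) * indicator A (s, B s w) \<partial>lborel) =
        of_nat CARD('n) * (\<integral>\<^sup>+s\<in>einterval 0 (unit_exit_time B w). indicator A (s, B s w) \<partial>lborel)" .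
    qed
    also have "\<dots> = of_nat CARD('n) * (\<integral>\<^sup>+w. (\<integral>\<^sup>+s\<in>einterval 0 (unit_exit_time B w). indicator A (s, B s w) \<partial>lborel) \<partial>P)"
    proof (rule nn_integral_cmult)
      have "(\<lambda>q. indicator A (occ_point q) * (if 0 < snd q \<and> ereal (snd q) < hit {x. 1 \<le> norm x} 0 (fst q) then 1 else 0) :: ennreal) \<in> borel_measurable (P \<Otimes>\<^sub>M lborel)"
      proof (rule borel_measurable_times_ennreal[OF measurable_compose[OF occ_point_measurable borel_measurable_indicator[OF Ab]]])
        have pr: "fst \<in> measurable (P \<Otimes>\<^sub>M lborel) P" "snd \<in> borel_measurable (P \<Otimes>\<^sub>M lborel)" by measurable
        note [measurable] = measurable_compose[OF pr(1) hit_measurable[OF closed_outside_ball outside_ball_nonempty]] pr(2)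
        show "(\<lambda>q. (if 0 < snd q \<and> ereal (snd q) < hit {x. 1 \<le> norm x} 0 (fst q) then 1 else 0) :: ennreal) \<in> borel_measurable (P \<Otimes>\<^sub>M lborel)" by measurable
      qed
      from lborel.borel_measurable_nn_integral_fst[OF this]
      have "(\<lambda>w. \<integral>\<^sup>+s. indicator A (occ_point (w, s)) * (if 0 < s \<and> ereal s < hit {x. 1 \<le> norm x} 0 w then 1 else 0) \<partial>lborel) \<in> borel_measurable P" by simp
      also have "?this \<longleftrightarrow> (\<lambda>w. \<integral>\<^sup>+s\<in>einterval 0 (unit_exit_time B w). indicator A (s, B s w) \<partial>lborel) \<in> borel_measurable P"
      proof (rule measurable_cong, rule nn_integral_cong)
        fix w s assume "w \<in> space P"
        then show "indicator A (occ_point (w, s)) * (if 0 < s \<and> ereal s < hit {x. 1 \<le> norm x} 0 w then 1 else 0) =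
          indicator A (s, B s w) * (indicator (einterval 0 (unit_exit_time B w)) s :: ennreal)"
          using occ_point_eq[of "(w, s)"] by (auto simp: occ_density_def indicator_def einterval_def unit_exit_time_eq zero_ereal_def)
      qed
      finally show "(\<lambda>w. \<integral>\<^sup>+s\<in>einterval 0 (unit_exit_time B w). indicator A (s, B s w) \<partial>lborel) \<in> borel_measurable P" .
    qed
    finally show "of_nat CARD('n) * (\<integral>\<^sup>+w. (\<integral>\<^sup>+s\<in>einterval 0 (unit_exit_time B w). indicator A (s, B s w) \<partial>lborel) \<partial>P) = emeasure occ_law A" ..
  qed
  also have "\<dots> = measure_of (space occ_law) (sets occ_law) (emeasure occ_law)"
    by (simp add: occ_law_def space_restrict_space)
  also have "\<dots> = occ_law" by (rule measure_of_of_measure)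
  finally show ?thesis .
qed

lemma sets_occ_law: "sets occ_law = sets (restrict_space borel ({0..} \<times> cball 0 1))"
  by (simp add: occ_law_def)

text \<open>The mean is \<open>CARD('n)\<close> times the expected integral of \<open>s\<close> up
  to the unit exit, and \<open>hit_second_moment\<close> with \<open>R = 1\<close> bounds that
  integral by \<open>(1 / CARD('n))\<^sup>2\<close>.\<close>

lemma occ_law_time_mean: "(\<integral>\<^sup>+z. ennreal (fst z) \<partial>occ_law) \<le> ennreal (1 / CARD('n))"
proof -
  let ?A = "{x :: real ^ 'n. 1 \<le> norm x}"
  have "(\<lambda>z. ennreal (fst z)) \<in> borel_measurable (borel :: (real \<times> (real ^ 'n)) measure)"
  proof -
    have "fst \<in> borel_measurable (borel :: (real \<times> (real ^ 'n)) measure)"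
      by (intro borel_measurable_continuous_onI continuous_intros)
    then show ?thesis by measurable
  qed
  then have "(\<integral>\<^sup>+z. ennreal (fst z) \<partial>occ_law) = (\<integral>\<^sup>+w. (\<integral>\<^sup>+s. ennreal (occ_density (w, s)) * ennreal s \<partial>lborel) \<partial>P)"
    using occ_nn_integral[of "\<lambda>z. ennreal (fst z)"] by simp
  also have "\<dots> = (\<integral>\<^sup>+w. ennreal CARD('n) * (\<integral>\<^sup>+s. ennreal s * indicator {0<..<ball_exit 1 w} s \<partial>lborel) \<partial>P)"
  proof (rule nn_integral_cong_AE)
    show "AE w in P. (\<integral>\<^sup>+s. ennreal (occ_density (w, s)) * ennreal s \<partial>lborel) =
      ennreal CARD('n) * (\<integral>\<^sup>+s. ennreal s * indicator {0<..<ball_exit 1 w} s \<partial>lborel)"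
      using ball_exit_props(1)[OF zero_less_one] AE_space
    proof eventually_elim
      case (elim w)
      note eq = ball_exit_finite(1)[OF zero_less_one elim(2,1)]
      have "(\<integral>\<^sup>+s. ennreal (occ_density (w, s)) * ennreal s \<partial>lborel) = (\<integral>\<^sup>+s. ennreal CARD('n) * (ennreal s * indicator {0<..<ball_exit 1 w} s) \<partial>lborel)"
        by (intro nn_integral_cong) (auto simp: occ_density_def eq indicator_def)
      also have "\<dots> = ennreal CARD('n) * (\<integral>\<^sup>+s. ennreal s * indicator {0<..<ball_exit 1 w} s \<partial>lborel)"
        by (rule nn_integral_cmult) measurable
      finally show ?case .
    qed
  qed
  also have "\<dots> \<le> ennreal CARD('n) * (\<integral>\<^sup>+w. (\<integral>\<^sup>+s. ennreal s * indicator {0<..<ball_exit 1 w} s \<partial>lborel) \<partial>P)"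
  proof -
    note [measurable] = stoppingD(1)[OF stopping_ball_exit[OF zero_less_one]]
    have "(\<lambda>w. \<integral>\<^sup>+s. ennreal s * indicator {0<..<ball_exit 1 w} s \<partial>lborel) \<in> borel_measurable P"
      by (rule lborel.borel_measurable_nn_integral)
         (simp add: greaterThanLessThan_def greaterThan_def lessThan_def indicator_def cong: if_cong)
    then show ?thesis by (simp add: nn_integral_cmult)
  qed
  also have "\<dots> \<le> ennreal CARD('n) * ennreal ((1\<^sup>2 / CARD('n))\<^sup>2)"
    unfolding ball_exit_def
    by (intro mult_left_mono hit_second_moment[OF closed_outside_ball outside_ball_nonempty hit_outside_ball(1)[OF zero_less_one]]) auto
  also have "\<dots> = ennreal (1 / CARD('n))"
    by (simp add: ennreal_mult[symmetric] power2_eq_square)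
  finally show ?thesis .
qed

text \<open>The signed counterpart of \<open>occ_nn_integral\<close>. Integrability holds because
  the total mass is \<open>CARD('n)\<close> times the finite mean exit time.\<close>

lemma occ_integral:
  assumes f: "f \<in> borel_measurable borel" "\<And>z. \<bar>f z\<bar> \<le> C"
  shows "(\<integral>z. f z \<partial>occ_law) = real CARD('n) * expectation (\<lambda>w. \<integral>s. f (s, B s w) * indicator {0<..<ball_exit 1 w} s \<partial>lborel)"
proof -
  interpret PL: pair_sigma_finite P lborel ..
  have dn: "0 \<le> occ_density q" for q by (simp add: occ_density_def)
  have C: "0 \<le> C" using f(2)[of undefined] by simp
  note [measurable] = occ_density_measurable
  have fp[measurable]: "(\<lambda>q. f (occ_point q)) \<in> borel_measurable (P \<Otimes>\<^sub>M lborel)"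
    by (rule measurable_compose[OF occ_point_measurable f(1)])
  have id: "integrable (P \<Otimes>\<^sub>M lborel) occ_density"
  proof (rule integrableI_nonneg)
    have "(\<integral>\<^sup>+q. ennreal (occ_density q) \<partial>(P \<Otimes>\<^sub>M lborel)) = (\<integral>\<^sup>+w. (\<integral>\<^sup>+s. ennreal (occ_density (w, s)) \<partial>lborel) \<partial>P)"
      by (rule lborel.nn_integral_fst[symmetric]) measurable
    also have "\<dots> = (\<integral>\<^sup>+w. ennreal (CARD('n) * ball_exit 1 w) \<partial>P)"
    proof (rule nn_integral_cong_AE)
      show "AE w in P. (\<integral>\<^sup>+s. ennreal (occ_density (w, s)) \<partial>lborel) = ennreal (CARD('n) * ball_exit 1 w)"
        using ball_exit_props(1)[OF zero_less_one] AE_space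
      proof eventually_elim
        case (elim w)
        note eq = ball_exit_finite(1)[OF zero_less_one elim(2,1)]
        have "(\<integral>\<^sup>+s. ennreal (occ_density (w, s)) \<partial>lborel) = (\<integral>\<^sup>+s. ennreal CARD('n) * indicator {0<..<ball_exit 1 w} s \<partial>lborel)"
          by (intro nn_integral_cong) (auto simp: occ_density_def eq indicator_def)
        also have "\<dots> = ennreal CARD('n) * ennreal (ball_exit 1 w)"
          by (subst nn_integral_cmult) (auto simp: ball_exit_nonneg)
        finally show ?case by (simp add: ennreal_mult[symmetric] ball_exit_nonneg)
      qed
    qed
    also have "\<dots> = ennreal (expectation (\<lambda>w. CARD('n) * ball_exit 1 w))"
      by (rule nn_integral_eq_integral[OF integrable_mult_right[OF ball_exit_props(2)[OF zero_less_one]]])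
         (simp add: ball_exit_nonneg)
    finally show "(\<integral>\<^sup>+q. ennreal (occ_density q) \<partial>(P \<Otimes>\<^sub>M lborel)) < \<infinity>" by simp
  qed (auto simp: dn)
  have ii: "integrable (P \<Otimes>\<^sub>M lborel) (\<lambda>q. occ_density q *\<^sub>R f (occ_point q))"
  proof (rule Bochner_Integration.integrable_bound[OF integrable_mult_right[OF id, of C]])
    have "\<bar>occ_density q * f (occ_point q)\<bar> \<le> C * occ_density q" for q
      using mult_left_mono[OF f(2)[of "occ_point q"] dn[of q]] dn[of q] by (simp add: abs_mult mult.commute)
    then show "AE q in P \<Otimes>\<^sub>M lborel. norm (occ_density q *\<^sub>R f (occ_point q)) \<le> norm (C * occ_density q)"
      using C dn by (intro AE_I2) (auto simp: abs_mult)
  qed measurable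
  have f': "f \<in> borel_measurable (restrict_space borel ({0..} \<times> cball 0 1))"
    using f(1) by (rule measurable_restrict_space1)
  have "(\<integral>z. f z \<partial>occ_law) = (\<integral>q. f (occ_point q) \<partial>density (P \<Otimes>\<^sub>M lborel) (\<lambda>q. ennreal (occ_density q)))"
    unfolding occ_law_def by (rule integral_distr[OF occ_point_measurable' f'])
  also have "\<dots> = (\<integral>q. occ_density q *\<^sub>R f (occ_point q) \<partial>(P \<Otimes>\<^sub>M lborel))"
    by (rule integral_density[OF fp occ_density_measurable]) (simp add: dn)
  also have "\<dots> = (\<integral>w. (\<integral>s. occ_density (w, s) *\<^sub>R f (occ_point (w, s)) \<partial>lborel) \<partial>P)"
    by (rule PL.integral_fst'[OF ii, symmetric])
  also have "\<dots> = (\<integral>w. real CARD('n) * (\<integral>s. f (s, B s w) * indicator {0<..<ball_exit 1 w} s \<partial>lborel) \<partial>P)"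
  proof (rule Bochner_Integration.integral_cong_AE)
    have m1: "(\<lambda>w. \<integral>s. occ_density (w, s) *\<^sub>R f (occ_point (w, s)) \<partial>lborel) \<in> borel_measurable P"
      by (rule borel_measurable_integrable[OF PL.integrable_fst'[OF ii]])
    then show "(\<lambda>w. \<integral>s. occ_density (w, s) *\<^sub>R f (occ_point (w, s)) \<partial>lborel) \<in> borel_measurable P" .
    have pr: "fst \<in> measurable (P \<Otimes>\<^sub>M lborel) P" "snd \<in> borel_measurable (P \<Otimes>\<^sub>M lborel)" by measurable
    note [measurable] = measurable_compose[OF pr(1) stoppingD(1)[OF stopping_ball_exit[OF zero_less_one]]] pr(2)
    have "(\<lambda>q. f (occ_point q) * (if 0 < snd q \<and> snd q < ball_exit 1 (fst q) then 1 else 0)) \<in> borel_measurable (P \<Otimes>\<^sub>M lborel)"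
      by measurable
    then have "(\<lambda>(w, s). f (occ_point (w, s)) * (if 0 < s \<and> s < ball_exit 1 w then 1 else 0)) \<in> borel_measurable (P \<Otimes>\<^sub>M lborel)"
      by (simp add: case_prod_beta')
    then have m2: "(\<lambda>w. \<integral>s. f (occ_point (w, s)) * (if 0 < s \<and> s < ball_exit 1 w then 1 else 0) \<partial>lborel) \<in> borel_measurable P"
      by (rule sigma_finite_measure.borel_measurable_lebesgue_integral[OF lborel.sigma_finite_measure_axioms])
    have eq2: "(\<integral>s. f (occ_point (w, s)) * (if 0 < s \<and> s < ball_exit 1 w then 1 else 0) \<partial>lborel) =
      (\<integral>s. f (s, B s w) * indicator {0<..<ball_exit 1 w} s \<partial>lborel)" if w: "w \<in> space P" for w
    proof (rule Bochner_Integration.integral_cong[OF refl])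
      fix s
      show "f (occ_point (w, s)) * (if 0 < s \<and> s < ball_exit 1 w then 1 else 0) = f (s, B s w) * indicator {0<..<ball_exit 1 w} s"
      proof (cases "0 < s \<and> s < ball_exit 1 w")
        case True
        then have "norm (B s w) < 1" by (intro ball_exit_before[OF zero_less_one w]) auto
        then have "occ_point (w, s) = (s, B s w)"
          using True by (simp add: occ_point_def Let_def path_at_skel[OF B_continuous[OF w]])
        then show ?thesis using True by simp
      qed (auto simp: indicator_def)
    qed
    have "(\<lambda>w. \<integral>s. f (s, B s w) * indicator {0<..<ball_exit 1 w} s \<partial>lborel) \<in> borel_measurable P"
      using m2 by (subst (asm) measurable_cong[OF eq2]) auto
    then show "(\<lambda>w. real CARD('n) * (\<integral>s. f (s, B s w) * indicator {0<..<ball_exit 1 w} s \<partial>lborel)) \<in> borel_measurable P"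
      by (intro borel_measurable_times) auto
    show "AE w in P. (\<integral>s. occ_density (w, s) *\<^sub>R f (occ_point (w, s)) \<partial>lborel) =
      real CARD('n) * (\<integral>s. f (s, B s w) * indicator {0<..<ball_exit 1 w} s \<partial>lborel)"
      using ball_exit_props(1)[OF zero_less_one] AE_space
    proof eventually_elim
      case (elim w)
      note eq = ball_exit_finite(1)[OF zero_less_one elim(2,1)]
      have "(\<integral>s. occ_density (w, s) *\<^sub>R f (occ_point (w, s)) \<partial>lborel) =
        (\<integral>s. real CARD('n) * (f (occ_point (w, s)) * (if 0 < s \<and> s < ball_exit 1 w then 1 else 0)) \<partial>lborel)"
        by (intro Bochner_Integration.integral_cong) (auto simp: occ_density_def eq)
      then show ?case using eq2[OF elim(2)] by simp
    qed
  qed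
  finally show ?thesis by simp
qed

end

subsection \<open>Brownian motion in a convex domain\<close>

locale bm_domain = bm P B for P :: "'w measure" and B :: "real \<Rightarrow> 'w \<Rightarrow> real ^ 'n" +
  fixes D :: "(real ^ 'n) set"
  assumes D_nonempty: "D \<noteq> {}" and D_open: "open D" and D_bounded: "bounded D" and D_convex: "convex D"
begin

lemma frontier_closed: "closed (frontier D)" by simp

lemma frontier_nonempty: "frontier D \<noteq> {}"
  using D_nonempty D_bounded not_bounded_UNIV unfolding frontier_eq_empty by auto

lemma closure_cases: "x \<in> closure D \<Longrightarrow> x \<in> D \<or> x \<in> frontier D"
  using D_open by (auto simp: frontier_def interior_open)

lemma frontier_disjoint: "x \<in> D \<Longrightarrow> x \<notin> frontier D"
  using D_open by (auto simp: frontier_def interior_open)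

lemma dist_le_diameter: "x \<in> closure D \<Longrightarrow> y \<in> closure D \<Longrightarrow> norm (x - y) \<le> diameter D"
  using diameter_bounded_bound[of "closure D" x y] D_bounded by (simp add: diameter_closure dist_norm bounded_closure)

lemma diameter_pos: "0 < diameter D"
proof -
  obtain x r where x: "x \<in> D" "0 < r" "cball x r \<subseteq> D"
    using D_nonempty D_open open_contains_cball by (metis ex_in_conv)
  obtain y :: "real ^ 'n" where y: "norm y = r" using vector_choose_size[of r] x(2) by auto
  then have "x + y \<in> D" using x(3) by (auto simp: dist_norm)
  then have "norm (x + y - x) \<le> diameter D"
    using x(1) closure_subset[of D] by (intro dist_le_diameter) auto
  then show ?thesis using y x(2) by simp
qed

abbreviation exit_time :: "real ^ 'n \<Rightarrow> 'w \<Rightarrow> ereal" where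
  "exit_time x w \<equiv> hit (frontier D) x w"

definition tau :: "real ^ 'n \<Rightarrow> 'w \<Rightarrow> real" where
  "tau x w = real_of_ereal (exit_time x w)"

lemma tau_nonneg: "0 \<le> tau x w"
  unfolding tau_def using first_hit_nonneg by (intro real_of_ereal_pos)

text \<open>The path up to \<open>u\<close> is connected, so it cannot reach the outside without
  meeting the frontier.\<close>

lemma exit_inside:
  assumes x: "x \<in> D" and w: "w \<in> space P" and u: "0 \<le> u" "ereal u < exit_time x w"
  shows "x + B u w \<in> D"
proof (rule ccontr)
  assume out: "x + B u w \<notin> D"
  let ?S = "(\<lambda>v. x + B v w) ` {0..u}"
  have "connected ?S"
  proof (rule connected_continuous_image)
    show "continuous_on {0..u} (\<lambda>v. x + B v w)"
      by (intro continuous_intros continuous_on_subset[OF B_continuous[OF w]]) auto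
  qed simp
  moreover have "x \<in> ?S" using B_0[OF w] u(1) by (intro image_eqI[of _ _ 0]) auto
  moreover have "x + B u w \<in> ?S" using u(1) by auto
  ultimately have "?S \<inter> frontier D \<noteq> {}"
    using x out by (intro connected_Int_frontier) auto
  then obtain v where v: "0 \<le> v" "v \<le> u" "x + B v w \<in> frontier D" by auto
  then have "exit_time x w \<le> ereal v" by (intro first_hit_le) auto
  also have "\<dots> \<le> ereal u" using v by simp
  finally show False using u(2) by simp
qed

lemma exit_stays:
  assumes x: "x \<in> closure D" and w: "w \<in> space P" and s: "0 \<le> s" "ereal s \<le> exit_time x w"
  shows "x + B s w \<in> closure D"
proof (cases "x \<in> D")
  case True
  show ?thesis
  proof (rule limit_point_in_closure[where g="\<lambda>u. x + B u w", OF _ s(1)])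
    show "continuous_on {0..} (\<lambda>u. x + B u w)" by (intro continuous_intros B_continuous[OF w])
    show "x + B 0 w \<in> closure D" using x B_0[OF w] by simp
    fix u assume u: "0 \<le> u" "u < s"
    then have "ereal u < ereal s" by simp
    then have "ereal u < exit_time x w" using s(2) by (rule less_le_trans)
    then show "x + B u w \<in> D" by (rule exit_inside[OF True w u(1)])
  qed
next
  case False
  then have "x + B 0 w \<in> frontier D" using closure_cases[OF x] B_0[OF w] by simp
  then have "exit_time x w \<le> ereal 0" by (intro first_hit_le) auto
  with s have "s = 0" by (metis ereal_less_eq(3) order.trans order_antisym)
  then show ?thesis using x B_0[OF w] by simp
qed

lemma exit_norm:
  assumes x: "x \<in> closure D" and w: "w \<in> space P" and s: "0 \<le> s" "ereal s \<le> exit_time x w"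
  shows "norm (B s w) \<le> diameter D"
  using dist_le_diameter[OF exit_stays[OF assms] x] by simp

lemma tau_facts:
  assumes x: "x \<in> closure D"
  shows "AE w in P. exit_time x w \<noteq> \<infinity>" "integrable P (tau x)" "expectation (tau x) \<le> (diameter D)\<^sup>2 / CARD('n)"
  unfolding tau_def[abs_def]
  by (rule hit_ball[OF frontier_closed frontier_nonempty exit_norm[OF x]]; assumption)+

text \<open>In direction \<open>e\<close> the path can rise by at most
  \<open>S - e \<bullet> x\<close> before leaving and can fall by at most the diameter, so
  \<open>hit_slab\<close> applies. Small values of \<open>S - e \<bullet> x\<close> give the decay
  near the boundary.\<close>

lemma tau_slab:
  assumes x: "x \<in> closure D" and e: "norm e = 1" and S: "\<And>z. z \<in> D \<Longrightarrow> e \<bullet> z \<le> S"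
  shows "expectation (tau x) \<le> diameter D * (S - e \<bullet> x)" "0 \<le> S - e \<bullet> x"
proof -
  have "closure D \<subseteq> {z. e \<bullet> z \<le> S}"
    using S by (intro closure_minimal closed_Collect_le continuous_intros) auto
  then have S': "e \<bullet> z \<le> S" if "z \<in> closure D" for z using that by auto
  then show nn: "0 \<le> S - e \<bullet> x" using x by simp
  show "expectation (tau x) \<le> diameter D * (S - e \<bullet> x)"
    unfolding tau_def[abs_def]
  proof (rule hit_expectation_limit(3)[OF frontier_closed frontier_nonempty])
    show "0 \<le> diameter D * (S - e \<bullet> x)" using nn diameter_pos by simp
    fix t :: real assume t: "0 \<le> t"
    have "expectation (\<lambda>w. real_of_ereal (min (exit_time x w) (ereal t))) \<le> (S - e \<bullet> x) * diameter D"
    proof (rule hit_slab[OF frontier_closed frontier_nonempty e _ t])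
      fix w s assume w: "w \<in> space P" and s: "0 \<le> s" "ereal s \<le> exit_time x w"
      have "e \<bullet> (x + B s w) \<le> S" by (rule S'[OF exit_stays[OF x w s]])
      moreover have "\<bar>e \<bullet> B s w\<bar> \<le> norm e * norm (B s w)" by (rule Cauchy_Schwarz_ineq2)
      moreover have "norm (B s w) \<le> diameter D" by (rule exit_norm[OF x w s])
      ultimately show "e \<bullet> B s w \<le> S - e \<bullet> x \<and> - diameter D \<le> e \<bullet> B s w"
        using e by (auto simp: inner_add_right)
    qed
    then show "expectation (\<lambda>w. real_of_ereal (min (exit_time x w) (ereal t))) \<le> diameter D * (S - e \<bullet> x)"
      by (simp only: mult.commute)
  qed
qed

text \<open>Nonnegative variance bounds the mean norm by the root of the mean squared norm.\<close>

lemma tau_norm: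
  assumes x: "x \<in> closure D"
  shows "expectation (\<lambda>w. norm (B (tau x w) w)) \<le> sqrt (CARD('n) * expectation (tau x))"
    "integrable P (\<lambda>w. norm (B (tau x w) w))"
proof -
  have a1: "expectation (\<lambda>w. (norm (B (tau x w) w))\<^sup>2) \<le> CARD('n) * expectation (tau x)"
    unfolding tau_def[abs_def] by (rule hit_norm_sq(1)[OF frontier_closed frontier_nonempty exit_norm[OF x]])
  have a2: "integrable P (\<lambda>w. (norm (B (tau x w) w))\<^sup>2)"
    unfolding tau_def[abs_def] by (rule hit_norm_sq(2)[OF frontier_closed frontier_nonempty exit_norm[OF x]])
  show a3: "integrable P (\<lambda>w. norm (B (tau x w) w))"
    unfolding tau_def[abs_def] by (rule hit_norm_sq(3)[OF frontier_closed frontier_nonempty exit_norm[OF x]])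
  have "0 \<le> variance (\<lambda>w. norm (B (tau x w) w))" by simp
  also have "\<dots> = expectation (\<lambda>w. (norm (B (tau x w) w))\<^sup>2) - (expectation (\<lambda>w. norm (B (tau x w) w)))\<^sup>2"
    by (rule variance_eq[OF a3 a2])
  finally show "expectation (\<lambda>w. norm (B (tau x w) w)) \<le> sqrt (CARD('n) * expectation (tau x))"
    using a1 by (intro real_le_rsqrt) simp
qed

lemma tau_stopping: "x \<in> closure D \<Longrightarrow> stopping (tau x)"
  unfolding tau_def[abs_def] by (rule stopping_hit[OF frontier_closed frontier_nonempty tau_facts(1)])

lemma tau_frontier:
  assumes x: "x \<in> closure D" and w: "w \<in> space P" and fin: "exit_time x w \<noteq> \<infinity>"
  shows "x + B (tau x w) w \<in> frontier D" "exit_time x w = ereal (tau x w)"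
proof -
  obtain t where t: "0 \<le> t" "x + B t w \<in> frontier D" "exit_time x w = ereal t"
    by (rule first_hit_attained[OF B_continuous[OF w] frontier_closed fin]) (rule that)
  then show "x + B (tau x w) w \<in> frontier D" "exit_time x w = ereal (tau x w)" by (simp_all add: tau_def)
qed

lemma tau_in_closure:
  assumes x: "x \<in> closure D" and w: "w \<in> space P"
  shows "x + B (tau x w) w \<in> closure D"
proof (cases "exit_time x w = \<infinity>")
  \<comment> \<open>An infinite exit time is read as \<open>0\<close>, and the path starts at
    \<open>x\<close>.\<close>
  case True
  then have "tau x w = 0" by (simp add: tau_def)
  then show ?thesis using x B_0[OF w] by simp
next
  case False
  then show ?thesis using tau_frontier[OF x w False] by (simp add: frontier_def)
qed

context
  fixes h0 h1 :: "real \<times> (real ^ 'n) \<Rightarrow> real" and C0 C1 :: real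
  assumes h0: "h0 \<in> borel_measurable borel" "\<And>z. \<bar>h0 z\<bar> \<le> C0"
    and h1: "h1 \<in> borel_measurable borel" "\<And>z. \<bar>h1 z\<bar> \<le> C1"
begin

abbreviation running :: "real \<Rightarrow> real ^ 'n \<Rightarrow> 'w \<Rightarrow> real" where
  "running t x w \<equiv> (\<integral>s. h1 (t + s, x + B s w) * (if 0 < s \<and> ereal s < exit_time x w then 1 else 0) \<partial>lborel)"

lemma value_fn_split:
  assumes x: "x \<in> closure D"
  shows "integrable P (\<lambda>w. h0 (t + tau x w, x + B (tau x w) w))" "integrable P (running t x)"
    "value_fn (frontier D) h0 h1 (t, x) = expectation (\<lambda>w. h0 (t + tau x w, x + B (tau x w) w)) + expectation (running t x)"
proof -
  note st = stoppingD(1,3)[OF tau_stopping[OF x]]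
  have pe: "payoff (frontier D) h0 h1 ((t, x), skel (\<lambda>t. B t w)) = h0 (t + tau x w, x + B (tau x w) w) + running t x w"
    if "w \<in> space P" for w
    unfolding tau_def by (rule payoff_skel[OF that frontier_closed frontier_nonempty])
  have "(\<lambda>w. h0 (t + tau x w, x + B (tau x w) w)) \<in> borel_measurable P"
    by (rule measurable_compose[OF _ h0(1)], intro borel_measurable_Pair borel_measurable_add borel_measurable_const st)
  then show i0: "integrable P (\<lambda>w. h0 (t + tau x w, x + B (tau x w) w))"
    using h0(2) by (intro integrable_const_bound[where B=C0]) auto
  have Pi: "integrable P (\<lambda>w. payoff (frontier D) h0 h1 ((t, x), skel (\<lambda>t. B t w)))"
    by (rule payoff_integrable[OF frontier_closed frontier_nonempty tau_facts(1)[OF x] tau_facts(2)[OF x, unfolded tau_def] h0 h1])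
  have "integrable P (\<lambda>w. payoff (frontier D) h0 h1 ((t, x), skel (\<lambda>t. B t w)) - h0 (t + tau x w, x + B (tau x w) w))"
    by (rule Bochner_Integration.integrable_diff[OF Pi i0])
  also have "?this \<longleftrightarrow> integrable P (running t x)"
    using pe by (intro Bochner_Integration.integrable_cong) auto
  finally show i1: "integrable P (running t x)" .
  have "value_fn (frontier D) h0 h1 (t, x) = expectation (\<lambda>w. h0 (t + tau x w, x + B (tau x w) w) + running t x w)"
    unfolding value_fn_eq[OF h0(1) h1(1)] using pe by (intro Bochner_Integration.integral_cong) auto
  also have "\<dots> = expectation (\<lambda>w. h0 (t + tau x w, x + B (tau x w) w)) + expectation (running t x)"
    by (rule Bochner_Integration.integral_add[OF i0 i1])
  finally show "value_fn (frontier D) h0 h1 (t, x) = expectation (\<lambda>w. h0 (t + tau x w, x + B (tau x w) w)) + expectation (running t x)" .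
qed

lemma running_bound:
  assumes x: "x \<in> closure D"
  shows "\<bar>expectation (running t x)\<bar> \<le> C1 * expectation (tau x)"
proof -
  have "\<bar>expectation (running t x)\<bar> \<le> expectation (\<lambda>w. \<bar>running t x w\<bar>)" by (rule integral_abs_bound)
  also have "\<dots> \<le> expectation (\<lambda>w. C1 * tau x w)"
  proof (rule integral_mono_AE[OF integrable_abs[OF value_fn_split(2)[OF x]] integrable_mult_right[OF tau_facts(2)[OF x]]])
    show "AE w in P. \<bar>running t x w\<bar> \<le> C1 * tau x w"
      using tau_facts(1)[OF x] AE_space
    proof eventually_elim
      case (elim w)
      show ?case unfolding tau_def
        by (rule payoff_bound(1)[OF elim(2) frontier_closed frontier_nonempty elim(1) h0(2) h1])
    qed
  qed
  finally show ?thesis by simp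
qed

text \<open>The boundary part changes by at most \<open>2 * C0\<close> and, by the Lipschitz bound,
  by a multiple of the mean exit time and of the mean displacement. Any upper bound \<open>g\<close>
  for the mean exit time is allowed, so that a concave one can be inserted.\<close>

lemma value_fn_close:
  fixes g :: real
  assumes x: "x \<in> closure D" and t: "0 \<le> t" and L: "0 \<le> L1" "0 \<le> L2"
    and lip: "\<And>s y. 0 \<le> s \<Longrightarrow> y \<in> closure D \<Longrightarrow> \<bar>h0 (s, y) - h0 (t, x)\<bar> \<le> L1 * \<bar>s - t\<bar> + L2 * norm (y - x)"
    and g: "expectation (tau x) \<le> g"
  shows "\<bar>value_fn (frontier D) h0 h1 (t, x) - h0 (t, x)\<bar> \<le> min (2 * C0) (L1 * g + L2 * sqrt (CARD('n) * g)) + C1 * g"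
proof -
  have C: "0 \<le> C1" using h1(2)[of undefined] by simp
  let ?d = "\<lambda>w. h0 (t + tau x w, x + B (tau x w) w) - h0 (t, x)"
  have i: "integrable P ?d" using value_fn_split(1)[OF x] by simp
  have e: "value_fn (frontier D) h0 h1 (t, x) - h0 (t, x) = expectation ?d + expectation (running t x)"
    unfolding value_fn_split(3)[OF x] using value_fn_split(1)[OF x] by (simp add: prob_space)
  have 1: "\<bar>expectation ?d\<bar> \<le> 2 * C0"
  proof -
    have "\<bar>?d w\<bar> \<le> 2 * C0" for w
      using h0(2)[of "(t + tau x w, x + B (tau x w) w)"] h0(2)[of "(t, x)"] by linarith
    then have "expectation (\<lambda>w. \<bar>?d w\<bar>) \<le> expectation (\<lambda>w. 2 * C0)"
      using i by (intro integral_mono) auto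
    then show ?thesis by (intro order_trans[OF integral_abs_bound]) (simp add: prob_space)
  qed
  have 2: "\<bar>expectation ?d\<bar> \<le> L1 * g + L2 * sqrt (CARD('n) * g)"
  proof -
    have "\<bar>expectation ?d\<bar> \<le> expectation (\<lambda>w. \<bar>?d w\<bar>)" by (rule integral_abs_bound)
    also have "\<dots> \<le> expectation (\<lambda>w. L1 * tau x w + L2 * norm (B (tau x w) w))"
    proof (rule integral_mono_AE[OF integrable_abs[OF i]])
      show "integrable P (\<lambda>w. L1 * tau x w + L2 * norm (B (tau x w) w))"
        by (intro Bochner_Integration.integrable_add integrable_mult_right tau_facts(2)[OF x] tau_norm(2)[OF x])
      show "AE w in P. \<bar>?d w\<bar> \<le> L1 * tau x w + L2 * norm (B (tau x w) w)"
        using AE_space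
      proof eventually_elim
        case (elim w)
        then show ?case using lip[OF _ tau_in_closure[OF x elim], of "t + tau x w"] t tau_nonneg[of x w] by simp
      qed
    qed
    also have "\<dots> = L1 * expectation (tau x) + L2 * expectation (\<lambda>w. norm (B (tau x w) w))"
      using tau_facts(2)[OF x] tau_norm(2)[OF x] by simp
    also have "\<dots> \<le> L1 * g + L2 * sqrt (CARD('n) * g)"
      using g L by (intro add_mono mult_left_mono order_trans[OF tau_norm(1)[OF x]]) auto
    finally show ?thesis .
  qed
  have 3: "\<bar>expectation (running t x)\<bar> \<le> C1 * g"
    using running_bound[OF x, of t] mult_left_mono[OF g C] by linarith
  show ?thesis unfolding e using 1 2 3 by linarith
qed

text \<open>\<open>one_step\<close> is applied to the scaled motion
  \<open>r *\<^sub>R B (t / r\<^sup>2)\<close>, whose exit time from the ball of radius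
  \<open>r\<close> is \<open>r\<^sup>2\<close> times the unit exit time. All step sizes then share
  the unit exit law.\<close>

lemma one_step_scaled:
  assumes x: "x \<in> D" and r: "0 < r" "ball x r \<subseteq> D"
  shows "value_fn (frontier D) h0 h1 (t, x) =
    expectation (\<lambda>w. value_fn (frontier D) h0 h1 (t + r\<^sup>2 * ball_exit 1 w, x + r *\<^sub>R B (ball_exit 1 w) w)) +
    r\<^sup>2 * expectation (\<lambda>w. \<integral>s. h1 (t + r\<^sup>2 * s, x + r *\<^sub>R B s w) * indicator {0<..<ball_exit 1 w} s \<partial>lborel)"
proof -
  let ?B = "\<lambda>t w. r *\<^sub>R B (t / r\<^sup>2) w"
  have bm: "bm P ?B" by (rule bm_scaled[OF r(1)])
  interpret b: bm_domain P ?B D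
    by (rule bm_domain.intro[OF bm]) (unfold_locales; rule D_nonempty D_open D_bounded D_convex)
  have xc: "x \<in> closure D" using x closure_subset by blast
  have v: "b.value_fn = value_fn"
    unfolding b.value_fn_def[abs_def] value_fn_def[abs_def] path_law_unique[OF bm_axioms bm] ..
  have Z: "b.ball_exit r w = r\<^sup>2 * ball_exit 1 w" if "w \<in> space P" for w
    unfolding b.ball_exit_def ball_exit_def first_hit_scaled[OF B_continuous[OF that] r(1)] by simp
  have nf: "ball x r \<inter> frontier D = {}" using r(2) frontier_disjoint by blast
  have "b.value_fn (frontier D) h0 h1 (t, x) =
    expectation (\<lambda>w. b.value_fn (frontier D) h0 h1 (t + b.ball_exit r w, x + ?B (b.ball_exit r w) w)) +
    expectation (\<lambda>w. \<integral>s. h1 (t + s, x + ?B s w) * indicator {0<..<b.ball_exit r w} s \<partial>lborel)"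
    by (rule b.one_step[OF frontier_closed frontier_nonempty b.tau_facts(1)[OF xc] b.tau_facts(2)[OF xc, unfolded b.tau_def] h0 h1 r(1) nf])
  also have "expectation (\<lambda>w. b.value_fn (frontier D) h0 h1 (t + b.ball_exit r w, x + ?B (b.ball_exit r w) w)) =
    expectation (\<lambda>w. value_fn (frontier D) h0 h1 (t + r\<^sup>2 * ball_exit 1 w, x + r *\<^sub>R B (ball_exit 1 w) w))"
    unfolding v using r(1) by (intro Bochner_Integration.integral_cong) (auto simp: Z)
  also have "expectation (\<lambda>w. \<integral>s. h1 (t + s, x + ?B s w) * indicator {0<..<b.ball_exit r w} s \<partial>lborel) =
    expectation (\<lambda>w. r\<^sup>2 * (\<integral>s. h1 (t + r\<^sup>2 * s, x + r *\<^sub>R B s w) * indicator {0<..<ball_exit 1 w} s \<partial>lborel))"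
  proof (rule Bochner_Integration.integral_cong[OF refl])
    fix w assume w: "w \<in> space P"
    have r2: "0 < r\<^sup>2" using r(1) by simp
    have "(\<integral>s. h1 (t + s, x + ?B s w) * indicator {0<..<b.ball_exit r w} s \<partial>lborel) =
      \<bar>r\<^sup>2\<bar> *\<^sub>R (\<integral>s. h1 (t + (0 + r\<^sup>2 * s), x + ?B (0 + r\<^sup>2 * s) w) * indicator {0<..<b.ball_exit r w} (0 + r\<^sup>2 * s) \<partial>lborel)"
      using r2 by (intro lborel_integral_real_affine) simp
    also have "(\<integral>s. h1 (t + (0 + r\<^sup>2 * s), x + ?B (0 + r\<^sup>2 * s) w) * indicator {0<..<b.ball_exit r w} (0 + r\<^sup>2 * s) \<partial>lborel) =
      (\<integral>s. h1 (t + r\<^sup>2 * s, x + r *\<^sub>R B s w) * indicator {0<..<ball_exit 1 w} s \<partial>lborel)"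
      using r2 by (intro Bochner_Integration.integral_cong) (auto simp: Z[OF w] indicator_def zero_less_mult_iff)
    finally show "(\<integral>s. h1 (t + s, x + ?B s w) * indicator {0<..<b.ball_exit r w} s \<partial>lborel) =
      r\<^sup>2 * (\<integral>s. h1 (t + r\<^sup>2 * s, x + r *\<^sub>R B s w) * indicator {0<..<ball_exit 1 w} s \<partial>lborel)" by simp
  qed
  finally show ?thesis unfolding v by simp
qed

lemma value_fn_step:
  assumes x: "x \<in> D" and r: "0 < r" "ball x r \<subseteq> D"
  shows "value_fn (frontier D) h0 h1 (t, x) =
    (\<integral>p. value_fn (frontier D) h0 h1 (t + r\<^sup>2 * fst p, x + r *\<^sub>R snd p) \<partial>(distr P borel (ball_exit 1) \<Otimes>\<^sub>M sphere_law)) +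
    r\<^sup>2 / CARD('n) * (\<integral>z. h1 (t + r\<^sup>2 * fst z, x + r *\<^sub>R snd z) \<partial>occ_law)"
proof -
  have m: "(\<lambda>p. (t + r\<^sup>2 * fst p, x + r *\<^sub>R snd p)) \<in> borel_measurable borel"
    by (intro borel_measurable_continuous_onI continuous_intros)
  note st = stoppingD(1,3)[OF stopping_ball_exit[OF zero_less_one]]
  have "(\<integral>p. value_fn (frontier D) h0 h1 (t + r\<^sup>2 * fst p, x + r *\<^sub>R snd p) \<partial>(distr P borel (ball_exit 1) \<Otimes>\<^sub>M sphere_law)) =
    expectation (\<lambda>w. value_fn (frontier D) h0 h1 (t + r\<^sup>2 * fst (ball_exit 1 w, B (ball_exit 1 w) w), x + r *\<^sub>R snd (ball_exit 1 w, B (ball_exit 1 w) w)))"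
    unfolding exit_law[symmetric]
    by (rule integral_distr[OF borel_measurable_Pair[OF st] measurable_compose[OF m value_fn_measurable[OF h0(1) h1(1)]]])
  moreover have "(\<integral>z. h1 (t + r\<^sup>2 * fst z, x + r *\<^sub>R snd z) \<partial>occ_law) =
    real CARD('n) * expectation (\<lambda>w. \<integral>s. h1 (t + r\<^sup>2 * fst (s, B s w), x + r *\<^sub>R snd (s, B s w)) * indicator {0<..<ball_exit 1 w} s \<partial>lborel)"
    by (rule occ_integral[OF measurable_compose[OF m h1(1)] h1(2)])
  ultimately show ?thesis using one_step_scaled[OF assms, of t] by simp
qed

end

end

subsection \<open>Expected exit times near the boundary\<close>

lemma sphere_law_symmetric:
  fixes f :: "real ^ 'n \<Rightarrow> real"
  assumes f: "f \<in> borel_measurable borel"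
  shows "(\<integral>z. f (- z) \<partial>sphere_law) = (\<integral>z. f z \<partial>sphere_law)"
proof -
  have neg: "orthogonal_transformation (\<lambda>x. - x :: real ^ 'n)" by (simp add: orthogonal_transformation_def linear_uminus)
  have "(\<integral>z. f z \<partial>sphere_law) = (\<integral>z. f z \<partial>distr sphere_law borel (\<lambda>x. - x))"
    using sphere_law_orthogonal[OF neg] by simp
  also have "\<dots> = (\<integral>z. f (- z) \<partial>sphere_law)" using f by (intro integral_distr) auto
  finally show ?thesis ..
qed

text \<open>The reflection \<open>z \<mapsto> - z\<close> preserves the law, so a spherical mean is
  a mean of antipodal averages, and a bound on those suffices.\<close>

lemma sphere_law_midpoint:
  fixes f :: "real ^ 'n \<Rightarrow> real"
  assumes f: "f \<in> borel_measurable borel" "\<And>z. \<bar>f z\<bar> \<le> C"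
    and le: "\<And>z. norm z = 1 \<Longrightarrow> (f (x + r *\<^sub>R z) + f (x - r *\<^sub>R z)) / 2 \<le> a"
  shows "(\<integral>z. f (x + r *\<^sub>R z) \<partial>sphere_law) \<le> a"
proof -
  interpret S: prob_space "sphere_law :: (real ^ 'n) measure" by (rule prob_space_sphere_law)
  note [measurable] = f(1)
  have m: "(\<lambda>z. f (x + r *\<^sub>R z)) \<in> borel_measurable borel" by measurable
  have i: "integrable sphere_law (\<lambda>z. f (x + r *\<^sub>R z))" "integrable sphere_law (\<lambda>z. f (x - r *\<^sub>R z))"
    using f(2) by (auto intro!: S.integrable_const_bound[where B=C])
  have "(\<integral>z. f (x + r *\<^sub>R z) \<partial>sphere_law) = (\<integral>z. f (x - r *\<^sub>R z) \<partial>sphere_law)"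
    using sphere_law_symmetric[OF m] by simp
  then have "2 * (\<integral>z. f (x + r *\<^sub>R z) \<partial>sphere_law) = (\<integral>z. f (x + r *\<^sub>R z) + f (x - r *\<^sub>R z) \<partial>sphere_law)"
    using i by simp
  also have "\<dots> \<le> (\<integral>z. 2 * a \<partial>(sphere_law :: (real ^ 'n) measure))"
  proof (rule integral_mono_AE)
    show "AE z in sphere_law. f (x + r *\<^sub>R z) + f (x - r *\<^sub>R z) \<le> 2 * a"
      using AE_sphere_law_norm
    proof eventually_elim
      case (elim z) from le[OF elim] show ?case by simp
    qed
  qed (use i in auto)
  finally show ?thesis by (simp add: S.prob_space)
qed

lemma min_midpoint:
  fixes p q r c :: real
  assumes "(p + q) / 2 \<le> r"
  shows "(min p c + min q c) / 2 \<le> min r c"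
  using assms by (auto simp: min_def)

lemma sqrt_midpoint:
  assumes "0 \<le> p" "0 \<le> q"
  shows "(sqrt p + sqrt q) / 2 \<le> sqrt ((p + q) / 2)"
proof (rule real_le_rsqrt)
  have "0 \<le> (sqrt p - sqrt q)\<^sup>2" by simp
  then have "2 * (sqrt p * sqrt q) \<le> p + q" using assms by (simp add: power2_diff)
  then show "((sqrt p + sqrt q) / 2)\<^sup>2 \<le> (p + q) / 2"
    using assms by (simp add: power2_sum power_divide)
qed

section \<open>Concave bounds from supporting hyperplanes\<close>

context bm_domain
begin

text \<open>The support function of \<open>D\<close>.\<close>

definition supp :: "real ^ 'n \<Rightarrow> real" where
  "supp e = (SUP z\<in>D. e \<bullet> z)"

text \<open>The distance to the complement of the convex set \<open>D\<close>, written as an infimum of affine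
  functions, which makes it concave.\<close>
definition depth :: "real ^ 'n \<Rightarrow> real" where
  "depth x = (INF e\<in>sphere 0 1. supp e - e \<bullet> x)"

lemma supp_upper: assumes "z \<in> D" shows "e \<bullet> z \<le> supp e"
proof -
  obtain b where b: "\<And>z. z \<in> D \<Longrightarrow> norm z \<le> b" using D_bounded by (auto simp: bounded_iff)
  have "e \<bullet> z \<le> norm e * b" if "z \<in> D" for z
    using norm_cauchy_schwarz[of e z] b[OF that] by (meson mult_left_mono norm_ge_zero order_trans)
  then have "bdd_above ((\<lambda>z. e \<bullet> z) ` D)" by (auto simp: bdd_above_def)
  then show ?thesis unfolding supp_def using assms by (intro cSUP_upper)
qed

lemma supp_nonneg: "x \<in> closure D \<Longrightarrow> norm e = 1 \<Longrightarrow> 0 \<le> supp e - e \<bullet> x"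
  using tau_slab(2) supp_upper by blast

lemma depth_le: "x \<in> closure D \<Longrightarrow> norm e = 1 \<Longrightarrow> depth x \<le> supp e - e \<bullet> x"
  unfolding depth_def by (intro cINF_lower bdd_belowI[of _ 0]) (auto intro: supp_nonneg simp del: diff_ge_0_iff_ge)

lemma sphere_nonempty: "sphere (0 :: real ^ 'n) 1 \<noteq> {}"
  by simp

lemma depth_greatest:
  assumes "\<And>e. norm e = 1 \<Longrightarrow> a \<le> supp e - e \<bullet> x"
  shows "a \<le> depth x"
  unfolding depth_def using assms sphere_nonempty by (intro cINF_greatest) auto

lemma depth_nonneg: "x \<in> closure D \<Longrightarrow> 0 \<le> depth x"
  by (intro depth_greatest supp_nonneg)

lemma depth_midpoint:
  assumes "x + y \<in> closure D" "x - y \<in> closure D"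
  shows "(depth (x + y) + depth (x - y)) / 2 \<le> depth x"
proof (rule depth_greatest)
  fix e :: "real ^ 'n" assume e: "norm e = 1"
  show "(depth (x + y) + depth (x - y)) / 2 \<le> supp e - e \<bullet> x"
    using depth_le[OF assms(1) e] depth_le[OF assms(2) e] by (simp add: inner_add_right inner_diff_right)
qed

lemma depth_continuous: "continuous_on (closure D) depth"
proof -
  have le: "depth x \<le> depth y + norm (x - y)" if "x \<in> closure D" for x y
  proof -
    have "depth x - norm (x - y) \<le> depth y"
    proof (rule depth_greatest)
      fix e :: "real ^ 'n" assume e: "norm e = 1"
      have "e \<bullet> (y - x) \<le> norm (x - y)"
        using norm_cauchy_schwarz[of e "y - x"] e by (simp add: norm_minus_commute)
      then show "depth x - norm (x - y) \<le> supp e - e \<bullet> y"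
        using depth_le[OF that e] by (simp add: inner_diff_right)
    qed
    then show ?thesis by simp
  qed
  have "1-lipschitz_on (closure D) depth"
  proof (rule lipschitz_onI)
    fix x y assume "x \<in> closure D" "y \<in> closure D"
    from le[OF this(1), of y] le[OF this(2), of x] show "dist (depth x) (depth y) \<le> 1 * dist x y"
      by (simp add: dist_real_def dist_norm norm_minus_commute abs_le_iff)
  qed simp
  then show ?thesis by (rule lipschitz_on_continuous_on)
qed

text \<open>At a nearest frontier point \<open>y\<close> there is a supporting hyperplane. Its
  outward unit normal \<open>e\<close> satisfies \<open>supp e \<le> e \<bullet> y\<close>, so the
  depth is at most \<open>e \<bullet> (y - x)\<close> and hence at most the distance to
  \<open>y\<close>.\<close>

lemma depth_le_infdist:
  assumes x: "x \<in> closure D"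
  shows "depth x \<le> infdist x (frontier D)"
proof -
  obtain y where y: "y \<in> frontier D" "infdist x (frontier D) = dist x y"
    using infdist_attains_inf[OF frontier_closed frontier_nonempty] by metis
  have "rel_interior (closure D) = D"
    using D_convex D_open by (simp add: convex_rel_interior_closure rel_interior_open)
  then have "y \<in> closure D" "y \<notin> rel_interior (closure D)"
    using y(1) frontier_disjoint by (auto simp: frontier_def)
  from supporting_hyperplane_rel_boundary[OF convex_closure[OF D_convex] this]
  obtain a where a: "a \<noteq> 0" "\<And>z. z \<in> closure D \<Longrightarrow> a \<bullet> y \<le> a \<bullet> z" by metis
  define e where "e = - (inverse (norm a) *\<^sub>R a)"
  have e: "norm e = 1" using a(1) by (simp add: e_def)
  have "e \<bullet> z \<le> e \<bullet> y" if "z \<in> D" for z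
    using a(2)[of z] that closure_subset[of D] by (auto simp: e_def intro!: mult_left_mono)
  then have "supp e \<le> e \<bullet> y" unfolding supp_def using D_nonempty by (intro cSUP_least)
  then have "depth x \<le> e \<bullet> (y - x)"
    using depth_le[OF x e] by (auto simp: inner_diff_right)
  also have "\<dots> \<le> norm e * norm (y - x)" by (rule norm_cauchy_schwarz)
  finally show ?thesis using e y(2) by (simp add: dist_norm norm_minus_commute)
qed

text \<open>A concave majorant of the mean exit time: the slab bound optimised over directions,
  capped by the bound from the enclosing ball.\<close>

definition exit_bound :: "real ^ 'n \<Rightarrow> real" where
  "exit_bound x = min (diameter D * depth x) ((diameter D)\<^sup>2 / CARD('n))"

lemma tau_le_exit_bound:
  assumes x: "x \<in> closure D"
  shows "expectation (tau x) \<le> exit_bound x"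
proof -
  have "expectation (tau x) / diameter D \<le> depth x"
  proof (rule depth_greatest)
    fix e :: "real ^ 'n" assume "norm e = 1"
    from tau_slab(1)[OF x this supp_upper] show "expectation (tau x) / diameter D \<le> supp e - e \<bullet> x"
      using diameter_pos by (simp add: field_simps)
  qed
  then show ?thesis unfolding exit_bound_def using tau_facts(3)[OF x] diameter_pos by (simp add: field_simps)
qed

lemma exit_bound_nonneg: "x \<in> closure D \<Longrightarrow> 0 \<le> exit_bound x"
  using depth_nonneg[of x] diameter_pos by (simp add: exit_bound_def)

lemma exit_bound_midpoint:
  assumes "x + y \<in> closure D" "x - y \<in> closure D"
  shows "(exit_bound (x + y) + exit_bound (x - y)) / 2 \<le> exit_bound x"
proof -
  have "diameter D * ((depth (x + y) + depth (x - y)) / 2) \<le> diameter D * depth x"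
    using depth_midpoint[OF assms] diameter_pos by (intro mult_left_mono) auto
  then have "(diameter D * depth (x + y) + diameter D * depth (x - y)) / 2 \<le> diameter D * depth x"
    by (simp add: field_simps)
  then show ?thesis unfolding exit_bound_def by (rule min_midpoint)
qed

text \<open>Bounds the distance of the value function from its boundary data.\<close>
definition err :: "real \<Rightarrow> real \<Rightarrow> real \<Rightarrow> real \<Rightarrow> real ^ 'n \<Rightarrow> real" where
  "err C0 C1 L1 L2 x = min (2 * C0) (L1 * exit_bound x + L2 * sqrt (CARD('n) * exit_bound x)) + C1 * exit_bound x"

context
  fixes C0 C1 L1 L2 :: real
  assumes nn: "0 \<le> C0" "0 \<le> C1" "0 \<le> L1" "0 \<le> L2"
begin

lemma err_nonneg: "x \<in> closure D \<Longrightarrow> 0 \<le> err C0 C1 L1 L2 x"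
  using exit_bound_nonneg[of x] nn by (auto simp: err_def intro!: add_nonneg_nonneg)

lemma err_le_const: "err C0 C1 L1 L2 x \<le> 2 * C0 + C1 * ((diameter D)\<^sup>2 / CARD('n))"
  unfolding err_def exit_bound_def using nn by (intro add_mono mult_left_mono) auto

lemma err_le_near:
  assumes x: "x \<in> closure D" and d: "infdist x (frontier D) \<le> d" "0 \<le> d"
  shows "err C0 C1 L1 L2 x \<le> (L1 + C1) * diameter D * d + L2 * sqrt CARD('n) * sqrt (diameter D) * sqrt d"
proof -
  have g: "exit_bound x \<le> diameter D * d"
    using depth_le_infdist[OF x] d diameter_pos by (intro min.coboundedI1[THEN order_trans] order_refl | simp add: exit_bound_def min_le_iff_disj)+
  have "err C0 C1 L1 L2 x \<le> (L1 * exit_bound x + L2 * sqrt (CARD('n) * exit_bound x)) + C1 * exit_bound x"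
    by (simp add: err_def)
  also have "\<dots> \<le> (L1 * (diameter D * d) + L2 * sqrt (CARD('n) * (diameter D * d))) + C1 * (diameter D * d)"
    using g nn by (intro add_mono mult_left_mono real_sqrt_le_mono) auto
  also have "\<dots> = (L1 + C1) * diameter D * d + L2 * sqrt CARD('n) * sqrt (diameter D) * sqrt d"
    by (simp add: real_sqrt_mult algebra_simps)
  finally show ?thesis .
qed

text \<open>Midpoint concavity survives the square root, nonnegative combinations and the minimum
  with a constant.\<close>

lemma err_midpoint:
  assumes xy: "x + y \<in> closure D" "x - y \<in> closure D"
  shows "(err C0 C1 L1 L2 (x + y) + err C0 C1 L1 L2 (x - y)) / 2 \<le> err C0 C1 L1 L2 x"
proof -
  let ?p = "exit_bound (x + y)" and ?q = "exit_bound (x - y)" and ?g = "exit_bound x"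
  let ?n = "real CARD('n)"
  have m: "(?p + ?q) / 2 \<le> ?g" by (rule exit_bound_midpoint[OF xy])
  have pq: "0 \<le> ?p" "0 \<le> ?q" using exit_bound_nonneg xy by auto
  have "(sqrt (?n * ?p) + sqrt (?n * ?q)) / 2 \<le> sqrt ((?n * ?p + ?n * ?q) / 2)"
    using pq by (intro sqrt_midpoint) auto
  also have "\<dots> \<le> sqrt (?n * ?g)"
    using mult_left_mono[OF m, of ?n] by (intro real_sqrt_le_mono) (simp add: field_simps)
  finally have s: "(sqrt (?n * ?p) + sqrt (?n * ?q)) / 2 \<le> sqrt (?n * ?g)" .
  have 1: "(L1 * ?p + L1 * ?q) / 2 \<le> L1 * ?g" using mult_left_mono[OF m nn(3)] by (simp add: field_simps)
  have 2: "(L2 * sqrt (?n * ?p) + L2 * sqrt (?n * ?q)) / 2 \<le> L2 * sqrt (?n * ?g)"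
    using mult_left_mono[OF s nn(4)] by (simp add: field_simps)
  have 3: "(C1 * ?p + C1 * ?q) / 2 \<le> C1 * ?g" using mult_left_mono[OF m nn(2)] by (simp add: field_simps)
  have "((L1 * ?p + L2 * sqrt (?n * ?p)) + (L1 * ?q + L2 * sqrt (?n * ?q))) / 2 \<le> L1 * ?g + L2 * sqrt (?n * ?g)"
    using 1 2 by (simp add: field_simps)
  note m2 = min_midpoint[OF this, of "2 * C0"]
  have add: "((a + a') + (b + b')) / 2 \<le> c + c'" if "(a + b) / 2 \<le> c" "(a' + b') / 2 \<le> c'" for a b c a' b' c' :: real
    using that by (simp add: field_simps)
  show ?thesis unfolding err_def min.commute[of "2 * C0"] by (rule add[OF m2 3])
qed

lemma err_continuous: "continuous_on (closure D) (err C0 C1 L1 L2)"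
  unfolding err_def exit_bound_def by (intro continuous_intros depth_continuous)

end

lemma ball_infdist_subset:
  assumes x: "x \<in> D"
  shows "ball x (infdist x (frontier D)) \<subseteq> D"
proof (rule ccontr)
  assume "\<not> ball x (infdist x (frontier D)) \<subseteq> D"
  then obtain y where y: "y \<in> ball x (infdist x (frontier D))" "y \<notin> D" by blast
  let ?S = "ball x (infdist x (frontier D))"
  have "x \<in> ?S" using y(1) by (auto simp: intro: le_less_trans[OF zero_le_dist])
  then have "?S \<inter> frontier D \<noteq> {}"
    using x y by (intro connected_Int_frontier connected_ball) blast+
  then obtain z where "z \<in> frontier D" "dist x z < infdist x (frontier D)" by auto
  then show False using infdist_le[of z "frontier D" x] by simp
qed

lemma step_in_closure:
  assumes x: "x \<in> closure D" and r: "0 \<le> r" "r \<le> infdist x (frontier D)" and z: "norm z \<le> 1"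
  shows "x + r *\<^sub>R z \<in> closure D"
proof (cases "x \<in> D \<and> 0 < r")
  case True
  have "ball x r \<subseteq> D" using ball_infdist_subset[of x] True r by (auto simp: subset_iff)
  then have "closure (ball x r) \<subseteq> closure D" by (rule closure_mono)
  moreover have "x + r *\<^sub>R z \<in> cball x r" using z r by (simp add: dist_norm mult_left_le)
  ultimately show ?thesis using True by auto
next
  case False
  then have "r = 0" using r closure_cases[OF x] by (auto simp: infdist_zero)
  then show ?thesis using x by simp
qed

text \<open>The two antipodal points of the step lie in the closed domain at distance
  \<open>2 * r\<close>. The factor makes a sum of two radii at most the diameter and a squared
  radius at most a quarter of its square.\<close>

lemma step_le_half_diameter:
  assumes x: "x \<in> closure D" and r: "0 \<le> r" "r \<le> infdist x (frontier D)"
  shows "2 * r \<le> diameter D"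
proof -
  obtain z :: "real ^ 'n" where z: "norm z = 1" using vector_choose_size[of 1] by auto
  have "norm ((x + r *\<^sub>R z) - (x + r *\<^sub>R (- z))) \<le> diameter D"
    using step_in_closure[OF x r, of z] step_in_closure[OF x r, of "- z"] z by (intro dist_le_diameter) auto
  moreover have "(x + r *\<^sub>R z) - (x + r *\<^sub>R (- z)) = (2 * r) *\<^sub>R z" by (simp add: algebra_simps scaleR_2[symmetric] flip: scaleR_add_left)
  ultimately have "norm ((2 * r) *\<^sub>R z) \<le> diameter D" by (simp only:)
  then show ?thesis using z r by simp
qed

end

subsection \<open>The walk on spheres\<close>

text \<open>Used to freeze the current state of the walk and integrate out the noise of the next
  step.\<close>

lemma (in prob_space) indep_var_fubini:
  fixes X Y :: "'a \<Rightarrow> 'b::second_countable_topology" and F :: "'b \<times> 'b \<Rightarrow> real"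
  assumes ind: "indep_var borel X borel Y" and F: "F \<in> borel_measurable borel" "\<And>p. \<bar>F p\<bar> \<le> C"
  shows "expectation (\<lambda>w. F (X w, Y w)) = expectation (\<lambda>w. \<integral>y. F (X w, y) \<partial>distr M borel Y)"
    "(\<lambda>w. \<integral>y. F (X w, y) \<partial>distr M borel Y) \<in> borel_measurable M"
    "\<bar>\<integral>y. F (x, y) \<partial>distr M borel Y\<bar> \<le> C"
proof -
  have X: "X \<in> borel_measurable M" and Y: "Y \<in> borel_measurable M"
    using ind by (auto dest: indep_var_rv1 indep_var_rv2)
  have d: "distr M borel X \<Otimes>\<^sub>M distr M borel Y = distr M (borel \<Otimes>\<^sub>M borel) (\<lambda>x. (X x, Y x))"
    using ind by (simp only: indep_var_distribution_eq)
  interpret DX: prob_space "distr M borel X" by (rule prob_space_distr[OF X])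
  interpret DY: prob_space "distr M borel Y" by (rule prob_space_distr[OF Y])
  interpret DD: pair_prob_space "distr M borel X" "distr M borel Y" ..
  have F': "F \<in> borel_measurable (borel \<Otimes>\<^sub>M borel)" using F(1) by (simp only: borel_prod)
  have F'': "F \<in> borel_measurable (distr M borel X \<Otimes>\<^sub>M distr M borel Y)" using F' d by simp
  have m: "(\<lambda>x. \<integral>y. F (x, y) \<partial>distr M borel Y) \<in> borel_measurable borel"
    using DY.borel_measurable_lebesgue_integral[of "\<lambda>x y. F (x, y)" borel] F' by simp
  have "expectation (\<lambda>w. F (X w, Y w)) = (\<integral>p. F p \<partial>distr M (borel \<Otimes>\<^sub>M borel) (\<lambda>x. (X x, Y x)))"
    by (rule integral_distr[symmetric, OF _ F']) (use X Y in measurable)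
  also have "\<dots> = (\<integral>x. (\<integral>y. F (x, y) \<partial>distr M borel Y) \<partial>distr M borel X)"
    unfolding d[symmetric] using F(2) F''
    by (intro DD.integral_fst'[symmetric] DD.P.integrable_const_bound[where B=C]) auto
  also have "\<dots> = expectation (\<lambda>w. \<integral>y. F (X w, y) \<partial>distr M borel Y)"
    by (rule integral_distr[OF X m])
  finally show "expectation (\<lambda>w. F (X w, Y w)) = expectation (\<lambda>w. \<integral>y. F (X w, y) \<partial>distr M borel Y)" .
  show "(\<lambda>w. \<integral>y. F (X w, y) \<partial>distr M borel Y) \<in> borel_measurable M"
    by (rule measurable_compose[OF X m])
  have Fx: "(\<lambda>y. F (x, y)) \<in> borel_measurable borel"
    by (rule measurable_compose[OF _ F(1)], intro borel_measurable_Pair) auto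
  have "\<bar>\<integral>y. F (x, y) \<partial>distr M borel Y\<bar> \<le> (\<integral>y. \<bar>F (x, y)\<bar> \<partial>distr M borel Y)" by (rule integral_abs_bound)
  also have "\<dots> \<le> (\<integral>y. C \<partial>distr M borel Y)"
    using F(2) Fx order_trans[OF abs_ge_zero F(2)] by (intro integral_mono DY.integrable_const_bound[where B=C]) auto
  also have "\<dots> = C" using DY.prob_space by simp
  finally show "\<bar>\<integral>y. F (x, y) \<partial>distr M borel Y\<bar> \<le> C" .
qed

definition noise_indices :: "source set" where
  "noise_indices = (\<Union>i\<in>{1..}. \<Union>k\<in>{1..}. {Src_VY i k, Src_rho i k, Src_Z i k})"

text \<open>One outcome of all sources at once. The walk is read as a function of these coordinates,
  so that measurability and independence become questions of which coordinates it looks at.\<close>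

type_synonym 'n noise = "source \<Rightarrow> real \<times> (real ^ 'n)"

definition dirn :: "nat \<Rightarrow> nat \<Rightarrow> ('n::finite) noise \<Rightarrow> real ^ 'n" where
  "dirn j k z = inverse (norm (snd (z (Src_Z j k)))) *\<^sub>R snd (z (Src_Z j k))"

definition rhon :: "nat \<Rightarrow> nat \<Rightarrow> ('n::finite) noise \<Rightarrow> real" where
  "rhon j k z = fst (z (Src_rho j k))"

definition steps :: "nat \<Rightarrow> nat \<Rightarrow> source set" where
  "steps j k = (\<Union>l\<in>{1..k}. {Src_rho j l, Src_Z j l})"

lemma norm_dirn_le: "norm (dirn j k z) \<le> 1"
  by (cases "snd (z (Src_Z j k)) = 0") (auto simp: dirn_def)

text \<open>All functions live on the whole space, with measurability and bounds free of domain
  conditions; only the Lipschitz and distance estimates are confined to the closed domain.\<close>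

locale wos = bm_domain P B D for P :: "'w measure" and B :: "real \<Rightarrow> 'w \<Rightarrow> real ^ 'n" and D +
  fixes rt :: "real ^ 'n \<Rightarrow> real" and \<beta> \<delta> L C0 C1 lt0 lx0 lt1 lx1 :: real
    and h0 h1 :: "real \<times> (real ^ 'n) \<Rightarrow> real" and W :: "source \<Rightarrow> 'w \<Rightarrow> real \<times> (real ^ 'n)" and M :: nat
  assumes rt_measurable: "rt \<in> borel_measurable borel" and rt_nonneg: "0 \<le> rt x" and rt_diam: "2 * rt x \<le> diameter D"
    and rt_le: "x \<in> closure D \<Longrightarrow> rt x \<le> infdist x (frontier D)"
    and rt_lower: "x \<in> closure D \<Longrightarrow> \<delta> \<le> infdist x (frontier D) \<Longrightarrow> \<beta> * \<delta> \<le> rt x"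
    and rt_lipschitz: "x \<in> closure D \<Longrightarrow> y \<in> closure D \<Longrightarrow> \<bar>rt x - rt y\<bar> \<le> L * norm (x - y)"
    and constants_nonneg: "0 < \<beta>" "0 < \<delta>" "0 \<le> L" "0 \<le> lt0" "0 \<le> lx0" "0 \<le> lt1" "0 \<le> lx1"
    and h0: "h0 \<in> borel_measurable borel" "\<And>z. \<bar>h0 z\<bar> \<le> C0"
    and h1: "h1 \<in> borel_measurable borel" "\<And>z. \<bar>h1 z\<bar> \<le> C1"
    and h0_lipschitz: "0 \<le> s \<Longrightarrow> 0 \<le> t \<Longrightarrow> x \<in> closure D \<Longrightarrow> y \<in> closure D \<Longrightarrow>
      \<bar>h0 (s, x) - h0 (t, y)\<bar> \<le> lt0 * \<bar>s - t\<bar> + lx0 * norm (x - y)"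
    and h1_lipschitz: "0 \<le> s \<Longrightarrow> 0 \<le> t \<Longrightarrow> x \<in> closure D \<Longrightarrow> y \<in> closure D \<Longrightarrow>
      \<bar>h1 (s, x) - h1 (t, y)\<bar> \<le> lt1 * \<bar>s - t\<bar> + lx1 * norm (x - y)"
    and W_indep: "indep_vars (\<lambda>_. borel) W noise_indices"
    and rho_nonneg: "1 \<le> j \<Longrightarrow> 1 \<le> k \<Longrightarrow> w \<in> space P \<Longrightarrow> 0 \<le> fst (W (Src_rho j k) w)"
    and rho_law: "1 \<le> j \<Longrightarrow> 1 \<le> k \<Longrightarrow> distr P borel (\<lambda>w. fst (W (Src_rho j k) w)) = distr P borel (ball_exit 1)"
    and Z_law: "1 \<le> j \<Longrightarrow> 1 \<le> k \<Longrightarrow>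
      distr P borel (\<lambda>w. inverse (norm (snd (W (Src_Z j k) w))) *\<^sub>R snd (W (Src_Z j k) w)) = sphere_law"
    and VY_measurable: "1 \<le> j \<Longrightarrow> 1 \<le> k \<Longrightarrow> W (Src_VY j k) \<in> measurable P occ_law"
    and VY_law: "1 \<le> j \<Longrightarrow> 1 \<le> k \<Longrightarrow> distr P occ_law (W (Src_VY j k)) = occ_law"
begin

abbreviation noise :: "'w \<Rightarrow> 'n noise" where
  "noise w \<equiv> \<lambda>s. W s w"

abbreviation pos :: "real ^ 'n \<Rightarrow> nat \<Rightarrow> nat \<Rightarrow> 'n noise \<Rightarrow> real ^ 'n" where
  "pos \<equiv> wos_position rt dirn"

abbreviation tim :: "real ^ 'n \<Rightarrow> nat \<Rightarrow> nat \<Rightarrow> 'n noise \<Rightarrow> real" where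
  "tim \<equiv> wos_time rt dirn rhon"

lemma C0_nonneg: "0 \<le> C0" and C1_nonneg: "0 \<le> C1"
  using h0(2)[of undefined] h1(2)[of undefined] by auto

lemma pos_closure: "x \<in> closure D \<Longrightarrow> pos x j k z \<in> closure D"
  by (induction k) (auto intro!: step_in_closure rt_le norm_dirn_le rt_nonneg)

lemma tim_nonneg: "1 \<le> j \<Longrightarrow> w \<in> space P \<Longrightarrow> 0 \<le> tim x j k (noise w)"
  by (induction k) (auto simp: rhon_def intro!: add_nonneg_nonneg mult_nonneg_nonneg rho_nonneg)

lemma steps_Suc: "steps j (Suc k) = steps j k \<union> {Src_rho j (Suc k), Src_Z j (Suc k)}"
  by (auto simp: steps_def le_Suc_eq)

lemma state_local:
  assumes "\<And>s. s \<in> steps j k \<Longrightarrow> z s = z' s"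
  shows "pos x j k z = pos x j k z' \<and> tim x j k z = tim x j k z'"
  using assms
proof (induction k)
  case (Suc k)
  then have "pos x j k z = pos x j k z' \<and> tim x j k z = tim x j k z'" by (simp add: steps_Suc)
  moreover have "dirn j (Suc k) z = dirn j (Suc k) z'" "rhon j (Suc k) z = rhon j (Suc k) z'"
    using Suc.prems by (simp_all add: steps_Suc dirn_def rhon_def)
  ultimately show ?case by simp
qed simp

lemma dirn_measurable: "Src_Z j k \<in> A \<Longrightarrow> dirn j k \<in> borel_measurable (PiM A (\<lambda>_. borel :: (real \<times> (real ^ 'n)) measure))"
proof -
  assume "Src_Z j k \<in> A"
  then have "(\<lambda>z. z (Src_Z j k)) \<in> measurable (PiM A (\<lambda>_. borel :: (real \<times> (real ^ 'n)) measure)) borel"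
    by (rule measurable_component_singleton)
  moreover have "(\<lambda>p :: real \<times> (real ^ 'n). inverse (norm (snd p)) *\<^sub>R snd p) \<in> borel_measurable borel"
  proof -
    have "snd \<in> borel_measurable (borel :: (real \<times> (real ^ 'n)) measure)"
      by (intro borel_measurable_continuous_onI continuous_intros)
    then show ?thesis by measurable
  qed
  ultimately show ?thesis unfolding dirn_def[abs_def] by (rule measurable_compose)
qed

lemma rhon_measurable: "Src_rho j k \<in> A \<Longrightarrow> rhon j k \<in> borel_measurable (PiM A (\<lambda>_. borel :: (real \<times> (real ^ 'n)) measure))"
proof -
  assume "Src_rho j k \<in> A"
  then have "(\<lambda>z. z (Src_rho j k)) \<in> measurable (PiM A (\<lambda>_. borel :: (real \<times> (real ^ 'n)) measure)) borel"
    by (rule measurable_component_singleton)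
  moreover have "fst \<in> borel_measurable (borel :: (real \<times> (real ^ 'n)) measure)"
    by (intro borel_measurable_continuous_onI continuous_intros)
  ultimately show ?thesis unfolding rhon_def[abs_def] by (rule measurable_compose)
qed

lemma state_measurable:
  assumes "steps j k \<subseteq> A"
  shows "pos x j k \<in> borel_measurable (PiM A (\<lambda>_. borel))" "tim x j k \<in> borel_measurable (PiM A (\<lambda>_. borel))"
proof -
  have "pos x j k \<in> borel_measurable (PiM A (\<lambda>_. borel)) \<and> tim x j k \<in> borel_measurable (PiM A (\<lambda>_. borel))"
    using assms
  proof (induction k)
    case (Suc k)
    then have IH: "pos x j k \<in> borel_measurable (PiM A (\<lambda>_. borel))" "tim x j k \<in> borel_measurable (PiM A (\<lambda>_. borel))"
      by (auto simp: steps_Suc)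
    have r: "(\<lambda>z. rt (pos x j k z)) \<in> borel_measurable (PiM A (\<lambda>_. borel))"
      by (rule measurable_compose[OF IH(1) rt_measurable])
    have s: "Src_Z j (Suc k) \<in> A" "Src_rho j (Suc k) \<in> A" using Suc.prems by (auto simp: steps_Suc)
    show ?case
      unfolding wos_position.simps wos_time.simps
      by (intro conjI borel_measurable_add IH borel_measurable_scaleR borel_measurable_times borel_measurable_power r
          dirn_measurable[OF s(1)] rhon_measurable[OF s(2)])
  qed simp
  then show "pos x j k \<in> borel_measurable (PiM A (\<lambda>_. borel))" "tim x j k \<in> borel_measurable (PiM A (\<lambda>_. borel))" by auto
qed

lemma steps_noise: "1 \<le> j \<Longrightarrow> steps j k \<subseteq> noise_indices"
  by (auto simp: steps_def noise_indices_def)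

definition state :: "real ^ 'n \<Rightarrow> nat \<Rightarrow> nat \<Rightarrow> 'w \<Rightarrow> real \<times> (real ^ 'n)" where
  "state x j k w = (tim x j k (noise w), pos x j k (noise w))"

text \<open>The state after \<open>k\<close> steps looks only at the coordinates in
  \<open>steps j k\<close>; \<open>g\<close> looks at a disjoint set.\<close>

lemma state_indep:
  assumes j: "1 \<le> j" and A: "A \<subseteq> noise_indices" "A \<inter> steps j k = {}"
    and g: "g \<in> borel_measurable (PiM A (\<lambda>_. borel))" and loc: "\<And>z. g (restrict z A) = g z"
  shows "indep_var borel (state x j k) borel (\<lambda>w. g (noise w))"
proof -
  have "indep_var (PiM (steps j k) (\<lambda>_. borel)) (\<lambda>w. restrict (\<lambda>i. W i w) (steps j k)) (PiM A (\<lambda>_. borel)) (\<lambda>w. restrict (\<lambda>i. W i w) A)"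
    by (rule indep_var_restrict[OF W_indep]) (use A steps_noise[OF j] in auto)
  moreover have "(\<lambda>z. (tim x j k z, pos x j k z)) \<in> measurable (PiM (steps j k) (\<lambda>_. borel)) borel"
    by (intro borel_measurable_Pair state_measurable) auto
  ultimately have "indep_var borel ((\<lambda>z. (tim x j k z, pos x j k z)) \<circ> (\<lambda>w. restrict (\<lambda>i. W i w) (steps j k))) borel (g \<circ> (\<lambda>w. restrict (\<lambda>i. W i w) A))"
    using g by (rule indep_var_compose)
  moreover have "(\<lambda>z. (tim x j k z, pos x j k z)) \<circ> (\<lambda>w. restrict (\<lambda>i. W i w) (steps j k)) = state x j k"
  proof (rule ext)
    fix w
    have "pos x j k (restrict (\<lambda>i. W i w) (steps j k)) = pos x j k (noise w) \<and> tim x j k (restrict (\<lambda>i. W i w) (steps j k)) = tim x j k (noise w)"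
      by (rule state_local) simp
    then show "((\<lambda>z. (tim x j k z, pos x j k z)) \<circ> (\<lambda>w. restrict (\<lambda>i. W i w) (steps j k))) w = state x j k w"
      by (simp add: state_def)
  qed
  moreover have "g \<circ> (\<lambda>w. restrict (\<lambda>i. W i w) A) = (\<lambda>w. g (noise w))" by (simp add: fun_eq_iff loc)
  ultimately show ?thesis by simp
qed

text \<open>Clock and direction of one step are distributed like exit time and exit point of the
  unit ball. This is where walk and Brownian motion meet.\<close>

lemma step_noise_law:
  assumes j: "1 \<le> j" and k: "1 \<le> k"
  shows "distr P borel (\<lambda>w. (rhon j k (noise w), dirn j k (noise w))) = distr P borel (ball_exit 1) \<Otimes>\<^sub>M sphere_law"
proof -
  have ind: "indep_var (PiM {Src_rho j k} (\<lambda>_. borel)) (\<lambda>w. restrict (\<lambda>i. W i w) {Src_rho j k}) (PiM {Src_Z j k} (\<lambda>_. borel)) (\<lambda>w. restrict (\<lambda>i. W i w) {Src_Z j k})"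
    by (rule indep_var_restrict[OF W_indep]) (use j k in \<open>auto simp: noise_indices_def\<close>)
  let ?X = "\<lambda>w. rhon j k (noise w)" and ?Y = "\<lambda>w. dirn j k (noise w)"
  have Wm: "W i \<in> borel_measurable P" if "i \<in> noise_indices" for i
    using W_indep that by (simp add: indep_vars_def)
  have ri: "Src_rho j k \<in> noise_indices" "Src_Z j k \<in> noise_indices" using j k by (auto simp: noise_indices_def)
  have rv: "(\<lambda>w. restrict (\<lambda>i. W i w) {s}) \<in> measurable P (PiM {s} (\<lambda>_. borel))" if "s \<in> noise_indices" for s
    using Wm[OF that] by (intro measurable_restrict) auto
  have Xm: "?X \<in> borel_measurable P" and Ym: "?Y \<in> borel_measurable P"
    using measurable_compose[OF rv[OF ri(1)] rhon_measurable[of j k]] measurable_compose[OF rv[OF ri(2)] dirn_measurable[of j k]]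
    by (auto simp: rhon_def dirn_def)
  have "distr P borel ?X \<Otimes>\<^sub>M distr P borel ?Y = distr P borel (\<lambda>w. (?X w, ?Y w))"
  proof (rule pair_measure_eqI)
    interpret DX: prob_space "distr P borel ?X" by (rule prob_space_distr[OF Xm])
    interpret DY: prob_space "distr P borel ?Y" by (rule prob_space_distr[OF Ym])
    show "sigma_finite_measure (distr P borel ?X)" "sigma_finite_measure (distr P borel ?Y)" ..
    have "sets (distr P borel ?X \<Otimes>\<^sub>M distr P borel ?Y) = sets ((borel :: real measure) \<Otimes>\<^sub>M (borel :: (real ^ 'n) measure))"
      by (rule sets_pair_measure_cong) auto
    then show "sets (distr P borel ?X \<Otimes>\<^sub>M distr P borel ?Y) = sets (distr P borel (\<lambda>w. (?X w, ?Y w)))"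
      by (simp only: borel_prod sets_distr)
    fix C :: "real set" and A :: "(real ^ 'n) set"
    assume "C \<in> sets (distr P borel ?X)" "A \<in> sets (distr P borel ?Y)"
    then have C: "C \<in> sets borel" and A: "A \<in> sets borel" by auto
    have CA: "C \<times> A \<in> sets borel" using pair_measureI[OF C A] by (simp only: borel_prod)
    let ?C = "rhon j k -` C \<inter> space (PiM {Src_rho j k} (\<lambda>_. borel :: (real \<times> (real ^ 'n)) measure))"
    let ?A = "dirn j k -` A \<inter> space (PiM {Src_Z j k} (\<lambda>_. borel :: (real \<times> (real ^ 'n)) measure))"
    have "?C \<in> sets (PiM {Src_rho j k} (\<lambda>_. borel))" "?A \<in> sets (PiM {Src_Z j k} (\<lambda>_. borel))"
      by (rule measurable_sets[OF rhon_measurable C], simp) (rule measurable_sets[OF dirn_measurable A], simp)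
    note indep_varD[OF ind this]
    moreover have "(\<lambda>w. restrict (\<lambda>i. W i w) {Src_rho j k}) -` ?C \<inter> space P = ?X -` C \<inter> space P"
      "(\<lambda>w. restrict (\<lambda>i. W i w) {Src_Z j k}) -` ?A \<inter> space P = ?Y -` A \<inter> space P"
      "(\<lambda>w. (restrict (\<lambda>i. W i w) {Src_rho j k}, restrict (\<lambda>i. W i w) {Src_Z j k})) -` (?C \<times> ?A) \<inter> space P = (\<lambda>w. (?X w, ?Y w)) -` (C \<times> A) \<inter> space P"
      by (auto simp: rhon_def dirn_def space_PiM)
    ultimately have "prob ((\<lambda>w. (?X w, ?Y w)) -` (C \<times> A) \<inter> space P) = prob (?X -` C \<inter> space P) * prob (?Y -` A \<inter> space P)" by simp
    then show "emeasure (distr P borel ?X) C * emeasure (distr P borel ?Y) A = emeasure (distr P borel (\<lambda>w. (?X w, ?Y w))) (C \<times> A)"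
      by (simp only: emeasure_distr[OF Xm C] emeasure_distr[OF Ym A] emeasure_distr[OF borel_measurable_Pair[OF Xm Ym] CA]
          emeasure_eq_measure ennreal_mult[OF measure_nonneg measure_nonneg])
  qed
  then show ?thesis
    using rho_law[OF j k] Z_law[OF j k] by (simp only: rhon_def dirn_def)
qed

abbreviation step_law :: "(real \<times> (real ^ 'n)) measure" where
  "step_law \<equiv> distr P borel (ball_exit 1) \<Otimes>\<^sub>M sphere_law"

lemma borel_space_pair:
  "(\<lambda>q :: (real \<times> (real ^ 'n)) \<times> real \<times> (real ^ 'n). (fst (fst q) + (rt (snd (fst q)))\<^sup>2 * fst (snd q), snd (fst q) + rt (snd (fst q)) *\<^sub>R snd (snd q))) \<in> borel_measurable borel"
proof -
  have c: "(\<lambda>q :: (real \<times> (real ^ 'n)) \<times> real \<times> (real ^ 'n). fst (fst q)) \<in> borel_measurable borel"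
    "(\<lambda>q :: (real \<times> (real ^ 'n)) \<times> real \<times> (real ^ 'n). snd (fst q)) \<in> borel_measurable borel"
    "(\<lambda>q :: (real \<times> (real ^ 'n)) \<times> real \<times> (real ^ 'n). fst (snd q)) \<in> borel_measurable borel"
    "(\<lambda>q :: (real \<times> (real ^ 'n)) \<times> real \<times> (real ^ 'n). snd (snd q)) \<in> borel_measurable borel"
    by (intro borel_measurable_continuous_onI continuous_intros)+
  show ?thesis
    by (intro borel_measurable_Pair borel_measurable_add borel_measurable_times borel_measurable_power borel_measurable_scaleR
        measurable_compose[OF c(2) rt_measurable] c)
qed

text \<open>The Markov property of the walk: the next clock and direction are independent of the
  state, which is therefore frozen under the inner integral.\<close>

lemma chain_step:
  fixes F :: "real \<times> (real ^ 'n) \<Rightarrow> real"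
  assumes j: "1 \<le> j" and F: "F \<in> borel_measurable borel" "\<And>z. \<bar>F z\<bar> \<le> C"
  shows "expectation (\<lambda>w. F (state x j (Suc k) w)) =
    expectation (\<lambda>w. \<integral>p. F (fst (state x j k w) + (rt (snd (state x j k w)))\<^sup>2 * fst p, snd (state x j k w) + rt (snd (state x j k w)) *\<^sub>R snd p) \<partial>step_law)"
    "(\<lambda>w. \<integral>p. F (fst (state x j k w) + (rt (snd (state x j k w)))\<^sup>2 * fst p, snd (state x j k w) + rt (snd (state x j k w)) *\<^sub>R snd p) \<partial>step_law) \<in> borel_measurable P"
    "\<bar>\<integral>p. F (t + (rt y)\<^sup>2 * fst p, y + rt y *\<^sub>R snd p) \<partial>step_law\<bar> \<le> C"
proof -
  let ?A = "{Src_rho j (Suc k), Src_Z j (Suc k)}"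
  have ind: "indep_var borel (state x j k) borel (\<lambda>w. (\<lambda>z. (rhon j (Suc k) z, dirn j (Suc k) z)) (noise w))"
  proof (rule state_indep[OF j, where A="?A"])
    show "?A \<subseteq> noise_indices" using j by (auto simp: noise_indices_def)
    show "?A \<inter> steps j k = {}" by (auto simp: steps_def)
    show "(\<lambda>z :: 'n noise. (rhon j (Suc k) z, dirn j (Suc k) z)) \<in> borel_measurable (PiM ?A (\<lambda>_. borel))"
      by (intro borel_measurable_Pair rhon_measurable dirn_measurable) auto
    show "(rhon j (Suc k) (restrict z ?A), dirn j (Suc k) (restrict z ?A)) = (rhon j (Suc k) z, dirn j (Suc k) z)" for z :: "'n noise"
      by (simp add: rhon_def dirn_def)
  qed
  define G where "G q = F (fst (fst q) + (rt (snd (fst q)))\<^sup>2 * fst (snd q), snd (fst q) + rt (snd (fst q)) *\<^sub>R snd (snd q))"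
    for q :: "(real \<times> (real ^ 'n)) \<times> real \<times> (real ^ 'n)"
  have G: "G \<in> borel_measurable borel"
    unfolding G_def by (rule measurable_compose[OF borel_space_pair F(1)])
  have Gb: "\<bar>G q\<bar> \<le> C" for q
    unfolding G_def by (rule F(2))
  have law: "distr P borel (\<lambda>w. (\<lambda>z. (rhon j (Suc k) z, dirn j (Suc k) z)) (noise w)) = step_law"
    using step_noise_law[OF j, of "Suc k"] by simp
  note fub = indep_var_fubini[OF ind G Gb, unfolded law, unfolded G_def fst_conv snd_conv]
  have "F (state x j (Suc k) w) = F (fst (state x j k w) + (rt (snd (state x j k w)))\<^sup>2 * rhon j (Suc k) (noise w),
     snd (state x j k w) + rt (snd (state x j k w)) *\<^sub>R dirn j (Suc k) (noise w))" for w
    by (simp add: state_def)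
  then show "expectation (\<lambda>w. F (state x j (Suc k) w)) =
    expectation (\<lambda>w. \<integral>p. F (fst (state x j k w) + (rt (snd (state x j k w)))\<^sup>2 * fst p, snd (state x j k w) + rt (snd (state x j k w)) *\<^sub>R snd p) \<partial>step_law)"
    using fub(1) by simp
  show "(\<lambda>w. \<integral>p. F (fst (state x j k w) + (rt (snd (state x j k w)))\<^sup>2 * fst p, snd (state x j k w) + rt (snd (state x j k w)) *\<^sub>R snd p) \<partial>step_law) \<in> borel_measurable P"
    by (rule fub(2))
  show "\<bar>\<integral>p. F (t + (rt y)\<^sup>2 * fst p, y + rt y *\<^sub>R snd p) \<partial>step_law\<bar> \<le> C"
    using fub(3)[of "(t, y)"] by simp
qed

text \<open>The sampled occupation point is no coordinate of \<open>steps j k\<close>, so it is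
  independent of the current state.\<close>

lemma running_step:
  assumes j: "1 \<le> j" and F: "F \<in> borel_measurable borel" "\<And>z. \<bar>F z\<bar> \<le> C"
  shows "expectation (\<lambda>w. (rt (snd (state x j k w)))\<^sup>2 * F (fst (state x j k w) + (rt (snd (state x j k w)))\<^sup>2 * fst (W (Src_VY j (Suc k)) w),
      snd (state x j k w) + rt (snd (state x j k w)) *\<^sub>R snd (W (Src_VY j (Suc k)) w))) =
    expectation (\<lambda>w. (rt (snd (state x j k w)))\<^sup>2 * (\<integral>z. F (fst (state x j k w) + (rt (snd (state x j k w)))\<^sup>2 * fst z,
      snd (state x j k w) + rt (snd (state x j k w)) *\<^sub>R snd z) \<partial>occ_law))"
proof -
  let ?A = "{Src_VY j (Suc k)}"
  have "indep_var borel (state x j k) borel (\<lambda>w. (\<lambda>z. z (Src_VY j (Suc k))) (noise w))"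
  proof (rule state_indep[OF j, where A="?A"])
    show "?A \<subseteq> noise_indices" using j by (auto simp: noise_indices_def)
    show "?A \<inter> steps j k = {}" by (auto simp: steps_def)
    show "(\<lambda>z. z (Src_VY j (Suc k))) \<in> borel_measurable (PiM ?A (\<lambda>_. borel))"
      by (rule measurable_component_singleton) simp
  qed simp
  then have ind: "indep_var borel (state x j k) borel (W (Src_VY j (Suc k)))" by simp
  define G where "G q = (rt (snd (fst q)))\<^sup>2 * F (fst (fst q) + (rt (snd (fst q)))\<^sup>2 * fst (snd q), snd (fst q) + rt (snd (fst q)) *\<^sub>R snd (snd q))"
    for q :: "(real \<times> (real ^ 'n)) \<times> real \<times> (real ^ 'n)"
  have c: "(\<lambda>q :: (real \<times> (real ^ 'n)) \<times> real \<times> (real ^ 'n). snd (fst q)) \<in> borel_measurable borel"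
    by (intro borel_measurable_continuous_onI continuous_intros)
  have G: "G \<in> borel_measurable borel"
    unfolding G_def by (intro borel_measurable_times borel_measurable_power measurable_compose[OF c rt_measurable]
       measurable_compose[OF borel_space_pair F(1)])
  have Gb: "\<bar>G q\<bar> \<le> (diameter D)\<^sup>2 * C" for q
    unfolding G_def abs_mult using rt_diam[of "snd (fst q)"] rt_nonneg[of "snd (fst q)"] F(2)
    by (intro mult_mono) (auto intro!: power_mono)
  have VYm: "W (Src_VY j (Suc k)) \<in> measurable P occ_law" and VYl: "distr P occ_law (W (Src_VY j (Suc k))) = occ_law"
    using VY_measurable[OF j, of "Suc k"] VY_law[OF j, of "Suc k"] by auto
  \<comment> \<open>The sampled point has its law on the restricted space, whereas the independence
    lemma works on the full Borel space; integrals of Borel functions agree.\<close>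
  have eq: "(\<integral>z. f z \<partial>distr P borel (W (Src_VY j (Suc k)))) = (\<integral>z. f z \<partial>occ_law)" if f: "f \<in> borel_measurable borel" for f :: "real \<times> (real ^ 'n) \<Rightarrow> real"
  proof -
    have "f \<in> borel_measurable occ_law"
      using measurable_restrict_space1[OF f] by (simp add: measurable_cong_sets[OF sets_occ_law refl])
    then have "(\<integral>z. f z \<partial>distr P occ_law (W (Src_VY j (Suc k)))) = expectation (\<lambda>w. f (W (Src_VY j (Suc k)) w))"
      by (rule integral_distr[OF VYm])
    moreover have "(\<integral>z. f z \<partial>distr P borel (W (Src_VY j (Suc k)))) = expectation (\<lambda>w. f (W (Src_VY j (Suc k)) w))"
      using ind by (intro integral_distr[OF _ f]) (auto dest: indep_var_rv2)
    ultimately show ?thesis by (simp only: VYl)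
  qed
  have fm: "(\<lambda>z. F (t + (rt y)\<^sup>2 * fst z, y + rt y *\<^sub>R snd z)) \<in> borel_measurable borel" for t y
    by (rule measurable_compose[OF _ F(1)], intro borel_measurable_continuous_onI continuous_intros)
  show ?thesis
    using indep_var_fubini(1)[OF ind G Gb] unfolding G_def fst_conv snd_conv by (simp add: eq[OF fm])
qed

end

subsection \<open>The bias of the walk\<close>

context wos
begin

lemma state_measurable_P:
  assumes j: "1 \<le> j"
  shows "state x j k \<in> borel_measurable P"
  using indep_var_rv1[OF state_indep[OF j, of "{}" k "\<lambda>_. (0, 0)" x]] by simp

lemma W_measurable: "i \<in> noise_indices \<Longrightarrow> W i \<in> borel_measurable P"
  using W_indep by (simp add: indep_vars_def)

lemma state_range:
  assumes "1 \<le> j" "x \<in> closure D" "w \<in> space P"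
  shows "0 \<le> fst (state x j k w)" "snd (state x j k w) \<in> closure D"
  using tim_nonneg[OF assms(1,3)] pos_closure[OF assms(2)] by (auto simp: state_def)

abbreviation u :: "real \<times> (real ^ 'n) \<Rightarrow> real" where
  "u \<equiv> value_fn (frontier D) h0 h1"

text \<open>The value function is controlled only for starts in the closed domain. Cutting it off
  makes it bounded everywhere, as \<open>chain_step\<close> requires.\<close>

definition uhat :: "real \<times> (real ^ 'n) \<Rightarrow> real" where
  "uhat z = (if 0 \<le> fst z \<and> snd z \<in> closure D then u z else 0)"

lemma domain_sets: "{z :: real \<times> (real ^ 'n). 0 \<le> fst z \<and> snd z \<in> closure D} \<in> sets borel"
proof -
  have "{z :: real \<times> (real ^ 'n). 0 \<le> fst z \<and> snd z \<in> closure D} = {0..} \<times> closure D" by auto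
  then show ?thesis by (simp add: borel_closed closed_Times)
qed

lemma uhat_measurable: "uhat \<in> borel_measurable borel"
  unfolding uhat_def[abs_def]
  by (rule measurable_If_set[OF value_fn_measurable[OF h0(1) h1(1)], of "\<lambda>_. 0"
      "{z. 0 \<le> fst z \<and> snd z \<in> closure D}", simplified]) (simp_all add: domain_sets)

lemma uhat_bound: "\<bar>uhat z\<bar> \<le> C0 + C1 * ((diameter D)\<^sup>2 / CARD('n))"
proof (cases "0 \<le> fst z \<and> snd z \<in> closure D")
  case True
  then have x: "snd z \<in> closure D" by simp
  have "\<bar>expectation (\<lambda>w. h0 (fst z + tau (snd z) w, snd z + B (tau (snd z) w) w))\<bar> \<le> expectation (\<lambda>w. C0)"
    using h0(2) value_fn_split(1)[OF h0 h1 x, of "fst z"]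
    by (intro order_trans[OF integral_abs_bound] integral_mono) auto
  then have 1: "\<bar>expectation (\<lambda>w. h0 (fst z + tau (snd z) w, snd z + B (tau (snd z) w) w))\<bar> \<le> C0"
    by (simp add: prob_space)
  have "C1 * expectation (tau (snd z)) \<le> C1 * ((diameter D)\<^sup>2 / CARD('n))"
    by (intro mult_left_mono tau_facts(3)[OF x] C1_nonneg)
  then have 2: "\<bar>expectation (running h1 (fst z) (snd z))\<bar> \<le> C1 * ((diameter D)\<^sup>2 / CARD('n))"
    using running_bound[OF h0 h1 x, of "fst z"] by linarith
  have "u z = expectation (\<lambda>w. h0 (fst z + tau (snd z) w, snd z + B (tau (snd z) w) w)) + expectation (running h1 (fst z) (snd z))"
    using value_fn_split(3)[OF h0 h1 x, of "fst z"] by simp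
  then have "uhat z = expectation (\<lambda>w. h0 (fst z + tau (snd z) w, snd z + B (tau (snd z) w) w)) + expectation (running h1 (fst z) (snd z))"
    using True by (simp add: uhat_def)
  then show ?thesis using 1 2 by linarith
next
  case False
  then have "uhat z = 0" unfolding uhat_def by (rule if_not_P)
  then show ?thesis using C0_nonneg C1_nonneg by simp
qed

lemma uhat_step:
  assumes t: "0 \<le> t" and y: "y \<in> closure D"
  shows "uhat (t, y) = (\<integral>p. uhat (t + (rt y)\<^sup>2 * fst p, y + rt y *\<^sub>R snd p) \<partial>step_law) +
    (rt y)\<^sup>2 / CARD('n) * (\<integral>z. h1 (t + (rt y)\<^sup>2 * fst z, y + rt y *\<^sub>R snd z) \<partial>occ_law)"
proof (cases "y \<in> D \<and> 0 < rt y")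
  case True
  have zm: "ball_exit 1 \<in> borel_measurable P" by (rule stoppingD(1)[OF stopping_ball_exit[OF zero_less_one]])
  interpret Z: prob_space "distr P borel (ball_exit 1)" by (rule prob_space_distr[OF zm])
  interpret S: prob_space "sphere_law :: (real ^ 'n) measure" by (rule prob_space_sphere_law)
  interpret ZS: pair_prob_space "distr P borel (ball_exit 1)" "sphere_law :: (real ^ 'n) measure" ..
  have sts: "sets step_law = sets borel"
  proof -
    have "sets step_law = sets ((borel :: real measure) \<Otimes>\<^sub>M (borel :: (real ^ 'n) measure))"
      by (rule sets_pair_measure_cong) auto
    then show ?thesis by (simp only: borel_prod)
  qed
  have m: "(\<lambda>p. (t + (rt y)\<^sup>2 * fst p, y + rt y *\<^sub>R snd p)) \<in> borel_measurable borel"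
    by (intro borel_measurable_continuous_onI continuous_intros)
  have ball: "ball y (rt y) \<subseteq> D"
    using ball_infdist_subset[of y] rt_le[OF y] True by (auto simp: subset_iff)
  have "AE p in step_law. 0 \<le> fst p \<and> norm (snd p) = 1"
  proof (rule ZS.AE_pair_measure)
    have "AE a in distr P borel (ball_exit 1). 0 \<le> a"
      by (subst AE_distr_iff[OF zm]) (auto simp: ball_exit_nonneg)
    then show "AE a in distr P borel (ball_exit 1). AE z in sphere_law. 0 \<le> fst (a, z) \<and> norm (snd (a, z)) = 1"
    proof eventually_elim
      case (elim a)
      show ?case using AE_sphere_law_norm by eventually_elim (use elim in simp)
    qed
  qed measurable
  then have "AE p in step_law. uhat (t + (rt y)\<^sup>2 * fst p, y + rt y *\<^sub>R snd p) = u (t + (rt y)\<^sup>2 * fst p, y + rt y *\<^sub>R snd p)"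
  proof eventually_elim
    case (elim p)
    have "y + rt y *\<^sub>R snd p \<in> closure D"
      using elim by (intro step_in_closure[OF y rt_nonneg rt_le[OF y]]) auto
    moreover have "0 \<le> t + (rt y)\<^sup>2 * fst p" using elim t by simp
    ultimately show ?case by (simp add: uhat_def)
  qed
  then have "(\<integral>p. uhat (t + (rt y)\<^sup>2 * fst p, y + rt y *\<^sub>R snd p) \<partial>step_law) = (\<integral>p. u (t + (rt y)\<^sup>2 * fst p, y + rt y *\<^sub>R snd p) \<partial>step_law)"
    using measurable_compose[OF m uhat_measurable] measurable_compose[OF m value_fn_measurable[OF h0(1) h1(1)]]
    by (intro integral_cong_AE) (simp_all add: measurable_cong_sets[OF sts refl])
  moreover have "u (t, y) = (\<integral>p. u (t + (rt y)\<^sup>2 * fst p, y + rt y *\<^sub>R snd p) \<partial>step_law) +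
    (rt y)\<^sup>2 / CARD('n) * (\<integral>z. h1 (t + (rt y)\<^sup>2 * fst z, y + rt y *\<^sub>R snd z) \<partial>occ_law)"
    using True by (intro value_fn_step[OF h0 h1 _ _ ball]) auto
  ultimately show ?thesis using t y by (simp add: uhat_def)
next
  case False
  \<comment> \<open>A walk with radius \<open>0\<close> stays where it is, and both sides reduce to
    \<open>uhat (t, y)\<close> because the step law has mass one.\<close>
  have "rt y = 0"
  proof (cases "y \<in> D")
    case True then show ?thesis using False rt_nonneg[of y] by simp
  next
    case False
    then have "y \<in> frontier D" using closure_cases[OF y] by simp
    then show ?thesis using rt_le[OF y] rt_nonneg[of y] by (simp add: infdist_zero)
  qed
  moreover have "prob_space step_law"
  proof -
    have zm: "ball_exit 1 \<in> borel_measurable P" by (rule stoppingD(1)[OF stopping_ball_exit[OF zero_less_one]])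
    interpret Z: prob_space "distr P borel (ball_exit 1)" by (rule prob_space_distr[OF zm])
    interpret S: prob_space "sphere_law :: (real ^ 'n) measure" by (rule prob_space_sphere_law)
    interpret ZS: pair_prob_space "distr P borel (ball_exit 1)" "sphere_law :: (real ^ 'n) measure" ..
    show ?thesis by (rule ZS.P.prob_space_axioms)
  qed
  ultimately show ?thesis by (simp add: prob_space.prob_space)
qed

section \<open>One sample of the estimator and its mean\<close>

abbreviation gain :: "real ^ 'n \<Rightarrow> nat \<Rightarrow> nat \<Rightarrow> 'n noise \<Rightarrow> real" where
  "gain x j k z \<equiv> (rt (pos x j k z))\<^sup>2 * h1 (tim x j k z + (rt (pos x j k z))\<^sup>2 * fst (z (Src_VY j (Suc k))),
     pos x j k z + rt (pos x j k z) *\<^sub>R snd (z (Src_VY j (Suc k))))"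

text \<open>The \<open>j\<close>-th summand of the estimator. The sum starts at \<open>0\<close>,
  pairing the state after \<open>k\<close> steps with the occupation point of index
  \<open>Suc k\<close>.\<close>

definition \<Phi> :: "real ^ 'n \<Rightarrow> nat \<Rightarrow> 'n noise \<Rightarrow> real" where
  "\<Phi> x j z = h0 (tim x j M z, pos x j M z) + 1 / CARD('n) * (\<Sum>k<M. gain x j k z)"

definition block :: "nat \<Rightarrow> source set" where
  "block j = (\<Union>k\<in>{1..}. {Src_VY j k, Src_rho j k, Src_Z j k})"

lemma block_noise: "1 \<le> j \<Longrightarrow> block j \<subseteq> noise_indices"
  by (auto simp: block_def noise_indices_def)

lemma steps_block: "steps j k \<subseteq> block j"
  by (auto simp: block_def steps_def)

lemma gain_measurable: "gain x j k \<in> borel_measurable (PiM (block j) (\<lambda>_. borel))"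
proof -
  note st = state_measurable[OF steps_block]
  have V: "(\<lambda>z :: 'n noise. z (Src_VY j (Suc k))) \<in> measurable (PiM (block j) (\<lambda>_. borel)) borel"
    by (rule measurable_component_singleton) (auto simp: block_def)
  have fs: "fst \<in> borel_measurable (borel :: (real \<times> (real ^ 'n)) measure)" "snd \<in> borel_measurable (borel :: (real \<times> (real ^ 'n)) measure)"
    by (intro borel_measurable_continuous_onI continuous_intros)+
  have r: "(\<lambda>z. rt (pos x j k z)) \<in> borel_measurable (PiM (block j) (\<lambda>_. borel))"
    by (rule measurable_compose[OF st(1) rt_measurable])
  show ?thesis
    by (intro borel_measurable_times borel_measurable_power r measurable_compose[OF _ h1(1)] borel_measurable_Pair
        borel_measurable_add st borel_measurable_scaleR measurable_compose[OF V fs(1)] measurable_compose[OF V fs(2)])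
qed

lemma \<Phi>_measurable: "\<Phi> x j \<in> borel_measurable (PiM (block j) (\<lambda>_. borel))"
  unfolding \<Phi>_def[abs_def]
  by (intro borel_measurable_add measurable_compose[OF _ h0(1)] borel_measurable_Pair state_measurable[OF steps_block]
      borel_measurable_times borel_measurable_const borel_measurable_sum gain_measurable)

lemma gain_local: "gain x j k (restrict z (block j)) = gain x j k z"
proof -
  have "pos x j k (restrict z (block j)) = pos x j k z \<and> tim x j k (restrict z (block j)) = tim x j k z"
    using steps_block by (intro state_local) auto
  moreover have "restrict z (block j) (Src_VY j (Suc k)) = z (Src_VY j (Suc k))" by (auto simp: block_def)
  ultimately show ?thesis by simp
qed

lemma \<Phi>_local: "\<Phi> x j (restrict z (block j)) = \<Phi> x j z"
proof -
  have "pos x j M (restrict z (block j)) = pos x j M z \<and> tim x j M (restrict z (block j)) = tim x j M z"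
    using steps_block by (intro state_local) auto
  then show ?thesis unfolding \<Phi>_def gain_local by simp
qed

lemma block_restrict_measurable: "1 \<le> j \<Longrightarrow> (\<lambda>w. restrict (noise w) (block j)) \<in> measurable P (PiM (block j) (\<lambda>_. borel))"
  using block_noise W_measurable by (intro measurable_restrict) auto

lemma gain_measurable_P: "1 \<le> j \<Longrightarrow> (\<lambda>w. gain x j k (noise w)) \<in> borel_measurable P"
  using measurable_compose[OF block_restrict_measurable gain_measurable[of x j k]] by (simp only: gain_local)

lemma \<Phi>_measurable_P: "1 \<le> j \<Longrightarrow> (\<lambda>w. \<Phi> x j (noise w)) \<in> borel_measurable P"
  using measurable_compose[OF block_restrict_measurable \<Phi>_measurable[of x j]] by (simp only: \<Phi>_local)

lemma rt_sq_le: "(rt y)\<^sup>2 \<le> (diameter D)\<^sup>2 / 4"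
  using power_mono[of "2 * rt y" "diameter D" 2] rt_diam[of y] rt_nonneg[of y] by (simp add: power_mult_distrib)

lemma gain_bound: "\<bar>gain x j k z\<bar> \<le> (diameter D)\<^sup>2 * C1"
  unfolding abs_mult using rt_sq_le h1(2) by (intro mult_mono) (auto intro: order_trans[OF rt_sq_le])

lemma \<Phi>_bound: "\<bar>\<Phi> x j z\<bar> \<le> C0 + M * (diameter D)\<^sup>2 * C1 / CARD('n)"
proof -
  have "\<bar>\<Sum>k<M. gain x j k z\<bar> \<le> (\<Sum>k<M. (diameter D)\<^sup>2 * C1)"
    by (rule order_trans[OF sum_abs sum_mono]) (rule gain_bound)
  then have "\<bar>\<Sum>k<M. gain x j k z\<bar> / CARD('n) \<le> M * (diameter D)\<^sup>2 * C1 / CARD('n)"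
    by (intro divide_right_mono) auto
  moreover have "\<bar>\<Phi> x j z\<bar> \<le> \<bar>h0 (tim x j M z, pos x j M z)\<bar> + \<bar>\<Sum>k<M. gain x j k z\<bar> / CARD('n)"
    unfolding \<Phi>_def by (rule order_trans[OF abs_triangle_ineq]) (simp add: abs_mult)
  ultimately show ?thesis using h0(2)[of "(tim x j M z, pos x j M z)"] by linarith
qed

lemma \<Phi>_integrable: "1 \<le> j \<Longrightarrow> integrable P (\<lambda>w. \<Phi> x j (noise w))"
  using \<Phi>_bound by (intro integrable_const_bound[where B="C0 + M * (diameter D)\<^sup>2 * C1 / CARD('n)"] \<Phi>_measurable_P) auto

lemma bounded_state_integrable:
  fixes F :: "real \<times> (real ^ 'n) \<Rightarrow> real"
  assumes "1 \<le> j" "F \<in> borel_measurable borel" "\<And>z. \<bar>F z\<bar> \<le> C"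
  shows "integrable P (\<lambda>w. F (state x j k w))"
  using assms(3) by (intro integrable_const_bound[where B=C] measurable_compose[OF state_measurable_P[OF assms(1)] assms(2)]) auto

lemma telescope:
  assumes j: "1 \<le> j" and x: "x \<in> closure D"
  shows "u (0, x) = expectation (\<lambda>w. uhat (state x j m w)) + 1 / CARD('n) * (\<Sum>k<m. expectation (\<lambda>w. gain x j k (noise w)))"
proof (induction m)
  case 0
  have "state x j 0 w = (0, x)" for w by (simp add: state_def)
  then show ?case using x by (simp add: uhat_def prob_space)
next
  case (Suc m)
  let ?t = "\<lambda>w. fst (state x j m w)" and ?y = "\<lambda>w. snd (state x j m w)"
  let ?Q = "\<lambda>w. \<integral>p. uhat (?t w + (rt (?y w))\<^sup>2 * fst p, ?y w + rt (?y w) *\<^sub>R snd p) \<partial>step_law"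
  let ?R = "\<lambda>w. (rt (?y w))\<^sup>2 * (\<integral>z. h1 (?t w + (rt (?y w))\<^sup>2 * fst z, ?y w + rt (?y w) *\<^sub>R snd z) \<partial>occ_law)"
  note cs = chain_step[OF j uhat_measurable uhat_bound]
  have iU: "integrable P (\<lambda>w. uhat (state x j m w))"
    by (rule bounded_state_integrable[OF j uhat_measurable uhat_bound])
  have iQ: "integrable P ?Q"
    using cs(3) by (intro integrable_const_bound[where B="C0 + C1 * ((diameter D)\<^sup>2 / CARD('n))"] cs(2)) auto
  have st: "uhat (state x j m w) = ?Q w + ?R w / CARD('n)" if "w \<in> space P" for w
    using uhat_step[OF state_range(1)[OF j x that, of m] state_range(2)[OF j x that, of m]] by simp
  have "expectation (\<lambda>w. gain x j m (noise w)) = expectation ?R"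
    using running_step[OF j h1, of x m] by (simp add: state_def)
  \<comment> \<open>The one-step identity at the random state: its source term is the drop of
    \<open>uhat\<close> in mean, so the gains telescope.\<close>
  moreover have "expectation (\<lambda>w. ?R w / CARD('n)) = expectation (\<lambda>w. uhat (state x j m w) - ?Q w)"
    using st by (intro Bochner_Integration.integral_cong) auto
  ultimately have "expectation (\<lambda>w. gain x j m (noise w)) / CARD('n) = expectation (\<lambda>w. uhat (state x j m w)) - expectation ?Q"
    using iU iQ by simp
  moreover have "expectation ?Q = expectation (\<lambda>w. uhat (state x j (Suc m) w))"
    by (rule cs(1)[symmetric])
  ultimately show ?case using Suc.IH by (simp add: algebra_simps add_divide_distrib)
qed

text \<open>The bound of \<open>err_le_near\<close> at distance \<open>\<delta>\<close>; within this
  distance the radius may be too small to guarantee progress.\<close>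

definition near_bound :: real where
  "near_bound = (lt0 + C1) * diameter D * \<delta> + lx0 * sqrt CARD('n) * sqrt (diameter D) * sqrt \<delta>"

text \<open>The bound of \<open>err_le_const\<close>, valid throughout the domain.\<close>

definition far_bound :: real where
  "far_bound = 2 * C0 + C1 * ((diameter D)\<^sup>2 / CARD('n))"

text \<open>The inverse of \<open>1 + q\<close>, where \<open>q\<close> compares the guaranteed
  growth \<open>(\<beta> * \<delta>)\<^sup>2\<close> of the squared distance per step with the
  largest value \<open>2 * (diameter D)\<^sup>2\<close> of the quadratic in
  \<open>lyap\<close>.\<close>

definition rate :: real where
  "rate = inverse (1 + \<beta>\<^sup>2 * \<delta>\<^sup>2 / (2 * (diameter D)\<^sup>2))"

abbreviation er :: "real ^ 'n \<Rightarrow> real" where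
  "er \<equiv> err C0 C1 lt0 lx0"

text \<open>A family of Lyapunov functions: one step of the walk maps index \<open>j\<close> below index \<open>j + 1\<close>.
  Close to the boundary the concave function \<open>er\<close> is small, and away from it the squared distance
  to \<open>x0\<close> grows by a fixed amount per step.\<close>
definition lyap :: "real ^ 'n \<Rightarrow> nat \<Rightarrow> real ^ 'n \<Rightarrow> real" where
  "lyap x0 j y = (if y \<in> closure D then
     min (er y) (near_bound + far_bound * rate ^ j * (2 * (diameter D)\<^sup>2 - (norm (y - x0))\<^sup>2) / (diameter D)\<^sup>2) else 0)"

lemma bounds_nonneg: "0 \<le> near_bound" "0 \<le> far_bound" "0 < rate" "rate \<le> 1"
  unfolding near_bound_def far_bound_def rate_def using constants_nonneg C0_nonneg C1_nonneg diameter_pos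
  by (auto intro!: add_nonneg_nonneg mult_nonneg_nonneg add_pos_nonneg inverse_le_1_iff[THEN iffD2] divide_nonneg_nonneg)

lemma lyap_measurable: "lyap x0 j \<in> borel_measurable borel"
proof -
  have "continuous_on (closure D) (\<lambda>y. min (er y) (near_bound + far_bound * rate ^ j * (2 * (diameter D)\<^sup>2 - (norm (y - x0))\<^sup>2) / (diameter D)\<^sup>2))"
    using diameter_pos C0_nonneg C1_nonneg constants_nonneg
    by (intro continuous_intros err_continuous) auto
  from borel_measurable_continuous_on_indicator[OF _ this]
  have "(\<lambda>y. indicator (closure D) y *\<^sub>R min (er y) (near_bound + far_bound * rate ^ j * (2 * (diameter D)\<^sup>2 - (norm (y - x0))\<^sup>2) / (diameter D)\<^sup>2)) \<in> borel_measurable borel"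
    by simp
  also have "(\<lambda>y. indicator (closure D) y *\<^sub>R min (er y) (near_bound + far_bound * rate ^ j * (2 * (diameter D)\<^sup>2 - (norm (y - x0))\<^sup>2) / (diameter D)\<^sup>2)) = lyap x0 j"
    by (auto simp: lyap_def fun_eq_iff)
  finally show ?thesis .
qed

text \<open>The reason for the constant \<open>2\<close> in \<open>lyap\<close>: the quadratic stays
  above the squared diameter, so index \<open>0\<close> covers \<open>far_bound\<close>, and the
  upper end costs only a factor two in the final bound.\<close>

lemma quad_range:
  assumes "x0 \<in> closure D" "y \<in> closure D"
  shows "(diameter D)\<^sup>2 \<le> 2 * (diameter D)\<^sup>2 - (norm (y - x0))\<^sup>2" "2 * (diameter D)\<^sup>2 - (norm (y - x0))\<^sup>2 \<le> 2 * (diameter D)\<^sup>2"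
  using power_mono[OF dist_le_diameter[OF assms(2,1)], of 2] by auto

lemma lyap_range:
  assumes x0: "x0 \<in> closure D"
  shows "0 \<le> lyap x0 j y" "lyap x0 j y \<le> far_bound"
proof -
  have "0 \<le> er y" if "y \<in> closure D" using that constants_nonneg C0_nonneg C1_nonneg by (intro err_nonneg) auto
  moreover have "er y \<le> far_bound" unfolding far_bound_def
    using constants_nonneg C0_nonneg C1_nonneg by (intro err_le_const) auto
  moreover have "0 \<le> near_bound + far_bound * rate ^ j * (2 * (diameter D)\<^sup>2 - (norm (y - x0))\<^sup>2) / (diameter D)\<^sup>2" if "y \<in> closure D"
    using bounds_nonneg quad_range[OF x0 that] order_trans[OF zero_le_power2 quad_range(1)[OF x0 that]]
    by (intro add_nonneg_nonneg divide_nonneg_nonneg mult_nonneg_nonneg) auto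
  ultimately show "0 \<le> lyap x0 j y" "lyap x0 j y \<le> far_bound"
    using bounds_nonneg(2) by (auto simp: lyap_def min_le_iff_disj)
qed

text \<open>Both branches are averaged over antipodal points. The branch \<open>er\<close> is
  concave and does not grow. The quadratic loses \<open>(rt y)\<^sup>2\<close>: away from the
  boundary that is a fixed fraction, and near it \<open>er y\<close> is already below
  \<open>near_bound\<close>.\<close>

lemma lyap_step:
  assumes x0: "x0 \<in> closure D" and y: "y \<in> closure D"
  shows "(\<integral>z. lyap x0 j (y + rt y *\<^sub>R z) \<partial>sphere_law) \<le> lyap x0 (Suc j) y"
proof -
  let ?d2 = "(diameter D)\<^sup>2"
  let ?f = "\<lambda>y. 2 * ?d2 - (norm (y - x0))\<^sup>2"
  have d2: "0 < ?d2" using diameter_pos by simp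
  note cn = C0_nonneg C1_nonneg constants_nonneg(4,5)
  have b: "\<bar>lyap x0 j z\<bar> \<le> far_bound" for z using lyap_range[OF x0, of j z] by simp
  have in1: "y + rt y *\<^sub>R z \<in> closure D" "y - rt y *\<^sub>R z \<in> closure D" if "norm z = 1" for z
    using step_in_closure[OF y rt_nonneg rt_le[OF y], of z] step_in_closure[OF y rt_nonneg rt_le[OF y], of "- z"] that by auto
  have 1: "(\<integral>z. lyap x0 j (y + rt y *\<^sub>R z) \<partial>sphere_law) \<le> er y"
  proof (rule sphere_law_midpoint[OF lyap_measurable b])
    fix z :: "real ^ 'n" assume z: "norm z = 1"
    have "lyap x0 j (y + rt y *\<^sub>R z) \<le> er (y + rt y *\<^sub>R z)" "lyap x0 j (y - rt y *\<^sub>R z) \<le> er (y - rt y *\<^sub>R z)"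
      using in1[OF z] by (auto simp: lyap_def)
    from divide_right_mono[OF add_mono[OF this], of 2]
    show "(lyap x0 j (y + rt y *\<^sub>R z) + lyap x0 j (y - rt y *\<^sub>R z)) / 2 \<le> er y"
      by (rule order_trans[OF _ err_midpoint[OF cn in1[OF z]]]) simp
  qed
  have 2: "(\<integral>z. lyap x0 j (y + rt y *\<^sub>R z) \<partial>sphere_law) \<le> near_bound + far_bound * rate ^ j * (?f y - (rt y)\<^sup>2) / ?d2"
  proof (rule sphere_law_midpoint[OF lyap_measurable b])
    fix z :: "real ^ 'n" assume z: "norm z = 1"
    \<comment> \<open>The parallelogram identity: the squared distance to \<open>x0\<close>,
      averaged over antipodal points, grows by exactly the squared radius.\<close>
    have par: "(norm (y + rt y *\<^sub>R z - x0))\<^sup>2 + (norm (y - rt y *\<^sub>R z - x0))\<^sup>2 = 2 * (norm (y - x0))\<^sup>2 + 2 * (rt y)\<^sup>2"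
    proof -
      have "(norm (a + b))\<^sup>2 + (norm (a - b))\<^sup>2 = 2 * (norm a)\<^sup>2 + 2 * (norm b)\<^sup>2" for a b :: "real ^ 'n"
        by (simp add: power2_norm_eq_inner inner_add_left inner_add_right inner_diff_left inner_diff_right)
      from this[of "y - x0" "rt y *\<^sub>R z"] show ?thesis using z by (simp add: algebra_simps)
    qed
    have "lyap x0 j (y + rt y *\<^sub>R z) + lyap x0 j (y - rt y *\<^sub>R z) \<le>
      (near_bound + far_bound * rate ^ j * ?f (y + rt y *\<^sub>R z) / ?d2) + (near_bound + far_bound * rate ^ j * ?f (y - rt y *\<^sub>R z) / ?d2)"
      using in1[OF z] by (intro add_mono) (auto simp: lyap_def)
    also have "\<dots> = 2 * near_bound + far_bound * rate ^ j * (?f (y + rt y *\<^sub>R z) + ?f (y - rt y *\<^sub>R z)) / ?d2"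
      by (simp only: add_divide_distrib distrib_left mult_2 ac_simps)
    also have "?f (y + rt y *\<^sub>R z) + ?f (y - rt y *\<^sub>R z) = 2 * (?f y - (rt y)\<^sup>2)" using par by simp
    finally show "(lyap x0 j (y + rt y *\<^sub>R z) + lyap x0 j (y - rt y *\<^sub>R z)) / 2 \<le> near_bound + far_bound * rate ^ j * (?f y - (rt y)\<^sup>2) / ?d2"
      by (simp add: field_simps)
  qed
  have "(\<integral>z. lyap x0 j (y + rt y *\<^sub>R z) \<partial>sphere_law) \<le> near_bound + far_bound * rate ^ Suc j * ?f y / ?d2"
  proof (cases "\<delta> \<le> infdist y (frontier D)")
    case True
    \<comment> \<open>Since the quadratic is at most \<open>2 * ?d2\<close>, losing
      \<open>(\<beta> * \<delta>)\<^sup>2\<close> means losing at least the fraction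
      \<open>q\<close>, and \<open>1 - q\<close> is at most \<open>1 / (1 + q)\<close>.\<close>
    define q where "q = \<beta>\<^sup>2 * \<delta>\<^sup>2 / (2 * ?d2)"
    have q: "0 \<le> q" using d2 by (simp add: q_def)
    have fy: "0 \<le> ?f y" "?f y \<le> 2 * ?d2" using quad_range[OF x0 y] zero_le_power2[of "diameter D"] by linarith+
    have "(\<beta> * \<delta>)\<^sup>2 \<le> (rt y)\<^sup>2" using rt_lower[OF y True] constants_nonneg by (intro power_mono) auto
    moreover have "q * ?f y \<le> q * (2 * ?d2)" using q fy by (intro mult_left_mono) auto
    moreover have "q * (2 * ?d2) = (\<beta> * \<delta>)\<^sup>2" using d2 by (simp add: q_def power_mult_distrib)
    ultimately have "?f y - (rt y)\<^sup>2 \<le> (1 - q) * ?f y" by (simp add: algebra_simps)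
    also have "\<dots> \<le> rate * ?f y"
    proof (rule mult_right_mono[OF _ fy(1)])
      have "(1 - q) * (1 + q) \<le> 1" by (simp add: algebra_simps)
      then show "1 - q \<le> rate" unfolding rate_def q_def[symmetric] using q by (simp add: field_simps)
    qed
    finally have "far_bound * rate ^ j * (?f y - (rt y)\<^sup>2) / ?d2 \<le> far_bound * rate ^ j * (rate * ?f y) / ?d2"
      using bounds_nonneg d2 by (intro divide_right_mono mult_left_mono) auto
    then show ?thesis using 2 by (simp add: mult_ac)
  next
    case False
    have "er y \<le> near_bound" unfolding near_bound_def
      using False constants_nonneg by (intro err_le_near[OF cn y]) auto
    moreover have "0 \<le> far_bound * rate ^ Suc j * ?f y / ?d2"
      using bounds_nonneg order_trans[OF zero_le_power2 quad_range(1)[OF x0 y]]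
      by (intro divide_nonneg_nonneg mult_nonneg_nonneg) auto
    ultimately show ?thesis using 1 by linarith
  qed
  with 1 show ?thesis using y by (simp add: lyap_def)
qed

text \<open>The last step is averaged first and raises the index by one, hence the induction over
  \<open>k\<close> with arbitrary \<open>i\<close>.\<close>

lemma lyap_expectation:
  assumes j: "1 \<le> j" and x: "x \<in> closure D"
  shows "expectation (\<lambda>w. lyap x i (snd (state x j k w))) \<le> lyap x (i + k) x"
proof (induction k arbitrary: i)
  case 0
  have "snd (state x j 0 w) = x" for w by (simp add: state_def)
  then show ?case by (simp add: prob_space)
next
  case (Suc k)
  define F where "F z = lyap x i (snd z)" for z :: "real \<times> (real ^ 'n)"
  have sm: "snd \<in> borel_measurable (borel :: (real \<times> (real ^ 'n)) measure)"
    by (intro borel_measurable_continuous_onI continuous_intros)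
  have F: "F \<in> borel_measurable borel"
    unfolding F_def by (rule measurable_compose[OF sm lyap_measurable])
  have Fb: "\<bar>F z\<bar> \<le> far_bound" for z
    using lyap_range[OF x, of i "snd z"] unfolding F_def by simp
  note cs = chain_step[OF j F Fb, unfolded F_def snd_conv]
  have zm: "ball_exit 1 \<in> borel_measurable P" by (rule stoppingD(1)[OF stopping_ball_exit[OF zero_less_one]])
  interpret Z: prob_space "distr P borel (ball_exit 1)" by (rule prob_space_distr[OF zm])
  interpret S: prob_space "sphere_law :: (real ^ 'n) measure" by (rule prob_space_sphere_law)
  interpret ZS: pair_prob_space "distr P borel (ball_exit 1)" "sphere_law :: (real ^ 'n) measure" ..
  \<comment> \<open>The function depends on the position only, so the clock integrates to
    one.\<close>
  have marg: "(\<integral>p. lyap x i (y + rt y *\<^sub>R snd p) \<partial>step_law) = (\<integral>z. lyap x i (y + rt y *\<^sub>R z) \<partial>sphere_law)" for y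
  proof -
    have m: "(\<lambda>z. lyap x i (y + rt y *\<^sub>R z)) \<in> borel_measurable borel"
      by (rule measurable_compose[OF _ lyap_measurable], intro borel_measurable_continuous_onI continuous_intros)
    have "(\<lambda>p. lyap x i (y + rt y *\<^sub>R snd p)) \<in> borel_measurable step_law"
      by (rule measurable_compose[OF measurable_snd]) (use m in simp)
    then have "integrable step_law (\<lambda>p. lyap x i (y + rt y *\<^sub>R snd p))"
      using lyap_range[OF x] by (intro ZS.P.integrable_const_bound[where B=far_bound]) auto
    from ZS.integral_fst'[OF this] show ?thesis using Z.prob_space by simp
  qed
  have "expectation (\<lambda>w. lyap x i (snd (state x j (Suc k) w))) =
    expectation (\<lambda>w. \<integral>z. lyap x i (snd (state x j k w) + rt (snd (state x j k w)) *\<^sub>R z) \<partial>sphere_law)"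
    unfolding cs(1) marg ..
  also have "\<dots> \<le> expectation (\<lambda>w. lyap x (Suc i) (snd (state x j k w)))"
  proof (rule integral_mono)
    show "integrable P (\<lambda>w. \<integral>z. lyap x i (snd (state x j k w) + rt (snd (state x j k w)) *\<^sub>R z) \<partial>sphere_law)"
      using cs(2,3) unfolding marg by (intro integrable_const_bound[where B=far_bound]) auto
    show "integrable P (\<lambda>w. lyap x (Suc i) (snd (state x j k w)))"
      using lyap_range[OF x] by (intro integrable_const_bound[where B=far_bound] measurable_compose[OF measurable_compose[OF state_measurable_P[OF j] sm] lyap_measurable]) auto
    fix w assume "w \<in> space P"
    then show "(\<integral>z. lyap x i (snd (state x j k w) + rt (snd (state x j k w)) *\<^sub>R z) \<partial>sphere_law) \<le> lyap x (Suc i) (snd (state x j k w))"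
      by (intro lyap_step[OF x state_range(2)[OF j x]])
  qed
  also have "\<dots> \<le> lyap x (i + Suc k) x" using Suc.IH[of "Suc i"] by simp
  finally show ?case .
qed

theorem bias:
  assumes j: "1 \<le> j" and x: "x \<in> closure D"
  shows "\<bar>u (0, x) - expectation (\<lambda>w. \<Phi> x j (noise w))\<bar> \<le> near_bound + 2 * far_bound * rate ^ M"
proof -
  note cn = C0_nonneg C1_nonneg constants_nonneg(4,5)
  have ig: "integrable P (\<lambda>w. gain x j k (noise w))" for k
  proof (rule integrable_const_bound[where B="(diameter D)\<^sup>2 * C1", OF AE_I2 gain_measurable_P[OF j]])
    show "norm (gain x j k (noise w)) \<le> (diameter D)\<^sup>2 * C1" for w
      unfolding real_norm_def by (rule gain_bound)
  qed
  have ih: "integrable P (\<lambda>w. h0 (state x j M w))" by (rule bounded_state_integrable[OF j h0])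
  have iu: "integrable P (\<lambda>w. uhat (state x j M w))" by (rule bounded_state_integrable[OF j uhat_measurable uhat_bound])
  have "\<Phi> x j (noise w) = h0 (state x j M w) + 1 / CARD('n) * (\<Sum>k<M. gain x j k (noise w))" for w
    by (simp add: \<Phi>_def state_def)
  then have "expectation (\<lambda>w. \<Phi> x j (noise w)) = expectation (\<lambda>w. h0 (state x j M w)) + 1 / CARD('n) * (\<Sum>k<M. expectation (\<lambda>w. gain x j k (noise w)))"
    using ig ih by (simp add: Bochner_Integration.integral_sum)
  then have "u (0, x) - expectation (\<lambda>w. \<Phi> x j (noise w)) = expectation (\<lambda>w. uhat (state x j M w) - h0 (state x j M w))"
    using telescope[OF j x, of M] ih iu by simp
  also have "\<bar>\<dots>\<bar> \<le> expectation (\<lambda>w. lyap x 0 (snd (state x j M w)))"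
  proof (rule order_trans[OF integral_abs_bound integral_mono])
    show "integrable P (\<lambda>w. \<bar>uhat (state x j M w) - h0 (state x j M w)\<bar>)" using iu ih by auto
    have sm: "snd \<in> borel_measurable (borel :: (real \<times> (real ^ 'n)) measure)"
      by (intro borel_measurable_continuous_onI continuous_intros)
    show "integrable P (\<lambda>w. lyap x 0 (snd (state x j M w)))"
      using lyap_range[OF x] by (intro integrable_const_bound[where B=far_bound] measurable_compose[OF measurable_compose[OF state_measurable_P[OF j] sm] lyap_measurable]) auto
    fix w assume w: "w \<in> space P"
    obtain t y where ty: "state x j M w = (t, y)" by fastforce
    have t: "0 \<le> t" and y: "y \<in> closure D" using state_range[OF j x w, of M] by (auto simp: ty)
    have "\<bar>u (t, y) - h0 (t, y)\<bar> \<le> min (2 * C0) (lt0 * exit_bound y + lx0 * sqrt (CARD('n) * exit_bound y)) + C1 * exit_bound y"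
      using h0_lipschitz[OF _ t _ y]
      by (intro value_fn_close[OF h0 h1 y t constants_nonneg(4,5) _ tau_le_exit_bound[OF y]]) auto
    then have e: "\<bar>u (t, y) - h0 (t, y)\<bar> \<le> er y" by (simp add: err_def)
    \<comment> \<open>At index \<open>0\<close> the quadratic branch is at least
      \<open>far_bound\<close>, so the minimum in \<open>lyap\<close> is \<open>er y\<close>, which
      bounds the error at the last state.\<close>
    have "er y \<le> far_bound" unfolding far_bound_def by (rule err_le_const[OF cn])
    also have "\<dots> \<le> near_bound + far_bound * (2 * (diameter D)\<^sup>2 - (norm (y - x))\<^sup>2) / (diameter D)\<^sup>2"
    proof -
      have "1 \<le> (2 * (diameter D)\<^sup>2 - (norm (y - x))\<^sup>2) / (diameter D)\<^sup>2"
        using quad_range(1)[OF x y] diameter_pos by simp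
      from mult_left_mono[OF this bounds_nonneg(2)] show ?thesis using bounds_nonneg(1) by simp
    qed
    finally have "lyap x 0 y = er y" using y by (simp add: lyap_def)
    then show "\<bar>uhat (state x j M w) - h0 (state x j M w)\<bar> \<le> lyap x 0 (snd (state x j M w))"
      using e t y by (simp add: ty uhat_def)
  qed
  also have "\<dots> \<le> lyap x M x" using lyap_expectation[OF j x, of 0 M] by simp
  \<comment> \<open>At the starting point the quadratic equals
    \<open>2 * (diameter D)\<^sup>2\<close>, the source of the factor two.\<close>
  also have "\<dots> \<le> near_bound + 2 * far_bound * rate ^ M"
    using x diameter_pos by (simp add: lyap_def min_le_iff_disj field_simps)
  finally show ?thesis .
qed

end

subsection \<open>Uniform deviation over a finite net\<close>

text \<open>Hoeffding's lemma on an interval of length \<open>2 * b\<close>: the factor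
  \<open>(2 * b)\<^sup>2 / 8\<close> becomes \<open>b\<^sup>2 / 2\<close>, and independence
  multiplies the factors.\<close>

lemma (in prob_space) exp_sum_bound:
  fixes G :: "'i \<Rightarrow> 'a \<Rightarrow> real"
  assumes J: "finite J" and ind: "indep_vars (\<lambda>_. borel) G J" and b: "\<And>j w. j \<in> J \<Longrightarrow> w \<in> space M \<Longrightarrow> \<bar>G j w\<bar> \<le> b"
    and l: "0 < l"
  shows "(\<integral>\<^sup>+w. ennreal (exp (l * (\<Sum>j\<in>J. G j w - expectation (G j)))) \<partial>M) \<le> ennreal (exp (card J * (l\<^sup>2 * b\<^sup>2 / 2)))"
proof -
  have "(\<integral>\<^sup>+w. ennreal (exp (l * (\<Sum>j\<in>J. G j w - expectation (G j)))) \<partial>M) =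
    (\<integral>\<^sup>+w. (\<Prod>j\<in>J. ennreal (exp (l * (G j w - expectation (G j))))) \<partial>M)"
    by (simp add: sum_distrib_left exp_sum J prod_ennreal)
  also have "\<dots> = (\<Prod>j\<in>J. \<integral>\<^sup>+w. ennreal (exp (l * (G j w - expectation (G j)))) \<partial>M)"
    by (intro indep_vars_nn_integral J indep_vars_compose2[OF ind]) auto
  also have "\<dots> \<le> (\<Prod>j\<in>J. ennreal (exp (l\<^sup>2 * b\<^sup>2 / 2)))"
  proof (intro prod_mono_ennreal)
    fix j assume j: "j \<in> J"
    interpret interval_bounded_random_variable M "G j" "- b" b
      using ind j b by unfold_locales (auto simp: indep_vars_def intro!: AE_I2 dest: abs_le_D1 abs_le_D2 minus_le_iff[THEN iffD1] b[OF j])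
    show "(\<integral>\<^sup>+w. ennreal (exp (l * (G j w - expectation (G j)))) \<partial>M) \<le> ennreal (exp (l\<^sup>2 * b\<^sup>2 / 2))"
      using Hoeffdings_lemma_nn_integral[OF l] by (simp add: power2_eq_square mult_ac)
  qed
  also have "\<dots> = ennreal (exp (card J * (l\<^sup>2 * b\<^sup>2 / 2)))"
    by (simp add: ennreal_power exp_of_nat_mult[symmetric])
  finally show ?thesis .
qed

text \<open>The maximum of finitely many averages is dominated through
  \<open>l * max \<bar>S c\<bar> \<le> ln (\<Sum>c. exp (l * S c) + exp (- l * S c))\<close>, the logarithm being
  replaced by its tangent at the mean.\<close>
lemma (in prob_space) expected_maximum_deviation:
  fixes G :: "'c \<Rightarrow> 'i \<Rightarrow> 'a \<Rightarrow> real"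
  assumes J: "finite J" "J \<noteq> {}" and C: "finite C" "C \<noteq> {}" "real (card C) \<le> N"
    and ind: "\<And>c. c \<in> C \<Longrightarrow> indep_vars (\<lambda>_. borel) (G c) J"
    and b: "\<And>c j w. c \<in> C \<Longrightarrow> j \<in> J \<Longrightarrow> w \<in> space M \<Longrightarrow> \<bar>G c j w\<bar> \<le> b"
  shows "\<exists>g. integrable M g \<and> (\<forall>w\<in>space M. \<forall>c\<in>C. \<bar>\<Sum>j\<in>J. G c j w - expectation (G c j)\<bar> \<le> g w) \<and>
    expectation g \<le> b * sqrt (2 * ln (2 * N) * card J)"
proof -
  let ?S = "\<lambda>c w. \<Sum>j\<in>J. G c j w - expectation (G c j)"
  obtain c0 j0 w0 where c0: "c0 \<in> C" and j0: "j0 \<in> J" and w0: "w0 \<in> space M" using J C not_empty by blast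
  have b0: "0 \<le> b" using b[OF c0 j0 w0] by linarith
  have N1: "1 \<le> N" using C card_gt_0_iff[of C] by linarith
  have n0: "0 < real (card J)" using J by (simp add: card_gt_0_iff)
  show ?thesis
  \<comment> \<open>The parameter \<open>l\<close> below divides by \<open>b\<close>; with
    \<open>b = 0\<close> all deviations vanish.\<close>
  proof (cases "b = 0")
    case True
    have "?S c w = 0" if "c \<in> C" "w \<in> space M" for c w
    proof (rule sum.neutral, rule ballI)
      fix j assume j: "j \<in> J"
      have z: "G c j w = 0" if "w \<in> space M" for w using b[OF \<open>c \<in> C\<close> j that] True by simp
      then have "expectation (G c j) = expectation (\<lambda>_. 0)" by (intro Bochner_Integration.integral_cong) auto
      then show "G c j w - expectation (G c j) = 0" using z that by simp
    qed
    then show ?thesis using True by (intro exI[of _ "\<lambda>_. 0"]) auto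
  next
    case False
    then have bp: "0 < b" using b0 by simp
    define q where "q = ln (2 * N)"
    have q: "0 < q" using N1 by (simp add: q_def)
    define n where "n = real (card J)"
    \<comment> \<open>Chosen so that the Hoeffding exponent equals \<open>q = ln (2 * N)\<close>,
      which balances it against the logarithm of the number of terms.\<close>
    define l where "l = sqrt (2 * q / n) / b"
    have l: "0 < l" using q n0 bp by (simp add: l_def n_def)
    have l2: "n * (l\<^sup>2 * b\<^sup>2 / 2) = q" using q n0 bp by (simp add: l_def n_def power_divide)
    \<comment> \<open>An upper bound for the mean of \<open>Q\<close>, which has at most
      \<open>2 * N\<close> terms of mean at most \<open>exp q\<close>. Its logarithm is
      \<open>2 * q\<close>.\<close>
    define A where "A = 2 * N * exp q"
    have A: "0 < A" using N1 by (simp add: A_def)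
    have lnA: "ln A = 2 * q" using N1 by (simp add: A_def q_def ln_mult)
    define Q where "Q w = (\<Sum>c\<in>C. exp (l * ?S c w) + exp (l * - ?S c w))" for w
    have Gm: "G c j \<in> borel_measurable M" if "c \<in> C" "j \<in> J" for c j
      using ind[OF that(1)] that(2) by (simp add: indep_vars_def)
    have Sm: "?S c \<in> borel_measurable M" if "c \<in> C" for c
      using Gm[OF that] by (intro borel_measurable_sum borel_measurable_diff) auto
    have Qm: "Q \<in> borel_measurable M"
      unfolding Q_def[abs_def]
    proof (rule borel_measurable_sum)
      fix c assume "c \<in> C"
      note S = Sm[OF this]
      show "(\<lambda>w. exp (l * ?S c w) + exp (l * - ?S c w)) \<in> borel_measurable M"
        by (intro borel_measurable_add measurable_compose[OF _ borel_measurable_exp] borel_measurable_times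
            borel_measurable_const borel_measurable_uminus S)
    qed
    have Q0: "0 \<le> Q w" for w unfolding Q_def by (intro sum_nonneg add_nonneg_nonneg) auto
    have e1: "(\<integral>\<^sup>+w. ennreal (exp (l * ?S c w)) \<partial>M) \<le> ennreal (exp q)" if c: "c \<in> C" for c
      using exp_sum_bound[OF J(1) ind[OF c] b[OF c] l] l2 by (simp add: n_def)
    have e2: "(\<integral>\<^sup>+w. ennreal (exp (l * - ?S c w)) \<partial>M) \<le> ennreal (exp q)" if c: "c \<in> C" for c
    proof -
      have "indep_vars (\<lambda>_. borel) (\<lambda>j w. - G c j w) J" by (rule indep_vars_compose2[OF ind[OF c]]) auto
      from exp_sum_bound[OF J(1) this _ l, of b] b[OF c]
      have "(\<integral>\<^sup>+w. ennreal (exp (l * (\<Sum>j\<in>J. - G c j w - expectation (\<lambda>w. - G c j w)))) \<partial>M) \<le> ennreal (exp q)"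
        using l2 by (simp add: n_def)
      moreover have "(\<Sum>j\<in>J. - G c j w - expectation (\<lambda>w. - G c j w)) = - ?S c w" for w
        by (simp add: sum_negf[symmetric])
      ultimately show ?thesis by simp
    qed
    have em: "(\<lambda>w. ennreal (exp (l * ?S c w))) \<in> borel_measurable M" "(\<lambda>w. ennreal (exp (l * - ?S c w))) \<in> borel_measurable M"
      if "c \<in> C" for c
      by (intro measurable_compose[OF _ measurable_ennreal] measurable_compose[OF _ borel_measurable_exp] borel_measurable_times
            borel_measurable_const borel_measurable_uminus Sm[OF that])+
    have "(\<integral>\<^sup>+w. ennreal (Q w) \<partial>M) = (\<integral>\<^sup>+w. (\<Sum>c\<in>C. ennreal (exp (l * ?S c w)) + ennreal (exp (l * - ?S c w))) \<partial>M)"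
      unfolding Q_def by (intro nn_integral_cong) (simp add: sum_ennreal ennreal_plus[symmetric] del: ennreal_plus)
    also have "\<dots> = (\<Sum>c\<in>C. \<integral>\<^sup>+w. ennreal (exp (l * ?S c w)) + ennreal (exp (l * - ?S c w)) \<partial>M)"
      by (intro nn_integral_sum borel_measurable_add em)
    also have "\<dots> = (\<Sum>c\<in>C. (\<integral>\<^sup>+w. ennreal (exp (l * ?S c w)) \<partial>M) + (\<integral>\<^sup>+w. ennreal (exp (l * - ?S c w)) \<partial>M))"
      by (intro sum.cong refl nn_integral_add em)
    also have "\<dots> \<le> (\<Sum>c\<in>C. ennreal (exp q) + ennreal (exp q))" by (intro sum_mono add_mono e1 e2)
    also have "\<dots> = ennreal (card C * (2 * exp q))"
      by (simp add: ennreal_plus[symmetric] ennreal_mult' ennreal_of_nat_eq_real_of_nat del: ennreal_plus)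
    also have "\<dots> \<le> ennreal A" using C(3) by (intro ennreal_leI) (simp add: A_def)
    finally have QA: "(\<integral>\<^sup>+w. ennreal (Q w) \<partial>M) \<le> ennreal A" .
    have Qi: "integrable M Q"
      using QA Q0 by (intro integrableI_bounded Qm) (auto simp: le_less_trans)
    have EQ: "expectation Q \<le> A"
      using QA nn_integral_eq_integral[OF Qi] Q0 A by simp
    \<comment> \<open>The tangent to the logarithm at \<open>A\<close>: it dominates every
      deviation, is affine in \<open>Q\<close> and so integrable at once, and has mean at most
      \<open>ln A / l\<close>.\<close>
    define g where "g w = (ln A + Q w / A - 1) / l" for w
    have gi: "integrable M g" unfolding g_def[abs_def] using Qi by simp
    have dom: "\<bar>?S c w\<bar> \<le> g w" if c: "c \<in> C" for c w
    proof -
      have "exp (l * \<bar>?S c w\<bar>) \<le> exp (l * ?S c w) + exp (l * - ?S c w)"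
        by (cases "0 \<le> ?S c w") (simp_all add: abs_of_nonneg abs_of_neg)
      also have "\<dots> \<le> Q w"
        unfolding Q_def by (rule member_le_sum[OF c _ C(1), where f="\<lambda>c. exp (l * ?S c w) + exp (l * - ?S c w)"]) (auto intro: add_nonneg_nonneg)
      finally have e: "exp (l * \<bar>?S c w\<bar>) \<le> Q w" .
      then have Qp: "0 < Q w" by (rule less_le_trans[OF exp_gt_zero])
      have "l * \<bar>?S c w\<bar> \<le> ln (Q w)" using e Qp by (simp only: ln_ge_iff)
      also have "ln (Q w) = ln A + ln (Q w / A)" using Qp A by (simp add: ln_div)
      also have "\<dots> \<le> ln A + (Q w / A - 1)" using Qp A by (intro add_left_mono ln_le_minus_one) simp
      finally show ?thesis using l by (simp add: g_def pos_le_divide_eq mult.commute)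
    qed
    have "expectation g = (ln A + expectation Q / A - 1) / l"
      unfolding g_def[abs_def] using Qi by (simp add: prob_space)
    also have "\<dots> \<le> (2 * q) / l" using EQ A l lnA by (intro divide_right_mono) (simp_all add: divide_simps)
    also have "\<dots> = b * sqrt (2 * q * n)"
    proof -
      have "sqrt (2 * q * n) * sqrt (2 * q / n) = sqrt ((2 * q) * (2 * q))"
        unfolding real_sqrt_mult[symmetric] using n0 by (simp add: n_def)
      also have "\<dots> = 2 * q" unfolding real_sqrt_abs2 using q by simp
      finally have "sqrt (2 * q * n) * sqrt (2 * q / n) = 2 * q" .
      then have "b * sqrt (2 * q * n) * l = 2 * q" using bp by (simp add: l_def)
      then show ?thesis using l by (simp add: field_simps)
    qed
    finally show ?thesis using gi dom unfolding q_def n_def by (intro exI[of _ g]) auto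
  qed
qed

section \<open>A finite net of the closed domain\<close>

lemma interval_grid:
  fixes t D :: real
  assumes t: "0 \<le> t" "t \<le> D" and D: "0 < D" and m: "1 \<le> (m::nat)"
  shows "\<exists>k<m. \<bar>t - (real k + 1/2) * (D / m)\<bar> \<le> D / (2 * m)"
\<comment> \<open>At the right end the floor would give the index \<open>m\<close>, one beyond the
  last cell.\<close>
proof (cases "t = D")
  case True
  have "(real (m - 1) + 1/2) * (D / m) = D - D / (2 * m)" using m by (simp add: of_nat_diff field_simps)
  then show ?thesis using True m D by (intro exI[of _ "m - 1"]) auto
next
  case False
  define s where "s = t * m / D"
  have s: "0 \<le> s" "s < m" using t D False m by (auto simp: s_def pos_divide_less_eq)
  define k where "k = nat \<lfloor>s\<rfloor>"
  have k: "real k \<le> s" "s < real k + 1" using s by (auto simp: k_def)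
  have "k < m" using k s by linarith
  moreover have "\<bar>s - (real k + 1/2)\<bar> \<le> 1/2" using k unfolding abs_le_iff by linarith
  then have "\<bar>s - (real k + 1/2)\<bar> * (D / m) \<le> 1/2 * (D / m)" using D by (intro mult_right_mono) auto
  moreover have "\<bar>s - (real k + 1/2)\<bar> * (D / m) = \<bar>t - (real k + 1/2) * (D / m)\<bar>"
  proof -
    have "(s - (real k + 1/2)) * (D / m) = t - (real k + 1/2) * (D / m)"
      using D m by (simp add: s_def field_simps)
    moreover have "\<bar>s - (real k + 1/2)\<bar> * (D / m) = \<bar>(s - (real k + 1/2)) * (D / m)\<bar>"
      using D m by (simp add: abs_mult)
    ultimately show ?thesis by simp
  qed
  ultimately show ?thesis by (intro exI[of _ k]) simp
qed

lemma norm_vec_le_componentwise: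
  fixes v :: "real ^ 'n"
  assumes "\<And>i. \<bar>v $ i\<bar> \<le> c" and "0 \<le> c"
  shows "norm v \<le> sqrt CARD('n) * c"
proof -
  have "(\<Sum>i\<in>UNIV. (norm (v $ i))\<^sup>2) \<le> (\<Sum>i\<in>(UNIV::'n set). c\<^sup>2)"
    using assms by (intro sum_mono power_mono) auto
  then have "norm v \<le> sqrt (CARD('n) * c\<^sup>2)"
    unfolding norm_vec_def L2_set_def by (intro real_sqrt_le_mono) simp
  then show ?thesis using assms(2) by (simp add: real_sqrt_mult)
qed

text \<open>A cube with side the diameter contains the domain and is cut into
  \<open>m ^ CARD('n)\<close> cells. Projecting the cell centres onto the closed convex domain puts
  them inside, and the projection is nonexpansive, so the covering radius is preserved.\<close>

lemma (in bm_domain) finite_net: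
  assumes m: "1 \<le> (m::nat)"
  shows "\<exists>C. finite C \<and> C \<noteq> {} \<and> C \<subseteq> closure D \<and> card C \<le> m ^ CARD('n) \<and>
    (\<forall>x\<in>closure D. \<exists>c\<in>C. norm (x - c) \<le> sqrt CARD('n) * (diameter D / (2 * m)))"
proof -
  define a where "a i = (INF x\<in>closure D. x $ i)" for i
  define p where "p f = (\<chi> i. a i + (real (f i) + 1/2) * (diameter D / m))" for f :: "'n \<Rightarrow> nat"
  let ?F = "PiE (UNIV :: 'n set) (\<lambda>_. {..<m})"
  define C where "C = (\<lambda>f. closest_point (closure D) (p f)) ` ?F"
  have ne: "closure D \<noteq> {}" using D_nonempty by simp
  have cv: "convex (closure D)" using D_convex by (rule convex_closure)
  have fin: "finite ?F" by (intro finite_PiE) auto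
  have bd: "bdd_below ((\<lambda>x. x $ i) ` closure D)" for i
  proof -
    obtain x0 where x0: "x0 \<in> closure D" using ne unfolding ex_in_conv[symmetric] by (elim exE) (rule that)
    have "x0 $ i - diameter D \<le> x $ i" if "x \<in> closure D" for x
      using dist_le_diameter[OF x0 that] component_le_norm_cart[of "x0 - x" i] by (simp add: dist_norm)
    then show ?thesis by (auto intro!: bdd_belowI2)
  qed
  have rng: "0 \<le> x $ i - a i" "x $ i - a i \<le> diameter D" if x: "x \<in> closure D" for x i
  proof -
    show "0 \<le> x $ i - a i" unfolding a_def using cINF_lower[OF bd x] by simp
    have "x $ i - diameter D \<le> a i" unfolding a_def
    proof (rule cINF_greatest[OF ne])
      fix y assume "y \<in> closure D"
      from dist_le_diameter[OF x this] show "x $ i - diameter D \<le> y $ i"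
        using component_le_norm_cart[of "x - y" i] by (simp add: dist_norm)
    qed
    then show "x $ i - a i \<le> diameter D" by simp
  qed
  have "card C \<le> card ?F" unfolding C_def by (rule card_image_le[OF fin])
  also have "card ?F = m ^ CARD('n)" by (simp add: card_PiE)
  finally have card: "card C \<le> m ^ CARD('n)" .
  have "\<exists>c\<in>C. norm (x - c) \<le> sqrt CARD('n) * (diameter D / (2 * m))" if x: "x \<in> closure D" for x
  proof -
    have "\<forall>i. \<exists>k<m. \<bar>x $ i - a i - (real k + 1/2) * (diameter D / m)\<bar> \<le> diameter D / (2 * m)"
      using interval_grid[OF rng[OF x] diameter_pos m] by blast
    then obtain f where f: "\<And>i. f i < m" "\<And>i. \<bar>x $ i - a i - (real (f i) + 1/2) * (diameter D / m)\<bar> \<le> diameter D / (2 * m)"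
      by metis
    have "norm (x - p f) \<le> sqrt CARD('n) * (diameter D / (2 * m))"
      using f(2) diameter_pos by (intro norm_vec_le_componentwise) (simp_all add: p_def diff_diff_eq)
    moreover have "dist (closest_point (closure D) x) (closest_point (closure D) (p f)) \<le> dist x (p f)"
      by (rule closest_point_lipschitz[OF cv closed_closure ne])
    ultimately have "norm (x - closest_point (closure D) (p f)) \<le> sqrt CARD('n) * (diameter D / (2 * m))"
      by (simp add: closest_point_self[OF x] dist_norm)
    moreover have "closest_point (closure D) (p f) \<in> C" unfolding C_def using f(1) by (intro imageI) auto
    ultimately show ?thesis by blast
  qed
  moreover have "C \<subseteq> closure D" unfolding C_def using closest_point_in_set[OF closed_closure ne] by auto
  moreover have "?F \<noteq> {}" using m by (auto simp: PiE_eq_empty_iff lessThan_empty_iff)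
  then have "C \<noteq> {}" by (simp add: C_def)
  moreover have "finite C" using fin by (simp add: C_def)
  ultimately show ?thesis using card by (intro exI[of _ C]) blast
qed

subsection \<open>Dependence on the starting point\<close>

context wos
begin

lemma pos_lipschitz:
  assumes xy: "x \<in> closure D" "y \<in> closure D"
  shows "norm (pos x j k z - pos y j k z) \<le> (1 + L) ^ k * norm (x - y)"
proof (induction k)
  case (Suc k)
  let ?p = "pos x j k z" and ?q = "pos y j k z"
  have "norm (pos x j (Suc k) z - pos y j (Suc k) z) = norm ((?p - ?q) + (rt ?p - rt ?q) *\<^sub>R dirn j (Suc k) z)"
    by (simp add: algebra_simps)
  also have "\<dots> \<le> norm (?p - ?q) + \<bar>rt ?p - rt ?q\<bar> * norm (dirn j (Suc k) z)"
    by (rule order_trans[OF norm_triangle_ineq]) simp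
  also have "\<dots> \<le> norm (?p - ?q) + (L * norm (?p - ?q)) * 1"
    using rt_lipschitz[OF pos_closure[OF xy(1)] pos_closure[OF xy(2)]] norm_dirn_le constants_nonneg(3)
    by (intro add_left_mono mult_mono) auto
  also have "\<dots> = (1 + L) * norm (?p - ?q)" by (simp add: algebra_simps)
  also have "\<dots> \<le> (1 + L) * ((1 + L) ^ k * norm (x - y))"
    using Suc.IH constants_nonneg(3) by (intro mult_left_mono) auto
  finally show ?case by (simp add: mult_ac)
qed simp

definition spread :: "real ^ 'n \<Rightarrow> real ^ 'n \<Rightarrow> real" where
  "spread x y = (1 + L) ^ M * norm (x - y)"

lemma spread_nonneg: "0 \<le> spread x y"
  unfolding spread_def using constants_nonneg(3) by simp

text \<open>Since \<open>k < M\<close>, one factor \<open>1 + L\<close> is left over and absorbs the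
  difference of the radii. Two radii sum to at most the diameter, which gives the bound for the
  squares.\<close>

lemma step_spread:
  assumes xy: "x \<in> closure D" "y \<in> closure D" and k: "k < M"
  shows "norm (pos x j k z - pos y j k z) + \<bar>rt (pos x j k z) - rt (pos y j k z)\<bar> \<le> spread x y"
    "\<bar>(rt (pos x j k z))\<^sup>2 - (rt (pos y j k z))\<^sup>2\<bar> \<le> diameter D * spread x y"
proof -
  let ?p = "pos x j k z" and ?q = "pos y j k z"
  have "norm (?p - ?q) + \<bar>rt ?p - rt ?q\<bar> \<le> (1 + L) * norm (?p - ?q)"
    using rt_lipschitz[OF pos_closure[OF xy(1)] pos_closure[OF xy(2)], of j k z j k z] by (simp add: algebra_simps)
  also have "\<dots> \<le> (1 + L) * ((1 + L) ^ k * norm (x - y))"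
    using pos_lipschitz[OF xy] constants_nonneg(3) by (intro mult_left_mono) auto
  also have "\<dots> = (1 + L) ^ Suc k * norm (x - y)" by simp
  also have "\<dots> \<le> spread x y"
    unfolding spread_def using k constants_nonneg(3) by (intro mult_right_mono power_increasing) auto
  finally show 1: "norm (?p - ?q) + \<bar>rt ?p - rt ?q\<bar> \<le> spread x y" .
  have "\<bar>(rt ?p)\<^sup>2 - (rt ?q)\<^sup>2\<bar> = (rt ?p + rt ?q) * \<bar>rt ?p - rt ?q\<bar>"
    using rt_nonneg[of ?p] rt_nonneg[of ?q] by (simp add: power2_eq_square square_diff_square_factored abs_mult)
  also have "\<dots> \<le> diameter D * spread x y"
    using rt_nonneg[of ?p] rt_nonneg[of ?q] rt_diam[of ?p] rt_diam[of ?q] 1 norm_ge_zero[of "?p - ?q"]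
    by (intro mult_mono) linarith+
  finally show "\<bar>(rt ?p)\<^sup>2 - (rt ?q)\<^sup>2\<bar> \<le> diameter D * spread x y" .
qed

text \<open>Dominates every elapsed time that multiplies a difference of squared radii, so a single
  random quantity carries the randomness of the Lipschitz constant.\<close>

definition clock :: "nat \<Rightarrow> 'n noise \<Rightarrow> real" where
  "clock j z = (\<Sum>k<M. rhon j (Suc k) z + fst (z (Src_VY j (Suc k))))"

lemma VY_range:
  assumes "1 \<le> j" "1 \<le> k" "w \<in> space P"
  shows "0 \<le> fst (W (Src_VY j k) w)" "norm (snd (W (Src_VY j k) w)) \<le> 1"
proof -
  have "space occ_law = ({0..} \<times> cball 0 1 :: (real \<times> (real ^ 'n)) set)"
    using sets_eq_imp_space_eq[OF sets_occ_law] by (simp add: space_restrict_space)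
  then show "0 \<le> fst (W (Src_VY j k) w)" "norm (snd (W (Src_VY j k) w)) \<le> 1"
    using measurable_space[OF VY_measurable[OF assms(1,2)] assms(3)] by auto
qed

lemma tim_lipschitz:
  assumes j: "1 \<le> j" and w: "w \<in> space P" and xy: "x \<in> closure D" "y \<in> closure D"
  shows "k \<le> M \<Longrightarrow> \<bar>tim x j k (noise w) - tim y j k (noise w)\<bar> \<le> diameter D * spread x y * (\<Sum>l<k. rhon j (Suc l) (noise w))"
proof (induction k)
  case (Suc k)
  let ?p = "pos x j k (noise w)" and ?q = "pos y j k (noise w)" and ?r = "rhon j (Suc k) (noise w)"
  have r: "0 \<le> ?r" using rho_nonneg[OF j _ w] by (simp add: rhon_def)
  have "\<bar>(rt ?p)\<^sup>2 - (rt ?q)\<^sup>2\<bar> * ?r \<le> diameter D * spread x y * ?r"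
    using Suc.prems by (intro mult_right_mono r step_spread(2)[OF xy]) auto
  then have "\<bar>(rt ?p)\<^sup>2 * ?r - (rt ?q)\<^sup>2 * ?r\<bar> \<le> diameter D * spread x y * ?r"
    using r by (simp add: left_diff_distrib[symmetric] abs_mult)
  moreover have "tim x j (Suc k) (noise w) = tim x j k (noise w) + (rt ?p)\<^sup>2 * ?r"
    "tim y j (Suc k) (noise w) = tim y j k (noise w) + (rt ?q)\<^sup>2 * ?r" by simp_all
  moreover have "diameter D * spread x y * (\<Sum>l<Suc k. rhon j (Suc l) (noise w)) =
     diameter D * spread x y * (\<Sum>l<k. rhon j (Suc l) (noise w)) + diameter D * spread x y * ?r"
    by (simp add: distrib_left)
  ultimately show ?case using Suc by linarith
qed simp

lemma clock_bounds:
  assumes j: "1 \<le> j" and w: "w \<in> space P"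
  shows "0 \<le> clock j (noise w)" "k \<le> M \<Longrightarrow> (\<Sum>l<k. rhon j (Suc l) (noise w)) \<le> clock j (noise w)"
    "k < M \<Longrightarrow> (\<Sum>l<k. rhon j (Suc l) (noise w)) + fst (W (Src_VY j (Suc k)) w) \<le> clock j (noise w)"
proof -
  have r: "0 \<le> rhon j (Suc l) (noise w)" for l using rho_nonneg[OF j _ w] by (simp add: rhon_def)
  have v: "0 \<le> fst (W (Src_VY j (Suc l)) w)" for l using VY_range(1)[OF j _ w] by simp
  have s: "(\<Sum>l<k. rhon j (Suc l) (noise w)) \<le> (\<Sum>l<M. rhon j (Suc l) (noise w))" if "k \<le> M" for k
    using r that by (intro sum_mono2) auto
  have c: "clock j (noise w) = (\<Sum>l<M. rhon j (Suc l) (noise w)) + (\<Sum>l<M. fst (W (Src_VY j (Suc l)) w))"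
    by (simp add: clock_def sum.distrib)
  have v0: "0 \<le> (\<Sum>l<M. fst (W (Src_VY j (Suc l)) w))" by (intro sum_nonneg v)
  have r0: "0 \<le> (\<Sum>l<M. rhon j (Suc l) (noise w))" by (intro sum_nonneg r)
  show "0 \<le> clock j (noise w)" using c v0 r0 by linarith
  show "k \<le> M \<Longrightarrow> (\<Sum>l<k. rhon j (Suc l) (noise w)) \<le> clock j (noise w)" using s[of k] c v0 by linarith
  have "k < M \<Longrightarrow> fst (W (Src_VY j (Suc k)) w) \<le> (\<Sum>l<M. fst (W (Src_VY j (Suc l)) w))"
    using v by (intro member_le_sum) auto
  then show "k < M \<Longrightarrow> (\<Sum>l<k. rhon j (Suc l) (noise w)) + fst (W (Src_VY j (Suc k)) w) \<le> clock j (noise w)"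
    using s[of k] c by linarith
qed

text \<open>The part of the Lipschitz constant of \<open>\<Phi>\<close> that is free of the clocks;
  \<open>lip_clock\<close> is the coefficient of the clocks. The quarter of the squared diameter
  bounds a squared radius.\<close>

definition lip_det :: real where
  "lip_det = lx0 + M * (diameter D * C1 + (diameter D)\<^sup>2 / 4 * lx1) / CARD('n)"

definition lip_clock :: real where
  "lip_clock = diameter D * (lt0 + M * ((diameter D)\<^sup>2 / 4 * lt1) / CARD('n))"

lemma lip_nonneg: "0 \<le> lip_det" "0 \<le> lip_clock"
  unfolding lip_det_def lip_clock_def using constants_nonneg C1_nonneg diameter_pos
  by (auto intro!: add_nonneg_nonneg mult_nonneg_nonneg divide_nonneg_nonneg)

lemma gain_lipschitz:
  assumes j: "1 \<le> j" and w: "w \<in> space P" and xy: "x \<in> closure D" "y \<in> closure D" and k: "k < M"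
  shows "\<bar>gain x j k (noise w) - gain y j k (noise w)\<bar> \<le> spread x y *
    (diameter D * C1 + (diameter D)\<^sup>2 / 4 * lx1 + diameter D * ((diameter D)\<^sup>2 / 4 * lt1) * clock j (noise w))"
proof -
  let ?p = "pos x j k (noise w)" and ?q = "pos y j k (noise w)" and ?t = "tim x j k (noise w)" and ?t' = "tim y j k (noise w)"
  define V Y where "V = fst (W (Src_VY j (Suc k)) w)" and "Y = snd (W (Src_VY j (Suc k)) w)"
  have V: "0 \<le> V" and Y: "norm Y \<le> 1" using VY_range[OF j _ w, of "Suc k"] by (auto simp: V_def Y_def)
  define a a' where "a = h1 (?t + (rt ?p)\<^sup>2 * V, ?p + rt ?p *\<^sub>R Y)" and "a' = h1 (?t' + (rt ?q)\<^sup>2 * V, ?q + rt ?q *\<^sub>R Y)"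
  have pc: "?p \<in> closure D" "?q \<in> closure D" by (intro pos_closure xy)+
  have tn: "0 \<le> ?t" "0 \<le> ?t'" by (intro tim_nonneg[OF j w])+
  have sq: "\<bar>(rt ?p)\<^sup>2 - (rt ?q)\<^sup>2\<bar> \<le> diameter D * spread x y" by (rule step_spread(2)[OF xy k])
  have dt: "\<bar>(?t + (rt ?p)\<^sup>2 * V) - (?t' + (rt ?q)\<^sup>2 * V)\<bar> \<le> diameter D * spread x y * clock j (noise w)"
  proof -
    have "(?t + (rt ?p)\<^sup>2 * V) - (?t' + (rt ?q)\<^sup>2 * V) = (?t - ?t') + ((rt ?p)\<^sup>2 - (rt ?q)\<^sup>2) * V" by (simp add: algebra_simps)
    then have "\<bar>(?t + (rt ?p)\<^sup>2 * V) - (?t' + (rt ?q)\<^sup>2 * V)\<bar> \<le> \<bar>?t - ?t'\<bar> + \<bar>(rt ?p)\<^sup>2 - (rt ?q)\<^sup>2\<bar> * V"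
      using V abs_triangle_ineq[of "?t - ?t'" "((rt ?p)\<^sup>2 - (rt ?q)\<^sup>2) * V"] by (simp only: abs_mult abs_of_nonneg)
    also have "\<dots> \<le> diameter D * spread x y * (\<Sum>l<k. rhon j (Suc l) (noise w)) + diameter D * spread x y * V"
      using k by (intro add_mono tim_lipschitz[OF j w xy] mult_right_mono[OF sq V]) auto
    also have "\<dots> = diameter D * spread x y * ((\<Sum>l<k. rhon j (Suc l) (noise w)) + V)" by (simp add: distrib_left)
    also have "\<dots> \<le> diameter D * spread x y * clock j (noise w)"
      unfolding V_def using diameter_pos by (intro mult_left_mono clock_bounds(3)[OF j w k] mult_nonneg_nonneg spread_nonneg) auto
    finally show ?thesis .
  qed
  have dx: "norm ((?p + rt ?p *\<^sub>R Y) - (?q + rt ?q *\<^sub>R Y)) \<le> spread x y"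
  proof -
    have "norm ((?p + rt ?p *\<^sub>R Y) - (?q + rt ?q *\<^sub>R Y)) = norm ((?p - ?q) + (rt ?p - rt ?q) *\<^sub>R Y)" by (simp add: algebra_simps)
    also have "\<dots> \<le> norm (?p - ?q) + \<bar>rt ?p - rt ?q\<bar> * norm Y" by (rule order_trans[OF norm_triangle_ineq]) simp
    also have "\<dots> \<le> norm (?p - ?q) + \<bar>rt ?p - rt ?q\<bar> * 1" using Y by (intro add_left_mono mult_left_mono) auto
    also have "\<dots> \<le> spread x y" using step_spread(1)[OF xy k] by simp
    finally show ?thesis .
  qed
  have "\<bar>a - a'\<bar> \<le> lt1 * \<bar>(?t + (rt ?p)\<^sup>2 * V) - (?t' + (rt ?q)\<^sup>2 * V)\<bar> + lx1 * norm ((?p + rt ?p *\<^sub>R Y) - (?q + rt ?q *\<^sub>R Y))"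
    unfolding a_def a'_def using tn V
    by (intro h1_lipschitz step_in_closure[OF pc(1) rt_nonneg rt_le[OF pc(1)] Y] step_in_closure[OF pc(2) rt_nonneg rt_le[OF pc(2)] Y]) auto
  also have "\<dots> \<le> lt1 * (diameter D * spread x y * clock j (noise w)) + lx1 * spread x y"
    using constants_nonneg by (intro add_mono mult_left_mono dt dx)
  finally have da: "\<bar>a - a'\<bar> \<le> lt1 * (diameter D * spread x y * clock j (noise w)) + lx1 * spread x y" .
  \<comment> \<open>The product rule: the difference of the squared radii meets the bound
    \<open>C1\<close>, the difference of the sources meets the squared radius.\<close>
  have "gain x j k (noise w) - gain y j k (noise w) = ((rt ?p)\<^sup>2 - (rt ?q)\<^sup>2) * a + (rt ?q)\<^sup>2 * (a - a')"
    by (simp add: a_def a'_def V_def Y_def algebra_simps)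
  then have "\<bar>gain x j k (noise w) - gain y j k (noise w)\<bar> \<le> \<bar>(rt ?p)\<^sup>2 - (rt ?q)\<^sup>2\<bar> * \<bar>a\<bar> + (rt ?q)\<^sup>2 * \<bar>a - a'\<bar>"
    using abs_triangle_ineq[of "((rt ?p)\<^sup>2 - (rt ?q)\<^sup>2) * a" "(rt ?q)\<^sup>2 * (a - a')"] by (simp only: abs_mult abs_power2)
  also have "\<dots> \<le> (diameter D * spread x y) * C1 + (diameter D)\<^sup>2 / 4 * (lt1 * (diameter D * spread x y * clock j (noise w)) + lx1 * spread x y)"
    using h1(2) diameter_pos spread_nonneg[of x y]
    by (intro add_mono mult_mono sq rt_sq_le da) (auto simp: a_def)
  also have "\<dots> = spread x y * (diameter D * C1 + (diameter D)\<^sup>2 / 4 * lx1 + diameter D * ((diameter D)\<^sup>2 / 4 * lt1) * clock j (noise w))"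
    by (simp add: algebra_simps)
  finally show ?thesis .
qed

lemma \<Phi>_lipschitz:
  assumes j: "1 \<le> j" and w: "w \<in> space P" and xy: "x \<in> closure D" "y \<in> closure D"
  shows "\<bar>\<Phi> x j (noise w) - \<Phi> y j (noise w)\<bar> \<le> spread x y * (lip_det + lip_clock * clock j (noise w))"
proof -
  let ?R = "clock j (noise w)" and ?s = "spread x y" and ?d = "real CARD('n)"
  have R: "0 \<le> ?R" by (rule clock_bounds(1)[OF j w])
  let ?c = "diameter D * C1 + (diameter D)\<^sup>2 / 4 * lx1 + diameter D * ((diameter D)\<^sup>2 / 4 * lt1) * ?R"
  have "\<bar>(\<Sum>k<M. gain x j k (noise w)) - (\<Sum>k<M. gain y j k (noise w))\<bar> \<le> (\<Sum>k<M. \<bar>gain x j k (noise w) - gain y j k (noise w)\<bar>)"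
    unfolding sum_subtractf[symmetric] by (rule sum_abs)
  also have "\<dots> \<le> (\<Sum>k<M. ?s * ?c)" by (intro sum_mono gain_lipschitz[OF j w xy]) auto
  also have "\<dots> = ?s * (M * ?c)" by simp
  finally have g: "\<bar>(\<Sum>k<M. gain x j k (noise w)) - (\<Sum>k<M. gain y j k (noise w))\<bar> / ?d \<le> ?s * (M * ?c) / ?d"
    by (intro divide_right_mono) auto
  have "\<bar>h0 (tim x j M (noise w), pos x j M (noise w)) - h0 (tim y j M (noise w), pos y j M (noise w))\<bar> \<le>
    lt0 * \<bar>tim x j M (noise w) - tim y j M (noise w)\<bar> + lx0 * norm (pos x j M (noise w) - pos y j M (noise w))"
    by (intro h0_lipschitz tim_nonneg[OF j w] pos_closure xy)
  also have "\<dots> \<le> lt0 * (diameter D * ?s * ?R) + lx0 * ?s"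
    using constants_nonneg diameter_pos pos_lipschitz[OF xy, of j M "noise w"]
    by (intro add_mono mult_left_mono order_trans[OF tim_lipschitz[OF j w xy order_refl]] clock_bounds(2)[OF j w] mult_nonneg_nonneg spread_nonneg)
      (auto simp: spread_def)
  finally have h: "\<bar>h0 (tim x j M (noise w), pos x j M (noise w)) - h0 (tim y j M (noise w), pos y j M (noise w))\<bar> \<le> lt0 * (diameter D * ?s * ?R) + lx0 * ?s" .
  have eq: "\<Phi> x j (noise w) - \<Phi> y j (noise w) = (h0 (tim x j M (noise w), pos x j M (noise w)) - h0 (tim y j M (noise w), pos y j M (noise w)))
     + ((\<Sum>k<M. gain x j k (noise w)) - (\<Sum>k<M. gain y j k (noise w))) / ?d"
    by (simp add: \<Phi>_def diff_divide_distrib)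
  have "\<bar>\<Phi> x j (noise w) - \<Phi> y j (noise w)\<bar> \<le> \<bar>h0 (tim x j M (noise w), pos x j M (noise w)) - h0 (tim y j M (noise w), pos y j M (noise w))\<bar>
     + \<bar>(\<Sum>k<M. gain x j k (noise w)) - (\<Sum>k<M. gain y j k (noise w))\<bar> / ?d"
    unfolding eq by (rule order_trans[OF abs_triangle_ineq]) (simp only: abs_divide abs_of_nat order_refl)
  also have "\<dots> \<le> (lt0 * (diameter D * ?s * ?R) + lx0 * ?s) + ?s * (M * ?c) / ?d" by (rule add_mono[OF h g])
  also have "\<dots> = ?s * (lip_det + lip_clock * ?R)"
  proof -
    have "(lt0 * (e * s * R) + lx0 * s) + s * (m * (e * C1 + q * lx1 + e * (q * lt1) * R)) / d =
      s * ((lx0 + m * (e * C1 + q * lx1) / d) + e * (lt0 + m * (q * lt1) / d) * R)" for e s R q m d :: real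
      by (simp only: distrib_left distrib_right add_divide_distrib times_divide_eq_right times_divide_eq_left mult_ac add_ac)
    then show ?thesis unfolding lip_det_def lip_clock_def .
  qed
  finally show ?thesis .
qed

text \<open>Each of the \<open>M\<close> walk clocks has mean at most \<open>1 / CARD('n)\<close> by
  optional stopping, each of the \<open>M\<close> sampled source times by
  \<open>occ_law_time_mean\<close>.\<close>

lemma clock_mean:
  assumes j: "1 \<le> j"
  shows "integrable P (\<lambda>w. clock j (noise w))" "expectation (\<lambda>w. clock j (noise w)) \<le> 2 * M / CARD('n)"
proof -
  have fsm: "fst \<in> borel_measurable (borel :: (real \<times> (real ^ 'n)) measure)"
    by (intro borel_measurable_continuous_onI continuous_intros)
  have zm: "ball_exit 1 \<in> borel_measurable P" by (rule stoppingD(1)[OF stopping_ball_exit[OF zero_less_one]])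
  have Wm: "(\<lambda>w. fst (W s w)) \<in> borel_measurable P" if "s \<in> noise_indices" for s
    by (rule measurable_compose[OF W_measurable[OF that] fsm])
  have r: "integrable P (\<lambda>w. rhon j (Suc k) (noise w)) \<and> expectation (\<lambda>w. rhon j (Suc k) (noise w)) \<le> 1 / CARD('n)" for k
  proof -
    have m: "(\<lambda>w. fst (W (Src_rho j (Suc k)) w)) \<in> borel_measurable P"
      using j by (intro Wm) (auto simp: noise_indices_def)
    have l: "distr P borel (\<lambda>w. fst (W (Src_rho j (Suc k)) w)) = distr P borel (ball_exit 1)"
      using rho_law[OF j, of "Suc k"] by simp
    have "integrable P (\<lambda>w. fst (W (Src_rho j (Suc k)) w))"
      using integrable_distr_eq[OF m, of "\<lambda>x. x"] integrable_distr_eq[OF zm, of "\<lambda>x. x"] ball_exit_props(2)[OF zero_less_one] l by simp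
    moreover have "expectation (\<lambda>w. fst (W (Src_rho j (Suc k)) w)) = expectation (ball_exit 1)"
      using integral_distr[OF m, of "\<lambda>x. x"] integral_distr[OF zm, of "\<lambda>x. x"] l by simp
    ultimately show ?thesis using ball_exit_props(3)[OF zero_less_one] by (simp add: rhon_def)
  qed
  have v: "integrable P (\<lambda>w. fst (W (Src_VY j (Suc k)) w)) \<and> expectation (\<lambda>w. fst (W (Src_VY j (Suc k)) w)) \<le> 1 / CARD('n)" for k
  proof -
    have m: "(\<lambda>w. fst (W (Src_VY j (Suc k)) w)) \<in> borel_measurable P"
      using j by (intro Wm) (auto simp: noise_indices_def)
    have VYm: "W (Src_VY j (Suc k)) \<in> measurable P occ_law" and VYl: "distr P occ_law (W (Src_VY j (Suc k))) = occ_law"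
      using VY_measurable[OF j, of "Suc k"] VY_law[OF j, of "Suc k"] by auto
    have fe: "(\<lambda>z. ennreal (fst z)) \<in> borel_measurable occ_law"
    proof -
      have "(\<lambda>z. ennreal (fst z)) \<in> borel_measurable (borel :: (real \<times> (real ^ 'n)) measure)"
        by (rule measurable_compose[OF fsm measurable_ennreal])
      from measurable_restrict_space1[OF this] show ?thesis by (simp add: measurable_cong_sets[OF sets_occ_law refl])
    qed
    have "(\<integral>\<^sup>+w. ennreal (fst (W (Src_VY j (Suc k)) w)) \<partial>P) = (\<integral>\<^sup>+z. ennreal (fst z) \<partial>distr P occ_law (W (Src_VY j (Suc k))))"
      by (rule nn_integral_distr[symmetric, OF VYm]) (simp only: VYl fe)
    then have le: "(\<integral>\<^sup>+w. ennreal (fst (W (Src_VY j (Suc k)) w)) \<partial>P) \<le> ennreal (1 / CARD('n))"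
      using occ_law_time_mean by (simp only: VYl)
    have nn: "AE w in P. 0 \<le> fst (W (Src_VY j (Suc k)) w)" using VY_range(1)[OF j, of "Suc k"] by (intro AE_I2) auto
    have i: "integrable P (\<lambda>w. fst (W (Src_VY j (Suc k)) w))"
      by (rule integrableI_nonneg[OF m nn]) (simp only: infinity_ennreal_def le_less_trans[OF le ennreal_less_top])
    then show ?thesis using le nn_integral_eq_integral[OF i nn] by simp
  qed
  show "integrable P (\<lambda>w. clock j (noise w))"
    unfolding clock_def by (intro Bochner_Integration.integrable_sum Bochner_Integration.integrable_add r[THEN conjunct1] v[THEN conjunct1])
  have "expectation (\<lambda>w. clock j (noise w)) = (\<Sum>k<M. expectation (\<lambda>w. rhon j (Suc k) (noise w)) + expectation (\<lambda>w. fst (W (Src_VY j (Suc k)) w)))"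
    unfolding clock_def using r v by simp
  also have "\<dots> \<le> (\<Sum>k<M. 1 / CARD('n) + 1 / CARD('n))" using r v by (intro sum_mono add_mono) auto
  finally show "expectation (\<lambda>w. clock j (noise w)) \<le> 2 * M / CARD('n)" by (simp add: mult.commute)
qed

lemma \<Phi>_indep: "indep_vars (\<lambda>_. borel) (\<lambda>j w. \<Phi> x j (noise w)) {1..n}"
proof -
  have "indep_vars (\<lambda>j. PiM (block j) (\<lambda>_. borel)) (\<lambda>j w. restrict (noise w) (block j)) {1..n}"
    by (rule indep_vars_restrict[OF W_indep]) (use block_noise in \<open>auto simp: disjoint_family_on_def block_def\<close>)
  from indep_vars_compose2[OF this, of "\<lambda>j. \<Phi> x j" "\<lambda>_. borel"] \<Phi>_measurable show ?thesis by (simp only: \<Phi>_local)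
qed

end

subsection \<open>The uniform error\<close>

text \<open>The number of cells per axis has to beat the growth \<open>(1 + L) ^ M\<close> and leave
  \<open>1 / (K * M\<^sup>2)\<close>. Rounding down costs at most a factor two, which the half cell
  width regains. The last identity yields the entropy term of the final bound.\<close>

lemma net_resolution:
  fixes L :: real and K M :: nat
  assumes "0 \<le> L" "1 \<le> K" "1 \<le> M"
  defines "a \<equiv> K * (real M)\<^sup>2 * (1 + L) ^ M"
  shows "1 \<le> nat \<lfloor>a\<rfloor>" "real (nat \<lfloor>a\<rfloor>) \<le> a" "a \<le> 2 * real (nat \<lfloor>a\<rfloor>)" "0 < a"
    "ln (2 * a ^ d) = d * (ln K + 2 * ln M + M * ln (1 + L)) + ln 2"
proof -
  have "1 \<le> real K" "1 \<le> (real M)\<^sup>2" "1 \<le> (1 + L) ^ M" using assms by (auto intro: one_le_power)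
  then have "1 * 1 \<le> real K * (real M)\<^sup>2" by (intro mult_mono) auto
  then have "1 * 1 \<le> real K * (real M)\<^sup>2 * (1 + L) ^ M" using \<open>1 \<le> (1 + L) ^ M\<close> by (intro mult_mono) auto
  then have a: "1 \<le> a" by (simp add: a_def)
  then have f: "1 \<le> \<lfloor>a\<rfloor>" by simp
  then show "1 \<le> nat \<lfloor>a\<rfloor>" by linarith
  have r: "real (nat \<lfloor>a\<rfloor>) = of_int \<lfloor>a\<rfloor>" using f by simp
  show "real (nat \<lfloor>a\<rfloor>) \<le> a" unfolding r by simp
  have "a < of_int \<lfloor>a\<rfloor> + 1" "1 \<le> real_of_int \<lfloor>a\<rfloor>" using f by linarith+
  then show "a \<le> 2 * real (nat \<lfloor>a\<rfloor>)" unfolding r by linarith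
  show "0 < a" using a by simp
  have "ln a = ln K + 2 * ln M + M * ln (1 + L)"
    unfolding a_def using assms by (simp add: ln_mult ln_realpow)
  then show "ln (2 * a ^ d) = d * (ln K + 2 * ln M + M * ln (1 + L)) + ln 2"
    using \<open>0 < a\<close> by (simp add: ln_mult ln_realpow)
qed

context wos
begin

text \<open>The bias bound is uniform in \<open>x\<close> already, so only the centred deviation is
  moved to a net point. That move costs the Lipschitz bound twice, once for the sample and once for
  its mean, which explains \<open>2 * lip_det\<close> and \<open>4 * M\<close>.\<close>

theorem uniform_error:
  fixes K n :: nat
  assumes K: "1 \<le> K" and n: "1 \<le> n" and M: "1 \<le> M"
  defines "s \<equiv> sqrt CARD('n) * diameter D / (K * (real M)\<^sup>2)"
  shows "\<exists>g. integrable P g \<and>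
    (\<forall>w\<in>space P. \<forall>x\<in>closure D. \<bar>u (0, x) - 1 / n * (\<Sum>i=1..n. \<Phi> x i (noise w))\<bar> \<le> g w) \<and>
    expectation g \<le> near_bound + 2 * far_bound * rate ^ M + s * (2 * lip_det + lip_clock * (4 * M / CARD('n))) +
      (C0 + M * (diameter D)\<^sup>2 * C1 / CARD('n)) * sqrt (2 * (CARD('n) * (ln K + 2 * ln M + M * ln (1 + L)) + ln 2) * n) / n"
proof -
  let ?d = "real CARD('n)"
  define b where "b = C0 + M * (diameter D)\<^sup>2 * C1 / CARD('n)"
  define a where "a = K * (real M)\<^sup>2 * (1 + L) ^ M"
  note a = net_resolution[OF constants_nonneg(3) K M, folded a_def]
  define m where "m = nat \<lfloor>a\<rfloor>"
  obtain C where C: "finite C" "C \<noteq> {}" "C \<subseteq> closure D" "card C \<le> m ^ CARD('n)"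
    and net: "\<And>x. x \<in> closure D \<Longrightarrow> \<exists>c\<in>C. norm (x - c) \<le> sqrt ?d * (diameter D / (2 * m))"
    using finite_net[OF a(1), folded m_def] by (elim exE conjE) (rule that; blast)
  have cardC: "real (card C) \<le> a ^ CARD('n)"
  proof -
    have "real (card C) \<le> real (m ^ CARD('n))" using C(4) by (simp only: of_nat_le_iff)
    also have "\<dots> \<le> a ^ CARD('n)" unfolding of_nat_power using a(2) by (intro power_mono) (auto simp: m_def)
    finally show ?thesis .
  qed
  have near: "\<exists>c\<in>C. spread x c \<le> s" if x: "x \<in> closure D" for x
  proof -
    obtain c where c: "c \<in> C" "norm (x - c) \<le> sqrt ?d * (diameter D / (2 * m))" using net[OF x] by blast
    have m0: "0 < real m" using a(1) unfolding m_def[symmetric] by linarith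
    have "spread x c \<le> (1 + L) ^ M * (sqrt ?d * (diameter D / (2 * m)))"
      unfolding spread_def using c(2) constants_nonneg(3) by (intro mult_left_mono) auto
    also have "\<dots> \<le> s"
    proof -
      have k: "0 < K * (real M)\<^sup>2" using K M by simp
      have "(1 + L) ^ M / (2 * m) \<le> 1 / (K * (real M)\<^sup>2)"
      proof -
        have "a \<le> 2 * real m" using a(3) unfolding m_def[symmetric] .
        then show ?thesis using m0 k unfolding a_def by (simp add: divide_simps mult_ac)
      qed
      from mult_left_mono[OF this, of "sqrt ?d * diameter D"] show ?thesis
        using diameter_pos by (simp add: s_def mult_ac)
    qed
    finally show ?thesis using c(1) by blast
  qed
  have s0: "0 \<le> s" using diameter_pos by (simp add: s_def)
  have "\<exists>g. integrable P g \<and> (\<forall>w\<in>space P. \<forall>c\<in>C. \<bar>\<Sum>j\<in>{1..n}. \<Phi> c j (noise w) - expectation (\<lambda>w. \<Phi> c j (noise w))\<bar> \<le> g w) \<and>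
    expectation g \<le> b * sqrt (2 * ln (2 * a ^ CARD('n)) * card {1..n})"
    using n \<Phi>_bound unfolding b_def
    by (intro expected_maximum_deviation C(1,2) cardC \<Phi>_indep) auto
  then obtain g0 where g0: "integrable P g0" "\<And>w c. w \<in> space P \<Longrightarrow> c \<in> C \<Longrightarrow> \<bar>\<Sum>j=1..n. \<Phi> c j (noise w) - expectation (\<lambda>w. \<Phi> c j (noise w))\<bar> \<le> g0 w"
    "expectation g0 \<le> b * sqrt (2 * (CARD('n) * (ln K + 2 * ln M + M * ln (1 + L)) + ln 2) * n)"
    unfolding a(5) by auto
  let ?cl = "\<lambda>j w. clock j (noise w)"
  define bb where "bb = near_bound + 2 * far_bound * rate ^ M"
  \<comment> \<open>One random variable for all \<open>x\<close>: bias, change of the mean, average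
    change of the samples, and average deviation on the net.\<close>
  define g where "g w = bb + s * (lip_det + lip_clock * (2 * M / CARD('n))) + (\<Sum>j=1..n. s * (lip_det + lip_clock * ?cl j w)) / n + g0 w / n" for w
  have cl: "integrable P (?cl j)" "expectation (?cl j) \<le> 2 * M / ?d" if "j \<in> {1..n}" for j using clock_mean[of j] that by auto
  have lipE: "\<bar>expectation (\<lambda>w. \<Phi> x j (noise w)) - expectation (\<lambda>w. \<Phi> c j (noise w))\<bar> \<le> s * (lip_det + lip_clock * (2 * M / ?d))"
    and lipw: "w \<in> space P \<Longrightarrow> \<bar>\<Phi> x j (noise w) - \<Phi> c j (noise w)\<bar> \<le> s * (lip_det + lip_clock * ?cl j w)"
    if j: "j \<in> {1..n}" and x: "x \<in> closure D" and c: "c \<in> C" "spread x c \<le> s" for x c j w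
  proof -
    have j1: "1 \<le> j" using j by simp
    have cD: "c \<in> closure D" using c C(3) by blast
    have w: "\<bar>\<Phi> x j (noise w) - \<Phi> c j (noise w)\<bar> \<le> s * (lip_det + lip_clock * ?cl j w)" if "w \<in> space P" for w
      using lip_nonneg clock_bounds(1)[OF j1 that]
      by (intro order_trans[OF \<Phi>_lipschitz[OF j1 that x cD]] mult_right_mono c(2)) auto
    then show "w \<in> space P \<Longrightarrow> \<bar>\<Phi> x j (noise w) - \<Phi> c j (noise w)\<bar> \<le> s * (lip_det + lip_clock * ?cl j w)" .
    have i: "integrable P (\<lambda>w. \<Phi> x j (noise w) - \<Phi> c j (noise w))"
      using \<Phi>_integrable[OF j1] by (intro Bochner_Integration.integrable_diff)
    have "\<bar>expectation (\<lambda>w. \<Phi> x j (noise w)) - expectation (\<lambda>w. \<Phi> c j (noise w))\<bar> = \<bar>expectation (\<lambda>w. \<Phi> x j (noise w) - \<Phi> c j (noise w))\<bar>"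
      by (simp only: Bochner_Integration.integral_diff[OF \<Phi>_integrable[OF j1] \<Phi>_integrable[OF j1]])
    also have "\<dots> \<le> expectation (\<lambda>w. s * (lip_det + lip_clock * ?cl j w))"
      using w cl(1)[OF j] by (intro order_trans[OF integral_abs_bound] integral_mono integrable_abs i) auto
    also have "\<dots> = s * (lip_det + lip_clock * expectation (?cl j))"
      using cl(1)[OF j] by (simp add: prob_space)
    also have "\<dots> \<le> s * (lip_det + lip_clock * (2 * M / ?d))"
      by (intro mult_left_mono add_left_mono cl(2)[OF j] lip_nonneg s0)
    finally show "\<bar>expectation (\<lambda>w. \<Phi> x j (noise w)) - expectation (\<lambda>w. \<Phi> c j (noise w))\<bar> \<le> s * (lip_det + lip_clock * (2 * M / ?d))" .
  qed
  have n0: "0 < real n" using n by simp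
  have "\<bar>u (0, x) - 1 / n * (\<Sum>i=1..n. \<Phi> x i (noise w))\<bar> \<le> g w" if w: "w \<in> space P" and x: "x \<in> closure D" for x w
  proof -
    obtain c where c: "c \<in> C" "spread x c \<le> s" using near[OF x] by blast
    let ?E = "\<lambda>x j. expectation (\<lambda>w. \<Phi> x j (noise w))"
    have "n * u (0, x) - (\<Sum>j=1..n. \<Phi> x j (noise w)) = (\<Sum>j=1..n. u (0, x) - \<Phi> x j (noise w))"
      by (simp add: sum_subtractf)
    \<comment> \<open>The deviation is kept as one sum at the net point, where the bound on the
      maximum applies; the remaining terms are estimated sample by sample.\<close>
    also have "\<dots> = (\<Sum>j=1..n. (u (0, x) - ?E x j) + (?E x j - ?E c j) - (\<Phi> x j (noise w) - \<Phi> c j (noise w))) - (\<Sum>j=1..n. \<Phi> c j (noise w) - ?E c j)"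
      unfolding sum_subtractf[symmetric] by (intro sum.cong) auto
    finally have eq: "n * u (0, x) - (\<Sum>j=1..n. \<Phi> x j (noise w)) = (\<Sum>j=1..n. (u (0, x) - ?E x j) + (?E x j - ?E c j) - (\<Phi> x j (noise w) - \<Phi> c j (noise w))) - (\<Sum>j=1..n. \<Phi> c j (noise w) - ?E c j)" .
    have "\<bar>n * u (0, x) - (\<Sum>j=1..n. \<Phi> x j (noise w))\<bar> \<le> (\<Sum>j=1..n. bb + s * (lip_det + lip_clock * (2 * M / ?d)) + s * (lip_det + lip_clock * ?cl j w)) + g0 w"
      unfolding eq
    proof (rule order_trans[OF abs_triangle_ineq4 add_mono[OF order_trans[OF sum_abs sum_mono] g0(2)[OF w c(1)]]])
      fix j assume j: "j \<in> {1..n}"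
      have "\<bar>u (0, x) - ?E x j\<bar> \<le> bb" using bias[of j x] j x by (simp add: bb_def)
      then show "\<bar>(u (0, x) - ?E x j) + (?E x j - ?E c j) - (\<Phi> x j (noise w) - \<Phi> c j (noise w))\<bar> \<le> bb + s * (lip_det + lip_clock * (2 * M / ?d)) + s * (lip_det + lip_clock * ?cl j w)"
        using lipE[OF j x c] lipw[OF j x c w] by linarith
    qed
    also have "\<dots> = n * g w"
    proof -
      define S where "S = (\<Sum>j=1..n. s * (lip_det + lip_clock * ?cl j w))"
      have "(\<Sum>j=1..n. bb + s * (lip_det + lip_clock * (2 * M / ?d)) + s * (lip_det + lip_clock * ?cl j w)) =
          n * (bb + s * (lip_det + lip_clock * (2 * M / ?d))) + S"
        unfolding S_def by (subst sum.distrib) simp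
      then show ?thesis unfolding g_def S_def[symmetric] using n0 by (simp add: distrib_left)
    qed
    finally have "\<bar>n * u (0, x) - (\<Sum>j=1..n. \<Phi> x j (noise w))\<bar> \<le> n * g w" .
    moreover have "n * u (0, x) - (\<Sum>j=1..n. \<Phi> x j (noise w)) = n * (u (0, x) - 1 / n * (\<Sum>j=1..n. \<Phi> x j (noise w)))"
      using n0 by (simp add: right_diff_distrib)
    ultimately have "n * \<bar>u (0, x) - 1 / n * (\<Sum>j=1..n. \<Phi> x j (noise w))\<bar> \<le> n * g w" by (simp only: abs_mult abs_of_nat)
    then show ?thesis using n0 by (simp only: mult_le_cancel_left_pos)
  qed
  moreover have lin: "integrable P (\<lambda>w. s * (lip_det + lip_clock * ?cl j w))" if "j \<in> {1..n}" for j using cl(1)[OF that] by simp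
  have gi: "integrable P g"
    unfolding g_def[abs_def] using lin g0(1)
    by (intro Bochner_Integration.integrable_add integrable_const Bochner_Integration.integrable_divide Bochner_Integration.integrable_sum) auto
  moreover have "expectation g \<le> bb + s * (2 * lip_det + lip_clock * (4 * M / ?d)) +
      b * sqrt (2 * (CARD('n) * (ln K + 2 * ln M + M * ln (1 + L)) + ln 2) * n) / n"
  proof -
    have S: "expectation (\<lambda>w. \<Sum>j=1..n. s * (lip_det + lip_clock * ?cl j w)) \<le> n * (s * (lip_det + lip_clock * (2 * M / ?d)))"
    proof -
      have "expectation (\<lambda>w. \<Sum>j=1..n. s * (lip_det + lip_clock * ?cl j w)) = (\<Sum>j=1..n. s * (lip_det + lip_clock * expectation (?cl j)))"
        using cl(1) lin by (subst Bochner_Integration.integral_sum) (auto simp: prob_space intro!: sum.cong)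
      also have "\<dots> \<le> (\<Sum>j=1..n. s * (lip_det + lip_clock * (2 * M / ?d)))"
        by (intro sum_mono mult_left_mono add_left_mono cl(2) lip_nonneg s0)
      finally show ?thesis by simp
    qed
    have si: "integrable P (\<lambda>w. \<Sum>j=1..n. s * (lip_det + lip_clock * ?cl j w))" by (intro Bochner_Integration.integrable_sum lin)
    have "expectation g = bb + s * (lip_det + lip_clock * (2 * M / ?d)) + expectation (\<lambda>w. \<Sum>j=1..n. s * (lip_det + lip_clock * ?cl j w)) / n + expectation g0 / n"
      unfolding g_def[abs_def] using si g0(1) by (simp add: prob_space)
    also have "\<dots> \<le> bb + s * (lip_det + lip_clock * (2 * M / ?d)) + (n * (s * (lip_det + lip_clock * (2 * M / ?d)))) / n +
       b * sqrt (2 * (CARD('n) * (ln K + 2 * ln M + M * ln (1 + L)) + ln 2) * n) / n"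
      by (intro add_mono divide_right_mono S g0(3) order_refl) auto
    also have "\<dots> = bb + s * (2 * lip_det + lip_clock * (4 * M / ?d)) + b * sqrt (2 * (CARD('n) * (ln K + 2 * ln M + M * ln (1 + L)) + ln 2) * n) / n"
    proof -
      have "s * (2 * lip_det + lip_clock * (4 * M / ?d)) = 2 * (s * (lip_det + lip_clock * (2 * M / ?d)))" by (simp add: algebra_simps)
      then show ?thesis using n0 by simp
    qed
    finally show ?thesis .
  qed
  ultimately show ?thesis unfolding bb_def b_def by (intro exI[of _ g]) auto
qed

end

text \<open>The bound obtained is enlarged to the claimed form. One copy of \<open>lx0\<close> goes
  into the summand of order \<open>1 / K\<close>, the rest of the deterministic part into that of
  order \<open>1 / (K * M\<^sup>2)\<close>. The clock part gains its logarithms from the factor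
  \<open>12 * 1\<close>, and the deviation part its factor \<open>3\<close> and the extra
  \<open>1\<close>.\<close>

lemma final_constants:
  fixes d K M n :: nat and dm C0 C1 lt0 lx0 lt1 lx1 L q :: real
  assumes d: "1 \<le> d" and K: "1 \<le> K" and M: "1 \<le> M" and n: "1 \<le> n" and dm: "0 < dm"
    and nn: "0 \<le> C0" "0 \<le> C1" "0 \<le> lt0" "0 \<le> lx0" "0 \<le> lt1" "0 \<le> lx1" "0 \<le> q"
  shows "sqrt d * dm / (K * (real M)\<^sup>2) * (2 * (lx0 + M * (dm * C1 + dm\<^sup>2 / 4 * lx1) / d) + dm * (lt0 + M * (dm\<^sup>2 / 4 * lt1) / d) * (4 * M / d)) +
      (C0 + M * dm\<^sup>2 * C1 / d) * sqrt (2 * q * n) / n \<le>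
    (lx0 + 2 * lt0 * dm / d + 1 / d * (2 * dm * C1 + dm\<^sup>2 * (lx1 + 2 * lt1 * dm / d))) * (sqrt d * dm / K)
      + (lx0 + (2 * M * dm * C1 + lx1 * M * dm\<^sup>2) / d) * (sqrt d * dm / (K * (real M)\<^sup>2))
      + 3 * sqrt 2 * (sqrt q + 1) * (C0 + M * dm\<^sup>2 * C1 / d) / sqrt n
      + 12 * dm\<^sup>2 * (ln n + ln M + ln 6 + 1) * (lt0 * d + lt1 * dm\<^sup>2 * M) / (d powr (3 / 2) * K * M)"
proof -
  define s where "s = sqrt d * dm / (K * (real M)\<^sup>2)"
  have pos: "0 < real d" "0 < real K" "0 < real M" "0 < real n" using assms by auto
  have s0: "0 \<le> s" using dm by (simp add: s_def)
  have 1: "s * lx0 \<le> (lx0 + 2 * lt0 * dm / d + 1 / d * (2 * dm * C1 + dm\<^sup>2 * (lx1 + 2 * lt1 * dm / d))) * (sqrt d * dm / K)"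
  proof -
    have "s \<le> sqrt d * dm / K"
    proof -
      have "1 \<le> (real M)\<^sup>2" using M by simp
      then have "real K * 1 \<le> K * (real M)\<^sup>2" using pos by (intro mult_left_mono) auto
      then show ?thesis unfolding s_def using pos dm by (intro divide_left_mono) auto
    qed
    moreover have "lx0 \<le> lx0 + 2 * lt0 * dm / d + 1 / d * (2 * dm * C1 + dm\<^sup>2 * (lx1 + 2 * lt1 * dm / d))"
      using nn dm pos by (auto intro!: add_nonneg_nonneg mult_nonneg_nonneg divide_nonneg_nonneg)
    ultimately have "lx0 * s \<le> (lx0 + 2 * lt0 * dm / d + 1 / d * (2 * dm * C1 + dm\<^sup>2 * (lx1 + 2 * lt1 * dm / d))) * (sqrt d * dm / K)"
      using nn s0 by (intro mult_mono) auto
    then show ?thesis by (simp add: mult.commute)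
  qed
  have 2: "s * (2 * (lx0 + M * (dm * C1 + dm\<^sup>2 / 4 * lx1) / d)) \<le> s * lx0 + (lx0 + (2 * M * dm * C1 + lx1 * M * dm\<^sup>2) / d) * s"
  proof -
    have "2 * (M * (dm * C1 + dm\<^sup>2 / 4 * lx1)) \<le> 2 * M * dm * C1 + lx1 * M * dm\<^sup>2"
      using nn dm pos by (simp add: algebra_simps)
    then have "2 * (lx0 + M * (dm * C1 + dm\<^sup>2 / 4 * lx1) / d) \<le> lx0 + (lx0 + (2 * M * dm * C1 + lx1 * M * dm\<^sup>2) / d)"
      using pos by (simp add: divide_simps)
    from mult_left_mono[OF this s0] show ?thesis by (simp add: algebra_simps)
  qed
  have 3: "s * (dm * (lt0 + M * (dm\<^sup>2 / 4 * lt1) / d) * (4 * M / d)) \<le> 12 * dm\<^sup>2 * (ln n + ln M + ln 6 + 1) * (lt0 * d + lt1 * dm\<^sup>2 * M) / (d powr (3 / 2) * K * M)"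
  proof -
    have dp: "d powr (3 / 2) = d * sqrt d"
      using pos powr_add[of "real d" 1 "1/2"] by (simp add: powr_half_sqrt)
    have sd: "sqrt d * sqrt d = d" by simp
    have e: "s * (dm * (lt0 + M * (dm\<^sup>2 / 4 * lt1) / d) * (4 * M / d)) = dm\<^sup>2 * (4 * lt0 * d + lt1 * dm\<^sup>2 * M) / (d * sqrt d * K * M)"
    proof -
      \<comment> \<open>With \<open>r\<close> for the root of the dimension all powers become
        rational.\<close>
      have "r * dm / (k * m\<^sup>2) * (dm * (lt0 + m * (dm\<^sup>2 / 4 * lt1) / (r * r)) * (4 * m / (r * r))) =
          dm\<^sup>2 * (4 * lt0 * (r * r) + lt1 * dm\<^sup>2 * m) / (r * r * r * k * m)" if "0 < r" "0 < k" "0 < m" for r k m :: real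
        using that by (simp add: field_simps power2_eq_square)
      from this[of "sqrt d" K M] show ?thesis using pos unfolding s_def sd by simp
    qed
    have "0 \<le> ln (real n)" "0 \<le> ln (real M)" "0 \<le> ln (6::real)" using n M by auto
    then have a: "12 * 1 * (lt0 * d + lt1 * dm\<^sup>2 * M) \<le> 12 * (ln n + ln M + ln 6 + 1) * (lt0 * d + lt1 * dm\<^sup>2 * M)"
      using nn dm by (intro mult_right_mono) auto
    have b: "4 * lt0 * d + lt1 * dm\<^sup>2 * M \<le> 12 * 1 * (lt0 * d + lt1 * dm\<^sup>2 * M)"
      using nn by (simp add: algebra_simps)
    have "dm\<^sup>2 * (4 * lt0 * d + lt1 * dm\<^sup>2 * M) \<le> dm\<^sup>2 * (12 * (ln n + ln M + ln 6 + 1) * (lt0 * d + lt1 * dm\<^sup>2 * M))"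
      by (rule mult_left_mono[OF order_trans[OF b a]]) simp
    then have "dm\<^sup>2 * (4 * lt0 * d + lt1 * dm\<^sup>2 * M) \<le> 12 * dm\<^sup>2 * (ln n + ln M + ln 6 + 1) * (lt0 * d + lt1 * dm\<^sup>2 * M)"
      by (simp only: mult_ac)
    then show ?thesis unfolding e dp by (rule divide_right_mono) simp
  qed
  have 4: "(C0 + M * dm\<^sup>2 * C1 / d) * sqrt (2 * q * n) / n \<le> 3 * sqrt 2 * (sqrt q + 1) * (C0 + M * dm\<^sup>2 * C1 / d) / sqrt n"
  proof -
    let ?b = "C0 + M * dm\<^sup>2 * C1 / d"
    have b: "0 \<le> ?b" using nn by (auto intro!: add_nonneg_nonneg mult_nonneg_nonneg divide_nonneg_nonneg)
    have "sqrt n / n = 1 / sqrt n" using pos by (simp add: real_div_sqrt frac_eq_eq)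
    moreover have "b * sqrt (2 * q * n) / n = (sqrt 2 * sqrt q) * b * (sqrt n / n)" for b
      by (simp add: real_sqrt_mult mult_ac)
    ultimately have "?b * sqrt (2 * q * n) / n = (sqrt 2 * sqrt q) * ?b * (1 / sqrt n)" by simp
    then have "?b * sqrt (2 * q * n) / n = (sqrt 2 * sqrt q) * ?b / sqrt n" by (simp only: times_divide_eq_right mult_1_right)
    moreover have "sqrt 2 * sqrt q \<le> 3 * sqrt 2 * (sqrt q + 1)"
      using nn by (simp add: algebra_simps)
    ultimately show ?thesis using b by (auto intro!: divide_right_mono mult_right_mono)
  qed
  show ?thesis unfolding s_def[symmetric] distrib_left[of s] using 1 2 3 4 by linarith
qed

subsection \<open>From the abstract walk to the given random variables\<close>

text \<open>The Lipschitz bound on \<open>D\<close> extends across the boundary because the radius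
  is squeezed to \<open>0\<close> there by the distance to the frontier. Measurability follows from
  continuity on the closed domain.\<close>

lemma (in bm_domain) distance_extension:
  fixes rbar :: "real ^ 'n \<Rightarrow> real"
  assumes \<beta>: "0 < \<beta>" and \<delta>: "0 < \<delta>" and L: "0 \<le> L"
    and rbar: "beta_eps_distance \<beta> \<delta> D rbar"
    and lip: "\<And>x y. x \<in> D \<Longrightarrow> y \<in> D \<Longrightarrow> \<bar>rbar x - rbar y\<bar> \<le> L * norm (x - y)"
  defines "rt \<equiv> \<lambda>x. if x \<in> D then rbar x else 0"
  shows "rt \<in> borel_measurable borel" "0 \<le> rt x" "2 * rt x \<le> diameter D"
    "x \<in> closure D \<Longrightarrow> rt x \<le> infdist x (frontier D)"
    "x \<in> closure D \<Longrightarrow> \<delta> \<le> infdist x (frontier D) \<Longrightarrow> \<beta> * \<delta> \<le> rt x"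
    "x \<in> closure D \<Longrightarrow> y \<in> closure D \<Longrightarrow> \<bar>rt x - rt y\<bar> \<le> L * norm (x - y)"
proof -
  have nn: "0 \<le> rt x" for x using rbar by (auto simp: rt_def beta_eps_distance_def)
  have le: "rt x \<le> infdist x (frontier D)" for x
    using rbar by (auto simp: rt_def beta_eps_distance_def infdist_nonneg)
  show "0 \<le> rt x" by (rule nn)
  show "rt x \<le> infdist x (frontier D)" by (rule le)
  show "2 * rt x \<le> diameter D"
  proof (cases "x \<in> D")
    case True
    then have "x \<in> closure D" by (rule subsetD[OF closure_subset])
    then show ?thesis by (rule step_le_half_diameter[OF _ nn le])
  next
    case False
    then show ?thesis using diameter_pos by (simp add: rt_def)
  qed
  show "\<beta> * \<delta> \<le> rt x" if x: "x \<in> closure D" and d: "\<delta> \<le> infdist x (frontier D)"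
  proof -
    have "x \<notin> frontier D" using d \<delta> by auto
    then have xD: "x \<in> D" using closure_cases[OF x] by blast
    have "\<beta> * \<delta> \<le> \<beta> * infdist x (frontier D)" using d \<beta> by (intro mult_left_mono) auto
    also have "\<dots> \<le> rbar x" using rbar xD d by (auto simp: beta_eps_distance_def)
    finally show ?thesis using xD by (simp add: rt_def)
  qed
  \<comment> \<open>Passing through an interior point \<open>z\<close> close to the boundary point
    \<open>y\<close> costs \<open>L\<close> times a distance plus the radius at \<open>z\<close>,
    which is at most \<open>dist z y\<close>.\<close>
  have edge: "rt x \<le> L * norm (x - y)" if x: "x \<in> D" and y: "y \<in> closure D" "y \<notin> D" for x y
  proof (rule field_le_epsilon)
    fix e :: real assume e: "0 < e"
    have "y \<in> frontier D" using closure_cases[OF y(1)] y(2) by blast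
    \<comment> \<open>The distance \<open>dist z y\<close> enters twice, with factors
      \<open>1\<close> and \<open>L\<close>, hence the division by \<open>1 + L\<close>.\<close>
    obtain z where z: "z \<in> D" "dist z y < e / (1 + L)"
      using y(1) e L unfolding closure_approachable by (meson add_pos_nonneg divide_pos_pos zero_less_one)
    have "rbar x \<le> rbar z + L * norm (x - z)" using lip[OF x z(1)] by linarith
    also have "rbar z \<le> infdist z (frontier D)" using rbar z(1) by (auto simp: beta_eps_distance_def)
    also have "infdist z (frontier D) \<le> dist z y" by (rule infdist_le) fact
    also have "L * norm (x - z) \<le> L * (norm (x - y) + dist z y)"
      using L norm_triangle_ineq[of "x - y" "y - z"] by (intro mult_left_mono) (auto simp: dist_norm norm_minus_commute)
    finally have "rbar x \<le> L * norm (x - y) + (1 + L) * dist z y" by (simp add: algebra_simps)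
    also have "(1 + L) * dist z y \<le> (1 + L) * (e / (1 + L))" using z(2) L by (intro mult_left_mono) auto
    also have "\<dots> = e" using L by simp
    finally show "rt x \<le> L * norm (x - y) + e" using x by (simp add: rt_def)
  qed
  have lip': "\<bar>rt x - rt y\<bar> \<le> L * norm (x - y)" if xy: "x \<in> closure D" "y \<in> closure D" for x y
  proof -
    consider "x \<in> D" "y \<in> D" | "x \<in> D" "y \<notin> D" | "x \<notin> D" "y \<in> D" | "x \<notin> D" "y \<notin> D" by blast
    then show ?thesis
    proof cases
      case 1 then show ?thesis using lip by (simp add: rt_def)
    next
      case 2
      then have "rt y = 0" by (simp add: rt_def)
      then show ?thesis using edge[OF 2(1) xy(2) 2(2)] nn[of x] by simp
    next
      case 3
      then have "rt x = 0" by (simp add: rt_def)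
      then show ?thesis using edge[OF 3(2) xy(1) 3(1)] nn[of y] by (simp add: norm_minus_commute)
    next
      case 4 then show ?thesis using L by (simp add: rt_def)
    qed
  qed
  then show "x \<in> closure D \<Longrightarrow> y \<in> closure D \<Longrightarrow> \<bar>rt x - rt y\<bar> \<le> L * norm (x - y)" .
  have "L-lipschitz_on (closure D) rt"
    using lip' L by (intro lipschitz_onI) (auto simp: dist_norm)
  then have c: "continuous_on (closure D) rt" by (rule lipschitz_on_continuous_on)
  have "(\<lambda>x. indicator (closure D) x *\<^sub>R rt x) \<in> borel_measurable borel"
    by (rule borel_measurable_continuous_on_indicator[OF _ c]) (rule borel_closed[OF closed_closure])
  also have "(\<lambda>x. indicator (closure D) x *\<^sub>R rt x) = rt"
    using closure_subset[of D] by (auto simp: rt_def indicator_def fun_eq_iff)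
  finally show "rt \<in> borel_measurable borel" .
qed

lemma zero_extension:
  fixes f :: "'a::topological_space \<Rightarrow> real"
  assumes S: "S \<in> sets borel" "S \<noteq> {}" and f: "f \<in> borel_measurable (restrict_space borel S)" "bounded (f ` S)"
  shows "(\<lambda>z. if z \<in> S then f z else 0) \<in> borel_measurable borel"
    "\<bar>if z \<in> S then f z else 0\<bar> \<le> sup_norm_on S f"
proof -
  have "(\<lambda>z. indicator S z *\<^sub>R f z) \<in> borel_measurable borel"
    using f(1) S(1) by (subst borel_measurable_restrict_space_iff[symmetric]) (simp_all only: space_borel Int_UNIV_right)
  also have "(\<lambda>z. indicator S z *\<^sub>R f z) = (\<lambda>z. if z \<in> S then f z else 0)" by (auto simp: fun_eq_iff indicator_def)
  finally show "(\<lambda>z. if z \<in> S then f z else 0) \<in> borel_measurable borel" .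
  obtain b where b: "\<And>z. z \<in> S \<Longrightarrow> \<bar>f z\<bar> \<le> b" using f(2) unfolding bounded_iff by auto
  have bdd: "bdd_above ((\<lambda>z. \<bar>f z\<bar>) ` S)" using b by (intro bdd_aboveI2)
  have le: "\<bar>f z\<bar> \<le> sup_norm_on S f" if "z \<in> S" for z
    unfolding sup_norm_on_def by (rule cSUP_upper[OF that bdd])
  obtain z0 where "z0 \<in> S" using S(2) unfolding ex_in_conv[symmetric] by (elim exE) (rule that)
  then have "0 \<le> sup_norm_on S f" using le[of z0] by linarith
  then show "\<bar>if z \<in> S then f z else 0\<bar> \<le> sup_norm_on S f" using le[of z] by simp
qed

text \<open>All sources are embedded into one space, since a family of independent variables has a common
  codomain type here; the missing component is \<open>0\<close>.\<close>
fun noise_source :: "(nat \<Rightarrow> nat \<Rightarrow> 'w \<Rightarrow> real) \<Rightarrow> (nat \<Rightarrow> nat \<Rightarrow> 'w \<Rightarrow> real ^ 'n) \<Rightarrow> (nat \<Rightarrow> nat \<Rightarrow> 'w \<Rightarrow> real)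
    \<Rightarrow> (nat \<Rightarrow> nat \<Rightarrow> 'w \<Rightarrow> real ^ 'n) \<Rightarrow> source \<Rightarrow> 'w \<Rightarrow> real \<times> (real ^ 'n)" where
  "noise_source V Y \<rho> Z (Src_VY i k) = (\<lambda>w. (V i k w, Y i k w))"
| "noise_source V Y \<rho> Z (Src_rho i k) = (\<lambda>w. (\<rho> i k w, 0))"
| "noise_source V Y \<rho> Z (Src_Z i k) = (\<lambda>w. (0, Z i k w))"
| "noise_source V Y \<rho> Z Src_B = (\<lambda>w. (0, 0))"

lemma (in prob_space) noise_source_indep:
  fixes Y Z :: "nat \<Rightarrow> nat \<Rightarrow> 'a \<Rightarrow> real ^ 'n"
  assumes indep: "indep_sets (source_events M V Y \<rho> Z B) source_indices"
    and m: "\<And>i. i \<in> noise_indices \<Longrightarrow> noise_source V Y \<rho> Z i \<in> borel_measurable M"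
  shows "indep_vars (\<lambda>_. borel) (noise_source V Y \<rho> Z) noise_indices"
  unfolding indep_vars_def2
proof (intro conjI ballI m)
  show "indep_sets (\<lambda>i. {noise_source V Y \<rho> Z i -` A \<inter> space M |A. A \<in> sets borel}) noise_indices"
  proof (rule indep_sets_mono[OF indep])
    show "noise_indices \<subseteq> source_indices" by (auto simp: noise_indices_def source_indices_def)
    have pre: "f -` A \<in> sets borel" if "f \<in> borel_measurable borel" "A \<in> sets borel"
      for f :: "'b::topological_space \<Rightarrow> 'c::topological_space" and A
      using measurable_sets[OF that] by (simp only: space_borel Int_UNIV_right)
    have c: "(\<lambda>a. (a, 0)) \<in> borel_measurable (borel :: real measure)"
      "(\<lambda>b. (0, b)) \<in> borel_measurable (borel :: (real ^ 'n) measure)"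
      by (intro borel_measurable_continuous_onI continuous_intros)+
    fix i assume i: "i \<in> noise_indices"
    have "noise_source V Y \<rho> Z i -` A \<inter> space M \<in> source_events M V Y \<rho> Z B i" if A: "A \<in> sets borel" for A
    proof (cases i)
      case (Src_VY j k)
      show ?thesis unfolding Src_VY source_events.simps noise_source.simps by (rule in_vimage_algebra[OF A])
    next
      case (Src_rho j k)
      have "\<rho> j k -` ((\<lambda>a. (a, 0 :: real ^ 'n)) -` A) \<inter> space M \<in> sets (vimage_algebra (space M) (\<rho> j k) borel)"
        by (rule in_vimage_algebra[OF pre[OF c(1) A]])
      then show ?thesis unfolding Src_rho source_events.simps noise_source.simps by (simp only: vimage_def mem_Collect_eq)
    next
      case (Src_Z j k)
      have "Z j k -` ((\<lambda>b. (0 :: real, b)) -` A) \<inter> space M \<in> sets (vimage_algebra (space M) (Z j k) borel)"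
        by (rule in_vimage_algebra[OF pre[OF c(2) A]])
      then show ?thesis unfolding Src_Z source_events.simps noise_source.simps by (simp only: vimage_def mem_Collect_eq)
    next
      case Src_B
      then show ?thesis using i by (auto simp: noise_indices_def)
    qed
    then show "{noise_source V Y \<rho> Z i -` A \<inter> space M |A. A \<in> sets borel} \<subseteq> source_events M V Y \<rho> Z B i"
      by (intro subsetI) (elim CollectE exE conjE, simp only:)
  qed
qed

text \<open>The copies are compared with the exit time among extended reals, since the latter can be
  infinite on a null set; \<open>real_of_ereal\<close> carries both laws back to the reals.\<close>

lemma (in bm) exit_law_of_copy:
  fixes \<rho> :: "'w \<Rightarrow> real"
  assumes \<rho>: "\<rho> \<in> borel_measurable P" and eq: "distr P borel (\<lambda>w. ereal (\<rho> w)) = distr P borel (unit_exit_time B)"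
  shows "distr P borel \<rho> = distr P borel (ball_exit 1)"
proof -
  have r: "real_of_ereal \<in> borel_measurable borel" by measurable
  have e: "(\<lambda>w. ereal (\<rho> w)) \<in> borel_measurable P" using \<rho> by measurable
  have ut: "unit_exit_time B = (\<lambda>w. hit {x. 1 \<le> norm x} 0 w)" by (rule ext) (rule unit_exit_time_eq)
  have um: "unit_exit_time B \<in> borel_measurable P"
    unfolding ut by (rule hit_measurable[OF closed_outside_ball outside_ball_nonempty])
  have "distr P borel \<rho> = distr (distr P borel (\<lambda>w. ereal (\<rho> w))) borel real_of_ereal"
    by (subst distr_distr[OF r e]) (simp add: comp_def)
  also have "\<dots> = distr P borel (ball_exit 1)"
    unfolding eq by (subst distr_distr[OF r um]) (simp add: comp_def ut ball_exit_def[abs_def])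
  finally show ?thesis .
qed

lemma direction_law:
  fixes Z :: "'w \<Rightarrow> real ^ 'n"
  assumes "distributed P lborel Z (\<lambda>x. ennreal (isotropic_normal_density 1 x))"
  shows "Z \<in> borel_measurable P" "distr P borel (\<lambda>w. inverse (norm (Z w)) *\<^sub>R Z w) = sphere_law"
proof -
  show Z: "Z \<in> borel_measurable P" using distributed_measurable[OF assms] by simp
  have g: "distr P borel Z = gauss1"
    using distributed_distr_eq_density[OF assms] by (simp add: gauss1_def cong: distr_cong)
  have n: "(\<lambda>x :: real ^ 'n. inverse (norm x) *\<^sub>R x) \<in> borel_measurable borel" by measurable
  show "distr P borel (\<lambda>w. inverse (norm (Z w)) *\<^sub>R Z w) = sphere_law"
    unfolding sphere_law_def g[symmetric] by (subst distr_distr[OF n Z]) (simp add: comp_def)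
qed

theorem theorem4p9:
  fixes D :: "(real ^ 'n) set" and P :: "'w measure"
    and B :: "real \<Rightarrow> 'w \<Rightarrow> real ^ 'n"
    and d n M :: nat and \<beta> \<delta> L :: real and L1 L2 :: "nat \<Rightarrow> real"
    and rbar :: "real ^ 'n \<Rightarrow> real"
    and V \<rho> :: "nat \<Rightarrow> nat \<Rightarrow> 'w \<Rightarrow> real"
    and Y Z \<xi> :: "nat \<Rightarrow> nat \<Rightarrow> 'w \<Rightarrow> real ^ 'n"
    and \<tau> :: "real ^ 'n \<Rightarrow> 'w \<Rightarrow> ereal"
    and X :: "real ^ 'n \<Rightarrow> nat \<Rightarrow> nat \<Rightarrow> 'w \<Rightarrow> real ^ 'n"
    and T :: "real ^ 'n \<Rightarrow> nat \<Rightarrow> nat \<Rightarrow> 'w \<Rightarrow> real"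
    and h :: "nat \<Rightarrow> real \<times> (real ^ 'n) \<Rightarrow> real"
    and h0n h1n :: real
    and w :: "real ^ 'n \<Rightarrow> real" and wbar :: "real ^ 'n \<Rightarrow> 'w \<Rightarrow> real"
  assumes d: "d = CARD('n)"
    and D: "D \<noteq> {}" "open D" "bounded D" "convex D"
    and P: "prob_space P"
    and B: "std_brownian_motion P B"
    and \<tau>: "\<And>x. x \<in> closure D \<Longrightarrow> \<tau> x = hitting_time (\<lambda>t \<omega>. x + B t \<omega>) (frontier D)"
    and \<beta>: "0 < \<beta>" "\<beta> \<le> 1" and \<delta>: "0 < \<delta>"
    and rbar: "beta_eps_distance \<beta> \<delta> D rbar"
    and rbar_frontier: "\<And>x. x \<in> frontier D \<Longrightarrow> rbar x = 0"
    and \<rho>_measurable: "\<And>j k. 1 \<le> j \<Longrightarrow> 1 \<le> k \<Longrightarrow> \<rho> j k \<in> borel_measurable P"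
    and \<rho>_nonneg: "\<And>j k \<omega>. 1 \<le> j \<Longrightarrow> 1 \<le> k \<Longrightarrow> \<omega> \<in> space P \<Longrightarrow> 0 \<le> \<rho> j k \<omega>"
    and \<rho>_distr: "\<And>j k. 1 \<le> j \<Longrightarrow> 1 \<le> k \<Longrightarrow>
      distr P borel (\<lambda>\<omega>. ereal (\<rho> j k \<omega>)) = distr P borel (unit_exit_time B)"
    and Z: "\<And>j k. 1 \<le> j \<Longrightarrow> 1 \<le> k \<Longrightarrow>
      distributed P lborel (Z j k) (\<lambda>x. ennreal (isotropic_normal_density 1 x))"
    and \<xi>: "\<xi> = (\<lambda>j k \<omega>. inverse (norm (Z j k \<omega>)) *\<^sub>R Z j k \<omega>)"
    and X: "X = wos_position rbar \<xi>"
    and T: "T = wos_time rbar \<xi> \<rho>"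
    and h_measurable: "\<And>i. i \<in> {0, 1} \<Longrightarrow>
      h i \<in> borel_measurable (restrict_space borel ({0..} \<times> closure D))"
    and h_bounded: "\<And>i. i \<in> {0, 1} \<Longrightarrow> bounded (h i ` ({0..} \<times> closure D))"
    and h0n: "h0n = sup_norm_on ({0..} \<times> closure D) (h 0)"
    and h1n: "h1n = sup_norm_on ({0..} \<times> closure D) (h 1)"
    and n: "1 \<le> n" and M: "1 \<le> M"
    and VY_measurable: "\<And>i k. 1 \<le> i \<Longrightarrow> 1 \<le> k \<Longrightarrow>
      (\<lambda>\<omega>. (V i k \<omega>, Y i k \<omega>)) \<in> measurable P (occupation_measure P B)"
    and VY_distr: "\<And>i k. 1 \<le> i \<Longrightarrow> 1 \<le> k \<Longrightarrow>
      distr P (occupation_measure P B) (\<lambda>\<omega>. (V i k \<omega>, Y i k \<omega>)) = occupation_measure P B"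
    and indep: "prob_space.indep_sets P (source_events P V Y \<rho> Z B) source_indices"
    and L: "0 \<le> L" and L1: "\<And>i. i \<in> {0, 1} \<Longrightarrow> 0 \<le> L1 i" and L2: "\<And>i. i \<in> {0, 1} \<Longrightarrow> 0 \<le> L2 i"
    and h_Lipschitz: "\<And>s t x y i. 0 \<le> s \<Longrightarrow> 0 \<le> t \<Longrightarrow> x \<in> closure D \<Longrightarrow> y \<in> closure D \<Longrightarrow> i \<in> {0, 1} \<Longrightarrow>
      \<bar>h i (s, x) - h i (t, y)\<bar> \<le> L1 i * \<bar>s - t\<bar> + L2 i * norm (x - y)"
    and rbar_Lipschitz: "\<And>x y. x \<in> D \<Longrightarrow> y \<in> D \<Longrightarrow> \<bar>rbar x - rbar y\<bar> \<le> L * norm (x - y)"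
    and w_continuous: "continuous_on D w"
    and w: "\<And>x. x \<in> D \<Longrightarrow>
      w x = prob_space.expectation P
              (\<lambda>\<omega>. h 0 (real_of_ereal (\<tau> x \<omega>), x + B (real_of_ereal (\<tau> x \<omega>)) \<omega>))
          + prob_space.expectation P (\<lambda>\<omega>. LBINT s=0..\<tau> x \<omega>. h 1 (s, x + B s \<omega>))"
    and wbar: "\<And>x \<omega>. x \<in> D \<Longrightarrow> \<omega> \<in> space P \<Longrightarrow>
      wbar x \<omega> = 1 / real n * (\<Sum>i=1..n. h 0 (T x i M \<omega>, X x i M \<omega>)
        + 1 / real d * (\<Sum>k=1..M. (rbar (X x i (k - 1) \<omega>))\<^sup>2 *
            h 1 (T x i (k - 1) \<omega> + (rbar (X x i (k - 1) \<omega>))\<^sup>2 * V i k \<omega>,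
                 X x i (k - 1) \<omega> + rbar (X x i (k - 1) \<omega>) *\<^sub>R Y i k \<omega>)))"
  shows "\<forall>K::nat. 1 \<le> K \<longrightarrow>
    (\<integral>\<^sup>+\<omega>. (SUP x\<in>D. ennreal \<bar>w x - wbar x \<omega>\<bar>) \<partial>P) \<le> ennreal (
      (L1 0 + h1n) * diameter D * \<delta> + L2 0 * sqrt d * sqrt (diameter D) * sqrt \<delta>
      + (4 * h0n + 2 * (diameter D)\<^sup>2 * h1n / d)
          * (1 + \<beta>\<^sup>2 * \<delta>\<^sup>2 / (2 * (diameter D)\<^sup>2)) powi (- int M)
      + (L2 0 + 2 * L1 0 * diameter D / d
          + 1 / d * (2 * diameter D * h1n
              + (diameter D)\<^sup>2 * (L2 1 + 2 * L1 1 * diameter D / d)))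
          * (sqrt d * diameter D / K)
      + (L2 0 + (2 * M * diameter D * h1n + L2 1 * M * (diameter D)\<^sup>2) / d)
          * (sqrt d * diameter D / (K * (real M)\<^sup>2))
      + 3 * sqrt 2 * (sqrt (d * (ln K + 2 * ln M + M * ln (1 + L)) + ln 2) + 1)
          * (h0n + M * (diameter D)\<^sup>2 * h1n / d) / sqrt n
      + 12 * (diameter D)\<^sup>2 * (ln n + ln M + ln 6 + 1)
          * (L1 0 * d + L1 1 * (diameter D)\<^sup>2 * M) / (d powr (3 / 2) * K * M))"
proof (intro allI impI)
  fix K :: nat assume K: "1 \<le> K"
  let ?S = "{0..} \<times> closure D :: (real \<times> (real ^ 'n)) set"
  define rt where "rt = (\<lambda>x. if x \<in> D then rbar x else 0)"
  define g0 where "g0 = (\<lambda>z. if z \<in> ?S then h 0 z else 0)"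
  define g1 where "g1 = (\<lambda>z. if z \<in> ?S then h 1 z else 0)"
  define W where "W = noise_source V Y \<rho> Z"
  interpret bm P B by (rule bm_if_std_brownian_motion[OF P B])
  interpret bm_domain P B D by unfold_locales (rule D)+
  have S: "?S \<in> sets borel" "?S \<noteq> {}"
    using D(1) by (auto intro!: borel_closed closed_Times)
  note ext = distance_extension[OF \<beta>(1) \<delta> L rbar rbar_Lipschitz]
  have hm: "h 0 \<in> borel_measurable (restrict_space borel ?S)" "bounded (h 0 ` ?S)"
    "h 1 \<in> borel_measurable (restrict_space borel ?S)" "bounded (h 1 ` ?S)"
    by (rule h_measurable h_bounded, simp)+
  note ext0 = zero_extension[OF S hm(1,2), folded g0_def h0n]
  note ext1 = zero_extension[OF S hm(3,4), folded g1_def h1n]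
  have g: "g0 (t, x) = h 0 (t, x)" "g1 (t, x) = h 1 (t, x)" if "0 \<le> t" "x \<in> closure D" for t x
    using that by (auto simp: g0_def g1_def)
  have Wm: "W i \<in> borel_measurable P" if "i \<in> noise_indices" for i
  proof -
    have vy: "(\<lambda>\<omega>. (V j k \<omega>, Y j k \<omega>)) \<in> borel_measurable P" if "1 \<le> j" "1 \<le> k" for j k
    proof (rule measurable_restrict_space2_iff[THEN iffD1, THEN conjunct1])
      show "(\<lambda>\<omega>. (V j k \<omega>, Y j k \<omega>)) \<in> measurable P (restrict_space borel ({0..} \<times> cball 0 1))"
        using VY_measurable[OF that] unfolding occupation_measure_eq
        by (simp only: measurable_cong_sets[OF refl sets_occ_law])
    qed
    have r: "(\<lambda>\<omega>. (\<rho> j k \<omega>, 0 :: real ^ 'n)) \<in> borel_measurable P" if "1 \<le> j" "1 \<le> k" for j k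
      by (intro borel_measurable_Pair \<rho>_measurable that borel_measurable_const)
    have z: "(\<lambda>\<omega>. (0 :: real, Z j k \<omega>)) \<in> borel_measurable P" if "1 \<le> j" "1 \<le> k" for j k
      by (intro borel_measurable_Pair direction_law(1)[OF Z[OF that]] borel_measurable_const)
    from that show ?thesis unfolding noise_indices_def W_def
      by (elim UN_E insertE emptyE) (simp_all only: noise_source.simps atLeast_iff vy r z)
  qed
  interpret wos P B D rt \<beta> \<delta> L h0n h1n "L1 0" "L2 0" "L1 1" "L2 1" g0 g1 W M
  proof unfold_locales
    show "rt \<in> borel_measurable borel" unfolding rt_def by (rule ext(1))
    show "0 \<le> rt x" for x unfolding rt_def by (rule ext(2))
    show "2 * rt x \<le> diameter D" for x unfolding rt_def by (rule ext(3))
    show "rt x \<le> infdist x (frontier D)" if "x \<in> closure D" for x unfolding rt_def by (rule ext(4)[OF _ _ that])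
    show "\<beta> * \<delta> \<le> rt x" if "x \<in> closure D" "\<delta> \<le> infdist x (frontier D)" for x unfolding rt_def by (rule ext(5)[OF _ _ that])
    show "\<bar>rt x - rt y\<bar> \<le> L * norm (x - y)" if "x \<in> closure D" "y \<in> closure D" for x y unfolding rt_def by (rule ext(6)[OF _ _ that])
    show "0 < \<beta>" "0 < \<delta>" "0 \<le> L" "0 \<le> L1 0" "0 \<le> L2 0" "0 \<le> L1 1" "0 \<le> L2 1"
      using \<beta> \<delta> L L1 L2 by auto
    show "g0 \<in> borel_measurable borel" "g1 \<in> borel_measurable borel" by (rule ext0(1), rule ext1(1))
    show "\<bar>g0 z\<bar> \<le> h0n" "\<bar>g1 z\<bar> \<le> h1n" for z
      using ext0(2) ext1(2) unfolding g0_def g1_def h0n h1n by auto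
    show "\<bar>g0 (s, x) - g0 (t, y)\<bar> \<le> L1 0 * \<bar>s - t\<bar> + L2 0 * norm (x - y)"
      "\<bar>g1 (s, x) - g1 (t, y)\<bar> \<le> L1 1 * \<bar>s - t\<bar> + L2 1 * norm (x - y)"
      if "0 \<le> s" "0 \<le> t" "x \<in> closure D" "y \<in> closure D" for s t x y
      using h_Lipschitz[OF that] that by (simp_all add: g)
    show "indep_vars (\<lambda>_. borel) W noise_indices"
      unfolding W_def by (rule noise_source_indep[OF indep Wm[unfolded W_def]])
    show "0 \<le> fst (W (Src_rho j k) \<omega>)" if "1 \<le> j" "1 \<le> k" "\<omega> \<in> space P" for j k \<omega>
      using \<rho>_nonneg[OF that] by (simp add: W_def)
    show "distr P borel (\<lambda>\<omega>. fst (W (Src_rho j k) \<omega>)) = distr P borel (ball_exit 1)" if "1 \<le> j" "1 \<le> k" for j k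
      using exit_law_of_copy[OF \<rho>_measurable[OF that] \<rho>_distr[OF that]] by (simp add: W_def)
    show "distr P borel (\<lambda>\<omega>. inverse (norm (snd (W (Src_Z j k) \<omega>))) *\<^sub>R snd (W (Src_Z j k) \<omega>)) = sphere_law" if "1 \<le> j" "1 \<le> k" for j k
      using direction_law(2)[OF Z[OF that]] by (simp add: W_def)
    show "W (Src_VY j k) \<in> measurable P occ_law" "distr P occ_law (W (Src_VY j k)) = occ_law" if "1 \<le> j" "1 \<le> k" for j k
      using VY_measurable[OF that] VY_distr[OF that] unfolding occupation_measure_eq W_def noise_source.simps by simp_all
  qed
  \<comment> \<open>On the frontier the given distance vanishes by assumption and \<open>rt\<close>
    by definition.\<close>
  have rt_eq: "rbar x = rt x" if "x \<in> closure D" for x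
    using closure_cases[OF that] rbar_frontier[of x] by (auto simp: rt_def)
  have dn: "dirn j k (noise \<omega>) = \<xi> j k \<omega>" "rhon j k (noise \<omega>) = \<rho> j k \<omega>" for j k \<omega>
    by (simp_all add: dirn_def rhon_def W_def \<xi>)
  have XT: "X x j k \<omega> = pos x j k (noise \<omega>) \<and> T x j k \<omega> = tim x j k (noise \<omega>)" if x: "x \<in> closure D" for x j k \<omega>
    unfolding X T
  proof (induction k)
    case (Suc k)
    then show ?case using rt_eq[OF pos_closure[OF x, of j k "noise \<omega>"]] by (simp add: dn)
  qed simp
  have wbar_eq: "wbar x \<omega> = 1 / n * (\<Sum>i=1..n. \<Phi> x i (noise \<omega>))" if x: "x \<in> D" and \<omega>: "\<omega> \<in> space P" for x \<omega>
  proof -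
    have xc: "x \<in> closure D" using x by (rule subsetD[OF closure_subset])
    have eq: "h 0 (T x i M \<omega>, X x i M \<omega>) + 1 / real d * (\<Sum>k=1..M. (rbar (X x i (k - 1) \<omega>))\<^sup>2 *
            h 1 (T x i (k - 1) \<omega> + (rbar (X x i (k - 1) \<omega>))\<^sup>2 * V i k \<omega>,
                 X x i (k - 1) \<omega> + rbar (X x i (k - 1) \<omega>) *\<^sub>R Y i k \<omega>)) = \<Phi> x i (noise \<omega>)" if i: "i \<in> {1..n}" for i
    proof -
      have i1: "1 \<le> i" using i by simp
      have p: "pos x i k (noise \<omega>) \<in> closure D" for k by (rule pos_closure[OF xc])
      have t: "0 \<le> tim x i k (noise \<omega>)" for k by (rule tim_nonneg[OF i1 \<omega>])
      have "(rbar (X x i k \<omega>))\<^sup>2 * h 1 (T x i k \<omega> + (rbar (X x i k \<omega>))\<^sup>2 * V i (Suc k) \<omega>,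
                 X x i k \<omega> + rbar (X x i k \<omega>) *\<^sub>R Y i (Suc k) \<omega>) = gain x i k (noise \<omega>)" for k
      proof -
        have v: "0 \<le> V i (Suc k) \<omega>" "norm (Y i (Suc k) \<omega>) \<le> 1"
          using VY_range[OF i1 _ \<omega>, of "Suc k"] by (simp_all add: W_def)
        have "pos x i k (noise \<omega>) + rt (pos x i k (noise \<omega>)) *\<^sub>R Y i (Suc k) \<omega> \<in> closure D"
          by (rule step_in_closure[OF p rt_nonneg rt_le[OF p] v(2)])
        moreover have "0 \<le> tim x i k (noise \<omega>) + (rt (pos x i k (noise \<omega>)))\<^sup>2 * V i (Suc k) \<omega>"
          using t v by simp
        moreover have "W (Src_VY i (Suc k)) \<omega> = (V i (Suc k) \<omega>, Y i (Suc k) \<omega>)" by (simp add: W_def)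
        ultimately show ?thesis using XT[OF xc, of i k \<omega>] rt_eq[OF p] g(2) by simp
      qed
      then show ?thesis
        using XT[OF xc, of i M \<omega>] g(1)[OF t p] by (simp add: \<Phi>_def sum.atLeast1_atMost_eq d)
    qed
    show ?thesis unfolding wbar[OF x \<omega>]
      by (rule arg_cong[where f="\<lambda>s. 1 / n * s"], rule sum.cong[OF refl]) (rule eq)
  qed
  \<comment> \<open>Up to its exit the path stays in the closed domain, where the extended data
    \<open>g0\<close> and \<open>g1\<close> agree with the given functions, so \<open>w\<close> is
    the value function at time \<open>0\<close>.\<close>
  have w_eq: "w x = u (0, x)" if x: "x \<in> D" for x
  proof -
    have xc: "x \<in> closure D" using x by (rule subsetD[OF closure_subset])
    have tx: "\<tau> x \<omega> = exit_time x \<omega>" for \<omega>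
      unfolding \<tau>[OF xc] by (rule hitting_time_eq_first_hit)
    have "expectation (\<lambda>\<omega>. h 0 (real_of_ereal (\<tau> x \<omega>), x + B (real_of_ereal (\<tau> x \<omega>)) \<omega>)) =
       expectation (\<lambda>\<omega>. g0 (0 + tau x \<omega>, x + B (tau x \<omega>) \<omega>))"
      using g(1)[OF tau_nonneg tau_in_closure[OF xc]]
      by (intro Bochner_Integration.integral_cong) (auto simp: tx tau_def)
    moreover have "expectation (\<lambda>\<omega>. LBINT s=0..\<tau> x \<omega>. h 1 (s, x + B s \<omega>)) = expectation (running g1 0 x)"
    proof (rule Bochner_Integration.integral_cong[OF refl])
      fix \<omega> assume \<omega>: "\<omega> \<in> space P"
      have t0: "0 \<le> exit_time x \<omega>" by (rule first_hit_nonneg)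
      have "indicator (einterval 0 (exit_time x \<omega>)) s *\<^sub>R h 1 (s, x + B s \<omega>) =
        g1 (0 + s, x + B s \<omega>) * (if 0 < s \<and> ereal s < exit_time x \<omega> then 1 else 0)" for s
      proof (cases "0 < s \<and> ereal s < exit_time x \<omega>")
        case True
        then have "x + B s \<omega> \<in> closure D" using exit_inside[OF x \<omega>, of s] closure_subset[of D] by auto
        then show ?thesis using True g(2)[of s "x + B s \<omega>"] by (simp add: einterval_def zero_ereal_def)
      next
        case False
        then show ?thesis by (auto simp: einterval_def zero_ereal_def)
      qed
      then show "(LBINT s=0..\<tau> x \<omega>. h 1 (s, x + B s \<omega>)) = running g1 0 x \<omega>"
        unfolding tx interval_lebesgue_integral_def set_lebesgue_integral_def using t0 by simp
    qed
    ultimately show ?thesis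
      unfolding w[OF x] using value_fn_split(3)[OF h0 h1 xc, of 0] by simp
  qed
  obtain e where e: "integrable P e"
    "\<And>\<omega> x. \<omega> \<in> space P \<Longrightarrow> x \<in> closure D \<Longrightarrow> \<bar>u (0, x) - 1 / n * (\<Sum>i=1..n. \<Phi> x i (noise \<omega>))\<bar> \<le> e \<omega>"
    "expectation e \<le> near_bound + 2 * far_bound * rate ^ M + sqrt CARD('n) * diameter D / (K * (real M)\<^sup>2) * (2 * lip_det + lip_clock * (4 * M / CARD('n))) +
      (h0n + M * (diameter D)\<^sup>2 * h1n / CARD('n)) * sqrt (2 * (CARD('n) * (ln K + 2 * ln M + M * ln (1 + L)) + ln 2) * n) / n"
    using uniform_error[OF K n M] by (elim exE conjE) (rule that; blast)
  have err: "\<bar>w x - wbar x \<omega>\<bar> \<le> e \<omega>" if "x \<in> D" "\<omega> \<in> space P" for x \<omega>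
    unfolding w_eq[OF that(1)] wbar_eq[OF that] by (rule e(2)[OF that(2) subsetD[OF closure_subset that(1)]])
  obtain x0 where x0: "x0 \<in> D" using D(1) unfolding ex_in_conv[symmetric] by (elim exE) (rule that)
  have e0: "0 \<le> e \<omega>" if "\<omega> \<in> space P" for \<omega> using err[OF x0 that] by linarith
  \<comment> \<open>Pointwise domination by the integrable \<open>e\<close> suffices, since the
    nonnegative integral is monotone for arbitrary functions; measurability of the supremum need not
    be settled.\<close>
  have "(\<integral>\<^sup>+\<omega>. (SUP x\<in>D. ennreal \<bar>w x - wbar x \<omega>\<bar>) \<partial>P) \<le> (\<integral>\<^sup>+\<omega>. ennreal (e \<omega>) \<partial>P)"
    by (intro nn_integral_mono SUP_least ennreal_leI err)
  also have "\<dots> = ennreal (expectation e)"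
    by (rule nn_integral_eq_integral[OF e(1) AE_I2[OF e0]])
  also have "\<dots> \<le> ennreal ((L1 0 + h1n) * diameter D * \<delta> + L2 0 * sqrt d * sqrt (diameter D) * sqrt \<delta>
      + (4 * h0n + 2 * (diameter D)\<^sup>2 * h1n / d)
          * (1 + \<beta>\<^sup>2 * \<delta>\<^sup>2 / (2 * (diameter D)\<^sup>2)) powi (- int M)
      + (L2 0 + 2 * L1 0 * diameter D / d
          + 1 / d * (2 * diameter D * h1n
              + (diameter D)\<^sup>2 * (L2 1 + 2 * L1 1 * diameter D / d)))
          * (sqrt d * diameter D / K)
      + (L2 0 + (2 * M * diameter D * h1n + L2 1 * M * (diameter D)\<^sup>2) / d)
          * (sqrt d * diameter D / (K * (real M)\<^sup>2))
      + 3 * sqrt 2 * (sqrt (d * (ln K + 2 * ln M + M * ln (1 + L)) + ln 2) + 1)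
          * (h0n + M * (diameter D)\<^sup>2 * h1n / d) / sqrt n
      + 12 * (diameter D)\<^sup>2 * (ln n + ln M + ln 6 + 1)
          * (L1 0 * d + L1 1 * (diameter D)\<^sup>2 * M) / (d powr (3 / 2) * K * M))"
  proof (rule ennreal_leI, rule order_trans[OF e(3)])
    have d1: "1 \<le> d" unfolding d by (simp add: Suc_le_eq)
    have q: "0 \<le> d * (ln K + 2 * ln M + M * ln (1 + L)) + ln 2"
      using K M L by (intro add_nonneg_nonneg mult_nonneg_nonneg) auto
    have r: "2 * far_bound * rate ^ M = (4 * h0n + 2 * (diameter D)\<^sup>2 * h1n / d)
          * (1 + \<beta>\<^sup>2 * \<delta>\<^sup>2 / (2 * (diameter D)\<^sup>2)) powi (- int M)"
      unfolding far_bound_def rate_def d by (simp add: power_int_minus power_inverse)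
    have nb: "near_bound = (L1 0 + h1n) * diameter D * \<delta> + L2 0 * sqrt d * sqrt (diameter D) * sqrt \<delta>"
      unfolding near_bound_def d ..
    note fc = final_constants[OF d1 K M n diameter_pos C0_nonneg C1_nonneg constants_nonneg(4) constants_nonneg(5) constants_nonneg(6) constants_nonneg(7) q]
    show "near_bound + 2 * far_bound * rate ^ M + sqrt CARD('n) * diameter D / (K * (real M)\<^sup>2) * (2 * lip_det + lip_clock * (4 * M / CARD('n))) +
      (h0n + M * (diameter D)\<^sup>2 * h1n / CARD('n)) * sqrt (2 * (CARD('n) * (ln K + 2 * ln M + M * ln (1 + L)) + ln 2) * n) / n \<le> (L1 0 + h1n) * diameter D * \<delta> + L2 0 * sqrt d * sqrt (diameter D) * sqrt \<delta>
      + (4 * h0n + 2 * (diameter D)\<^sup>2 * h1n / d)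
          * (1 + \<beta>\<^sup>2 * \<delta>\<^sup>2 / (2 * (diameter D)\<^sup>2)) powi (- int M)
      + (L2 0 + 2 * L1 0 * diameter D / d
          + 1 / d * (2 * diameter D * h1n
              + (diameter D)\<^sup>2 * (L2 1 + 2 * L1 1 * diameter D / d)))
          * (sqrt d * diameter D / K)
      + (L2 0 + (2 * M * diameter D * h1n + L2 1 * M * (diameter D)\<^sup>2) / d)
          * (sqrt d * diameter D / (K * (real M)\<^sup>2))
      + 3 * sqrt 2 * (sqrt (d * (ln K + 2 * ln M + M * ln (1 + L)) + ln 2) + 1)
          * (h0n + M * (diameter D)\<^sup>2 * h1n / d) / sqrt n
      + 12 * (diameter D)\<^sup>2 * (ln n + ln M + ln 6 + 1)
          * (L1 0 * d + L1 1 * (diameter D)\<^sup>2 * M) / (d powr (3 / 2) * K * M)"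
      unfolding r nb lip_det_def lip_clock_def d[symmetric] using fc by linarith
  qed
  finally show "(\<integral>\<^sup>+\<omega>. (SUP x\<in>D. ennreal \<bar>w x - wbar x \<omega>\<bar>) \<partial>P) \<le> ennreal ((L1 0 + h1n) * diameter D * \<delta> + L2 0 * sqrt d * sqrt (diameter D) * sqrt \<delta>
      + (4 * h0n + 2 * (diameter D)\<^sup>2 * h1n / d)
          * (1 + \<beta>\<^sup>2 * \<delta>\<^sup>2 / (2 * (diameter D)\<^sup>2)) powi (- int M)
      + (L2 0 + 2 * L1 0 * diameter D / d
          + 1 / d * (2 * diameter D * h1n
              + (diameter D)\<^sup>2 * (L2 1 + 2 * L1 1 * diameter D / d)))
          * (sqrt d * diameter D / K)
      + (L2 0 + (2 * M * diameter D * h1n + L2 1 * M * (diameter D)\<^sup>2) / d)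
          * (sqrt d * diameter D / (K * (real M)\<^sup>2))
      + 3 * sqrt 2 * (sqrt (d * (ln K + 2 * ln M + M * ln (1 + L)) + ln 2) + 1)
          * (h0n + M * (diameter D)\<^sup>2 * h1n / d) / sqrt n
      + 12 * (diameter D)\<^sup>2 * (ln n + ln M + ln 6 + 1)
          * (L1 0 * d + L1 1 * (diameter D)\<^sup>2 * M) / (d powr (3 / 2) * K * M))" .
qed

end
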